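(* (Inner bound, decode-and-forward, no common message.) Let $(U,V_1,V_2,X,X_1,Y,Y_1,Z)$ be random variables on finite alphabets with joint distribution of the form $P_{Y,Z,Y_1|X,X_1}(y,z,y_1|x,x_1)\,P_{X,X_1|U,V_1,V_2}(x,x_1|u,v_1,v_2)\,P_{U,V_1,V_2}(u,v_1,v_2)$, with $P_{Y,Z,Y_1|X,X_1}$ the channel. Write $M=\min\{I(U;Y_1|X_1),I(U,X_1;Y),I(U,X_1;Z)\}$. Then every quadruple $(R_1,R_2,R_{e1},R_{e2})$ of positive reals satisfying \begin{align*} &R_{e1}\le R_1,\quad R_{e2}\le R_2,\\ &R_1\le M+I(V_1;Y|U,X_1),\quad R_2\le M+I(V_2;Z|U,X_1),\\ &R_1+R_2\le M+I(V_1;Y|U,X_1)+I(V_2;Z|U,X_1)-I(V_1;V_2|U,X_1),\\ &R_{e1}\le I(V_1;Y|U,X_1)-I(V_1;V_2|U,X_1)-I(V_1;Z|U,X_1,V_2),\\ &R_{e2}\le I(V_2;Z|U,X_1)-I(V_1;V_2|U,X_1)-I(V_2;Y|U,X_1,V_1) \end{align*} belongs to $\mathcal R^{(B)}$.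
   Context: Discrete memoryless relay broadcast channel with two confidential messages (no common message): finite alphabets $\mathcal X,\mathcal X_1,\mathcal Y,\mathcal Y_1,\mathcal Z$ and a transition probability $p(y,y_1,z|x,x_1)$, used memorylessly over $N$ channel uses. $X$ is the transmitter input, $X_1$ the relay input, $Y$ the output at receiver 1, $Y_1$ the output at the relay, $Z$ the output at receiver 2. Messages $W_1,W_2$ are independent and uniform over finite sets $\mathcal W_1,\mathcal W_2$. A code of length $N$: a stochastic encoder mapping $(w_1,w_2)$ to $x^N$; a stochastic relay encoder producing $x_{1,i}$ from $(y_{1,1},\dots,y_{1,i-1})$; a decoder at receiver 1 mapping $y^N$ to an estimate of $W_1$ with error probability $P_{e1}$; a decoder at receiver 2 mapping $z^N$ to an estimate of $W_2$ with error probability $P_{e2}$. Equivocations $\Delta_1=\frac1N H(W_1|Z^N)$, $\Delta_2=\frac1N H(W_2|Y^N)$. A quadruple $(R_1,R_2,R_{e1},R_{e2})$ of positive reals is achievable if for every $\epsilon>0$ there exist codes with $\lim_{N}\frac{\log|\mathcal W_j|}{N}=R_j$ ($j=1,2$), $\lim_N\Delta_1\ge R_{e1}$, $\lim_N\Delta_2\ge R_{e2}$, $P_{e1},P_{e2}\le\epsilon$. $\mathcal R^{(B)}$ is the set of achievable quadruples. Logarithms are base 2. *)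

theory Defs
  imports "HOL-Probability.Probability"
begin

definition ent :: "'w pmf \<Rightarrow> ('w \<Rightarrow> 'a) \<Rightarrow> real" where
  "ent P f = - (\<Sum>a\<in>set_pmf (map_pmf f P).
                   pmf (map_pmf f P) a * log 2 (pmf (map_pmf f P) a))"

definition cond_ent :: "'w pmf \<Rightarrow> ('w \<Rightarrow> 'a) \<Rightarrow> ('w \<Rightarrow> 'b) \<Rightarrow> real" where
  "cond_ent P A B = ent P (\<lambda>w. (A w, B w)) - ent P B"

definition mi :: "'w pmf \<Rightarrow> ('w \<Rightarrow> 'a) \<Rightarrow> ('w \<Rightarrow> 'b) \<Rightarrow> real" where
  "mi P A B = ent P A + ent P B - ent P (\<lambda>w. (A w, B w))"

definition cmi :: "'w pmf \<Rightarrow> ('w \<Rightarrow> 'a) \<Rightarrow> ('w \<Rightarrow> 'b) \<Rightarrow> ('w \<Rightarrow> 'c) \<Rightarrow> real" where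
  "cmi P A B C = ent P (\<lambda>w. (A w, C w)) + ent P (\<lambda>w. (B w, C w))
                 - ent P (\<lambda>w. (A w, B w, C w)) - ent P C"

text \<open>Codes: message set sizes (messages are 0..<m), stochastic encoder,
  stochastic relay encoder (time index i, past relay outputs y1_1..y1_{i}),
  decoder at receiver 1 (from y^N), decoder at receiver 2 (from z^N).\<close>
record ('x, 'x1, 'y, 'y1, 'z) rbc_code =
  msz1 :: nat
  msz2 :: nat
  enc  :: "nat \<Rightarrow> nat \<Rightarrow> 'x list pmf"
  rel  :: "nat \<Rightarrow> 'y1 list \<Rightarrow> 'x1 pmf"
  dec1 :: "'y list \<Rightarrow> nat"
  dec2 :: "'z list \<Rightarrow> nat"

definition valid_code :: "nat \<Rightarrow> ('x, 'x1, 'y, 'y1, 'z) rbc_code \<Rightarrow> bool" where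
  "valid_code N c \<longleftrightarrow> msz1 c > 0 \<and> msz2 c > 0 \<and>
     (\<forall>w1<msz1 c. \<forall>w2<msz2 c. \<forall>xs\<in>set_pmf (enc c w1 w2). length xs = N)"

primrec rbc_run ::
  "('x \<Rightarrow> 'x1 \<Rightarrow> ('y \<times> 'y1 \<times> 'z) pmf) \<Rightarrow> (nat \<Rightarrow> 'y1 list \<Rightarrow> 'x1 pmf) \<Rightarrow> 'x list \<Rightarrow> nat
    \<Rightarrow> ('x1 list \<times> 'y list \<times> 'y1 list \<times> 'z list) pmf" where
  "rbc_run W r xs 0 = return_pmf ([], [], [], [])"
| "rbc_run W r xs (Suc i) =
     bind_pmf (rbc_run W r xs i) (\<lambda>(x1s, ys, y1s, zs).
       bind_pmf (r i y1s) (\<lambda>x1.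
         map_pmf (\<lambda>(y, y1, z). (x1s @ [x1], ys @ [y], y1s @ [y1], zs @ [z]))
                 (W (xs ! i) x1)))"

definition code_law ::
  "('x \<Rightarrow> 'x1 \<Rightarrow> ('y \<times> 'y1 \<times> 'z) pmf) \<Rightarrow> nat \<Rightarrow> ('x, 'x1, 'y, 'y1, 'z) rbc_code
    \<Rightarrow> (nat \<times> nat \<times> 'y list \<times> 'z list) pmf" where
  "code_law W N c =
     bind_pmf (pmf_of_set {0..<msz1 c}) (\<lambda>w1.
     bind_pmf (pmf_of_set {0..<msz2 c}) (\<lambda>w2.
     bind_pmf (enc c w1 w2) (\<lambda>xs.
     map_pmf (\<lambda>(x1s, ys, y1s, zs). (w1, w2, ys, zs)) (rbc_run W (rel c) xs N))))"

definition Pe1 :: "('x \<Rightarrow> 'x1 \<Rightarrow> ('y \<times> 'y1 \<times> 'z) pmf) \<Rightarrow> nat \<Rightarrow> ('x, 'x1, 'y, 'y1, 'z) rbc_code \<Rightarrow> real" where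
  "Pe1 W N c = measure_pmf.prob (code_law W N c) {(w1, w2, ys, zs). dec1 c ys \<noteq> w1}"

definition Pe2 :: "('x \<Rightarrow> 'x1 \<Rightarrow> ('y \<times> 'y1 \<times> 'z) pmf) \<Rightarrow> nat \<Rightarrow> ('x, 'x1, 'y, 'y1, 'z) rbc_code \<Rightarrow> real" where
  "Pe2 W N c = measure_pmf.prob (code_law W N c) {(w1, w2, ys, zs). dec2 c zs \<noteq> w2}"

definition Delta1 :: "('x \<Rightarrow> 'x1 \<Rightarrow> ('y \<times> 'y1 \<times> 'z) pmf) \<Rightarrow> nat \<Rightarrow> ('x, 'x1, 'y, 'y1, 'z) rbc_code \<Rightarrow> real" where
  "Delta1 W N c = cond_ent (code_law W N c) (\<lambda>(w1, w2, ys, zs). w1) (\<lambda>(w1, w2, ys, zs). zs) / real N"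

definition Delta2 :: "('x \<Rightarrow> 'x1 \<Rightarrow> ('y \<times> 'y1 \<times> 'z) pmf) \<Rightarrow> nat \<Rightarrow> ('x, 'x1, 'y, 'y1, 'z) rbc_code \<Rightarrow> real" where
  "Delta2 W N c = cond_ent (code_law W N c) (\<lambda>(w1, w2, ys, zs). w2) (\<lambda>(w1, w2, ys, zs). ys) / real N"

definition achievable ::
  "('x \<Rightarrow> 'x1 \<Rightarrow> ('y \<times> 'y1 \<times> 'z) pmf) \<Rightarrow> real \<Rightarrow> real \<Rightarrow> real \<Rightarrow> real \<Rightarrow> bool" where
  "achievable W R1 R2 Re1 Re2 \<longleftrightarrow> R1 > 0 \<and> R2 > 0 \<and> Re1 > 0 \<and> Re2 > 0 \<and>
     (\<forall>\<epsilon>>0. \<exists>C :: nat \<Rightarrow> ('x, 'x1, 'y, 'y1, 'z) rbc_code.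
        (\<forall>N. valid_code N (C N)) \<and>
        (\<lambda>N. log 2 (real (msz1 (C N))) / real N) \<longlonglongrightarrow> R1 \<and>
        (\<lambda>N. log 2 (real (msz2 (C N))) / real N) \<longlonglongrightarrow> R2 \<and>
        (\<exists>L. (\<lambda>N. Delta1 W N (C N)) \<longlonglongrightarrow> L \<and> L \<ge> Re1) \<and>
        (\<exists>L. (\<lambda>N. Delta2 W N (C N)) \<longlonglongrightarrow> L \<and> L \<ge> Re2) \<and>
        (\<forall>\<^sub>F N in sequentially. Pe1 W N (C N) \<le> \<epsilon> \<and> Pe2 W N (C N) \<le> \<epsilon>))"

definition RB :: "('x \<Rightarrow> 'x1 \<Rightarrow> ('y \<times> 'y1 \<times> 'z) pmf) \<Rightarrow> (real \<times> real \<times> real \<times> real) set" where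
  "RB W = {(R1, R2, Re1, Re2). achievable W R1 R2 Re1 Re2}"

definition single_law ::
  "('x \<Rightarrow> 'x1 \<Rightarrow> ('y \<times> 'y1 \<times> 'z) pmf) \<Rightarrow> ('u \<times> 'v1 \<times> 'v2) pmf \<Rightarrow> ('u \<Rightarrow> 'v1 \<Rightarrow> 'v2 \<Rightarrow> ('x \<times> 'x1) pmf)
    \<Rightarrow> ('u \<times> 'v1 \<times> 'v2 \<times> 'x \<times> 'x1 \<times> 'y \<times> 'y1 \<times> 'z) pmf" where
  "single_law W PUV PX =
     bind_pmf PUV (\<lambda>(u, v1, v2).
     bind_pmf (PX u v1 v2) (\<lambda>(x, x1).
     map_pmf (\<lambda>(y, y1, z). (u, v1, v2, x, x1, y, y1, z)) (W x x1)))"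

definition "rvU  = (\<lambda>(u, v1, v2, x, x1, y, y1, z). u)"
definition "rvV1 = (\<lambda>(u, v1, v2, x, x1, y, y1, z). v1)"
definition "rvV2 = (\<lambda>(u, v1, v2, x, x1, y, y1, z). v2)"
definition "rvX  = (\<lambda>(u, v1, v2, x, x1, y, y1, z). x)"
definition "rvX1 = (\<lambda>(u, v1, v2, x, x1, y, y1, z). x1)"
definition "rvY  = (\<lambda>(u, v1, v2, x, x1, y, y1, z). y)"
definition "rvY1 = (\<lambda>(u, v1, v2, x, x1, y, y1, z). y1)"
definition "rvZ  = (\<lambda>(u, v1, v2, x, x1, y, y1, z). z)"

end

theory Submission
  imports Defs
begin

text \<open>Decode-and-forward by block Markov superposition. Over \<open>T + 1\<close> blocks the cloud word of block \<open>b\<close> is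
  selected by two consecutive cloud indices: the relay sends \<open>x1 (w b)\<close> and decodes \<open>w (b + 1)\<close> from its output,
  and the receivers decode the indices backwards from the last block. Both receivers learn the cloud indices, so
  these carry only rate that need not be secret.

  On top of each cloud word sits a code with two confidential messages. A pair of jointly typical codewords is
  found by binning (the mutual covering lemma). The message of each side has a secret part, a public part and a
  dummy, and public part and dummy are as large as the information the other receiver has about the codeword.
  The equivocation is bounded by giving the other receiver the second codeword as well: it can then
  almost decode the codeword once the secret part is known. This bounds the equivocation from both sides,
  hence its rate converges to the rate of the secret part. All tests compare products of information densities
  with a threshold, so the weak law of large numbers and changes of measure suffice.

  Entropies are computed for an ideal relay that knows the cloud indices. The true law agrees with the ideal one
  as long as no decision is wrong, so conditional entropies differ by at most one bit plus the error probability
  times the logarithm of the number of messages.\<close>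

subsection \<open>Expectations over finite distributions\<close>

text \<open>The rates of the private code are forced. Put J1 = I(V1;V2|U,X1) + I(V1;Z|U,X1,V2).
  Receiver 2, given the second codeword, can single out one among about 2^(n J1) first codewords. If
  binning, public part and dummy together have rate J1, they saturate this receiver and it can still
  resolve them, so the equivocation is the secret rate up to the slack. Receiver 1 resolves rate
  I(V1;Y|U,X1), so I(V1;Y|U,X1) - J1 is left for the secret part, as in the claim. The public part
  may be smaller than what is needed for saturation, hence the dummy. Achievability asks for a limit
  along all block lengths. Hence the upper bound on the equivocation, and padding letters after the
  last block. The obstacle to a direct computation is the relay: its letters depend on earlier
  outputs, so under the true law the blocks are not independent given the cloud indices. Only the
  ideal relay has a product law. Comparing the two laws pointwise on one event lets error
  probabilities and entropies pass from one to the other.\<close>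

definition pexp :: "'a pmf \<Rightarrow> ('a \<Rightarrow> real) \<Rightarrow> real" where
  "pexp P f = (\<Sum>x\<in>set_pmf P. pmf P x * f x)"

lemma pexp_eq_expectation: "finite (set_pmf P) \<Longrightarrow> pexp P f = measure_pmf.expectation P f"
  unfolding pexp_def by (subst integral_measure_pmf_real[of "set_pmf P"]) (auto simp: mult.commute)

lemma pexp_superset:
  "finite A \<Longrightarrow> set_pmf P \<subseteq> A \<Longrightarrow> pexp P f = (\<Sum>x\<in>A. pmf P x * f x)"
  unfolding pexp_def by (rule sum.mono_neutral_left) (auto simp: set_pmf_iff)

lemma pexp_cong: "(\<And>x. x \<in> set_pmf P \<Longrightarrow> f x = g x) \<Longrightarrow> pexp P f = pexp P g"
  unfolding pexp_def by (rule sum.cong) auto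

text \<open>A sum over an infinite support is 0, so order, linearity and exchange of expectations
  hold without integrability conditions. Finite support matters for constants, for composition of
  kernels and for agreement with the integral.\<close>

lemma pexp_mono: "(\<And>x. x \<in> set_pmf P \<Longrightarrow> f x \<le> g x) \<Longrightarrow> pexp P f \<le> pexp P g"
  unfolding pexp_def by (rule sum_mono) (auto intro: mult_left_mono)

lemma pexp_add: "pexp P (\<lambda>x. f x + g x) = pexp P f + pexp P g"
  unfolding pexp_def by (simp add: sum.distrib distrib_left)

lemma pexp_diff: "pexp P (\<lambda>x. f x - g x) = pexp P f - pexp P g"
  unfolding pexp_def by (simp add: sum_subtractf right_diff_distrib)

lemma pexp_cmult: "pexp P (\<lambda>x. c * f x) = c * pexp P f"
  unfolding pexp_def by (simp add: sum_distrib_left mult.left_commute)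

lemma pexp_cmultr: "pexp P (\<lambda>x. f x * c) = pexp P f * c"
  using pexp_cmult[of P c f] by (simp add: mult.commute)

lemma pexp_sum: "pexp P (\<lambda>x. \<Sum>i\<in>A. f i x) = (\<Sum>i\<in>A. pexp P (f i))"
  unfolding pexp_def by (simp add: sum_distrib_left sum.swap[of _ A])

lemma sum_pmf_support: "finite (set_pmf P) \<Longrightarrow> (\<Sum>x\<in>set_pmf P. pmf P x) = 1"
  by (rule sum_pmf_eq_1) auto

lemma pexp_const: "finite (set_pmf P) \<Longrightarrow> pexp P (\<lambda>_. c) = c"
  unfolding pexp_def by (simp add: sum_distrib_right[symmetric] sum_pmf_support)

lemma pexp_nonneg: "(\<And>x. x \<in> set_pmf P \<Longrightarrow> 0 \<le> f x) \<Longrightarrow> 0 \<le> pexp P f"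
  unfolding pexp_def by (auto intro!: sum_nonneg mult_nonneg_nonneg)

lemma pexp_le_const: "finite (set_pmf P) \<Longrightarrow> (\<And>x. x \<in> set_pmf P \<Longrightarrow> f x \<le> c) \<Longrightarrow> pexp P f \<le> c"
  using pexp_mono[of P f "\<lambda>_. c"] by (simp add: pexp_const)

lemma pexp_ge_const: "finite (set_pmf P) \<Longrightarrow> (\<And>x. x \<in> set_pmf P \<Longrightarrow> c \<le> f x) \<Longrightarrow> c \<le> pexp P f"
  using pexp_mono[of P "\<lambda>_. c" f] by (simp add: pexp_const)

lemma pexp_return [simp]: "pexp (return_pmf x) f = f x"
  unfolding pexp_def by simp

lemma pexp_bind:
  assumes "finite (set_pmf P)" "\<And>x. x \<in> set_pmf P \<Longrightarrow> finite (set_pmf (k x))"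
  shows "pexp (bind_pmf P k) f = pexp P (\<lambda>x. pexp (k x) f)"
proof -
  have fin: "finite (set_pmf (bind_pmf P k))" using assms by auto
  have "pexp (bind_pmf P k) f = (\<Sum>a\<in>set_pmf P. pmf P a *\<^sub>R measure_pmf.expectation (k a) f)"
    unfolding pexp_eq_expectation[OF fin] using assms by (intro pmf_expectation_bind) auto
  also have "\<dots> = pexp P (\<lambda>x. pexp (k x) f)"
    unfolding pexp_def[of P] using assms by (intro sum.cong) (auto simp: pexp_eq_expectation)
  finally show ?thesis .
qed

lemma pexp_map: "finite (set_pmf P) \<Longrightarrow> pexp (map_pmf g P) f = pexp P (\<lambda>x. f (g x))"
  by (simp add: map_pmf_def pexp_bind)

lemma pexp_pair:
  "finite (set_pmf P) \<Longrightarrow> finite (set_pmf Q) \<Longrightarrow>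
   pexp (pair_pmf P Q) f = pexp P (\<lambda>x. pexp Q (\<lambda>y. f (x, y)))"
  by (simp add: pair_pmf_def pexp_bind)

lemma pexp_commute: "pexp P (\<lambda>x. pexp Q (\<lambda>y. f x y)) = pexp Q (\<lambda>y. pexp P (\<lambda>x. f x y))"
  unfolding pexp_def sum_distrib_left by (subst sum.swap) (simp add: mult.left_commute)

lemma pexp_pmf_of_set:
  "finite A \<Longrightarrow> A \<noteq> {} \<Longrightarrow> pexp (pmf_of_set A) f = (\<Sum>x\<in>A. f x) / card A"
  unfolding pexp_def by (simp add: sum_divide_distrib)

text \<open>The derandomisation step: it passes from a bound averaged over random codebooks to one
  codebook that attains it.\<close>

lemma pexp_ex_le:
  assumes "finite (set_pmf P)"
  shows "\<exists>x\<in>set_pmf P. f x \<le> pexp P f"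
proof (rule ccontr)
  assume "\<not> ?thesis"
  then have *: "\<And>x. x \<in> set_pmf P \<Longrightarrow> pexp P f < f x" by auto
  have "(\<Sum>x\<in>set_pmf P. pmf P x * pexp P f) < (\<Sum>x\<in>set_pmf P. pmf P x * f x)"
    using assms * by (intro sum_strict_mono) (auto simp: set_pmf_not_empty intro!: mult_strict_left_mono pmf_positive)
  moreover have "(\<Sum>x\<in>set_pmf P. pmf P x * pexp P f) = pexp P f"
    using pexp_const[OF assms, of "pexp P f"] by (simp add: pexp_def)
  ultimately show False by (simp add: pexp_def)
qed

lemma pexp_markov:
  assumes "\<And>x. x \<in> set_pmf P \<Longrightarrow> 0 \<le> f x" "c > 0"
  shows "pexp P (\<lambda>x. of_bool (f x \<ge> c)) \<le> pexp P f / c"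
proof -
  have "pexp P (\<lambda>x. of_bool (f x \<ge> c)) \<le> pexp P (\<lambda>x. f x * (1/c))"
    using assms by (intro pexp_mono) (auto simp: field_simps)
  then show ?thesis by (simp only: pexp_cmultr) simp
qed

lemma prob_eq_pexp:
  assumes "finite (set_pmf P)"
  shows "measure_pmf.prob P {x. Q x} = pexp P (\<lambda>x. of_bool (Q x))"
proof -
  have "measure_pmf.prob P {x. Q x} = measure_pmf.prob P ({x. Q x} \<inter> set_pmf P)"
    by (simp add: measure_Int_set_pmf)
  also have "\<dots> = sum (pmf P) ({x. Q x} \<inter> set_pmf P)"
    using assms by (simp add: measure_measure_pmf_finite)
  also have "\<dots> = pexp P (\<lambda>x. of_bool (Q x))"
    unfolding pexp_def using assms by (intro sum.mono_neutral_cong_left) auto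
  finally show ?thesis .
qed

lemma pmf_map_eq_pexp:
  "finite (set_pmf P) \<Longrightarrow> pmf (map_pmf f P) y = pexp P (\<lambda>x. of_bool (f x = y))"
  by (simp add: pmf_map vimage_def prob_eq_pexp)

lemma pmf_bind_eq_pexp:
  "finite (set_pmf P) \<Longrightarrow> pmf (bind_pmf P k) y = pexp P (\<lambda>x. pmf (k x) y)"
  by (simp add: pmf_bind pexp_eq_expectation)

lemma pexp_of_bool_compl:
  "finite (set_pmf P) \<Longrightarrow> pexp P (\<lambda>x. of_bool (\<not> Q x)) = 1 - pexp P (\<lambda>x. of_bool (Q x))"
  using pexp_diff[of P "\<lambda>_. 1" "\<lambda>x. of_bool (Q x)"] by (simp add: pexp_const of_bool_not_iff)

subsection \<open>Entropy\<close>

lemma ent_pexp: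
  "finite (set_pmf P) \<Longrightarrow> ent P f = pexp P (\<lambda>w. - log 2 (pmf (map_pmf f P) (f w)))"
  using pexp_map[of P f "\<lambda>a. - log 2 (pmf (map_pmf f P) a)"]
  by (simp add: ent_def pexp_def sum_negf)

lemma pmf_map_pos: "w \<in> set_pmf P \<Longrightarrow> pmf (map_pmf f P) (f w) > 0"
  by (simp add: pmf_positive)

lemma ent_map: "ent (map_pmf h P) f = ent P (\<lambda>w. f (h w))"
  by (simp add: ent_def map_pmf_comp o_def)

lemma cond_ent_map: "cond_ent (map_pmf h P) A B = cond_ent P (\<lambda>w. A (h w)) (\<lambda>w. B (h w))"
  by (simp add: cond_ent_def ent_map)

text \<open>Entropy depends only on the partition of the support that the variable induces.
  Re-encodings such as reordered tuples, message indices and concatenated blocks are handled through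
  this criterion.\<close>

lemma ent_inj':
  assumes "finite (set_pmf P)"
    "\<And>w w'. w \<in> set_pmf P \<Longrightarrow> w' \<in> set_pmf P \<Longrightarrow> f w = f w' \<longleftrightarrow> g w = g w'"
  shows "ent P f = ent P g"
proof -
  have "map_pmf f P = map_pmf (\<lambda>w. f w) P" by simp
  have "ent P f = pexp P (\<lambda>w. - log 2 (pmf (map_pmf f P) (f w)))" by (rule ent_pexp[OF assms(1)])
  also have "\<dots> = pexp P (\<lambda>w. - log 2 (pmf (map_pmf g P) (g w)))"
    using assms by (intro pexp_cong arg_cong[where f="\<lambda>x. - log 2 x"])
      (auto simp: pmf_map_eq_pexp intro!: pexp_cong)
  also have "\<dots> = ent P g" by (rule ent_pexp[OF assms(1), symmetric])
  finally show ?thesis .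
qed

lemma cond_ent_inj':
  assumes "finite (set_pmf P)"
    "\<And>x x'. x \<in> set_pmf P \<Longrightarrow> x' \<in> set_pmf P \<Longrightarrow> B x = B x' \<longleftrightarrow> B' x = B' x'"
    "\<And>x x'. x \<in> set_pmf P \<Longrightarrow> x' \<in> set_pmf P \<Longrightarrow> B x = B x' \<Longrightarrow> A x = A x' \<longleftrightarrow> A' x = A' x'"
  shows "cond_ent P A B = cond_ent P A' B'"
proof -
  have "ent P (\<lambda>x. (A x, B x)) = ent P (\<lambda>x. (A' x, B' x))"
  proof (rule ent_inj'[OF assms(1)])
    fix x x' assume w: "x \<in> set_pmf P" "x' \<in> set_pmf P"
    show "(A x, B x) = (A x', B x') \<longleftrightarrow> (A' x, B' x) = (A' x', B' x')"
      using assms(2)[OF w] assms(3)[OF w] by auto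
  qed
  moreover have "ent P B = ent P B'"
    by (rule ent_inj'[OF assms(1,2)])
  ultimately show ?thesis by (simp add: cond_ent_def)
qed

lemma cond_ent_pexp:
  assumes "finite (set_pmf P)"
  shows "cond_ent P A B = pexp P (\<lambda>w. - log 2 (pmf (map_pmf (\<lambda>w. (A w, B w)) P) (A w, B w) / pmf (map_pmf B P) (B w)))"
proof -
  have "cond_ent P A B = pexp P (\<lambda>w. - log 2 (pmf (map_pmf (\<lambda>w. (A w, B w)) P) (A w, B w)) - (- log 2 (pmf (map_pmf B P) (B w))))"
    unfolding cond_ent_def pexp_diff ent_pexp[OF assms] by simp
  also have "\<dots> = pexp P (\<lambda>w. - log 2 (pmf (map_pmf (\<lambda>w. (A w, B w)) P) (A w, B w) / pmf (map_pmf B P) (B w)))"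
  proof (rule pexp_cong)
    fix w assume "w \<in> set_pmf P"
    then have "pmf (map_pmf (\<lambda>w. (A w, B w)) P) (A w, B w) > 0" "pmf (map_pmf B P) (B w) > 0"
      using pmf_map_pos[of w P "\<lambda>w. (A w, B w)"] pmf_map_pos[of w P B] by auto
    then show "- log 2 (pmf (map_pmf (\<lambda>w. (A w, B w)) P) (A w, B w)) - (- log 2 (pmf (map_pmf B P) (B w)))
      = - log 2 (pmf (map_pmf (\<lambda>w. (A w, B w)) P) (A w, B w) / pmf (map_pmf B P) (B w))"
      by (simp add: log_divide)
  qed
  finally show ?thesis .
qed

lemma log2_ge: "0 < x \<Longrightarrow> - log 2 x \<ge> (1 - x) / ln (2::real)"
  using ln_le_minus_one[of x] divide_right_mono[of "1 - x" "- ln x" "ln 2"] by (simp add: log_def)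

text \<open>Gibbs' inequality for a reference kernel \<open>q\<close> of total mass at most 1. Most
  of the later upper bounds on conditional entropy amount to a choice of \<open>q\<close>.\<close>

lemma cond_ent_le_cross:
  assumes fin: "finite (set_pmf P)"
    and pos: "\<And>x. x \<in> set_pmf P \<Longrightarrow> 0 < q (A x) (B x)"
    and sub: "\<And>b. b \<in> B ` set_pmf P \<Longrightarrow> (\<Sum>a\<in>A ` set_pmf P. q a b) \<le> 1"
    and nn: "\<And>a b. 0 \<le> q a b"
  shows "cond_ent P A B \<le> pexp P (\<lambda>x. - log 2 (q (A x) (B x)))"
proof -
  let ?pab = "\<lambda>x. pmf (map_pmf (\<lambda>x. (A x, B x)) P) (A x, B x)"
  let ?pb = "\<lambda>x. pmf (map_pmf B P) (B x)"
  \<comment> \<open>The ratio of the reference joint law to the true one. Its mean is at most 1, and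
    \<open>log2_ge\<close> turns this into the claimed inequality.\<close>
  let ?r = "\<lambda>(a, b). q a b * pmf (map_pmf B P) b / pmf (map_pmf (\<lambda>x. (A x, B x)) P) (a, b)"
  have posab: "\<And>x. x \<in> set_pmf P \<Longrightarrow> ?pab x > 0"
    using pmf_map_pos[of _ P "\<lambda>x. (A x, B x)"] by simp
  have posb: "\<And>x. x \<in> set_pmf P \<Longrightarrow> ?pb x > 0"
    using pmf_map_pos[of _ P B] by simp
  have "pexp P (\<lambda>x. ?r (A x, B x)) = pexp (map_pmf (\<lambda>x. (A x, B x)) P) ?r"
    using fin by (simp add: pexp_map)
  also have "\<dots> = (\<Sum>(a,b)\<in>(\<lambda>x. (A x, B x)) ` set_pmf P. q a b * pmf (map_pmf B P) b)"
    unfolding pexp_def set_map_pmf using posab by (intro sum.cong) (auto simp: field_simps dest: posab)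
  also have "\<dots> \<le> (\<Sum>(a,b)\<in>(A ` set_pmf P) \<times> (B ` set_pmf P). q a b * pmf (map_pmf B P) b)"
    using fin nn by (intro sum_mono2) auto
  also have "\<dots> = (\<Sum>b\<in>B ` set_pmf P. \<Sum>a\<in>A ` set_pmf P. q a b * pmf (map_pmf B P) b)"
    by (subst sum.swap) (simp add: sum.cartesian_product)
  also have "\<dots> = (\<Sum>b\<in>B ` set_pmf P. (\<Sum>a\<in>A ` set_pmf P. q a b) * pmf (map_pmf B P) b)"
    by (simp add: sum_distrib_right)
  also have "\<dots> \<le> (\<Sum>b\<in>B ` set_pmf P. 1 * pmf (map_pmf B P) b)"
    by (intro sum_mono mult_right_mono sub) auto
  also have "\<dots> = 1"
    using sum_pmf_support[of "map_pmf B P"] fin by simp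
  finally have r1: "pexp P (\<lambda>x. ?r (A x, B x)) \<le> 1" .
  have "0 \<le> (1 - pexp P (\<lambda>x. ?r (A x, B x))) / ln 2" using r1 by simp
  also have "\<dots> = pexp P (\<lambda>x. (1 - ?r (A x, B x)) / ln 2)"
    using pexp_cmultr[of P "\<lambda>x. 1 - ?r (A x, B x)" "1 / ln 2"] fin by (simp add: pexp_diff pexp_const)
  also have "\<dots> \<le> pexp P (\<lambda>x. - log 2 (?r (A x, B x)))"
    using posab posb pos by (intro pexp_mono log2_ge) auto
  also have "\<dots> = pexp P (\<lambda>x. - log 2 (q (A x) (B x)) - (- log 2 (?pab x / ?pb x)))"
  proof (rule pexp_cong)
    fix x assume w: "x \<in> set_pmf P"
    show "- log 2 (?r (A x, B x)) = - log 2 (q (A x) (B x)) - (- log 2 (?pab x / ?pb x))"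
      using posab[OF w] posb[OF w] pos[OF w] by (simp add: log_divide log_mult)
  qed
  finally show ?thesis
    unfolding pexp_diff cond_ent_pexp[OF fin] by simp
qed

lemma pmf_map_pair_le:
  assumes fin: "finite (set_pmf P)"
  shows "pmf (map_pmf (\<lambda>w. (A w, B w)) P) (a, b) \<le> pmf (map_pmf B P) b"
  using fin by (auto simp: pmf_map_eq_pexp intro!: pexp_mono)

lemma cond_ent_nonneg:
  assumes fin: "finite (set_pmf P)"
  shows "0 \<le> cond_ent P A B"
  unfolding cond_ent_pexp[OF fin]
proof (rule pexp_nonneg)
  fix x assume w: "x \<in> set_pmf P"
  have "pmf (map_pmf (\<lambda>x. (A x, B x)) P) (A x, B x) > 0" "pmf (map_pmf B P) (B x) > 0"
    using w pmf_map_pos[of x P "\<lambda>x. (A x, B x)"] pmf_map_pos[of x P B] by auto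
  then show "0 \<le> - log 2 (pmf (map_pmf (\<lambda>x. (A x, B x)) P) (A x, B x) / pmf (map_pmf B P) (B x))"
    using pmf_map_pair_le[OF fin, of A B "A x" "B x"] by simp
qed

lemma sum_pmf_pair:
  assumes fin: "finite (set_pmf P)" and "finite S"
  shows "(\<Sum>a\<in>S. pmf (map_pmf (\<lambda>w. (A w, B w)) P) (a, b)) \<le> pmf (map_pmf B P) b"
proof -
  have "(\<Sum>a\<in>S. pmf (map_pmf (\<lambda>w. (A w, B w)) P) (a, b)) = pexp P (\<lambda>x. \<Sum>a\<in>S. of_bool ((A x, B x) = (a, b)))"
    using fin by (simp add: pmf_map_eq_pexp pexp_sum)
  also have "\<dots> \<le> pexp P (\<lambda>x. of_bool (B x = b))"
  proof (rule pexp_mono)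
    fix x show "(\<Sum>a\<in>S. of_bool ((A x, B x) = (a, b))) \<le> (of_bool (B x = b) :: real)"
      using \<open>finite S\<close> by (cases "B x = b") (auto simp: of_bool_def sum.delta)
  qed
  finally show ?thesis using fin by (simp add: pmf_map_eq_pexp)
qed

text \<open>Take as reference kernel the conditional law of \<open>A\<close> given \<open>B\<close>,
  evaluated at \<open>g (C x)\<close>: its cross entropy is exactly the conditional entropy given
  \<open>B\<close>.\<close>

lemma cond_ent_reduce:
  assumes fin: "finite (set_pmf P)"
    and g: "\<And>x. x \<in> set_pmf P \<Longrightarrow> B x = g (C x)"
  shows "cond_ent P A C \<le> cond_ent P A B"
proof -
  let ?q = "\<lambda>a c. pmf (map_pmf (\<lambda>x. (A x, B x)) P) (a, g c) / pmf (map_pmf B P) (g c)"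
  have "cond_ent P A C \<le> pexp P (\<lambda>x. - log 2 (?q (A x) (C x)))"
  proof (rule cond_ent_le_cross[OF fin])
    fix x assume w: "x \<in> set_pmf P"
    show "0 < ?q (A x) (C x)"
      using w pmf_map_pos[of x P "\<lambda>x. (A x, B x)"] pmf_map_pos[of x P B] g[OF w] by auto
  next
    fix c assume "c \<in> C ` set_pmf P"
    show "(\<Sum>a\<in>A ` set_pmf P. ?q a c) \<le> 1"
      using sum_pmf_pair[OF fin, of "A ` set_pmf P" A B "g c"] fin pmf_nonneg[of "map_pmf B P" "g c"]
      by (auto simp: sum_divide_distrib[symmetric] divide_le_eq_1 less_le simp del: pmf_nonneg)
  qed auto
  also have "\<dots> = cond_ent P A B"
    unfolding cond_ent_pexp[OF fin] by (intro pexp_cong) (simp add: g[symmetric])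
  finally show ?thesis .
qed

lemma ent_eq_cond_ent: "finite (set_pmf P) \<Longrightarrow> ent P A = cond_ent P A (\<lambda>_. ())"
proof -
  assume fin: "finite (set_pmf P)"
  have "ent P (\<lambda>w. (A w, ())) = ent P A" using fin by (intro ent_inj') auto
  moreover have "ent P (\<lambda>_. ()) = 0" by (simp add: ent_def)
  ultimately show ?thesis by (simp add: cond_ent_def)
qed

lemma ent_nonneg: "finite (set_pmf P) \<Longrightarrow> 0 \<le> ent P A"
  unfolding ent_eq_cond_ent by (rule cond_ent_nonneg)

lemma cond_ent_le_log_card:
  assumes fin: "finite (set_pmf P)" and S: "finite S" "A ` set_pmf P \<subseteq> S"
  shows "cond_ent P A B \<le> log 2 (card S)"
proof -
  have ne: "card S > 0" using S set_pmf_not_empty[of P] by (auto simp: card_gt_0_iff)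
  have "cond_ent P A B \<le> pexp P (\<lambda>w. - log 2 (1 / real (card S)))"
  proof (rule cond_ent_le_cross[OF fin, where q="\<lambda>_ _. 1 / real (card S)"])
    show "(\<Sum>a\<in>A ` set_pmf P. 1 / real (card S)) \<le> 1"
      using card_mono[OF S] ne by (simp add: divide_le_eq_1)
  qed (use ne in auto)
  also have "\<dots> = log 2 (card S)" using ne fin by (simp add: pexp_const log_divide)
  finally show ?thesis .
qed

lemma ent_le_log_card:
  "finite (set_pmf P) \<Longrightarrow> finite S \<Longrightarrow> A ` set_pmf P \<subseteq> S \<Longrightarrow> ent P A \<le> log 2 (card S)"
  unfolding ent_eq_cond_ent by (rule cond_ent_le_log_card)

lemma cond_ent_chain:
  assumes fin: "finite (set_pmf P)"
  shows "cond_ent P (\<lambda>w. (A w, B w)) C = cond_ent P B C + cond_ent P A (\<lambda>w. (B w, C w))"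
proof -
  have "ent P (\<lambda>w. ((A w, B w), C w)) = ent P (\<lambda>w. (A w, B w, C w))"
    using fin by (intro ent_inj') auto
  then show ?thesis by (simp add: cond_ent_def)
qed

lemma cond_ent_mono:
  assumes fin: "finite (set_pmf P)"
    and g: "\<And>w. w \<in> set_pmf P \<Longrightarrow> A w = g (D w)"
  shows "cond_ent P A B \<le> cond_ent P D B"
proof -
  have "cond_ent P D B = cond_ent P (\<lambda>w. (D w, A w)) B"
    using fin g by (intro cond_ent_inj') auto
  then show ?thesis
    using cond_ent_chain[OF fin, of D A B] cond_ent_nonneg[OF fin, of D "\<lambda>w. (A w, B w)"] by simp
qed

lemma cond_ent_subadd:
  assumes fin: "finite (set_pmf P)"
  shows "cond_ent P (\<lambda>w. (A w, B w)) C \<le> cond_ent P B C + cond_ent P A C"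
  using cond_ent_chain[OF fin, of A B C] cond_ent_reduce[OF fin, of C snd "\<lambda>w. (B w, C w)" A] by simp

lemma cmi_eq:
  assumes "finite (set_pmf P)"
  shows "cmi P A B C = cond_ent P A C - cond_ent P A (\<lambda>w. (B w, C w))"
  by (simp add: cmi_def cond_ent_def)

lemma cmi_nonneg: "finite (set_pmf P) \<Longrightarrow> 0 \<le> cmi P A B C"
  unfolding cmi_eq using cond_ent_reduce[of P C snd "\<lambda>w. (B w, C w)" A] by simp

lemma cmi_map: "cmi (map_pmf h P) A B C = cmi P (\<lambda>w. A (h w)) (\<lambda>w. B (h w)) (\<lambda>w. C (h w))"
  by (simp add: cmi_def ent_map)

lemma mi_eq_cmi: "finite (set_pmf P) \<Longrightarrow> mi P A B = cmi P A B (\<lambda>_. ())"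
proof -
  assume fin: "finite (set_pmf P)"
  have "ent P (\<lambda>w. (A w, ())) = ent P A" "ent P (\<lambda>w. (B w, ())) = ent P B"
    "ent P (\<lambda>w. (A w, B w, ())) = ent P (\<lambda>w. (A w, B w))"
    using fin by (auto intro!: ent_inj')
  moreover have "ent P (\<lambda>_. ()) = 0" by (simp add: ent_def)
  ultimately show ?thesis by (simp add: mi_def cmi_def)
qed

subsection \<open>More on conditional entropy\<close>

lemma pmf_map_Pair_bind:
  "pmf (bind_pmf Q (\<lambda>w. map_pmf (Pair w) (\<Lambda> w))) (w, x) = pmf Q w * pmf (\<Lambda> w) x"
proof -
  have 1: "pmf (map_pmf (Pair w') (\<Lambda> w')) (w, x) = of_bool (w' = w) * pmf (\<Lambda> w) x" for w'
  proof (cases "w' = w")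
    case True
    then show ?thesis using pmf_map_inj'[of "Pair w" "\<Lambda> w" x] by (simp add: inj_on_def)
  next
    case False
    then have "(w, x) \<notin> set_pmf (map_pmf (Pair w') (\<Lambda> w'))" by auto
    then have "pmf (map_pmf (Pair w') (\<Lambda> w')) (w, x) = 0" by (simp only: set_pmf_iff not_not)
    then show ?thesis using False by simp
  qed
  have "pmf (bind_pmf Q (\<lambda>w. map_pmf (Pair w) (\<Lambda> w))) (w, x)
    = measure_pmf.expectation Q (\<lambda>w'. of_bool (w' = w) * pmf (\<Lambda> w) x)"
    by (simp add: pmf_bind 1)
  also have "\<dots> = (\<Sum>w'\<in>{w}. pmf Q w' *\<^sub>R (of_bool (w' = w) * pmf (\<Lambda> w) x))"
    by (rule integral_measure_pmf) auto
  finally show ?thesis by simp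
qed

lemma pmf_map_nz: "w \<in> set_pmf P \<Longrightarrow> pmf (map_pmf f P) (f w) \<noteq> 0"
  using pmf_map_pos[of w P f] by simp

text \<open>Since \<open>w\<close> is retained in the observed variable, the joint pmf is a product
  and its logarithm splits.\<close>

lemma ent_mixture:
  assumes fin: "finite (set_pmf Q)" "\<And>w. w \<in> set_pmf Q \<Longrightarrow> finite (set_pmf (\<Lambda> w))"
  shows "ent (bind_pmf Q (\<lambda>w. map_pmf (Pair w) (\<Lambda> w))) (\<lambda>(w, x). (w, f x))
    = ent Q id + pexp Q (\<lambda>w. ent (\<Lambda> w) f)"
proof -
  let ?P = "bind_pmf Q (\<lambda>w. map_pmf (Pair w) (\<Lambda> w))"
  have finP: "finite (set_pmf ?P)" using fin by auto
  have m: "map_pmf (\<lambda>(w, x). (w, f x)) ?P = bind_pmf Q (\<lambda>w. map_pmf (Pair w) (map_pmf f (\<Lambda> w)))"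
    by (simp add: map_bind_pmf map_pmf_comp)
  have "ent ?P (\<lambda>(w, x). (w, f x)) = pexp Q (\<lambda>w. pexp (\<Lambda> w) (\<lambda>x. - log 2 (pmf Q w * pmf (map_pmf f (\<Lambda> w)) (f x))))"
    unfolding ent_pexp[OF finP] m using fin
    by (subst pexp_bind) (auto simp: pexp_map pmf_map_Pair_bind intro!: pexp_cong)
  also have "\<dots> = pexp Q (\<lambda>w. pexp (\<Lambda> w) (\<lambda>x. - log 2 (pmf Q w) + - log 2 (pmf (map_pmf f (\<Lambda> w)) (f x))))"
    by (intro pexp_cong) (simp add: log_mult pmf_map_nz set_pmf_iff)
  also have "\<dots> = pexp Q (\<lambda>w. - log 2 (pmf Q w) + ent (\<Lambda> w) f)"
    using fin by (intro pexp_cong) (simp only: pexp_add pexp_const ent_pexp)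
  also have "\<dots> = ent Q id + pexp Q (\<lambda>w. ent (\<Lambda> w) f)"
    unfolding pexp_add ent_pexp[OF fin(1), of id] by (simp add: map_pmf_id)
  finally show ?thesis .
qed

lemma cond_ent_mixture:
  assumes fin: "finite (set_pmf Q)" "\<And>w. w \<in> set_pmf Q \<Longrightarrow> finite (set_pmf (\<Lambda> w))"
  shows "cond_ent (bind_pmf Q (\<lambda>w. map_pmf (Pair w) (\<Lambda> w))) (\<lambda>(w, x). A x) (\<lambda>(w, x). (w, B x))
    = pexp Q (\<lambda>w. cond_ent (\<Lambda> w) A B)"
proof -
  let ?P = "bind_pmf Q (\<lambda>w. map_pmf (Pair w) (\<Lambda> w))"
  have finP: "finite (set_pmf ?P)" using fin by auto
  have "ent ?P (\<lambda>z. ((case z of (w, x) \<Rightarrow> A x), (case z of (w, x) \<Rightarrow> (w, B x)))) = ent ?P (\<lambda>(w, x). (w, A x, B x))"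
    using finP by (intro ent_inj') auto
  moreover have "ent ?P (\<lambda>(w, x). (w, A x, B x)) = ent Q id + pexp Q (\<lambda>w. ent (\<Lambda> w) (\<lambda>x. (A x, B x)))"
    by (rule ent_mixture[OF fin])
  moreover have "ent ?P (\<lambda>(w, x). (w, B x)) = ent Q id + pexp Q (\<lambda>w. ent (\<Lambda> w) B)"
    by (rule ent_mixture[OF fin])
  ultimately show ?thesis
    unfolding cond_ent_def pexp_diff by linarith
qed

lemma ent_pair:
  assumes fin: "finite (set_pmf P)" "finite (set_pmf Q)"
  shows "ent (pair_pmf P Q) (\<lambda>(x, y). (f x, g y)) = ent P f + ent Q g"
proof -
  have "ent (pair_pmf P Q) (\<lambda>(x, y). (f x, g y)) =
     pexp P (\<lambda>x. pexp Q (\<lambda>y. - log 2 (pmf (map_pmf f P) (f x) * pmf (map_pmf g Q) (g y))))"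
    using fin by (simp add: ent_pexp map_pair pexp_pair pmf_pair)
  also have "\<dots> = pexp P (\<lambda>x. pexp Q (\<lambda>y. - log 2 (pmf (map_pmf f P) (f x)) + - log 2 (pmf (map_pmf g Q) (g y))))"
    by (intro pexp_cong) (simp add: log_mult pmf_map_nz)
  also have "\<dots> = ent P f + ent Q g"
    using fin by (simp only: pexp_add pexp_const ent_pexp)
  finally show ?thesis .
qed

lemma cond_ent_pair:
  assumes fin: "finite (set_pmf P)" "finite (set_pmf Q)"
  shows "cond_ent (pair_pmf P Q) (\<lambda>(x, y). (A x, A' y)) (\<lambda>(x, y). (B x, B' y)) = cond_ent P A B + cond_ent Q A' B'"
proof -
  have "ent (pair_pmf P Q) (\<lambda>w. ((case w of (x, y) \<Rightarrow> (A x, A' y)), (case w of (x, y) \<Rightarrow> (B x, B' y))))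
    = ent (pair_pmf P Q) (\<lambda>(x, y). ((A x, B x), (A' y, B' y)))"
    using fin by (intro ent_inj') auto
  then show ?thesis
    unfolding cond_ent_def using ent_pair[OF fin, of "\<lambda>x. (A x, B x)" "\<lambda>y. (A' y, B' y)"] ent_pair[OF fin, of B B']
    by simp
qed

lemma inverse_ln2_le: "1 / ln 2 \<le> (2::real)"
proof -
  have "ln (1 / 2) \<le> 1 / 2 - (1::real)" by (rule ln_le_minus_one) simp
  then show ?thesis by (simp add: ln_div field_simps)
qed

lemma log2_inverse_double: "0 < y \<Longrightarrow> log 2 (1 / (2 * y)) = - (1 + log 2 y)"
  by (simp add: log_divide log_mult)

text \<open>The tangent of the logarithm at \<open>2 powr c\<close>. It replaces Jensen's
  inequality: if the mean of \<open>y\<close> is at most a multiple of \<open>2 powr c\<close>, the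
  mean of its logarithm is at most \<open>c\<close> plus a constant.\<close>

lemma log2_tangent:
  assumes "0 < y" shows "log 2 y \<le> c + (y / 2 powr c - 1) / ln 2"
proof -
  have "ln (y / 2 powr c) \<le> y / 2 powr c - 1"
    using assms by (intro ln_le_minus_one) auto
  then have "ln y - c * ln 2 \<le> y / 2 powr c - 1"
    using assms by (simp add: ln_div ln_powr)
  then have "(ln y - c * ln 2) / ln 2 \<le> (y / 2 powr c - 1) / ln 2"
    by (rule divide_right_mono) simp
  then show ?thesis by (simp add: log_def diff_divide_distrib)
qed

text \<open>The second half of the mixture \<open>q\<close> in the proof pays for the outcomes where \<open>K\<close> is not in the list.\<close>

lemma cond_ent_list_bound:
  assumes fin: "finite (set_pmf P)" and S: "finite S" "\<And>x. x \<in> set_pmf P \<Longrightarrow> K x \<in> S"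
    and c: "c \<ge> 0" "pexp P (\<lambda>x. of_bool (W x) * real (card {k\<in>S. k \<noteq> K x \<and> k \<in> L (B x)})) \<le> 2 powr c"
  shows "cond_ent P K B \<le> c + 3 + pexp P (\<lambda>x. of_bool (\<not> (W x \<and> K x \<in> L (B x)))) * log 2 (card S)"
proof -
  have cS: "card S > 0" using S set_pmf_not_empty[of P] by (auto simp: card_gt_0_iff)
  \<comment> \<open>The first half is uniform on the candidates listed for the observation, so a
    listed \<open>K x\<close> costs one bit plus the logarithm of the list length.\<close>
  define q where "q = (\<lambda>k b. (if k \<in> S \<inter> L b then 1 / (2 * real (card (S \<inter> L b))) else 0)
     + (if k \<in> S then 1 / (2 * real (card S)) else 0))"
  define N where "N = (\<lambda>x. of_bool (W x) * real (card {k\<in>S. k \<noteq> K x \<and> k \<in> L (B x)}))"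
  have N0: "0 \<le> N x" for x by (simp add: N_def)
  have qge: "K x \<in> S \<Longrightarrow> q (K x) (B x) \<ge> 1 / (2 * real (card S))" for x
    by (simp add: q_def)
  have qnn: "0 \<le> q a b" for a b by (simp add: q_def)
  have "cond_ent P K B \<le> pexp P (\<lambda>x. - log 2 (q (K x) (B x)))"
  proof (rule cond_ent_le_cross[OF fin, where q=q and A=K and B=B])
    fix x assume w: "x \<in> set_pmf P"
    show "0 < q (K x) (B x)"
    proof (rule less_le_trans)
      show "0 < 1 / (2 * real (card S))" using cS by simp
      show "1 / (2 * real (card S)) \<le> q (K x) (B x)" by (rule qge[OF S(2)[OF w]])
    qed
  next
    fix b
    have "(\<Sum>a\<in>K ` set_pmf P. q a b) \<le> (\<Sum>a\<in>S. q a b)"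
      using S qnn by (intro sum_mono2) auto
    also have "\<dots> = (\<Sum>a\<in>S \<inter> L b. 1 / (2 * real (card (S \<inter> L b)))) + (\<Sum>a\<in>S. 1 / (2 * real (card S)))"
      unfolding q_def sum.distrib using S(1)
      by (intro arg_cong2[where f="(+)"] sum.mono_neutral_cong_right) auto
    also have "\<dots> \<le> 1 / 2 + 1 / 2"
      using cS by (intro add_mono) (auto simp: field_simps)
    finally show "(\<Sum>a\<in>K ` set_pmf P. q a b) \<le> 1" by simp
  qed (rule qnn)
  \<comment> \<open>The logarithm of the list length is replaced by its tangent, which is affine in
    \<open>N x\<close>, because only the mean of \<open>N\<close> is controlled.\<close>
  also have "\<dots> \<le> pexp P (\<lambda>x. (c + 1 + (N x + 1) * (1 / (2 powr c * ln 2)) - 1 / ln 2)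
      + of_bool (\<not> (W x \<and> K x \<in> L (B x))) * log 2 (card S))"
  proof (rule pexp_mono)
    fix x assume w: "x \<in> set_pmf P"
    have K: "K x \<in> S" by (rule S(2)[OF w])
    have tan: "log 2 (N x + 1) \<le> c + (N x + 1) * (1 / (2 powr c * ln 2)) - 1 / ln 2"
      using log2_tangent[of "N x + 1" c] N0[of x] by (simp add: diff_divide_distrib)
    show "- log 2 (q (K x) (B x)) \<le> (c + 1 + (N x + 1) * (1 / (2 powr c * ln 2)) - 1 / ln 2)
      + of_bool (\<not> (W x \<and> K x \<in> L (B x))) * log 2 (card S)"
    proof (cases "W x \<and> K x \<in> L (B x)")
      case True
      have "S \<inter> L (B x) = insert (K x) {k\<in>S. k \<noteq> K x \<and> k \<in> L (B x)}" using K True by auto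
      then have card: "real (card (S \<inter> L (B x))) = N x + 1"
        using S(1) True by (simp add: N_def)
      have "q (K x) (B x) \<ge> 1 / (2 * (N x + 1))"
        using K True by (simp add: q_def card)
      moreover have "1 / (2 * (N x + 1)) > 0" using N0[of x] by simp
      ultimately have "log 2 (1 / (2 * (N x + 1))) \<le> log 2 (q (K x) (B x))"
        by (intro log_mono) auto
      moreover have "log 2 (1 / (2 * (N x + 1))) = - (1 + log 2 (N x + 1))"
        using N0[of x] by (intro log2_inverse_double) simp
      ultimately show ?thesis using tan True by simp
    next
      case False
      have "log 2 (1 / (2 * real (card S))) \<le> log 2 (q (K x) (B x))"
        using cS qge[OF K] by (intro log_mono) auto
      moreover have "log 2 (1 / (2 * real (card S))) = - (1 + log 2 (card S))"
        using cS by (intro log2_inverse_double) simp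
      moreover have "0 \<le> log 2 (N x + 1)" using N0[of x] by simp
      ultimately show ?thesis using tan False by simp
    qed
  qed
  also have "\<dots> = c + 1 + (pexp P N + 1) * (1 / (2 powr c * ln 2)) - 1 / ln 2 + pexp P (\<lambda>x. of_bool (\<not> (W x \<and> K x \<in> L (B x)))) * log 2 (card S)"
    using fin by (simp only: pexp_add pexp_diff pexp_const pexp_cmultr)
  \<comment> \<open>As \<open>c \<ge> 0\<close>, both the mean number of false candidates and the 1
    for the true candidate are at most \<open>2 powr c\<close>. What remains is
    \<open>1 / ln 2 \<le> 2\<close>, hence the constant 3.\<close>
  also have "(pexp P N + 1) * (1 / (2 powr c * ln 2)) \<le> (2 powr c + 2 powr c) * (1 / (2 powr c * ln 2))"
    using c ge_one_powr_ge_zero[of 2 c] unfolding N_def by (intro mult_right_mono add_mono) auto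
  also have "(2 powr c + 2 powr c) * (1 / (2 powr c * ln 2)) = 2 / ln (2::real)"
    by (simp add: field_simps)
  also have "c + 1 + 2 / ln 2 - 1 / ln 2 + pexp P (\<lambda>x. of_bool (\<not> (W x \<and> K x \<in> L (B x)))) * log 2 (card S)
     = c + 1 + 1 / ln 2 + pexp P (\<lambda>x. of_bool (\<not> (W x \<and> K x \<in> L (B x)))) * log 2 (card S)"
    by (simp add: field_simps)
  also have "\<dots> \<le> c + 3 + pexp P (\<lambda>x. of_bool (\<not> (W x \<and> K x \<in> L (B x)))) * log 2 (card S)"
    using inverse_ln2_le by simp
  finally show ?thesis by simp
qed

lemma pexp_agree:
  assumes "finite (set_pmf P)" "finite (set_pmf Q)"
    and "\<And>w. w \<in> G \<Longrightarrow> pmf P w = pmf Q w" "\<And>w. w \<notin> G \<Longrightarrow> f w = 0"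
  shows "pexp P f = pexp Q f"
proof -
  have "pexp P f = (\<Sum>w\<in>set_pmf P \<union> set_pmf Q. pmf P w * f w)"
    using assms by (intro pexp_superset) auto
  also have "\<dots> = (\<Sum>w\<in>set_pmf P \<union> set_pmf Q. pmf Q w * f w)"
  proof (rule sum.cong)
    fix w assume "w \<in> set_pmf P \<union> set_pmf Q"
    show "pmf P w * f w = pmf Q w * f w"
      using assms(3,4)[of w] by (cases "w \<in> G") auto
  qed simp
  also have "\<dots> = pexp Q f"
    using assms by (intro pexp_superset[symmetric]) auto
  finally show ?thesis .
qed

text \<open>The reference kernel \<open>q\<close> of the proof is half the conditional law on \<open>G\<close>, which \<open>P\<close> and \<open>Q\<close>
  share, and half the uniform distribution.\<close>

lemma cond_ent_agree:
  assumes fin: "finite (set_pmf P)" "finite (set_pmf Q)"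
    and agree: "\<And>z. z \<in> G \<Longrightarrow> pmf P z = pmf Q z"
    and S: "finite S" "\<And>z. z \<in> set_pmf Q \<Longrightarrow> A z \<in> S"
  shows "cond_ent Q A B \<le> cond_ent P A B + 1 + pexp Q (\<lambda>z. of_bool (z \<notin> G)) * log 2 (card S)"
proof -
  have cS: "card S > 0" using S set_pmf_not_empty[of Q] by (auto simp: card_gt_0_iff)
  define m where "m = (\<lambda>a b. pexp Q (\<lambda>z. of_bool (z \<in> G \<and> A z = a \<and> B z = b)))"
  define mb where "mb = (\<lambda>b. pexp Q (\<lambda>z. of_bool (z \<in> G \<and> B z = b)))"
  have mP: "m a b = pexp P (\<lambda>z. of_bool (z \<in> G \<and> A z = a \<and> B z = b))" for a b
    unfolding m_def using fin agree by (intro pexp_agree[where G=G]) auto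
  have mbP: "mb b = pexp P (\<lambda>z. of_bool (z \<in> G \<and> B z = b))" for b
    unfolding mb_def using fin agree by (intro pexp_agree[where G=G]) auto
  have mnn: "0 \<le> m a b" "0 \<le> mb b" "m a b \<le> mb b" for a b
    unfolding m_def mb_def by (auto intro!: pexp_nonneg pexp_mono)
  have mpos: "m (A z) (B z) > 0" if "z \<in> set_pmf Q" "z \<in> G" for z
  proof -
    have "pmf Q z \<le> m (A z) (B z)"
      unfolding m_def pexp_def using that fin member_le_sum[of z "set_pmf Q" "\<lambda>x. pmf Q x * of_bool (x \<in> G \<and> A x = A z \<and> B x = B z)"]
      by simp
    then show ?thesis using that pmf_positive[of z Q] by linarith
  qed
  define h where "h = (\<lambda>z. of_bool (z \<in> G) * - log 2 (m (A z) (B z) / mb (B z)))"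
  define q where "q = (\<lambda>a b. m a b / (2 * mb b) + (if a \<in> S then 1 / (2 * real (card S)) else 0))"
  have "cond_ent Q A B \<le> pexp Q (\<lambda>z. - log 2 (q (A z) (B z)))"
  proof (rule cond_ent_le_cross[OF fin(2), where q=q and A=A and B=B])
    fix z assume w: "z \<in> set_pmf Q"
    show "0 < q (A z) (B z)"
      using S(2)[OF w] cS mnn unfolding q_def by (intro add_nonneg_pos) auto
  next
    fix b
    have "(\<Sum>a\<in>A ` set_pmf Q. q a b) \<le> (\<Sum>a\<in>S. q a b)"
      using S mnn by (intro sum_mono2) (auto simp: q_def)
    also have "\<dots> = (\<Sum>a\<in>S. m a b) / (2 * mb b) + 1 / 2"
      using cS by (simp add: q_def sum.distrib sum_divide_distrib)
    also have "(\<Sum>a\<in>S. m a b) \<le> mb b"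
      unfolding m_def mb_def pexp_sum[symmetric]
    proof (rule pexp_mono)
      fix x show "(\<Sum>a\<in>S. of_bool (x \<in> G \<and> A x = a \<and> B x = b)) \<le> (of_bool (x \<in> G \<and> B x = b) :: real)"
        using S(1) by (cases "x \<in> G \<and> B x = b") (auto simp: of_bool_def sum.delta)
    qed
    then have "(\<Sum>a\<in>S. m a b) / (2 * mb b) + 1 / 2 \<le> 1"
      using mnn(2)[of b] by (cases "mb b = 0") (auto simp: field_simps)
    finally show "(\<Sum>a\<in>A ` set_pmf Q. q a b) \<le> 1" .
  qed (auto simp: q_def mnn)
  also have "\<dots> \<le> pexp Q (\<lambda>z. h z + 1 + of_bool (z \<notin> G) * log 2 (card S))"
  proof (rule pexp_mono)
    fix z assume w: "z \<in> set_pmf Q"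
    show "- log 2 (q (A z) (B z)) \<le> h z + 1 + of_bool (z \<notin> G) * log 2 (card S)"
    proof (cases "z \<in> G")
      case True
      have pos: "m (A z) (B z) > 0" "mb (B z) > 0"
        using mpos[OF w True] mnn(3)[of "A z" "B z"] by auto
      have "log 2 (m (A z) (B z) / (2 * mb (B z))) \<le> log 2 (q (A z) (B z))"
        using pos by (intro log_mono) (auto simp: q_def)
      then show ?thesis using True pos by (simp add: h_def log_divide log_mult)
    next
      case False
      have "log 2 (1 / (2 * real (card S))) \<le> log 2 (q (A z) (B z))"
        using cS S(2)[OF w] mnn by (intro log_mono) (auto simp: q_def)
      then show ?thesis using False cS by (simp add: h_def log_divide log_mult)
    qed
  qed
  also have "\<dots> = pexp Q h + 1 + pexp Q (\<lambda>z. of_bool (z \<notin> G)) * log 2 (card S)"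
    using fin by (simp only: pexp_add pexp_const pexp_cmultr)
  also have "pexp Q h = pexp P h"
    using fin agree by (intro pexp_agree[where G=G]) (auto simp: h_def)
  \<comment> \<open>The event \<open>G\<close> is revealed as extra observation: on \<open>G\<close>
    the conditional probability is then exactly the ratio in \<open>h\<close>, and off
    \<open>G\<close> the integrand is nonnegative while \<open>h\<close> is 0. Revealing it only
    lowers the entropy under \<open>P\<close>.\<close>
  also have "\<dots> \<le> cond_ent P A (\<lambda>z. (B z, z \<in> G))"
    unfolding cond_ent_pexp[OF fin(1)]
  proof (rule pexp_mono)
    fix z assume w: "z \<in> set_pmf P"
    let ?a = "pmf (map_pmf (\<lambda>z. (A z, B z, z \<in> G)) P) (A z, B z, z \<in> G)"
    let ?b = "pmf (map_pmf (\<lambda>z. (B z, z \<in> G)) P) (B z, z \<in> G)"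
    show "h z \<le> - log 2 (?a / ?b)"
    proof (cases "z \<in> G")
      case True
      have "?a = m (A z) (B z)" "?b = mb (B z)"
        using fin True by (auto simp: mP mbP pmf_map_eq_pexp intro!: pexp_cong)
      then show ?thesis using True by (simp add: h_def)
    next
      case False
      have "?a > 0" "?b > 0"
        using w pmf_map_pos[of z P "\<lambda>z. (A z, B z, z \<in> G)"] pmf_map_pos[of z P "\<lambda>z. (B z, z \<in> G)"] by auto
      then show ?thesis
        using pmf_map_pair_le[OF fin(1), of A "\<lambda>z. (B z, z \<in> G)" "A z" "(B z, z \<in> G)"] False
        by (simp add: h_def)
    qed
  qed
  also have "\<dots> \<le> cond_ent P A B"
    by (rule cond_ent_reduce[OF fin(1), where g=fst]) simp
  finally show ?thesis by simp
qed

subsection \<open>Product distributions on lists\<close>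

text \<open>A memoryless channel \<open>k\<close> with input word \<open>as\<close> has output law
  \<open>seq_pmf (map k as)\<close>; independent identically distributed letters are
  \<open>seq_pmf (replicate n p)\<close>.\<close>

primrec seq_pmf :: "'a pmf list \<Rightarrow> 'a list pmf" where
  "seq_pmf [] = return_pmf []"
| "seq_pmf (p # ps) = bind_pmf p (\<lambda>x. map_pmf (Cons x) (seq_pmf ps))"

lemma seq_pmf_Cons_pair: "seq_pmf (p # ps) = map_pmf (\<lambda>(x, xs). x # xs) (pair_pmf p (seq_pmf ps))"
  by (simp add: pair_pmf_def map_bind_pmf map_pmf_def[symmetric] map_pmf_comp bind_return_pmf bind_assoc_pmf)

lemma finite_set_seq_pmf: "(\<And>p. p \<in> set ps \<Longrightarrow> finite (set_pmf p)) \<Longrightarrow> finite (set_pmf (seq_pmf ps))"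
  by (induction ps) auto

lemma finite_set_seq_pmf_finite [simp]: "finite (set_pmf (seq_pmf (ps :: 'a::finite pmf list)))"
  by (rule finite_set_seq_pmf) simp

lemma set_seq_pmf: "set_pmf (seq_pmf ps) = {xs. list_all2 (\<lambda>x p. x \<in> set_pmf p) xs ps}"
  by (induction ps) (auto simp: list_all2_Cons2)

lemma length_seq_pmf: "xs \<in> set_pmf (seq_pmf ps) \<Longrightarrow> length xs = length ps"
  by (auto simp: set_seq_pmf dest: list_all2_lengthD)

lemma pmf_map_Cons: "pmf (map_pmf (Cons x) P) ys = (case ys of [] \<Rightarrow> 0 | y # ys' \<Rightarrow> of_bool (y = x) * pmf P ys')"
proof (cases ys)
  case Nil
  then have "ys \<notin> set_pmf (map_pmf (Cons x) P)" by auto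
  then show ?thesis using Nil by (simp only: set_pmf_iff not_not list.case)
next
  case (Cons y ys')
  show ?thesis
  proof (cases "y = x")
    case True
    then show ?thesis using Cons pmf_map_inj'[of "Cons x" P ys'] by (simp add: inj_on_def)
  next
    case False
    then have "ys \<notin> set_pmf (map_pmf (Cons x) P)" using Cons by auto
    then show ?thesis using Cons False by (simp only: set_pmf_iff not_not list.case) simp
  qed
qed

lemma pmf_seq_pmf_Cons: "pmf (seq_pmf (p # ps)) (x # xs) = pmf p x * pmf (seq_pmf ps) xs"
proof -
  have "pmf (seq_pmf (p # ps)) (x # xs) = measure_pmf.expectation p (\<lambda>y. of_bool (x = y) * pmf (seq_pmf ps) xs)"
    by (simp add: pmf_bind pmf_map_Cons)
  also have "\<dots> = (\<Sum>y\<in>{x}. pmf p y *\<^sub>R (of_bool (x = y) * pmf (seq_pmf ps) xs))"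
    by (rule integral_measure_pmf) auto
  finally show ?thesis by simp
qed

lemma pmf_seq_pmf_length: "length xs \<noteq> length ps \<Longrightarrow> pmf (seq_pmf ps) xs = 0"
  using length_seq_pmf[of xs ps] by (auto simp: set_pmf_iff)

lemma seq_pmf_append:
  "seq_pmf (ps @ qs) = bind_pmf (seq_pmf ps) (\<lambda>xs. map_pmf ((@) xs) (seq_pmf qs))"
proof (induction ps)
  case (Cons p ps)
  have "(@) (x # xs) = (\<lambda>ys. x # xs @ ys)" for x :: 'a and xs by (rule ext) simp
  then show ?case
    by (simp add: Cons bind_return_pmf bind_assoc_pmf bind_map_pmf map_bind_pmf map_pmf_comp)
next
  case Nil
  have "(@) [] = (\<lambda>ys :: 'a list. ys)" by (rule ext) simp
  then show ?case by (simp add: bind_return_pmf)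
qed

lemma seq_pmf_concat:
  "seq_pmf (concat pss) = map_pmf concat (seq_pmf (map seq_pmf pss))"
  by (induction pss)
     (simp_all add: seq_pmf_append map_bind_pmf map_pmf_comp)

lemma seq_pmf_map: "seq_pmf (map (\<lambda>x. map_pmf (h x) (f x)) xs) = map_pmf (map2 h xs) (seq_pmf (map f xs))"
  by (induction xs) (simp_all add: map_bind_pmf bind_map_pmf map_pmf_comp)

lemma seq_pmf_map': "seq_pmf (map (\<lambda>x. map_pmf h (f x)) xs) = map_pmf (map h) (seq_pmf (map f xs))"
  by (induction xs) (simp_all add: map_bind_pmf bind_map_pmf map_pmf_comp)

text \<open>The second-stage draw of one letter commutes with the first-stage draws of the others,
  so all first stages may be drawn before all second stages. This separates cloud word, codeword
  pair and channel output.\<close>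

lemma seq_pmf_bind:
  "seq_pmf (map (\<lambda>x. bind_pmf (f x) (g x)) xs) = bind_pmf (seq_pmf (map f xs)) (\<lambda>ys. seq_pmf (map2 g xs ys))"
proof (induction xs)
  case (Cons x xs)
  have "seq_pmf (map (\<lambda>x. bind_pmf (f x) (g x)) (x # xs))
    = bind_pmf (f x) (\<lambda>y. bind_pmf (g x y) (\<lambda>z. bind_pmf (seq_pmf (map f xs)) (\<lambda>ys. map_pmf (Cons z) (seq_pmf (map2 g xs ys)))))"
    by (simp add: Cons bind_assoc_pmf map_bind_pmf)
  also have "\<dots> = bind_pmf (f x) (\<lambda>y. bind_pmf (seq_pmf (map f xs)) (\<lambda>ys. bind_pmf (g x y) (\<lambda>z. map_pmf (Cons z) (seq_pmf (map2 g xs ys)))))"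
    by (subst bind_commute_pmf) simp
  also have "\<dots> = bind_pmf (seq_pmf (map f (x # xs))) (\<lambda>ys. seq_pmf (map2 g (x # xs) ys))"
    by (simp add: bind_assoc_pmf bind_map_pmf)
  finally show ?case .
qed (simp add: bind_return_pmf)

lemma pexp_seq_Cons:
  assumes "finite (set_pmf p)" "\<And>p. p \<in> set ps \<Longrightarrow> finite (set_pmf p)"
  shows "pexp (seq_pmf (p # ps)) f = pexp p (\<lambda>x. pexp (seq_pmf ps) (\<lambda>xs. f (x # xs)))"
  using assms by (simp add: pexp_bind pexp_map finite_set_seq_pmf)

lemma pexp_seq_prod_le1:
  assumes "\<And>x. x \<in> set xs \<Longrightarrow> finite (set_pmf (p x))" "\<And>x y. 0 \<le> f x y"
    and "\<And>x. x \<in> set xs \<Longrightarrow> pexp (p x) (f x) \<le> 1"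
  shows "pexp (seq_pmf (map p xs)) (\<lambda>ys. prod_list (map2 f xs ys)) \<le> 1"
  using assms
proof (induction xs)
  case (Cons x xs)
  have "pexp (seq_pmf (map p (x # xs))) (\<lambda>ys. prod_list (map2 f (x # xs) ys))
    = pexp (p x) (\<lambda>y. f x y * pexp (seq_pmf (map p xs)) (\<lambda>ys. prod_list (map2 f xs ys)))"
    using Cons.prems by (subst list.map, subst pexp_seq_Cons) (auto simp: pexp_cmult)
  also have "\<dots> \<le> pexp (p x) (\<lambda>y. f x y * 1)"
    using Cons by (intro pexp_mono mult_left_mono) auto
  also have "\<dots> \<le> 1" using Cons.prems by simp
  finally show ?case .
qed simp

lemma cond_ent_seq:
  assumes "\<And>p. p \<in> set ps \<Longrightarrow> finite (set_pmf p)"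
  shows "cond_ent (seq_pmf ps) (map A) (map B) = (\<Sum>p\<leftarrow>ps. cond_ent p A B)"
  using assms
proof (induction ps)
  case Nil
  then show ?case by (simp add: cond_ent_def ent_def)
next
  case (Cons p ps)
  have fin: "finite (set_pmf p)" "finite (set_pmf (seq_pmf ps))"
    using Cons.prems by (auto intro: finite_set_seq_pmf)
  have "cond_ent (seq_pmf (p # ps)) (map A) (map B)
     = cond_ent (pair_pmf p (seq_pmf ps)) (\<lambda>(x, xs). A x # map A xs) (\<lambda>(x, xs). B x # map B xs)"
    unfolding seq_pmf_Cons_pair cond_ent_map by (simp add: case_prod_unfold)
  also have "\<dots> = cond_ent (pair_pmf p (seq_pmf ps)) (\<lambda>(x, xs). (A x, map A xs)) (\<lambda>(x, xs). (B x, map B xs))"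
    using fin by (intro cond_ent_inj') auto
  also have "\<dots> = cond_ent p A B + cond_ent (seq_pmf ps) (map A) (map B)"
    by (rule cond_ent_pair[OF fin])
  finally show ?case using Cons by simp
qed

lemma ent_seq_map:
  assumes "\<And>p. p \<in> set ps \<Longrightarrow> finite (set_pmf p)"
  shows "ent (seq_pmf ps) (map A) = (\<Sum>p\<leftarrow>ps. ent p A)"
  using assms
proof (induction ps)
  case Nil
  then show ?case by (simp add: ent_def)
next
  case (Cons p ps)
  have fin: "finite (set_pmf p)" "finite (set_pmf (seq_pmf ps))"
    using Cons.prems by (auto intro: finite_set_seq_pmf)
  have "ent (seq_pmf (p # ps)) (map A) = ent (pair_pmf p (seq_pmf ps)) (\<lambda>(x, xs). A x # map A xs)"
    unfolding seq_pmf_Cons_pair ent_map by (simp add: case_prod_unfold)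
  also have "\<dots> = ent (pair_pmf p (seq_pmf ps)) (\<lambda>(x, xs). (A x, map A xs))"
    using fin by (intro ent_inj') auto
  also have "\<dots> = ent p A + ent (seq_pmf ps) (map A)"
    by (rule ent_pair[OF fin])
  finally show ?case using Cons by simp
qed

lemma pexp_seq_second_moment:
  assumes fin: "finite (set_pmf P)" and mu: "pexp P f = \<mu>"
  shows "pexp (seq_pmf (replicate n P)) (\<lambda>xs. sum_list (map f xs) - real n * \<mu>) = 0"
    and "pexp (seq_pmf (replicate n P)) (\<lambda>xs. (sum_list (map f xs) - real n * \<mu>)\<^sup>2) = real n * pexp P (\<lambda>x. (f x - \<mu>)\<^sup>2)"
proof (induction n)
  case (Suc n)
  let ?Q = "seq_pmf (replicate n P)"
  have finQ: "finite (set_pmf ?Q)" using fin by (intro finite_set_seq_pmf) auto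
  have step: "pexp (seq_pmf (replicate (Suc n) P)) g = pexp P (\<lambda>x. pexp ?Q (\<lambda>xs. g (x # xs)))" for g
    using fin by (subst replicate_Suc, subst pexp_seq_Cons) auto
  have c: "pexp P (\<lambda>x. f x - \<mu>) = 0" using fin mu by (simp add: pexp_diff pexp_const)
  {
    case 1
    have "pexp (seq_pmf (replicate (Suc n) P)) (\<lambda>xs. sum_list (map f xs) - real (Suc n) * \<mu>)
      = pexp P (\<lambda>x. pexp ?Q (\<lambda>xs. (f x - \<mu>) + (sum_list (map f xs) - real n * \<mu>)))"
      unfolding step by (intro pexp_cong) (simp add: algebra_simps)
    also have "\<dots> = 0"
      using Suc(1) finQ fin c by (simp only: pexp_add pexp_const)
    finally show ?case .
  next
    case 2
    have "pexp (seq_pmf (replicate (Suc n) P)) (\<lambda>xs. (sum_list (map f xs) - real (Suc n) * \<mu>)\<^sup>2)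
      = pexp P (\<lambda>x. pexp ?Q (\<lambda>xs. (f x - \<mu>)\<^sup>2 + 2 * (f x - \<mu>) * (sum_list (map f xs) - real n * \<mu>) + (sum_list (map f xs) - real n * \<mu>)\<^sup>2))"
      unfolding step by (intro pexp_cong) (simp add: algebra_simps power2_eq_square)
    also have "\<dots> = pexp P (\<lambda>x. (f x - \<mu>)\<^sup>2 + 2 * (f x - \<mu>) * 0 + real n * pexp P (\<lambda>x. (f x - \<mu>)\<^sup>2))"
      using Suc finQ by (simp only: pexp_add pexp_const pexp_cmult)
    also have "\<dots> = real (Suc n) * pexp P (\<lambda>x. (f x - \<mu>)\<^sup>2)"
      using fin by (simp add: pexp_add pexp_const algebra_simps)
    finally show ?case .
  }
qed simp_all

text \<open>Chebyshev's inequality: the variance of the sum grows like \<open>n\<close>, the squared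
  deviation like the square of \<open>n\<close>.\<close>

lemma weak_law:
  fixes f :: "'a \<Rightarrow> real"
  assumes fin: "finite (set_pmf P)" and s: "s > 0" and e: "e > 0"
  shows "\<forall>\<^sub>F n in sequentially. pexp (seq_pmf (replicate n P))
     (\<lambda>xs. of_bool (\<bar>sum_list (map f xs) - real n * pexp P f\<bar> \<ge> real n * s)) \<le> e"
proof -
  define v where "v = pexp P (\<lambda>x. (f x - pexp P f)\<^sup>2)"
  have "pexp (seq_pmf (replicate n P)) (\<lambda>xs. of_bool (\<bar>sum_list (map f xs) - real n * pexp P f\<bar> \<ge> real n * s)) \<le> e"
    if n: "real n \<ge> max 1 (v / (s\<^sup>2 * e))" for n
  proof -
    have np: "real n > 0" using n by simp
    have "pexp (seq_pmf (replicate n P)) (\<lambda>xs. of_bool (\<bar>sum_list (map f xs) - real n * pexp P f\<bar> \<ge> real n * s))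
       = pexp (seq_pmf (replicate n P)) (\<lambda>xs. of_bool ((sum_list (map f xs) - real n * pexp P f)\<^sup>2 \<ge> (real n * s)\<^sup>2))"
    proof (rule pexp_cong)
      fix xs
      have "\<bar>real n * s\<bar> = real n * s" using s by simp
      then have "\<bar>sum_list (map f xs) - real n * pexp P f\<bar> \<ge> real n * s \<longleftrightarrow> (real n * s)\<^sup>2 \<le> (sum_list (map f xs) - real n * pexp P f)\<^sup>2"
        using abs_le_square_iff[of "real n * s" "sum_list (map f xs) - real n * pexp P f"] by simp
      then show "of_bool (\<bar>sum_list (map f xs) - real n * pexp P f\<bar> \<ge> real n * s)
        = (of_bool ((sum_list (map f xs) - real n * pexp P f)\<^sup>2 \<ge> (real n * s)\<^sup>2) :: real)"
        by simp
    qed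
    also have "\<dots> \<le> pexp (seq_pmf (replicate n P)) (\<lambda>xs. (sum_list (map f xs) - real n * pexp P f)\<^sup>2) / (real n * s)\<^sup>2"
      using np s by (intro pexp_markov) auto
    also have "\<dots> = real n * v / (real n * s)\<^sup>2"
      using pexp_seq_second_moment(2)[OF fin refl, of n f] by (simp add: v_def)
    also have "\<dots> = v / (real n * s\<^sup>2)"
      using np by (simp add: power2_eq_square field_simps)
    also have "\<dots> \<le> e"
      using n np s e by (simp add: field_simps)
    finally show ?thesis .
  qed
  moreover have "\<forall>\<^sub>F n in sequentially. real n \<ge> max 1 (v / (s\<^sup>2 * e))"
    using filterlim_real_sequentially[unfolded filterlim_at_top, rule_format, of "max 1 (v / (s\<^sup>2 * e))"] .
  ultimately show ?thesis by (rule eventually_mono[rotated])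
qed

subsection \<open>Information densities\<close>

text \<open>The likelihood ratio P(v|c,t) / P(v|t), that is, the exponential of the information
  density of \<open>v\<close> and \<open>c\<close> given \<open>t\<close>. It is 0 at impossible
  letters.\<close>

definition dens :: "'a pmf \<Rightarrow> ('a \<Rightarrow> 'v) \<Rightarrow> ('a \<Rightarrow> 'c) \<Rightarrow> ('a \<Rightarrow> 't) \<Rightarrow> 'v \<Rightarrow> 'c \<Rightarrow> 't \<Rightarrow> real" where
  "dens R V C T v c t = pmf (map_pmf (\<lambda>w. (V w, C w, T w)) R) (v, c, t) * pmf (map_pmf T R) t
     / (pmf (map_pmf (\<lambda>w. (V w, T w)) R) (v, t) * pmf (map_pmf (\<lambda>w. (C w, T w)) R) (c, t))"

lemma dens_nonneg: "0 \<le> dens R V C T v c t"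
  by (simp add: dens_def)

lemma dens_pos: "w \<in> set_pmf R \<Longrightarrow> 0 < dens R V C T (V w) (C w) (T w)"
  using pmf_map_pos[of w R "\<lambda>w. (V w, C w, T w)"] pmf_map_pos[of w R T]
    pmf_map_pos[of w R "\<lambda>w. (V w, T w)"] pmf_map_pos[of w R "\<lambda>w. (C w, T w)"]
  by (simp add: dens_def)

lemma pexp_log_dens:
  assumes fin: "finite (set_pmf R)"
  shows "pexp R (\<lambda>x. log 2 (dens R V C T (V x) (C x) (T x))) = cmi R V C T"
proof -
  let ?l = "\<lambda>f x. - log 2 (pmf (map_pmf f R) (f x))"
  have "pexp R (\<lambda>x. log 2 (dens R V C T (V x) (C x) (T x)))
    = pexp R (\<lambda>x. ?l (\<lambda>x. (V x, T x)) x + ?l (\<lambda>x. (C x, T x)) x - ?l (\<lambda>x. (V x, C x, T x)) x - ?l T x)"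
  proof (rule pexp_cong)
    fix x assume w: "x \<in> set_pmf R"
    note nz = pmf_map_nz[OF w, of "\<lambda>x. (V x, C x, T x)"] pmf_map_nz[OF w, of T]
      pmf_map_nz[OF w, of "\<lambda>x. (V x, T x)"] pmf_map_nz[OF w, of "\<lambda>x. (C x, T x)"]
    show "log 2 (dens R V C T (V x) (C x) (T x)) =
      ?l (\<lambda>x. (V x, T x)) x + ?l (\<lambda>x. (C x, T x)) x - ?l (\<lambda>x. (V x, C x, T x)) x - ?l T x"
      unfolding dens_def using nz by (simp add: log_mult log_divide)
  qed
  also have "\<dots> = cmi R V C T"
    unfolding cmi_def by (simp only: pexp_add pexp_diff ent_pexp[OF fin])
  finally show ?thesis .
qed

text \<open>If \<open>v\<close> is drawn from its conditional law given \<open>t\<close> without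
  regard to \<open>c\<close>, weighting by the density yields P(v|c,t), whose sum over
  \<open>v\<close> is at most 1, and 0 at impossible \<open>c\<close>. Together with Markov's
  inequality this is behind the false alarm bounds.\<close>

lemma pexp_dens_le1:
  assumes fin: "finite (set_pmf R)" "finite (set_pmf (K t))"
    and K: "\<And>v. pmf (map_pmf (\<lambda>w. (V w, T w)) R) (v, t) = pmf (map_pmf T R) t * pmf (K t) v"
  shows "pexp (K t) (\<lambda>v. dens R V C T v c t) \<le> 1"
proof -
  let ?vct = "\<lambda>v. pmf (map_pmf (\<lambda>w. (V w, C w, T w)) R) (v, c, t)"
  let ?ct = "pmf (map_pmf (\<lambda>w. (C w, T w)) R) (c, t)"
  have "pexp (K t) (\<lambda>v. dens R V C T v c t) \<le> (\<Sum>v\<in>set_pmf (K t). ?vct v / ?ct)"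
    unfolding pexp_def
  proof (rule sum_mono)
    fix v
    show "pmf (K t) v * dens R V C T v c t \<le> ?vct v / ?ct"
      by (cases "pmf (K t) v = 0"; cases "pmf (map_pmf T R) t = 0") (auto simp: dens_def K)
  qed
  also have "\<dots> = (\<Sum>v\<in>set_pmf (K t). ?vct v) / ?ct" by (simp add: sum_divide_distrib)
  also have "\<dots> \<le> 1"
    using sum_pmf_pair[OF fin, of V "\<lambda>w. (C w, T w)" "(c, t)"] pmf_nonneg[of "map_pmf (\<lambda>w. (C w, T w)) R" "(c, t)"]
    by (auto simp: divide_le_eq_1 less_le simp del: pmf_nonneg)
  finally show ?thesis .
qed

subsection \<open>Random codebooks\<close>

lemma finite_set_Pi_pmf:
  assumes "finite I" "\<And>i. i \<in> I \<Longrightarrow> finite (set_pmf (p i))"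
  shows "finite (set_pmf (Pi_pmf I d p))"
  using assms by (simp add: set_Pi_pmf finite_PiE_dflt)

lemma pexp_Pi_one:
  assumes "finite I" "\<And>i. i \<in> I \<Longrightarrow> finite (set_pmf (p i))" "i \<in> I"
  shows "pexp (Pi_pmf I d p) (\<lambda>c. f (c i)) = pexp (p i) f"
proof -
  have "finite (set_pmf (Pi_pmf I d p))" using assms by (intro finite_set_Pi_pmf) auto
  then have "pexp (Pi_pmf I d p) (\<lambda>c. f (c i)) = pexp (map_pmf (\<lambda>c. c i) (Pi_pmf I d p)) f"
    by (simp add: pexp_map)
  then show ?thesis using assms by (simp add: Pi_pmf_component)
qed

lemma pexp_Pi_two:
  assumes fin: "finite I" "\<And>i. i \<in> I \<Longrightarrow> finite (set_pmf (p i))" and ij: "i \<in> I" "j \<in> I" "i \<noteq> j"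
  shows "pexp (Pi_pmf I d p) (\<lambda>c. f (c i) (c j)) = pexp (p i) (\<lambda>x. pexp (p j) (\<lambda>y. f x y))"
proof -
  let ?J = "I - {i}"
  have I: "I = insert i ?J" "finite ?J" "i \<notin> ?J" "j \<in> ?J" using fin ij by auto
  have fJ: "finite (set_pmf (Pi_pmf ?J d p))" using fin by (intro finite_set_Pi_pmf) auto
  have "pexp (Pi_pmf (insert i ?J) d p) (\<lambda>c. f (c i) (c j)) = pexp (p i) (\<lambda>x. pexp (Pi_pmf ?J d p) (\<lambda>c. f x (c j)))"
    using I ij fin fJ by (subst Pi_pmf_insert) (auto simp: pexp_map pexp_pair case_prod_unfold)
  also have "\<dots> = pexp (p i) (\<lambda>x. pexp (p j) (\<lambda>y. f x y))"
    using I fin by (intro pexp_cong pexp_Pi_one) auto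
  finally show ?thesis using I(1) by simp
qed

lemma Pi_pmf_support:
  "finite I \<Longrightarrow> c \<in> set_pmf (Pi_pmf I d p) \<Longrightarrow> i \<in> I \<Longrightarrow> c i \<in> set_pmf (p i)"
  by (auto simp: set_Pi_pmf PiE_dflt_def)

text \<open>The mutual covering lemma, by Chebyshev's inequality applied to the number of good pairs.\<close>

lemma mutual_covering:
  fixes p1 :: "'v1 pmf" and p2 :: "'v2 pmf" and L1 L2 :: nat
  assumes fin: "finite (set_pmf p1)" "finite (set_pmf p2)" "finite I1" "finite I2"
    and idx: "\<And>l. l < L1 \<Longrightarrow> f1 l \<in> I1" "\<And>l. l < L2 \<Longrightarrow> f2 l \<in> I2"
      "inj_on f1 {..<L1}" "inj_on f2 {..<L2}"
    and g1: "\<And>v1. v1 \<in> set_pmf p1 \<Longrightarrow> pexp p2 (\<lambda>v2. of_bool (Gd v1 v2)) \<le> g"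
    and g2: "\<And>v2. v2 \<in> set_pmf p2 \<Longrightarrow> pexp p1 (\<lambda>v1. of_bool (Gd v1 v2)) \<le> g"
    and p: "0 < p" "p \<le> pexp p1 (\<lambda>v1. pexp p2 (\<lambda>v2. of_bool (Gd v1 v2)))"
    and L: "0 < L1" "0 < L2"
  shows "pexp (Pi_pmf I1 d1 (\<lambda>_. p1)) (\<lambda>c1. pexp (Pi_pmf I2 d2 (\<lambda>_. p2)) (\<lambda>c2.
      of_bool (\<not> (\<exists>l1<L1. \<exists>l2<L2. Gd (c1 (f1 l1)) (c2 (f2 l2))))))
    \<le> (1 / (real L1 * real L2) + g / real L1 + g / real L2) / p"
proof -
  define p' where "p' = pexp p1 (\<lambda>v1. pexp p2 (\<lambda>v2. of_bool (Gd v1 v2)) :: real)"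
  have p': "0 < p'" "p \<le> p'" using p by (auto simp: p'_def)
  have p'2: "p' = pexp p2 (\<lambda>v2. pexp p1 (\<lambda>v1. of_bool (Gd v1 v2)))"
    unfolding p'_def by (rule pexp_commute)
  have "set_pmf p1 \<noteq> {}" by (rule set_pmf_not_empty)
  then obtain v0 where "v0 \<in> set_pmf p1" by auto
  moreover have "0 \<le> pexp p2 (\<lambda>v2. of_bool (Gd v0 v2) :: real)" by (rule pexp_nonneg) simp
  ultimately have g0: "0 \<le> g" using g1[of v0] by linarith
  define C1 where "C1 = Pi_pmf I1 d1 (\<lambda>_. p1)"
  define C2 where "C2 = Pi_pmf I2 d2 (\<lambda>_. p2)"
  have finC: "finite (set_pmf C1)" "finite (set_pmf C2)"
    using fin by (auto simp: C1_def C2_def intro: finite_set_Pi_pmf)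
  define E where "E = (\<lambda>F. pexp C1 (\<lambda>c1. pexp C2 (\<lambda>c2. F c1 c2 :: real)))"
  define b where "b = (\<lambda>c1 c2 l1 l2. of_bool (Gd (c1 (f1 l1)) (c2 (f2 l2))) :: real)"
  define X where "X = (\<lambda>c1 c2. \<Sum>l1<L1. \<Sum>l2<L2. b c1 c2 l1 l2)"
  define \<mu> where "\<mu> = real L1 * real L2 * p'"
  have \<mu>: "\<mu> > 0" using L p' by (simp add: \<mu>_def)
  have E1: "E (\<lambda>c1 c2. b c1 c2 l1 l2) = p'" if "l1 < L1" "l2 < L2" for l1 l2
  proof -
    have "E (\<lambda>c1 c2. b c1 c2 l1 l2) = pexp C1 (\<lambda>c1. pexp p2 (\<lambda>v2. of_bool (Gd (c1 (f1 l1)) v2)))"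
      unfolding E_def b_def C2_def using fin idx(2)[OF that(2)] by (intro pexp_cong pexp_Pi_one) auto
    also have "\<dots> = p'"
      unfolding C1_def p'_def using fin idx(1)[OF that(1)] by (intro pexp_Pi_one) auto
    finally show ?thesis .
  qed
  have EX: "E X = \<mu>"
    unfolding X_def E_def pexp_sum using E1 by (simp add: E_def \<mu>_def)
  \<comment> \<open>Two index pairs without a common index give independent events. If they share
    one index, fixing the shared codeword leaves two independent events: one has probability at most
    \<open>g\<close>, the other integrates to \<open>p'\<close>.\<close>
  have E2: "E (\<lambda>c1 c2. b c1 c2 l1 l2 * b c1 c2 l1' l2') \<le>
      p'\<^sup>2 + of_bool (l1 = l1') * (g * p') + of_bool (l2 = l2') * (g * p') + of_bool (l1 = l1' \<and> l2 = l2') * p'"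
    if l: "l1 < L1" "l2 < L2" "l1' < L1" "l2' < L2" for l1 l2 l1' l2'
  proof -
    note i1 = idx(1)[OF l(1)] idx(1)[OF l(3)] and i2 = idx(2)[OF l(2)] idx(2)[OF l(4)]
    have n1: "l1 \<noteq> l1' \<Longrightarrow> f1 l1 \<noteq> f1 l1'" and n2: "l2 \<noteq> l2' \<Longrightarrow> f2 l2 \<noteq> f2 l2'"
      using idx(3,4) l by (auto simp: inj_on_def)
    have pp: "0 \<le> p'" "0 \<le> p'\<^sup>2" "0 \<le> g * p'" using p' g0 by auto
    consider "l1 = l1'" "l2 = l2'" | "l1 = l1'" "l2 \<noteq> l2'" | "l1 \<noteq> l1'" "l2 = l2'" | "l1 \<noteq> l1'" "l2 \<noteq> l2'" by blast
    then show ?thesis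
    proof cases
      case 1
      have "E (\<lambda>c1 c2. b c1 c2 l1 l2 * b c1 c2 l1' l2') = E (\<lambda>c1 c2. b c1 c2 l1 l2)"
        unfolding E_def b_def using 1 by (intro pexp_cong) auto
      then show ?thesis using E1[OF l(1,2)] 1 pp by simp
    next
      case 2
      have "E (\<lambda>c1 c2. b c1 c2 l1 l2 * b c1 c2 l1' l2') = pexp C1 (\<lambda>c1.
          pexp p2 (\<lambda>x. pexp p2 (\<lambda>y. of_bool (Gd (c1 (f1 l1)) x) * of_bool (Gd (c1 (f1 l1)) y))))"
        unfolding E_def b_def C2_def using fin i2 n2 2
        by (intro pexp_cong, subst pexp_Pi_two[where f="\<lambda>x y. of_bool (Gd _ x) * of_bool (Gd _ y)"]) auto
      also have "\<dots> = pexp p1 (\<lambda>v. pexp p2 (\<lambda>x. pexp p2 (\<lambda>y. of_bool (Gd v x) * of_bool (Gd v y))))"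
        unfolding C1_def using fin i1 by (intro pexp_Pi_one) auto
      also have "\<dots> = pexp p1 (\<lambda>v. pexp p2 (\<lambda>x. of_bool (Gd v x)) * pexp p2 (\<lambda>y. of_bool (Gd v y)))"
        by (simp only: pexp_cmult pexp_cmultr)
      also have "\<dots> \<le> pexp p1 (\<lambda>v. g * pexp p2 (\<lambda>y. of_bool (Gd v y)))"
        by (intro pexp_mono mult_right_mono g1 pexp_nonneg) auto
      also have "\<dots> = g * p'" by (simp only: pexp_cmult p'_def)
      finally show ?thesis using 2 pp by (simp add: add_increasing)
    next
      case 3
      have "E (\<lambda>c1 c2. b c1 c2 l1 l2 * b c1 c2 l1' l2') = pexp C2 (\<lambda>c2. pexp C1 (\<lambda>c1. b c1 c2 l1 l2 * b c1 c2 l1' l2'))"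
        unfolding E_def by (rule pexp_commute)
      also have "\<dots> = pexp C2 (\<lambda>c2.
          pexp p1 (\<lambda>x. pexp p1 (\<lambda>y. of_bool (Gd x (c2 (f2 l2))) * of_bool (Gd y (c2 (f2 l2))))))"
        unfolding b_def C1_def using fin i1 n1 3
        by (intro pexp_cong, subst pexp_Pi_two[where f="\<lambda>x y. of_bool (Gd x _) * of_bool (Gd y _)"]) auto
      also have "\<dots> = pexp p2 (\<lambda>v. pexp p1 (\<lambda>x. pexp p1 (\<lambda>y. of_bool (Gd x v) * of_bool (Gd y v))))"
        unfolding C2_def using fin i2 by (intro pexp_Pi_one) auto
      also have "\<dots> = pexp p2 (\<lambda>v. pexp p1 (\<lambda>x. of_bool (Gd x v)) * pexp p1 (\<lambda>y. of_bool (Gd y v)))"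
        by (simp only: pexp_cmult pexp_cmultr)
      also have "\<dots> \<le> pexp p2 (\<lambda>v. g * pexp p1 (\<lambda>y. of_bool (Gd y v)))"
        by (intro pexp_mono mult_right_mono g2 pexp_nonneg) auto
      also have "\<dots> = g * p'" by (simp only: pexp_cmult p'2)
      finally show ?thesis using 3 pp by (simp add: add_increasing)
    next
      case 4
      have "E (\<lambda>c1 c2. b c1 c2 l1 l2 * b c1 c2 l1' l2') = pexp C1 (\<lambda>c1.
          pexp p2 (\<lambda>x. pexp p2 (\<lambda>y. of_bool (Gd (c1 (f1 l1)) x) * of_bool (Gd (c1 (f1 l1')) y))))"
        unfolding E_def b_def C2_def using fin i2 n2 4
        by (intro pexp_cong, subst pexp_Pi_two[where f="\<lambda>x y. of_bool (Gd _ x) * of_bool (Gd _ y)"]) auto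
      also have "\<dots> = pexp C1 (\<lambda>c1. pexp p2 (\<lambda>x. of_bool (Gd (c1 (f1 l1)) x)) * pexp p2 (\<lambda>y. of_bool (Gd (c1 (f1 l1')) y)))"
        by (simp only: pexp_cmult pexp_cmultr)
      also have "\<dots> = pexp p1 (\<lambda>u. pexp p1 (\<lambda>v. pexp p2 (\<lambda>x. of_bool (Gd u x)) * pexp p2 (\<lambda>y. of_bool (Gd v y))))"
        unfolding C1_def using fin i1 n1 4
        by (subst pexp_Pi_two[where f="\<lambda>u v. pexp p2 (\<lambda>x. of_bool (Gd u x)) * pexp p2 (\<lambda>y. of_bool (Gd v y))"]) auto
      also have "\<dots> = p' * p'"
        by (simp only: pexp_cmult pexp_cmultr p'_def)
      finally show ?thesis using 4 pp by (simp add: power2_eq_square)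
    qed
  qed
  have EX2: "E (\<lambda>c1 c2. (X c1 c2)\<^sup>2) \<le> \<mu>\<^sup>2 + real L1 * real L2 * p' * (1 + g * L1 + g * L2)"
  proof -
    have "E (\<lambda>c1 c2. (X c1 c2)\<^sup>2) = E (\<lambda>c1 c2. \<Sum>l1<L1. \<Sum>l2<L2. \<Sum>l1'<L1. \<Sum>l2'<L2. b c1 c2 l1 l2 * b c1 c2 l1' l2')"
    proof -
      have "(X c1 c2)\<^sup>2 = (\<Sum>l1<L1. \<Sum>l2<L2. b c1 c2 l1 l2 * X c1 c2)" for c1 c2
        unfolding power2_eq_square by (subst X_def) (simp only: sum_distrib_right)
      also have "\<dots> c1 c2 = (\<Sum>l1<L1. \<Sum>l2<L2. \<Sum>l1'<L1. \<Sum>l2'<L2. b c1 c2 l1 l2 * b c1 c2 l1' l2')" for c1 c2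
        unfolding X_def by (simp only: sum_distrib_left)
      finally show ?thesis by simp
    qed
    also have "\<dots> = (\<Sum>l1<L1. \<Sum>l2<L2. \<Sum>l1'<L1. \<Sum>l2'<L2. E (\<lambda>c1 c2. b c1 c2 l1 l2 * b c1 c2 l1' l2'))"
      by (simp only: E_def pexp_sum)
    also have "\<dots> \<le> (\<Sum>l1<L1. \<Sum>l2<L2. \<Sum>l1'<L1. \<Sum>l2'<L2.
      p'\<^sup>2 + of_bool (l1 = l1') * (g * p') + of_bool (l2 = l2') * (g * p') + of_bool (l1 = l1' \<and> l2 = l2') * p')"
      by (intro sum_mono E2) auto
    also have "\<dots> = (\<Sum>l1<L1. \<Sum>l2<L2. real L1 * real L2 * p'\<^sup>2 + real L2 * (g * p') + real L1 * (g * p') + p')"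
    proof (intro sum.cong refl)
      fix l1 l2 assume l: "l1 \<in> {..<L1}" "l2 \<in> {..<L2}"
      have "(\<Sum>l1'<L1. \<Sum>l2'<L2. (of_bool (l1 = l1') * (g * p'))) = real L2 * (g * p')"
        using l by (simp add: sum_distrib_left[symmetric] of_bool_def if_distrib[where f="\<lambda>x. x * _"] cong: if_cong)
      moreover have "(\<Sum>l1'<L1. \<Sum>l2'<L2. (of_bool (l2 = l2') * (g * p'))) = real L1 * (g * p')"
        using l by (simp add: of_bool_def if_distrib[where f="\<lambda>x. x * _"] cong: if_cong)
      moreover have "(\<Sum>l1'<L1. \<Sum>l2'<L2. (of_bool (l1 = l1' \<and> l2 = l2') * p')) = p'"
      proof -
        have "(\<Sum>l1'<L1. \<Sum>l2'<L2. (of_bool (l1 = l1' \<and> l2 = l2') * p')) = (\<Sum>l1'<L1. if l1 = l1' then p' else 0)"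
        proof (rule sum.cong)
          fix l1' show "(\<Sum>l2'<L2. (of_bool (l1 = l1' \<and> l2 = l2') * p')) = (if l1 = l1' then p' else 0)"
            using l by (cases "l1 = l1'") (simp_all add: of_bool_def if_distrib[where f="\<lambda>x. x * _"] cong: if_cong)
        qed simp
        then show ?thesis using l by simp
      qed
      ultimately show "(\<Sum>l1'<L1. \<Sum>l2'<L2.
      p'\<^sup>2 + of_bool (l1 = l1') * (g * p') + of_bool (l2 = l2') * (g * p') + of_bool (l1 = l1' \<and> l2 = l2') * p')
        = real L1 * real L2 * p'\<^sup>2 + real L2 * (g * p') + real L1 * (g * p') + p'"
        by (simp only: sum.distrib) simp
    qed
    also have "\<dots> = \<mu>\<^sup>2 + real L1 * real L2 * p' * (1 + g * L1 + g * L2)"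
      by (simp add: \<mu>_def power2_eq_square algebra_simps)
    finally show ?thesis .
  qed
  have "\<mu>\<^sup>2 * E (\<lambda>c1 c2. of_bool (\<not> (\<exists>l1<L1. \<exists>l2<L2. Gd (c1 (f1 l1)) (c2 (f2 l2)))))
    = E (\<lambda>c1 c2. \<mu>\<^sup>2 * of_bool (\<not> (\<exists>l1<L1. \<exists>l2<L2. Gd (c1 (f1 l1)) (c2 (f2 l2)))))"
    by (simp only: E_def pexp_cmult)
  \<comment> \<open>If no pair is good, the count \<open>X\<close> is 0 and misses its mean by
    \<open>\<mu>\<close>, so the indicator times the square of \<open>\<mu>\<close> is dominated by
    the squared deviation.\<close>
  also have "\<dots> \<le> E (\<lambda>c1 c2. (X c1 c2)\<^sup>2 - 2 * \<mu> * X c1 c2 + \<mu>\<^sup>2)"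
    unfolding E_def
  proof (intro pexp_mono)
    fix c1 c2
    show "\<mu>\<^sup>2 * of_bool (\<not> (\<exists>l1<L1. \<exists>l2<L2. Gd (c1 (f1 l1)) (c2 (f2 l2)))) \<le> (X c1 c2)\<^sup>2 - 2 * \<mu> * X c1 c2 + \<mu>\<^sup>2"
    proof (cases "\<exists>l1<L1. \<exists>l2<L2. Gd (c1 (f1 l1)) (c2 (f2 l2))")
      case True
      have "0 \<le> (X c1 c2 - \<mu>)\<^sup>2" by simp
      then show ?thesis using True by (simp add: power2_diff algebra_simps)
    next
      case False
      have "X c1 c2 = 0" unfolding X_def b_def using False by (intro sum.neutral ballI) auto
      then show ?thesis using False by simp
    qed
  qed
  also have "\<dots> = E (\<lambda>c1 c2. (X c1 c2)\<^sup>2) - 2 * \<mu> * \<mu> + \<mu>\<^sup>2"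
  proof -
    have "E (\<lambda>c1 c2. (X c1 c2)\<^sup>2 - 2 * \<mu> * X c1 c2 + \<mu>\<^sup>2) = E (\<lambda>c1 c2. (X c1 c2)\<^sup>2) - 2 * \<mu> * E X + \<mu>\<^sup>2"
      unfolding E_def using finC by (simp only: pexp_add pexp_diff pexp_cmult pexp_const)
    then show ?thesis by (simp add: EX)
  qed
  also have "\<dots> \<le> real L1 * real L2 * p' * (1 + g * L1 + g * L2)"
    using EX2 by (simp add: power2_eq_square)
  finally have "E (\<lambda>c1 c2. of_bool (\<not> (\<exists>l1<L1. \<exists>l2<L2. Gd (c1 (f1 l1)) (c2 (f2 l2)))))
    \<le> real L1 * real L2 * p' * (1 + g * L1 + g * L2) / \<mu>\<^sup>2"
    using \<mu> by (simp add: field_simps)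
  also have "\<dots> = (1 / (real L1 * real L2) + g / real L1 + g / real L2) / p'"
    using L p' by (simp add: \<mu>_def power2_eq_square field_simps)
  also have "\<dots> \<le> (1 / (real L1 * real L2) + g / real L1 + g / real L2) / p"
    using p p' g0 by (intro divide_left_mono) auto
  finally show ?thesis by (simp add: E_def C1_def C2_def)
qed

text \<open>Summing over all good pairs \<open>(l1, l2)\<close> is the union bound that replaces the
  (codebook dependent) choice of the transmitted pair by a fixed one.\<close>

lemma false_positives:
  fixes p1 :: "'v1 pmf" and p2 :: "'v2 pmf" and L1 L2 :: nat
  assumes fin: "finite (set_pmf p1)" "finite (set_pmf p2)" "finite I1" "finite I2"
      "\<And>v1 v2. finite (set_pmf (\<kappa> v1 v2))"
    and idx: "\<And>l. l < L1 \<Longrightarrow> f1 l \<in> I1" "\<And>l. l < L2 \<Longrightarrow> f2 l \<in> I2"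
    and g1: "\<And>v1. v1 \<in> set_pmf p1 \<Longrightarrow> pexp p2 (\<lambda>v2. of_bool (Gd v1 v2)) \<le> g"
    and g0: "0 \<le> g" "0 \<le> \<beta>"
    and \<tau>: "\<And>v2 ou. v2 \<in> set_pmf p2 \<Longrightarrow> pexp p1 (\<lambda>v1. of_bool (\<tau> v1 v2 ou)) \<le> \<beta>"
    and cand: "\<And>l. l < L1 \<Longrightarrow> Cand l \<subseteq> I1 - {f1 l}" "\<And>l. l < L1 \<Longrightarrow> real (card (Cand l)) \<le> N"
  shows "pexp (Pi_pmf I1 d1 (\<lambda>_. p1)) (\<lambda>c1. pexp (Pi_pmf I2 d2 (\<lambda>_. p2)) (\<lambda>c2.
      \<Sum>l1<L1. \<Sum>l2<L2. of_bool (Gd (c1 (f1 l1)) (c2 (f2 l2))) *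
        pexp (\<kappa> (c1 (f1 l1)) (c2 (f2 l2))) (\<lambda>ou. \<Sum>k\<in>Cand l1. of_bool (\<tau> (c1 k) (c2 (f2 l2)) ou))))
    \<le> real L1 * real L2 * g * N * \<beta>"
proof -
  define C1 where "C1 = Pi_pmf I1 d1 (\<lambda>_. p1)"
  define C2 where "C2 = Pi_pmf I2 d2 (\<lambda>_. p2)"
  have finC: "finite (set_pmf C1)" "finite (set_pmf C2)"
    using fin by (auto simp: C1_def C2_def intro: finite_set_Pi_pmf)
  have fp_one: "pexp C1 (\<lambda>c1. pexp C2 (\<lambda>c2. of_bool (Gd (c1 (f1 l1)) (c2 (f2 l2))) *
        pexp (\<kappa> (c1 (f1 l1)) (c2 (f2 l2))) (\<lambda>ou. of_bool (\<tau> (c1 k) (c2 (f2 l2)) ou)))) \<le> g * \<beta>"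
    if l: "l1 < L1" "l2 < L2" "k \<in> Cand l1" for l1 l2 k
  proof -
    have k: "k \<in> I1" "f1 l1 \<noteq> k" using cand(1)[OF l(1)] l(3) by auto
    have "pexp C1 (\<lambda>c1. pexp C2 (\<lambda>c2. of_bool (Gd (c1 (f1 l1)) (c2 (f2 l2))) *
        pexp (\<kappa> (c1 (f1 l1)) (c2 (f2 l2))) (\<lambda>ou. of_bool (\<tau> (c1 k) (c2 (f2 l2)) ou))))
      = pexp C1 (\<lambda>c1. pexp p2 (\<lambda>v2. of_bool (Gd (c1 (f1 l1)) v2) *
        pexp (\<kappa> (c1 (f1 l1)) v2) (\<lambda>ou. of_bool (\<tau> (c1 k) v2 ou))))"
      unfolding C2_def using fin idx(2)[OF l(2)]
      by (intro pexp_cong) (rule pexp_Pi_one[where f="\<lambda>v2. of_bool (Gd _ v2) * pexp (\<kappa> _ v2) (\<lambda>ou. of_bool (\<tau> _ v2 ou))"], auto)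
    also have "\<dots> = pexp p1 (\<lambda>v1. pexp p1 (\<lambda>v1'. pexp p2 (\<lambda>v2. of_bool (Gd v1 v2) *
        pexp (\<kappa> v1 v2) (\<lambda>ou. of_bool (\<tau> v1' v2 ou)))))"
      unfolding C1_def using fin idx(1)[OF l(1)] k
      by (intro pexp_Pi_two[where f="\<lambda>v1 v1'. pexp p2 (\<lambda>v2. of_bool (Gd v1 v2) * pexp (\<kappa> v1 v2) (\<lambda>ou. of_bool (\<tau> v1' v2 ou)))"]) auto
    \<comment> \<open>Since \<open>k\<close> differs from \<open>f1 l1\<close>, the tested codeword
      is independent of the transmitted pair and of the output, so its mean can be taken first. What
      remains is the probability of a good pair, at most \<open>g\<close>.\<close>
    also have "\<dots> = pexp p1 (\<lambda>v1. pexp p2 (\<lambda>v2. of_bool (Gd v1 v2) *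
        pexp (\<kappa> v1 v2) (\<lambda>ou. pexp p1 (\<lambda>v1'. of_bool (\<tau> v1' v2 ou)))))"
      by (intro pexp_cong, subst pexp_commute, simp only: pexp_cmult)
        (intro pexp_cong arg_cong2[where f="(*)"] refl pexp_commute)
    also have "\<dots> \<le> pexp p1 (\<lambda>v1. pexp p2 (\<lambda>v2. of_bool (Gd v1 v2) * \<beta>))"
      by (intro pexp_mono mult_left_mono, rule pexp_le_const[OF fin(5) \<tau>]) auto
    also have "\<dots> = pexp p1 (\<lambda>v1. pexp p2 (\<lambda>v2. of_bool (Gd v1 v2)) * \<beta>)"
      by (simp only: pexp_cmultr)
    also have "\<dots> \<le> g * \<beta>"
      by (intro pexp_le_const[OF fin(1)] mult_right_mono g1) (use g0 in auto)
    finally show ?thesis .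
  qed
  have "pexp C1 (\<lambda>c1. pexp C2 (\<lambda>c2. \<Sum>l1<L1. \<Sum>l2<L2. of_bool (Gd (c1 (f1 l1)) (c2 (f2 l2))) *
        pexp (\<kappa> (c1 (f1 l1)) (c2 (f2 l2))) (\<lambda>ou. \<Sum>k\<in>Cand l1. of_bool (\<tau> (c1 k) (c2 (f2 l2)) ou))))
    = (\<Sum>l1<L1. \<Sum>l2<L2. \<Sum>k\<in>Cand l1. pexp C1 (\<lambda>c1. pexp C2 (\<lambda>c2. of_bool (Gd (c1 (f1 l1)) (c2 (f2 l2))) *
        pexp (\<kappa> (c1 (f1 l1)) (c2 (f2 l2))) (\<lambda>ou. of_bool (\<tau> (c1 k) (c2 (f2 l2)) ou)))))"
    by (simp only: pexp_sum sum_distrib_left)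
  also have "\<dots> \<le> (\<Sum>l1<L1. \<Sum>l2<L2. \<Sum>k\<in>Cand l1. g * \<beta>)"
    by (intro sum_mono fp_one) auto
  also have "\<dots> = (\<Sum>l1<L1. real L2 * (real (card (Cand l1)) * (g * \<beta>)))" by simp
  also have "\<dots> \<le> (\<Sum>l1<L1. real L2 * (N * (g * \<beta>)))"
    using cand(2) g0 by (intro sum_mono mult_left_mono mult_right_mono) auto
  also have "\<dots> = real L1 * real L2 * g * N * \<beta>" by simp
  finally show ?thesis by (simp only: C1_def C2_def)
qed

text \<open>Five quantities have to be small at once: the covering failure and two kinds of false
  alarms for each side. Each is divided by its bound, so their sum has mean at most 5, and a
  codebook whose sum is at most 5 keeps each within 5 times its bound. A codeword index is a message
  with a position in its bin; \<open>j\<close> distinguishes the two tests of a side.\<close>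

lemma one_shot_private:
  fixes p1 :: "'v1 pmf" and p2 :: "'v2 pmf" and L1 L2 :: nat and M1 :: "'m1 set" and M2 :: "'m2 set"
    and \<tau>1 :: "bool \<Rightarrow> 'v1 \<Rightarrow> 'v2 \<Rightarrow> 'o \<Rightarrow> bool" and \<tau>2 :: "bool \<Rightarrow> 'v2 \<Rightarrow> 'v1 \<Rightarrow> 'o \<Rightarrow> bool"
  assumes fin: "finite (set_pmf p1)" "finite (set_pmf p2)" "finite M1" "finite M2" "M1 \<noteq> {}" "M2 \<noteq> {}"
      "\<And>v1 v2. finite (set_pmf (\<kappa> v1 v2))"
    and g1: "\<And>v1. v1 \<in> set_pmf p1 \<Longrightarrow> pexp p2 (\<lambda>v2. of_bool (Gd v1 v2)) \<le> g"
    and g2: "\<And>v2. v2 \<in> set_pmf p2 \<Longrightarrow> pexp p1 (\<lambda>v1. of_bool (Gd v1 v2)) \<le> g"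
    and p: "0 < p" "p \<le> pexp p1 (\<lambda>v1. pexp p2 (\<lambda>v2. of_bool (Gd v1 v2)))"
    and L: "0 < L1" "0 < L2"
    and cov: "(1 / (real L1 * real L2) + g / real L1 + g / real L2) / p \<le> cov"
    and \<tau>1: "\<And>j v2 ou. v2 \<in> set_pmf p2 \<Longrightarrow> pexp p1 (\<lambda>v1. of_bool (\<tau>1 j v1 v2 ou)) \<le> \<beta>1 j"
    and \<tau>2: "\<And>j v1 ou. v1 \<in> set_pmf p1 \<Longrightarrow> pexp p2 (\<lambda>v2. of_bool (\<tau>2 j v2 v1 ou)) \<le> \<beta>2 j"
    and cand1: "\<And>j k. k \<in> M1 \<times> {..<L1} \<Longrightarrow> Cand1 j k \<subseteq> M1 \<times> {..<L1} - {k}"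
      "\<And>j k. k \<in> M1 \<times> {..<L1} \<Longrightarrow> real (card (Cand1 j k)) \<le> N1 j"
    and cand2: "\<And>j k. k \<in> M2 \<times> {..<L2} \<Longrightarrow> Cand2 j k \<subseteq> M2 \<times> {..<L2} - {k}"
      "\<And>j k. k \<in> M2 \<times> {..<L2} \<Longrightarrow> real (card (Cand2 j k)) \<le> N2 j"
    and b1: "\<And>j. real L1 * real L2 * g * N1 j * \<beta>1 j \<le> b1 j" "\<And>j. 0 < b1 j" "\<And>j. 0 < \<beta>1 j"
    and b2: "\<And>j. real L1 * real L2 * g * N2 j * \<beta>2 j \<le> b2 j" "\<And>j. 0 < b2 j" "\<And>j. 0 < \<beta>2 j"
  shows "\<exists>c1 c2 l1 l2.
     (\<forall>k\<in>M1 \<times> {..<L1}. c1 k \<in> set_pmf p1) \<and> (\<forall>k\<in>M2 \<times> {..<L2}. c2 k \<in> set_pmf p2) \<and>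
     (\<forall>m1 m2. l1 m1 m2 < L1 \<and> l2 m1 m2 < L2) \<and>
     pexp (pair_pmf (pmf_of_set M1) (pmf_of_set M2)) (\<lambda>(m1, m2).
        of_bool (\<not> Gd (c1 (m1, l1 m1 m2)) (c2 (m2, l2 m1 m2)))) \<le> 5 * cov \<and>
     (\<forall>j. pexp (pair_pmf (pmf_of_set M1) (pmf_of_set M2)) (\<lambda>(m1, m2).
        of_bool (Gd (c1 (m1, l1 m1 m2)) (c2 (m2, l2 m1 m2))) *
          pexp (\<kappa> (c1 (m1, l1 m1 m2)) (c2 (m2, l2 m1 m2)))
            (\<lambda>ou. \<Sum>k\<in>Cand1 j (m1, l1 m1 m2). of_bool (\<tau>1 j (c1 k) (c2 (m2, l2 m1 m2)) ou))) \<le> 5 * b1 j) \<and>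
     (\<forall>j. pexp (pair_pmf (pmf_of_set M1) (pmf_of_set M2)) (\<lambda>(m1, m2).
        of_bool (Gd (c1 (m1, l1 m1 m2)) (c2 (m2, l2 m1 m2))) *
          pexp (\<kappa> (c1 (m1, l1 m1 m2)) (c2 (m2, l2 m1 m2)))
            (\<lambda>ou. \<Sum>k\<in>Cand2 j (m2, l2 m1 m2). of_bool (\<tau>2 j (c2 k) (c1 (m1, l1 m1 m2)) ou))) \<le> 5 * b2 j)"
proof -
  let ?U = "pair_pmf (pmf_of_set M1) (pmf_of_set M2)"
  define I1 where "I1 = M1 \<times> {..<L1}"
  define I2 where "I2 = M2 \<times> {..<L2}"
  define C1 where "C1 = Pi_pmf I1 undefined (\<lambda>_. p1)"
  define C2 where "C2 = Pi_pmf I2 undefined (\<lambda>_. p2)"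
  have finI: "finite I1" "finite I2" using fin by (auto simp: I1_def I2_def)
  have finC: "finite (set_pmf C1)" "finite (set_pmf C2)" "finite (set_pmf ?U)"
    using fin finI by (auto simp: C1_def C2_def intro: finite_set_Pi_pmf)
  have "set_pmf p1 \<noteq> {}" by (rule set_pmf_not_empty)
  then obtain v0 where "v0 \<in> set_pmf p1" by auto
  moreover have "0 \<le> pexp p2 (\<lambda>v2. of_bool (Gd v0 v2) :: real)" by (rule pexp_nonneg) simp
  ultimately have g0: "0 \<le> g" using g1[of v0] by linarith
  have "0 < (1 / (real L1 * real L2) + g / real L1 + g / real L2) / p"
    using L g0 p by (intro divide_pos_pos add_pos_nonneg) auto
  with cov have cov0: "0 < cov" by linarith
  define ok where "ok = (\<lambda>c1 c2 (m1::'m1) (m2::'m2). \<exists>l1<L1. \<exists>l2<L2. Gd (c1 (m1, l1)) (c2 (m2, l2)))"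
  define X0 where "X0 = (\<lambda>c1 c2 m1 m2. of_bool (\<not> ok c1 c2 m1 m2) :: real)"
  define X1 where "X1 = (\<lambda>j c1 c2 (m1::'m1) (m2::'m2). \<Sum>l1<L1. \<Sum>l2<L2. of_bool (Gd (c1 (m1, l1)) (c2 (m2, l2))) *
        pexp (\<kappa> (c1 (m1, l1)) (c2 (m2, l2))) (\<lambda>ou. \<Sum>k\<in>Cand1 j (m1, l1). of_bool (\<tau>1 j (c1 k) (c2 (m2, l2)) ou)) :: real)"
  define X2 where "X2 = (\<lambda>j c1 c2 (m1::'m1) (m2::'m2). \<Sum>l2<L2. \<Sum>l1<L1. of_bool (Gd (c1 (m1, l1)) (c2 (m2, l2))) *
        pexp (\<kappa> (c1 (m1, l1)) (c2 (m2, l2))) (\<lambda>ou. \<Sum>k\<in>Cand2 j (m2, l2). of_bool (\<tau>2 j (c2 k) (c1 (m1, l1)) ou)) :: real)"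
  define E where "E = (\<lambda>F. pexp C1 (\<lambda>c1. pexp C2 (\<lambda>c2. F c1 c2 :: real)))"
  have E0: "E (\<lambda>c1 c2. X0 c1 c2 m1 m2) \<le> cov" if "m1 \<in> M1" "m2 \<in> M2" for m1 m2
    unfolding E_def X0_def C1_def C2_def ok_def
    by (rule order_trans[OF mutual_covering[of p1 p2 I1 I2 L1 "Pair m1" L2 "Pair m2" Gd g p] cov])
      (use fin finI that g1 g2 p L in \<open>auto simp: I1_def I2_def inj_on_def\<close>)
  have E1: "E (\<lambda>c1 c2. X1 j c1 c2 m1 m2) \<le> b1 j" if "m1 \<in> M1" "m2 \<in> M2" for m1 m2 j
    unfolding E_def X1_def C1_def C2_def
    by (rule order_trans[OF false_positives[of p1 p2 I1 I2 "\<kappa>" L1 "Pair m1" L2 "Pair m2" Gd g "\<beta>1 j" "\<tau>1 j" "\<lambda>l. Cand1 j (m1, l)" "N1 j"] b1(1)])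
      (use fin finI that g1 g0 b1(3) L \<tau>1 cand1 in \<open>auto simp: I1_def I2_def less_imp_le\<close>)
  have E2: "E (\<lambda>c1 c2. X2 j c1 c2 m1 m2) \<le> b2 j" if "m1 \<in> M1" "m2 \<in> M2" for m1 m2 j
  proof -
    have "E (\<lambda>c1 c2. X2 j c1 c2 m1 m2) = pexp C2 (\<lambda>c2. pexp C1 (\<lambda>c1. X2 j c1 c2 m1 m2))"
      unfolding E_def by (rule pexp_commute)
    also have "\<dots> \<le> real L2 * real L1 * g * N2 j * \<beta>2 j"
      unfolding X2_def C1_def C2_def
      by (rule false_positives[of p2 p1 I2 I1 "\<lambda>a b. \<kappa> b a" L2 "Pair m2" L1 "Pair m1" "\<lambda>a b. Gd b a" g "\<beta>2 j" "\<tau>2 j" "\<lambda>l. Cand2 j (m2, l)" "N2 j"])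
        (use fin finI that g2 g0 b2(3) L \<tau>2 cand2 in \<open>auto simp: I1_def I2_def less_imp_le\<close>)
    also have "\<dots> \<le> b2 j" using b2(1)[of j] by (simp add: mult.commute)
    finally show ?thesis .
  qed
  define F where "F = (\<lambda>c1 c2 m1 m2. X0 c1 c2 m1 m2 / cov + X1 True c1 c2 m1 m2 / b1 True + X1 False c1 c2 m1 m2 / b1 False
     + X2 True c1 c2 m1 m2 / b2 True + X2 False c1 c2 m1 m2 / b2 False)"
  have EF: "E (\<lambda>c1 c2. F c1 c2 m1 m2) \<le> 5" if m: "m1 \<in> M1" "m2 \<in> M2" for m1 m2
  proof -
    have "E (\<lambda>c1 c2. F c1 c2 m1 m2) = E (\<lambda>c1 c2. X0 c1 c2 m1 m2) / cov + E (\<lambda>c1 c2. X1 True c1 c2 m1 m2) / b1 True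
      + E (\<lambda>c1 c2. X1 False c1 c2 m1 m2) / b1 False + E (\<lambda>c1 c2. X2 True c1 c2 m1 m2) / b2 True
      + E (\<lambda>c1 c2. X2 False c1 c2 m1 m2) / b2 False"
      unfolding F_def E_def divide_inverse by (simp only: pexp_add pexp_cmultr)
    moreover have "E (\<lambda>c1 c2. X0 c1 c2 m1 m2) / cov \<le> 1" using E0[OF m] cov0 by simp
    moreover have u1: "E (\<lambda>c1 c2. X1 j c1 c2 m1 m2) / b1 j \<le> 1" for j using E1[OF m] b1(2) by simp
    moreover have u2: "E (\<lambda>c1 c2. X2 j c1 c2 m1 m2) / b2 j \<le> 1" for j using E2[OF m] b2(2) by simp
    ultimately show ?thesis using u1[of True] u1[of False] u2[of True] u2[of False] by linarith
  qed
  have "pexp (pair_pmf C1 C2) (\<lambda>(c1, c2). pexp ?U (\<lambda>(m1, m2). F c1 c2 m1 m2))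
    = pexp ?U (\<lambda>m. pexp (pair_pmf C1 C2) (\<lambda>c. F (fst c) (snd c) (fst m) (snd m)))"
    unfolding case_prod_unfold by (rule pexp_commute)
  also have "\<dots> \<le> 5"
    by (rule pexp_le_const[OF finC(3)]) (use finC(1,2) EF fin in \<open>auto simp: pexp_pair E_def\<close>)
  finally obtain c where c: "c \<in> set_pmf (pair_pmf C1 C2)"
    and cF: "(case c of (c1, c2) \<Rightarrow> pexp ?U (\<lambda>(m1, m2). F c1 c2 m1 m2)) \<le> 5"
    using pexp_ex_le[of "pair_pmf C1 C2" "\<lambda>(c1, c2). pexp ?U (\<lambda>(m1, m2). F c1 c2 m1 m2)"] finC by fastforce
  obtain c1 c2 where c12: "c = (c1, c2)" by force
  have sup: "\<forall>k\<in>I1. c1 k \<in> set_pmf p1" "\<forall>k\<in>I2. c2 k \<in> set_pmf p2"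
    using c c12 finI Pi_pmf_support[of I1 c1 undefined "\<lambda>_. p1"] Pi_pmf_support[of I2 c2 undefined "\<lambda>_. p2"]
    by (auto simp: C1_def C2_def)
  \<comment> \<open>The chosen positions may depend on the whole codebook; (0, 0) is the default
    when the two bins contain no good pair.\<close>
  have "\<exists>l. fst l < L1 \<and> snd l < L2 \<and> (ok c1 c2 m1 m2 \<longrightarrow> Gd (c1 (m1, fst l)) (c2 (m2, snd l)))" for m1 m2
  proof (cases "ok c1 c2 m1 m2")
    case True
    then show ?thesis by (auto simp: ok_def)
  next
    case False
    then show ?thesis using L by (intro exI[of _ "(0, 0)"]) auto
  qed
  then obtain l where l: "\<And>m1 m2. fst (l m1 m2) < L1" "\<And>m1 m2. snd (l m1 m2) < L2"
     "\<And>m1 m2. ok c1 c2 m1 m2 \<Longrightarrow> Gd (c1 (m1, fst (l m1 m2))) (c2 (m2, snd (l m1 m2)))"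
    by metis
  define l1 where "l1 = (\<lambda>m1 m2. fst (l m1 m2))"
  define l2 where "l2 = (\<lambda>m1 m2. snd (l m1 m2))"
  define s where "s = (\<lambda>G. pexp ?U (\<lambda>(m1, m2). G m1 m2 :: real))"
  have Xnn: "0 \<le> X0 c1 c2 m1 m2" "0 \<le> X1 j c1 c2 m1 m2" "0 \<le> X2 j c1 c2 m1 m2" for j m1 m2
    unfolding X0_def X1_def X2_def by (auto intro!: sum_nonneg mult_nonneg_nonneg pexp_nonneg)
  have sF: "s (F c1 c2) \<le> 5" using cF c12 by (simp add: s_def)
  have snn: "(\<And>m1 m2. 0 \<le> G m1 m2) \<Longrightarrow> 0 \<le> s G" for G unfolding s_def by (rule pexp_nonneg) auto
  have sF_eq: "s (F c1 c2) = s (X0 c1 c2) / cov + s (X1 True c1 c2) / b1 True + s (X1 False c1 c2) / b1 False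
     + s (X2 True c1 c2) / b2 True + s (X2 False c1 c2) / b2 False"
    unfolding s_def F_def case_prod_unfold divide_inverse by (simp only: pexp_add pexp_cmultr)
  have nn: "0 \<le> s (X0 c1 c2) / cov" "0 \<le> s (X1 j c1 c2) / b1 j" "0 \<le> s (X2 j c1 c2) / b2 j" for j
    using cov0 b1(2)[of j] b2(2)[of j] by (auto intro!: divide_nonneg_pos snn Xnn)
  have s': "s (X0 c1 c2) / cov \<le> 5" "s (X1 True c1 c2) / b1 True \<le> 5" "s (X1 False c1 c2) / b1 False \<le> 5"
    "s (X2 True c1 c2) / b2 True \<le> 5" "s (X2 False c1 c2) / b2 False \<le> 5"
    using sF sF_eq nn(1) nn(2)[of True] nn(2)[of False] nn(3)[of True] nn(3)[of False] by linarith+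
  have s0: "s (X0 c1 c2) / cov \<le> 5" and s1: "s (X1 j c1 c2) / b1 j \<le> 5" and s2: "s (X2 j c1 c2) / b2 j \<le> 5" for j
    using s' by (cases j; simp only:)+
  have c0: "s (\<lambda>m1 m2. of_bool (\<not> Gd (c1 (m1, l1 m1 m2)) (c2 (m2, l2 m1 m2)))) \<le> 5 * cov"
  proof -
    have "s (\<lambda>m1 m2. of_bool (\<not> Gd (c1 (m1, l1 m1 m2)) (c2 (m2, l2 m1 m2)))) \<le> s (X0 c1 c2)"
      unfolding s_def X0_def using l(3) by (intro pexp_mono) (auto simp: l1_def l2_def)
    then show ?thesis using s0 cov0 by (simp add: field_simps)
  qed
  have c1: "s (\<lambda>m1 m2. of_bool (Gd (c1 (m1, l1 m1 m2)) (c2 (m2, l2 m1 m2))) *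
          pexp (\<kappa> (c1 (m1, l1 m1 m2)) (c2 (m2, l2 m1 m2)))
            (\<lambda>ou. \<Sum>k\<in>Cand1 j (m1, l1 m1 m2). of_bool (\<tau>1 j (c1 k) (c2 (m2, l2 m1 m2)) ou))) \<le> 5 * b1 j" for j
  proof -
    have "s (\<lambda>m1 m2. of_bool (Gd (c1 (m1, l1 m1 m2)) (c2 (m2, l2 m1 m2))) *
          pexp (\<kappa> (c1 (m1, l1 m1 m2)) (c2 (m2, l2 m1 m2)))
            (\<lambda>ou. \<Sum>k\<in>Cand1 j (m1, l1 m1 m2). of_bool (\<tau>1 j (c1 k) (c2 (m2, l2 m1 m2)) ou))) \<le> s (X1 j c1 c2)"
      unfolding s_def
    proof (rule pexp_mono, clarify)
      fix m1 m2
      define h where "h = (\<lambda>l1 l2. of_bool (Gd (c1 (m1, l1)) (c2 (m2, l2))) *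
        pexp (\<kappa> (c1 (m1, l1)) (c2 (m2, l2))) (\<lambda>ou. \<Sum>k\<in>Cand1 j (m1, l1). of_bool (\<tau>1 j (c1 k) (c2 (m2, l2)) ou)) :: real)"
      have hnn: "0 \<le> h a b" for a b unfolding h_def by (auto intro!: mult_nonneg_nonneg pexp_nonneg sum_nonneg)
      have "h (l1 m1 m2) (l2 m1 m2) \<le> (\<Sum>b<L2. h (l1 m1 m2) b)"
        using hnn l by (intro member_le_sum) (auto simp: l2_def)
      also have "\<dots> \<le> (\<Sum>a<L1. \<Sum>b<L2. h a b)"
        using hnn l member_le_sum[of "l1 m1 m2" "{..<L1}" "\<lambda>a. \<Sum>b<L2. h a b"] by (auto simp: l1_def intro: sum_nonneg)
      finally show "of_bool (Gd (c1 (m1, l1 m1 m2)) (c2 (m2, l2 m1 m2))) *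
          pexp (\<kappa> (c1 (m1, l1 m1 m2)) (c2 (m2, l2 m1 m2)))
            (\<lambda>ou. \<Sum>k\<in>Cand1 j (m1, l1 m1 m2). of_bool (\<tau>1 j (c1 k) (c2 (m2, l2 m1 m2)) ou)) \<le> X1 j c1 c2 m1 m2"
        by (simp only: h_def X1_def)
    qed
    then show ?thesis using s1[of j] b1(2)[of j] by (simp add: field_simps)
  qed
  have c2: "s (\<lambda>m1 m2. of_bool (Gd (c1 (m1, l1 m1 m2)) (c2 (m2, l2 m1 m2))) *
          pexp (\<kappa> (c1 (m1, l1 m1 m2)) (c2 (m2, l2 m1 m2)))
            (\<lambda>ou. \<Sum>k\<in>Cand2 j (m2, l2 m1 m2). of_bool (\<tau>2 j (c2 k) (c1 (m1, l1 m1 m2)) ou))) \<le> 5 * b2 j" for j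
  proof -
    have "s (\<lambda>m1 m2. of_bool (Gd (c1 (m1, l1 m1 m2)) (c2 (m2, l2 m1 m2))) *
          pexp (\<kappa> (c1 (m1, l1 m1 m2)) (c2 (m2, l2 m1 m2)))
            (\<lambda>ou. \<Sum>k\<in>Cand2 j (m2, l2 m1 m2). of_bool (\<tau>2 j (c2 k) (c1 (m1, l1 m1 m2)) ou))) \<le> s (X2 j c1 c2)"
      unfolding s_def
    proof (rule pexp_mono, clarify)
      fix m1 m2
      define h where "h = (\<lambda>l1 l2. of_bool (Gd (c1 (m1, l1)) (c2 (m2, l2))) *
        pexp (\<kappa> (c1 (m1, l1)) (c2 (m2, l2))) (\<lambda>ou. \<Sum>k\<in>Cand2 j (m2, l2). of_bool (\<tau>2 j (c2 k) (c1 (m1, l1)) ou)) :: real)"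
      have hnn: "0 \<le> h a b" for a b unfolding h_def by (auto intro!: mult_nonneg_nonneg pexp_nonneg sum_nonneg)
      have "h (l1 m1 m2) (l2 m1 m2) \<le> (\<Sum>a<L1. h a (l2 m1 m2))"
        using hnn l member_le_sum[of "l1 m1 m2" "{..<L1}" "\<lambda>a. h a (l2 m1 m2)"] by (auto simp: l1_def)
      also have "\<dots> \<le> (\<Sum>b<L2. \<Sum>a<L1. h a b)"
        using hnn l member_le_sum[of "l2 m1 m2" "{..<L2}" "\<lambda>b. \<Sum>a<L1. h a b"] by (auto simp: l2_def intro: sum_nonneg)
      finally show "of_bool (Gd (c1 (m1, l1 m1 m2)) (c2 (m2, l2 m1 m2))) *
          pexp (\<kappa> (c1 (m1, l1 m1 m2)) (c2 (m2, l2 m1 m2)))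
            (\<lambda>ou. \<Sum>k\<in>Cand2 j (m2, l2 m1 m2). of_bool (\<tau>2 j (c2 k) (c1 (m1, l1 m1 m2)) ou)) \<le> X2 j c1 c2 m1 m2"
        by (simp only: h_def X2_def)
    qed
    then show ?thesis using s2[of j] b2(2)[of j] by (simp add: field_simps)
  qed
  show ?thesis
    using sup l(1,2) c0 c1 c2 unfolding s_def I1_def I2_def
    by (intro exI[of _ c1] exI[of _ c2] exI[of _ l1] exI[of _ l2] conjI allI) (auto simp: l1_def l2_def)
qed

subsection \<open>Words and their densities\<close>

text \<open>\<open>ts\<close> is the conditioning word, \<open>cs\<close> the observed word and
  \<open>vs\<close> the codeword. Zipping truncates to the shortest word, which is why the tests
  below check lengths.\<close>

definition wprod :: "('v \<Rightarrow> 'c \<Rightarrow> 't \<Rightarrow> real) \<Rightarrow> 't list \<Rightarrow> 'c list \<Rightarrow> 'v list \<Rightarrow> real" where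
  "wprod f ts cs vs = prod_list (map2 (\<lambda>(t, c) v. f v c t) (zip ts cs) vs)"

lemma wprod_Cons [simp]: "wprod f (t # ts) (c # cs) (v # vs) = f v c t * wprod f ts cs vs"
  by (simp add: wprod_def)

lemma wprod_Nil [simp]: "wprod f [] cs vs = 1" "wprod f ts [] vs = 1" "wprod f ts cs [] = 1"
  by (simp_all add: wprod_def)

lemma wprod_nonneg: "(\<And>v c t. 0 \<le> f v c t) \<Longrightarrow> 0 \<le> wprod f ts cs vs"
proof (induction ts arbitrary: cs vs)
  case (Cons t ts)
  then show ?case by (cases cs; cases vs) auto
qed simp

lemma pexp_wprod_le1:
  assumes "length cs = length ts" "\<And>v c t. 0 \<le> f v c t"
    "\<And>t. t \<in> set ts \<Longrightarrow> finite (set_pmf (K t))"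
    "\<And>t c. t \<in> set ts \<Longrightarrow> pexp (K t) (\<lambda>v. f v c t) \<le> 1"
  shows "pexp (seq_pmf (map K ts)) (wprod f ts cs) \<le> 1"
proof -
  have "map K (map fst (zip ts cs)) = map (\<lambda>x. K (fst x)) (zip ts cs)"
    by (simp only: map_map o_def)
  then have "map K ts = map (\<lambda>x. K (fst x)) (zip ts cs)"
    using assms(1) by simp
  moreover have "pexp (seq_pmf (map (\<lambda>x. K (fst x)) (zip ts cs))) (wprod f ts cs) \<le> 1"
    unfolding wprod_def
    using assms by (intro pexp_seq_prod_le1) (auto dest: set_zip_leftD)
  ultimately show ?thesis by simp
qed

lemma wprod_false_positive:
  assumes "length cs = length ts" "\<And>v c t. 0 \<le> f v c t" "0 < x"
    "\<And>t. t \<in> set ts \<Longrightarrow> finite (set_pmf (K t))"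
    "\<And>t c. t \<in> set ts \<Longrightarrow> pexp (K t) (\<lambda>v. f v c t) \<le> 1"
  shows "pexp (seq_pmf (map K ts)) (\<lambda>vs. of_bool (x \<le> wprod f ts cs vs)) \<le> 1 / x"
proof -
  have "pexp (seq_pmf (map K ts)) (\<lambda>vs. of_bool (x \<le> wprod f ts cs vs)) \<le> pexp (seq_pmf (map K ts)) (wprod f ts cs) / x"
    using assms by (intro pexp_markov wprod_nonneg) auto
  also have "\<dots> \<le> 1 / x"
    using assms by (intro divide_right_mono pexp_wprod_le1) auto
  finally show ?thesis .
qed

lemma log_wprod_map:
  assumes "\<And>x. x \<in> set ws \<Longrightarrow> 0 < f (V x) (C x) (T x)"
  shows "0 < wprod f (map T ws) (map C ws) (map V ws)"
    "log 2 (wprod f (map T ws) (map C ws) (map V ws)) = sum_list (map (\<lambda>x. log 2 (f (V x) (C x) (T x))) ws)"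
proof -
  have "0 < wprod f (map T ws) (map C ws) (map V ws) \<and>
    log 2 (wprod f (map T ws) (map C ws) (map V ws)) = sum_list (map (\<lambda>x. log 2 (f (V x) (C x) (T x))) ws)"
    using assms
  proof (induction ws)
    case (Cons w ws)
    have "0 < f (V w) (C w) (T w)" using Cons.prems by simp
    moreover have "0 < wprod f (map T ws) (map C ws) (map V ws)"
      "log 2 (wprod f (map T ws) (map C ws) (map V ws)) = sum_list (map (\<lambda>x. log 2 (f (V x) (C x) (T x))) ws)"
      using Cons by auto
    ultimately show ?case by (simp add: log_mult)
  qed simp
  then show "0 < wprod f (map T ws) (map C ws) (map V ws)"
    "log 2 (wprod f (map T ws) (map C ws) (map V ws)) = sum_list (map (\<lambda>x. log 2 (f (V x) (C x) (T x))) ws)"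
    by auto
qed

lemma wprod_swap:
  "length cs = length ts \<Longrightarrow> length vs = length ts \<Longrightarrow> wprod f ts cs vs = wprod (\<lambda>c v t. f v c t) ts vs cs"
proof (induction ts arbitrary: cs vs)
  case (Cons t ts)
  then show ?case by (cases cs; cases vs) auto
qed simp

lemma dens_swap: "finite (set_pmf R) \<Longrightarrow> dens R V C T v c t = dens R C V T c v t"
proof -
  assume fin: "finite (set_pmf R)"
  have "pmf (map_pmf (\<lambda>w. (V w, C w, T w)) R) (v, c, t) = pmf (map_pmf (\<lambda>w. (C w, V w, T w)) R) (c, v, t)"
    using fin by (auto simp: pmf_map_eq_pexp intro!: pexp_cong)
  then show ?thesis by (simp add: dens_def mult.commute)
qed

text \<open>The logarithm of the product is a sum of information densities with mean
  \<open>cmi R V C T\<close>. The lower estimate lets true words pass the tests; the upper one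
  limits the change of measure from jointly to independently drawn codewords.\<close>

lemma weak_law_dens:
  assumes fin: "finite (set_pmf R)" and s: "0 < s" and e: "0 < e"
  shows "\<forall>\<^sub>F n in sequentially. pexp (seq_pmf (replicate n R)) (\<lambda>ws. of_bool (\<not>
     (2 powr (real n * (cmi R V C T - s)) \<le> wprod (dens R V C T) (map T ws) (map C ws) (map V ws) \<and>
      wprod (dens R V C T) (map T ws) (map C ws) (map V ws) \<le> 2 powr (real n * (cmi R V C T + s))))) \<le> e"
proof -
  let ?f = "\<lambda>w. log 2 (dens R V C T (V w) (C w) (T w))"
  have "\<forall>\<^sub>F n in sequentially. pexp (seq_pmf (replicate n R))
     (\<lambda>xs. of_bool (\<bar>sum_list (map ?f xs) - real n * pexp R ?f\<bar> \<ge> real n * s)) \<le> e"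
    by (rule weak_law[OF fin s e])
  then show ?thesis
  proof (rule eventually_mono)
    fix n
    assume le: "pexp (seq_pmf (replicate n R)) (\<lambda>xs. of_bool (\<bar>sum_list (map ?f xs) - real n * pexp R ?f\<bar> \<ge> real n * s)) \<le> e"
    have "pexp (seq_pmf (replicate n R)) (\<lambda>ws. of_bool (\<not>
     (2 powr (real n * (cmi R V C T - s)) \<le> wprod (dens R V C T) (map T ws) (map C ws) (map V ws) \<and>
      wprod (dens R V C T) (map T ws) (map C ws) (map V ws) \<le> 2 powr (real n * (cmi R V C T + s)))))
      \<le> pexp (seq_pmf (replicate n R)) (\<lambda>xs. of_bool (\<bar>sum_list (map ?f xs) - real n * pexp R ?f\<bar> \<ge> real n * s))"
    proof (rule pexp_mono)
      fix ws assume "ws \<in> set_pmf (seq_pmf (replicate n R))"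
      then have sup: "\<And>w. w \<in> set ws \<Longrightarrow> w \<in> set_pmf R"
        by (auto simp: set_seq_pmf list_all2_conv_all_nth in_set_conv_nth)
      let ?d = "wprod (dens R V C T) (map T ws) (map C ws) (map V ws)"
      have d: "0 < ?d" "log 2 ?d = sum_list (map ?f ws)"
        using log_wprod_map[of ws "dens R V C T" V C T] dens_pos[OF sup] by auto
      have "\<bar>sum_list (map ?f ws) - real n * pexp R ?f\<bar> \<ge> real n * s"
        if "\<not> (2 powr (real n * (cmi R V C T - s)) \<le> ?d \<and> ?d \<le> 2 powr (real n * (cmi R V C T + s)))"
      proof (rule ccontr)
        assume "\<not> ?thesis"
        then have "\<bar>log 2 ?d - real n * cmi R V C T\<bar> < real n * s"
          by (simp add: d(2) pexp_log_dens[OF fin])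
        then have "real n * (cmi R V C T - s) \<le> log 2 ?d" "log 2 ?d \<le> real n * (cmi R V C T + s)"
          by (auto simp: algebra_simps)
        then show False using that d(1) by (simp add: le_log_iff log_le_iff)
      qed
      then show "of_bool (\<not> (2 powr (real n * (cmi R V C T - s)) \<le> ?d \<and> ?d \<le> 2 powr (real n * (cmi R V C T + s))))
        \<le> (of_bool (\<bar>sum_list (map ?f ws) - real n * pexp R ?f\<bar> \<ge> real n * s) :: real)"
        by simp
    qed
    then show "pexp (seq_pmf (replicate n R)) (\<lambda>ws. of_bool (\<not>
     (2 powr (real n * (cmi R V C T - s)) \<le> wprod (dens R V C T) (map T ws) (map C ws) (map V ws) \<and>
      wprod (dens R V C T) (map T ws) (map C ws) (map V ws) \<le> 2 powr (real n * (cmi R V C T + s))))) \<le> e"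
      using le by simp
  qed
qed

subsection \<open>The superposition letters\<close>

text \<open>\<open>'t\<close> is the cloud letter \<open>(u, x1)\<close>, and \<open>\<kappa>\<close> is the channel with the
  prefix kernel from the auxiliary letters to \<open>x\<close> absorbed.\<close>

locale letters =
  fixes pt :: "'t::finite pmf" and p12 :: "'t \<Rightarrow> ('v1::finite \<times> 'v2::finite) pmf"
    and \<kappa> :: "'t \<times> 'v1 \<times> 'v2 \<Rightarrow> 'o::finite pmf"
    and Yf :: "'o \<Rightarrow> 'y::finite" and Zf :: "'o \<Rightarrow> 'z::finite"
begin

definition "pa = bind_pmf pt (\<lambda>t. map_pmf (Pair t) (p12 t))"
definition "R = bind_pmf pa (\<lambda>a. map_pmf (Pair a) (\<kappa> a))"
definition vT :: "('t \<times> 'v1 \<times> 'v2) \<times> 'o \<Rightarrow> 't" where "vT w = fst (fst w)"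
definition vV1 :: "('t \<times> 'v1 \<times> 'v2) \<times> 'o \<Rightarrow> 'v1" where "vV1 w = fst (snd (fst w))"
definition vV2 :: "('t \<times> 'v1 \<times> 'v2) \<times> 'o \<Rightarrow> 'v2" where "vV2 w = snd (snd (fst w))"
definition vY :: "('t \<times> 'v1 \<times> 'v2) \<times> 'o \<Rightarrow> 'y" where "vY w = Yf (snd w)"
definition vZ :: "('t \<times> 'v1 \<times> 'v2) \<times> 'o \<Rightarrow> 'z" where "vZ w = Zf (snd w)"
definition "p1 t = map_pmf fst (p12 t)"
definition "p2 t = map_pmf snd (p12 t)"
definition "I1 = cmi R vV1 vY vT"
definition "I2 = cmi R vV2 vZ vT"
definition "I12 = cmi R vV1 vV2 vT"
text \<open>What receiver 2 can learn about the first codeword when it is given the second one as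
  well; \<open>J2\<close> is the mirror image.\<close>

definition "J1 = cmi R vV1 (\<lambda>w. (vV2 w, vZ w)) vT"
definition "J2 = cmi R vV2 (\<lambda>w. (vV1 w, vY w)) vT"
definition "leak1 = cmi R vV1 vZ (\<lambda>w. (vT w, vV2 w))"
definition "leak2 = cmi R vV2 vY (\<lambda>w. (vT w, vV1 w))"
text \<open>For letters of positive probability this is the divergence of the law of the Z letter at
  input \<open>a\<close> from its law given only the cloud letter and \<open>v2\<close>. It is kept
  as a function of the letter because leakage is bounded codeword by codeword; its mean is
  \<open>leak1\<close>.\<close>

definition "D1 a = pexp (\<kappa> a) (\<lambda>ou. log 2 (dens R vV1 vZ (\<lambda>w. (vT w, vV2 w)) (fst (snd a)) (Zf ou) (fst a, snd (snd a))))"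
definition "D2 a = pexp (\<kappa> a) (\<lambda>ou. log 2 (dens R vV2 vY (\<lambda>w. (vT w, vV1 w)) (snd (snd a)) (Yf ou) (fst a, fst (snd a))))"

lemma pexp_R: "pexp R f = pexp pt (\<lambda>t. pexp (p12 t) (\<lambda>v. pexp (\<kappa> (t, v)) (\<lambda>ou. f ((t, v), ou))))"
  by (simp add: R_def pa_def pexp_bind pexp_map)

lemma J1_eq: "J1 = I12 + leak1"
proof -
  have "ent R (\<lambda>w. (vZ w, vT w, vV2 w)) = ent R (\<lambda>w. ((vV2 w, vZ w), vT w))"
    "ent R (\<lambda>w. (vT w, vV2 w)) = ent R (\<lambda>w. (vV2 w, vT w))"
    "ent R (\<lambda>w. (vV1 w, vT w, vV2 w)) = ent R (\<lambda>w. (vV1 w, vV2 w, vT w))"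
    "ent R (\<lambda>w. (vV1 w, vZ w, vT w, vV2 w)) = ent R (\<lambda>w. (vV1 w, (vV2 w, vZ w), vT w))"
    by (auto intro!: ent_inj')
  then show ?thesis by (simp add: J1_def I12_def leak1_def cmi_def)
qed

lemma J2_eq: "J2 = I12 + leak2"
proof -
  have "ent R (\<lambda>w. (vY w, vT w, vV1 w)) = ent R (\<lambda>w. ((vV1 w, vY w), vT w))"
    "ent R (\<lambda>w. (vT w, vV1 w)) = ent R (\<lambda>w. (vV1 w, vT w))"
    "ent R (\<lambda>w. (vV2 w, vT w, vV1 w)) = ent R (\<lambda>w. (vV1 w, vV2 w, vT w))"
    "ent R (\<lambda>w. (vV2 w, vY w, vT w, vV1 w)) = ent R (\<lambda>w. (vV2 w, (vV1 w, vY w), vT w))"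
    by (auto intro!: ent_inj')
  then show ?thesis by (simp add: J2_def I12_def leak2_def cmi_def)
qed

lemma pexp_D1: "pexp pa D1 = leak1"
proof -
  have "pexp pa D1 = pexp R (\<lambda>w. log 2 (dens R vV1 vZ (\<lambda>w. (vT w, vV2 w)) (vV1 w) (vZ w) (vT w, vV2 w)))"
    by (simp add: pexp_R pa_def pexp_bind pexp_map D1_def vT_def vV1_def vV2_def vZ_def)
  then show ?thesis by (simp add: pexp_log_dens leak1_def)
qed

lemma pexp_D2: "pexp pa D2 = leak2"
proof -
  have "pexp pa D2 = pexp R (\<lambda>w. log 2 (dens R vV2 vY (\<lambda>w. (vT w, vV1 w)) (vV2 w) (vY w) (vT w, vV1 w)))"
    by (simp add: pexp_R pa_def pexp_bind pexp_map D2_def vT_def vV1_def vV2_def vY_def)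
  then show ?thesis by (simp add: pexp_log_dens leak2_def)
qed

lemma map_fst_R: "map_pmf fst R = pa"
  by (simp add: R_def map_bind_pmf map_pmf_comp map_pmf_const bind_return_pmf')

lemma map_vT: "map_pmf vT R = pt"
proof -
  have "map_pmf vT R = map_pmf fst (map_pmf fst R)" by (simp add: map_pmf_comp vT_def[abs_def])
  also have "\<dots> = pt"
    by (simp add: map_fst_R pa_def map_bind_pmf map_pmf_comp map_pmf_const bind_return_pmf')
  finally show ?thesis .
qed

lemma pmf_V1T: "pmf (map_pmf (\<lambda>w. (vV1 w, vT w)) R) (v, t) = pmf (map_pmf vT R) t * pmf (p1 t) v"
proof -
  have "pmf (map_pmf (\<lambda>w. (vV1 w, vT w)) R) (v, t) = pmf (map_pmf (\<lambda>w. (vT w, vV1 w)) R) (t, v)"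
    by (auto simp: pmf_map_eq_pexp intro!: pexp_cong)
  also have "map_pmf (\<lambda>w. (vT w, vV1 w)) R = bind_pmf pt (\<lambda>t. map_pmf (Pair t) (p1 t))"
    by (simp add: R_def pa_def p1_def map_bind_pmf bind_map_pmf map_pmf_comp vT_def vV1_def map_pmf_const bind_assoc_pmf)
       (simp add: map_pmf_def)
  finally show ?thesis by (simp add: pmf_map_Pair_bind map_vT)
qed

lemma pmf_V2T: "pmf (map_pmf (\<lambda>w. (vV2 w, vT w)) R) (v, t) = pmf (map_pmf vT R) t * pmf (p2 t) v"
proof -
  have "pmf (map_pmf (\<lambda>w. (vV2 w, vT w)) R) (v, t) = pmf (map_pmf (\<lambda>w. (vT w, vV2 w)) R) (t, v)"
    by (auto simp: pmf_map_eq_pexp intro!: pexp_cong)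
  also have "map_pmf (\<lambda>w. (vT w, vV2 w)) R = bind_pmf pt (\<lambda>t. map_pmf (Pair t) (p2 t))"
    by (simp add: R_def pa_def p2_def map_bind_pmf bind_map_pmf map_pmf_comp vT_def vV2_def map_pmf_const bind_assoc_pmf)
       (simp add: map_pmf_def)
  finally show ?thesis by (simp add: pmf_map_Pair_bind map_vT)
qed

lemma pmf_V12T: "pmf (map_pmf (\<lambda>w. (vV1 w, vV2 w, vT w)) R) (v1, v2, t) = pmf pt t * pmf (p12 t) (v1, v2)"
proof -
  have "pmf (map_pmf (\<lambda>w. (vV1 w, vV2 w, vT w)) R) (v1, v2, t) = pmf (map_pmf fst R) (t, v1, v2)"
    by (auto simp: pmf_map_eq_pexp vT_def vV1_def vV2_def intro!: pexp_cong)
  then show ?thesis by (simp add: map_fst_R pa_def pmf_map_Pair_bind)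
qed

lemma pexp_dens_V1: "pexp (p1 t) (\<lambda>v. dens R vV1 C vT v c t) \<le> 1"
  by (rule pexp_dens_le1) (auto simp: pmf_V1T)

lemma pexp_dens_V2: "pexp (p2 t) (\<lambda>v. dens R vV2 C vT v c t) \<le> 1"
  by (rule pexp_dens_le1) (auto simp: pmf_V2T)

text \<open>Change of measure: the joint law of the two private letters is the product of its
  marginals weighted by their density. It transfers typicality under the joint law to codewords
  drawn independently of each other.\<close>

lemma pexp_p12:
  assumes "t \<in> set_pmf pt"
  shows "pexp (p12 t) F = pexp (p1 t) (\<lambda>v1. pexp (p2 t) (\<lambda>v2. dens R vV1 vV2 vT v1 v2 t * F (v1, v2)))"
proof -
  have pt: "pmf pt t > 0" using assms by (simp add: pmf_positive)
  have d: "pmf (p1 t) v1 * (pmf (p2 t) v2 * dens R vV1 vV2 vT v1 v2 t) = pmf (p12 t) (v1, v2)" for v1 v2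
  proof (cases "pmf (p12 t) (v1, v2) = 0")
    case True
    then show ?thesis by (simp add: dens_def pmf_V12T)
  next
    case False
    then have "(v1, v2) \<in> set_pmf (p12 t)" by (simp add: set_pmf_iff)
    then have "v1 \<in> set_pmf (p1 t)" "v2 \<in> set_pmf (p2 t)" by (force simp: p1_def p2_def)+
    then have "pmf (p1 t) v1 \<noteq> 0" "pmf (p2 t) v2 \<noteq> 0" by (auto simp: set_pmf_iff)
    then show ?thesis using pt by (simp add: dens_def pmf_V12T pmf_V1T pmf_V2T map_vT)
  qed
  have "pexp (p12 t) F = (\<Sum>v\<in>UNIV. pmf (p12 t) v * F v)"
    by (rule pexp_superset) auto
  also have "\<dots> = (\<Sum>v1\<in>UNIV. \<Sum>v2\<in>UNIV. pmf (p12 t) (v1, v2) * F (v1, v2))"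
    by (simp add: sum.cartesian_product flip: UNIV_Times_UNIV)
  also have "\<dots> = (\<Sum>v1\<in>UNIV. pmf (p1 t) v1 * (\<Sum>v2\<in>UNIV. pmf (p2 t) v2 * (dens R vV1 vV2 vT v1 v2 t * F (v1, v2))))"
    unfolding sum_distrib_left d[symmetric] by (simp add: mult.assoc)
  also have "\<dots> = pexp (p1 t) (\<lambda>v1. pexp (p2 t) (\<lambda>v2. dens R vV1 vV2 vT v1 v2 t * F (v1, v2)))"
    by (simp add: pexp_superset[of UNIV])
  finally show ?thesis .
qed

lemma pexp_seq_p12:
  assumes "set ts \<subseteq> set_pmf pt"
  shows "pexp (seq_pmf (map p12 ts)) F = pexp (seq_pmf (map p1 ts)) (\<lambda>v1s. pexp (seq_pmf (map p2 ts))
     (\<lambda>v2s. wprod (dens R vV1 vV2 vT) ts v2s v1s * F (zip v1s v2s)))"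
  using assms
proof (induction ts arbitrary: F)
  case (Cons t ts)
  let ?d = "dens R vV1 vV2 vT"
  have "pexp (seq_pmf (map p12 (t # ts))) F = pexp (p12 t) (\<lambda>v. pexp (seq_pmf (map p12 ts)) (\<lambda>vs. F (v # vs)))"
    by (subst list.map, subst pexp_seq_Cons) auto
  also have "\<dots> = pexp (p12 t) (\<lambda>v. pexp (seq_pmf (map p1 ts)) (\<lambda>v1s. pexp (seq_pmf (map p2 ts))
     (\<lambda>v2s. wprod ?d ts v2s v1s * F (v # zip v1s v2s))))"
    using Cons by simp
  also have "\<dots> = pexp (p1 t) (\<lambda>v1. pexp (p2 t) (\<lambda>v2. pexp (seq_pmf (map p1 ts)) (\<lambda>v1s. pexp (seq_pmf (map p2 ts))
     (\<lambda>v2s. ?d v1 v2 t * (wprod ?d ts v2s v1s * F ((v1, v2) # zip v1s v2s))))))"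
    using Cons.prems by (subst pexp_p12) (auto simp: pexp_cmult)
  also have "\<dots> = pexp (p1 t) (\<lambda>v1. pexp (seq_pmf (map p1 ts)) (\<lambda>v1s. pexp (p2 t) (\<lambda>v2. pexp (seq_pmf (map p2 ts))
     (\<lambda>v2s. ?d v1 v2 t * (wprod ?d ts v2s v1s * F ((v1, v2) # zip v1s v2s))))))"
    by (intro pexp_cong pexp_commute)
  also have "\<dots> = pexp (seq_pmf (map p1 (t # ts))) (\<lambda>v1s. pexp (seq_pmf (map p2 (t # ts)))
     (\<lambda>v2s. wprod ?d (t # ts) v2s v1s * F (zip v1s v2s)))"
  proof -
    have A: "pexp (seq_pmf (map p1 (t # ts))) G = pexp (p1 t) (\<lambda>v. pexp (seq_pmf (map p1 ts)) (\<lambda>vs. G (v # vs)))" for G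
      unfolding list.map by (rule pexp_seq_Cons) auto
    have B: "pexp (seq_pmf (map p2 (t # ts))) G = pexp (p2 t) (\<lambda>v. pexp (seq_pmf (map p2 ts)) (\<lambda>vs. G (v # vs)))" for G
      unfolding list.map by (rule pexp_seq_Cons) auto
    show ?thesis unfolding A B by (simp add: mult.assoc)
  qed
  finally show ?case .
qed simp

lemma map2_replicate_unit: "length ys = n \<Longrightarrow> map2 (\<lambda>_. g) (replicate n ()) ys = map g ys"
  by (induction ys arbitrary: n) auto

lemma seq_R: "seq_pmf (replicate n R) = bind_pmf (seq_pmf (replicate n pt)) (\<lambda>ts.
    bind_pmf (seq_pmf (map p12 ts)) (\<lambda>vs. map_pmf (zip (zip ts vs)) (seq_pmf (map \<kappa> (zip ts vs)))))"
proof -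
  let ?G = "\<lambda>t. bind_pmf (p12 t) (\<lambda>v. map_pmf (Pair (t, v)) (\<kappa> (t, v)))"
  have R: "R = bind_pmf pt ?G"
    by (simp add: R_def pa_def bind_assoc_pmf bind_map_pmf)
  have "seq_pmf (replicate n R) = seq_pmf (map (\<lambda>_. bind_pmf pt ?G) (replicate n ()))"
    by (simp add: R map_replicate)
  also have "\<dots> = bind_pmf (seq_pmf (map (\<lambda>_. pt) (replicate n ()))) (\<lambda>ts. seq_pmf (map2 (\<lambda>_. ?G) (replicate n ()) ts))"
    by (rule seq_pmf_bind)
  also have "\<dots> = bind_pmf (seq_pmf (replicate n pt)) (\<lambda>ts. seq_pmf (map ?G ts))"
    by (intro bind_pmf_cong) (auto simp: map_replicate dest!: length_seq_pmf intro!: arg_cong[where f=seq_pmf] map2_replicate_unit)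
  also have "\<dots> = bind_pmf (seq_pmf (replicate n pt)) (\<lambda>ts.
    bind_pmf (seq_pmf (map p12 ts)) (\<lambda>vs. map_pmf (zip (zip ts vs)) (seq_pmf (map \<kappa> (zip ts vs)))))"
  proof (intro bind_pmf_cong refl)
    fix ts
    have "map_pmf (map2 Pair as) (seq_pmf (map \<kappa> as)) = map_pmf (zip as) (seq_pmf (map \<kappa> as))" for as
      by (intro map_pmf_cong) auto
    then show "seq_pmf (map ?G ts) = bind_pmf (seq_pmf (map p12 ts)) (\<lambda>vs. map_pmf (zip (zip ts vs)) (seq_pmf (map \<kappa> (zip ts vs))))"
      unfolding seq_pmf_bind by (simp add: case_prod_unfold seq_pmf_map)
  qed
  finally show ?thesis .
qed

lemma pexp_seq_R: "pexp (seq_pmf (replicate n R)) F = pexp (seq_pmf (replicate n pt)) (\<lambda>ts.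
    pexp (seq_pmf (map p12 ts)) (\<lambda>vs. pexp (seq_pmf (map \<kappa> (zip ts vs))) (\<lambda>os. F (zip (zip ts vs) os))))"
  by (simp add: seq_R pexp_bind pexp_map)

end

subsection \<open>Equivocation of a wiretap code\<close>

text \<open>H(S|Z) \<ge> H(S|Z,K2) = H(M,Z) - H(Z,K2) - H(K1|S,Z,K2), because (K1,S,Z,K2) and (M,Z)
  determine each other. Expanding the first two terms gives H(M) - H(K2) minus the leakage H(Z|K2) -
  H(Z|M).\<close>

lemma secrecy_core:
  assumes fin: "finite (set_pmf P)"
    and dep: "\<And>w. w \<in> set_pmf P \<Longrightarrow> K2 w = k2 (M w)" "\<And>w. w \<in> set_pmf P \<Longrightarrow> K1 w = k1 (M w)"
      "\<And>w. w \<in> set_pmf P \<Longrightarrow> S w = sf (K1 w)" "\<And>w. w \<in> set_pmf P \<Longrightarrow> M w = mf (K1 w) (K2 w)"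
    and leak: "cond_ent P Z K2 \<le> cond_ent P Z M + leak"
    and amb: "cond_ent P K1 (\<lambda>w. (S w, Z w, K2 w)) \<le> amb"
  shows "ent P M - ent P K2 - leak - amb \<le> cond_ent P S Z"
proof -
  have "cond_ent P S (\<lambda>w. (Z w, K2 w)) \<le> cond_ent P S Z"
    by (rule cond_ent_reduce[OF fin, where g=fst]) simp
  moreover have "ent P (\<lambda>w. (K1 w, S w, Z w, K2 w)) = ent P (\<lambda>w. (Z w, M w))"
  proof (rule ent_inj'[OF fin])
    fix a b assume ab: "a \<in> set_pmf P" "b \<in> set_pmf P"
    show "(K1 a, S a, Z a, K2 a) = (K1 b, S b, Z b, K2 b) \<longleftrightarrow> (Z a, M a) = (Z b, M b)"
      using dep(1)[OF ab(1)] dep(1)[OF ab(2)] dep(2)[OF ab(1)] dep(2)[OF ab(2)] dep(3)[OF ab(1)] dep(3)[OF ab(2)]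
        dep(4)[OF ab(1)] dep(4)[OF ab(2)] by (metis Pair_inject)
  qed
  ultimately show ?thesis
    using leak amb unfolding cond_ent_def by linarith
qed

lemma pexp_seq_sum:
  assumes "\<And>x. x \<in> set xs \<Longrightarrow> finite (set_pmf (f x))"
  shows "pexp (seq_pmf (map f xs)) (\<lambda>ys. sum_list (map2 g xs ys)) = sum_list (map (\<lambda>x. pexp (f x) (g x)) xs)"
  using assms
proof (induction xs)
  case (Cons x xs)
  have fin: "finite (set_pmf (f x))" "finite (set_pmf (seq_pmf (map f xs)))"
    using Cons.prems by (auto intro!: finite_set_seq_pmf)
  have "pexp (seq_pmf (map f (x # xs))) (\<lambda>ys. sum_list (map2 g (x # xs) ys))
    = pexp (f x) (\<lambda>y. pexp (seq_pmf (map f xs)) (\<lambda>ys. g x y + sum_list (map2 g xs ys)))"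
    unfolding list.map using Cons.prems by (subst pexp_seq_Cons) auto
  also have "\<dots> = sum_list (map (\<lambda>x. pexp (f x) (g x)) (x # xs))"
    using fin Cons by (simp add: pexp_add pexp_const)
  finally show ?case .
qed simp

lemma sum_lists_prod_le1:
  fixes q :: "'b \<Rightarrow> 'z::finite \<Rightarrow> real"
  assumes q: "\<And>b z. 0 \<le> q b z" "\<And>b. (\<Sum>z\<in>UNIV. q b z) \<le> 1"
  shows "(\<Sum>zs\<in>{zs. length zs = length bs}. prod_list (map2 q bs zs)) \<le> 1"
proof (induction bs)
  case (Cons b bs)
  have nn: "0 \<le> prod_list (map2 q bs zs)" for bs zs
    by (rule prod_list_nonneg) (auto simp: q)
  have im: "{zs :: 'z list. length zs = length (b # bs)} = (\<lambda>(z, zs). z # zs) ` (UNIV \<times> {zs. length zs = length bs})"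
    by (auto simp: length_Suc_conv image_iff)
  have "(\<Sum>zs\<in>{zs. length zs = length (b # bs)}. prod_list (map2 q (b # bs) zs))
    = (\<Sum>(z, zs)\<in>UNIV \<times> {zs. length zs = length bs}. q b z * prod_list (map2 q bs zs))"
    unfolding im by (subst sum.reindex) (auto simp: inj_on_def case_prod_unfold)
  also have "\<dots> = (\<Sum>z\<in>UNIV. q b z * (\<Sum>zs\<in>{zs. length zs = length bs}. prod_list (map2 q bs zs)))"
    by (simp add: sum.cartesian_product[symmetric] sum_distrib_left)
  also have "\<dots> \<le> (\<Sum>z\<in>UNIV. q b z * 1)"
    using Cons q by (intro sum_mono mult_left_mono) auto
  also have "\<dots> \<le> 1" using q by simp
  finally show ?case .
qed simp

lemma card_lists_length: "card {zs :: 'z::finite list. length zs = n} = CARD('z) ^ n"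
  using card_lists_length_eq[of "UNIV :: 'z set" n] by simp

lemma finite_lists_length: "finite {zs :: 'z::finite list. length zs = n}"
  using finite_lists_length_eq[of "UNIV :: 'z set" n] by simp

lemma log_prod_list_map2:
  assumes "length bs = length zs" "\<And>b z. (b, z) \<in> set (zip bs zs) \<Longrightarrow> 0 < (q b z :: real)"
  shows "0 < prod_list (map2 q bs zs)"
    "log 2 (prod_list (map2 q bs zs)) = sum_list (map2 (\<lambda>b z. log 2 (q b z)) bs zs)"
proof -
  have "0 < prod_list (map2 q bs zs) \<and> log 2 (prod_list (map2 q bs zs)) = sum_list (map2 (\<lambda>b z. log 2 (q b z)) bs zs)"
    using assms
  proof (induction bs zs rule: list_induct2)
    case (Cons b bs z zs)
    have "0 < q b z" using Cons.prems by simp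
    moreover have "0 < prod_list (map2 q bs zs) \<and> log 2 (prod_list (map2 q bs zs)) = sum_list (map2 (\<lambda>b z. log 2 (q b z)) bs zs)"
      using Cons by simp
    ultimately show ?case by (simp add: log_mult)
  qed simp
  then show "0 < prod_list (map2 q bs zs)"
    "log 2 (prod_list (map2 q bs zs)) = sum_list (map2 (\<lambda>b z. log 2 (q b z)) bs zs)" by auto
qed

text \<open>Mixing the reference channel \<open>q\<close> with the uniform distribution bounds the contribution
  of the atypical codewords.\<close>

lemma leak_bound:
  fixes Q :: "'m pmf" and kz :: "'b \<times> 'v \<Rightarrow> 'z::finite pmf" and q :: "'b \<Rightarrow> 'z \<Rightarrow> real"
  assumes fin: "finite (set_pmf Q)"
    and len: "\<And>m. m \<in> set_pmf Q \<Longrightarrow> length (bw m) = n" "\<And>m. m \<in> set_pmf Q \<Longrightarrow> length (vw m) = n"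
    and bw: "\<And>m. m \<in> set_pmf Q \<Longrightarrow> bw m = bw' (K2 m)"
    and q: "\<And>b z. 0 \<le> q b z" "\<And>b. (\<Sum>z\<in>UNIV. q b z) \<le> 1"
    and gpos: "\<And>m b v z. m \<in> set_pmf Q \<Longrightarrow> good m \<Longrightarrow> (b, v) \<in> set (zip (bw m) (vw m)) \<Longrightarrow> z \<in> set_pmf (kz (b, v)) \<Longrightarrow> 0 < q b z"
    and gsum: "\<And>m. m \<in> set_pmf Q \<Longrightarrow> good m \<Longrightarrow>
      sum_list (map (\<lambda>(b, v). pexp (kz (b, v)) (\<lambda>z. log 2 (pmf (kz (b, v)) z / q b z))) (zip (bw m) (vw m))) \<le> Dn"
    and Dn: "0 \<le> Dn"
  defines "P \<equiv> bind_pmf Q (\<lambda>m. map_pmf (Pair m) (seq_pmf (map kz (zip (bw m) (vw m)))))"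
  shows "cond_ent P snd (\<lambda>w. K2 (fst w)) \<le> cond_ent P snd fst + (1 + Dn + pexp Q (\<lambda>m. of_bool (\<not> good m)) * (real n * log 2 (CARD('z))))"
proof -
  let ?A = "\<lambda>m. zip (bw m) (vw m)"
  have finP: "finite (set_pmf P)" unfolding P_def using fin by auto
  define lz where "lz = real n * log 2 (CARD('z))"
  have lz0: "0 \<le> lz" by (simp add: lz_def)
  define u where "u = 1 / real (CARD('z) ^ n)"
  have u: "0 < u" "- log 2 u = lz"
    by (auto simp: u_def lz_def log_divide log_nat_power)
  define q' where "q' = (\<lambda>zs k. if length zs = n then prod_list (map2 q (bw' k) zs) / 2 + u / 2 else 0)"
  have pl: "0 \<le> prod_list (map2 q bs zs)" for bs zs
    by (rule prod_list_nonneg) (auto simp: q)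
  have zlen: "length zs = n" if "m \<in> set_pmf Q" "zs \<in> set_pmf (seq_pmf (map kz (?A m)))" for m zs
    using length_seq_pmf[OF that(2)] len that(1) by simp
  have "cond_ent P snd (\<lambda>w. K2 (fst w)) \<le> pexp P (\<lambda>w. - log 2 (q' (snd w) (K2 (fst w))))"
  proof (rule cond_ent_le_cross[OF finP, where q=q' and A=snd and B="\<lambda>w. K2 (fst w)"])
    fix w assume "w \<in> set_pmf P"
    then obtain m zs where "w = (m, zs)" "m \<in> set_pmf Q" "zs \<in> set_pmf (seq_pmf (map kz (?A m)))"
      unfolding P_def by auto
    then show "0 < q' (snd w) (K2 (fst w))"
      using zlen[of m zs] u pl[of "bw' (K2 m)" zs] by (simp add: q'_def add_nonneg_pos)
  next
    fix b assume "b \<in> (\<lambda>w. K2 (fst w)) ` set_pmf P"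
    then obtain m where m: "m \<in> set_pmf Q" "b = K2 m" unfolding P_def by auto
    have lb: "length (bw' b) = n" using bw[OF m(1)] len(1)[OF m(1)] m(2) by simp
    have "(\<Sum>a\<in>snd ` set_pmf P. q' a b) \<le> (\<Sum>a\<in>{zs. length zs = n}. q' a b)"
    proof (rule sum_mono2[OF finite_lists_length])
      show "snd ` set_pmf P \<subseteq> {zs. length zs = n}" unfolding P_def using zlen by auto
    qed (use u pl in \<open>auto simp: q'_def intro: add_nonneg_nonneg\<close>)
    also have "\<dots> = (\<Sum>a\<in>{zs. length zs = length (bw' b)}. prod_list (map2 q (bw' b) a)) / 2 + (\<Sum>a\<in>{zs :: 'z list. length zs = n}. u / 2)"
      unfolding lb by (simp add: q'_def sum.distrib sum_divide_distrib)
    also have "\<dots> \<le> 1 / 2 + 1 / 2"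
      using sum_lists_prod_le1[of q "bw' b"] q by (intro add_mono) (auto simp: card_lists_length u_def)
    finally show "(\<Sum>a\<in>snd ` set_pmf P. q' a b) \<le> 1" by simp
  qed (use u pl in \<open>auto simp: q'_def intro: add_nonneg_nonneg\<close>)
  also have "\<dots> = pexp Q (\<lambda>m. pexp (seq_pmf (map kz (?A m))) (\<lambda>zs. - log 2 (q' zs (K2 m))))"
    unfolding P_def using fin by (subst pexp_bind) (auto simp: pexp_map)
  also have "\<dots> \<le> pexp Q (\<lambda>m. ent (seq_pmf (map kz (?A m))) (map (\<lambda>z. z)) + ((1 + Dn) + of_bool (\<not> good m) * lz))"
  proof (rule pexp_mono)
    fix m assume m: "m \<in> set_pmf Q"
    let ?S = "seq_pmf (map kz (?A m))"
    have entS: "ent ?S (map (\<lambda>z. z)) = sum_list (map (\<lambda>a. ent (kz a) (\<lambda>z. z)) (?A m))"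
      by (subst ent_seq_map) (auto simp: o_def)
    show "pexp ?S (\<lambda>zs. - log 2 (q' zs (K2 m))) \<le> ent ?S (map (\<lambda>z. z)) + ((1 + Dn) + of_bool (\<not> good m) * lz)"
    proof (cases "good m")
      case False
      have "pexp ?S (\<lambda>zs. - log 2 (q' zs (K2 m))) \<le> 1 + lz"
      proof (rule pexp_le_const)
        fix zs assume zs: "zs \<in> set_pmf ?S"
        have "log 2 (u / 2) \<le> log 2 (q' zs (K2 m))"
          using zlen[OF m zs] u pl[of "bw' (K2 m)" zs] by (intro log_mono) (auto simp: q'_def)
        then show "- log 2 (q' zs (K2 m)) \<le> 1 + lz"
          using u by (simp add: log_divide)
      qed simp
      moreover have "0 \<le> ent ?S (map (\<lambda>z. z))" by (rule ent_nonneg) simp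
      ultimately show ?thesis using False Dn by simp
    next
      case True
      \<comment> \<open>On good codewords only the reference half of the mixture is used, at the
        price of one bit.\<close>
      have "pexp ?S (\<lambda>zs. - log 2 (q' zs (K2 m))) \<le> pexp ?S (\<lambda>zs. 1 + sum_list (map2 (\<lambda>a z. - log 2 (q (fst a) z)) (?A m) zs))"
      proof (rule pexp_mono)
        fix zs assume zs: "zs \<in> set_pmf ?S"
        have l: "length (bw m) = length zs" using zlen[OF m zs] len(1)[OF m] by simp
        have pos: "0 < q b z" if bz: "(b, z) \<in> set (zip (bw m) zs)" for b z
        proof -
          obtain i where i: "i < length (bw m)" "i < length zs" "b = bw m ! i" "z = zs ! i"
            using bz by (auto simp: set_zip)
          have "(b, vw m ! i) \<in> set (zip (bw m) (vw m))"
            using i len m by (auto simp: set_zip)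
          moreover have "z \<in> set_pmf (kz (b, vw m ! i))"
            using zs i len[OF m] by (auto simp: set_seq_pmf list_all2_conv_all_nth)
          ultimately show ?thesis using gpos[OF m True] by blast
        qed
        note lp = log_prod_list_map2[of "bw m" zs q, OF l pos]
        have eq: "sum_list (map2 (\<lambda>a z. - log 2 (q (fst a) z)) (?A m) zs) = - sum_list (map2 (\<lambda>b z. log 2 (q b z)) (bw m) zs)"
        proof -
          have "map2 (\<lambda>a z. - log 2 (q (fst a) z)) (?A m) zs = map2 (\<lambda>b z. - log 2 (q b z)) (bw m) zs"
            using len[OF m] l by (intro nth_equalityI) auto
          then show ?thesis by (simp add: uminus_sum_list_map case_prod_unfold o_def)
        qed
        have "log 2 (prod_list (map2 q (bw m) zs) / 2) \<le> log 2 (q' zs (K2 m))"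
          using zlen[OF m zs] u lp(1) bw[OF m] by (intro log_mono) (auto simp: q'_def)
        then have "log 2 (prod_list (map2 q (bw m) zs)) - 1 \<le> log 2 (q' zs (K2 m))"
          using lp(1) by (simp add: log_divide)
        then show "- log 2 (q' zs (K2 m)) \<le> 1 + sum_list (map2 (\<lambda>a z. - log 2 (q (fst a) z)) (?A m) zs)"
          unfolding eq using lp(2) by linarith
      qed
      also have "\<dots> = 1 + sum_list (map (\<lambda>a. pexp (kz a) (\<lambda>z. - log 2 (q (fst a) z))) (?A m))"
        by (subst pexp_add) (simp add: pexp_const pexp_seq_sum)
      \<comment> \<open>Letter by letter, cross entropy is entropy plus divergence; along a good
        codeword the divergences sum to at most \<open>Dn\<close>.\<close>
      also have "sum_list (map (\<lambda>a. pexp (kz a) (\<lambda>z. - log 2 (q (fst a) z))) (?A m))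
        = sum_list (map (\<lambda>a. ent (kz a) (\<lambda>z. z) + pexp (kz a) (\<lambda>z. log 2 (pmf (kz a) z / q (fst a) z))) (?A m))"
      proof (intro arg_cong[where f=sum_list] map_cong refl)
        fix a assume a: "a \<in> set (?A m)"
        have "ent (kz a) (\<lambda>z. z) + pexp (kz a) (\<lambda>z. log 2 (pmf (kz a) z / q (fst a) z))
          = pexp (kz a) (\<lambda>z. - log 2 (pmf (kz a) z) + log 2 (pmf (kz a) z / q (fst a) z))"
          unfolding pexp_add by (simp add: ent_pexp map_pmf_ident)
        also have "\<dots> = pexp (kz a) (\<lambda>z. - log 2 (q (fst a) z))"
        proof (rule pexp_cong)
          fix z assume z: "z \<in> set_pmf (kz a)"
          have "0 < q (fst a) z" using gpos[OF m True, of "fst a" "snd a" z] a z by simp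
          then show "- log 2 (pmf (kz a) z) + log 2 (pmf (kz a) z / q (fst a) z) = - log 2 (q (fst a) z)"
            using z by (simp add: log_divide set_pmf_iff)
        qed
        finally show "pexp (kz a) (\<lambda>z. - log 2 (q (fst a) z))
          = ent (kz a) (\<lambda>z. z) + pexp (kz a) (\<lambda>z. log 2 (pmf (kz a) z / q (fst a) z))" by simp
      qed
      also have "\<dots> = ent ?S (map (\<lambda>z. z)) + sum_list (map (\<lambda>a. pexp (kz a) (\<lambda>z. log 2 (pmf (kz a) z / q (fst a) z))) (?A m))"
        unfolding entS by (rule sum_list_addf)
      also have "sum_list (map (\<lambda>a. pexp (kz a) (\<lambda>z. log 2 (pmf (kz a) z / q (fst a) z))) (?A m)) \<le> Dn"
        using gsum[OF m True] by (simp add: case_prod_unfold)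
      finally show ?thesis using True by simp
    qed
  qed
  also have "\<dots> = cond_ent P snd fst + (1 + Dn + pexp Q (\<lambda>m. of_bool (\<not> good m)) * lz)"
  proof -
    have "cond_ent P snd fst = cond_ent P (\<lambda>(m, zs). map (\<lambda>z. z) zs) (\<lambda>(m, zs). (m, ()))"
      using finP by (intro cond_ent_inj') auto
    also have "\<dots> = pexp Q (\<lambda>m. cond_ent (seq_pmf (map kz (?A m))) (map (\<lambda>z. z)) (\<lambda>_. ()))"
      unfolding P_def using fin by (intro cond_ent_mixture) auto
    also have "\<dots> = pexp Q (\<lambda>m. ent (seq_pmf (map kz (?A m))) (map (\<lambda>z. z)))"
      by (simp add: ent_eq_cond_ent)
    finally show ?thesis
      using fin by (simp only: pexp_add pexp_const pexp_cmultr)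
  qed
  finally show ?thesis by (simp add: lz_def)
qed

text \<open>Wrong candidates in the list are false alarms, so \<open>cond_ent_list_bound\<close>
  applies with their mean number. \<open>W\<close> marks the messages with a good codeword pair.
  False alarms are counted only there; a message outside \<open>W\<close> and a missed true
  candidate contribute \<open>\<delta>\<close> each.\<close>

lemma list_from_fp:
  fixes U :: "'m pmf" and ks :: "'m \<Rightarrow> 'o pmf"
  assumes fin: "finite (set_pmf U)" "\<And>m. finite (set_pmf (ks m))"
    and S: "finite S" "\<And>m. m \<in> set_pmf U \<Longrightarrow> K m \<in> S"
    and C: "\<And>m ou. m \<in> set_pmf U \<Longrightarrow> {k\<in>S. k \<noteq> K m \<and> k \<in> L (B m ou)} \<subseteq> {k\<in>C (K m). \<tau> m k ou}"
      "\<And>m. m \<in> set_pmf U \<Longrightarrow> finite (C (K m))"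
    and fp: "pexp U (\<lambda>m. of_bool (W m) * pexp (ks m) (\<lambda>ou. \<Sum>k\<in>C (K m). of_bool (\<tau> m k ou))) \<le> 2 powr c" "0 \<le> c"
    and miss: "pexp U (\<lambda>m. of_bool (\<not> W m)) \<le> \<delta>"
      "\<And>m. m \<in> set_pmf U \<Longrightarrow> W m \<Longrightarrow> pexp (ks m) (\<lambda>ou. of_bool (K m \<notin> L (B m ou))) \<le> \<delta>"
  shows "cond_ent (bind_pmf U (\<lambda>m. map_pmf (Pair m) (ks m))) (\<lambda>w. K (fst w)) (\<lambda>w. B (fst w) (snd w))
    \<le> c + 3 + 2 * \<delta> * log 2 (card S)"
proof -
  let ?P = "bind_pmf U (\<lambda>m. map_pmf (Pair m) (ks m))"
  have finP: "finite (set_pmf ?P)" using fin by auto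
  have P: "pexp ?P F = pexp U (\<lambda>m. pexp (ks m) (\<lambda>ou. F (m, ou)))" for F
    using fin by (simp add: pexp_bind pexp_map)
  have "set_pmf U \<noteq> {}" by (rule set_pmf_not_empty)
  then have cS: "card S > 0" using S by (auto simp: card_gt_0_iff)
  have d0: "0 \<le> \<delta>" using miss(1) pexp_nonneg[of U "\<lambda>m. of_bool (\<not> W m)"] by simp
  have "cond_ent ?P (\<lambda>w. K (fst w)) (\<lambda>w. B (fst w) (snd w))
    \<le> c + 3 + pexp ?P (\<lambda>w. of_bool (\<not> (W (fst w) \<and> K (fst w) \<in> L (B (fst w) (snd w))))) * log 2 (card S)"
  proof (rule cond_ent_list_bound[OF finP S(1) _ fp(2), where W="\<lambda>w. W (fst w)"])
    have "pexp ?P (\<lambda>w. of_bool (W (fst w)) * real (card {k \<in> S. k \<noteq> K (fst w) \<and> k \<in> L (B (fst w) (snd w))}))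
       = pexp U (\<lambda>m. of_bool (W m) * pexp (ks m) (\<lambda>ou. real (card {k \<in> S. k \<noteq> K m \<and> k \<in> L (B m ou)})))"
      by (simp add: P pexp_cmult)
    also have "\<dots> \<le> pexp U (\<lambda>m. of_bool (W m) * pexp (ks m) (\<lambda>ou. \<Sum>k\<in>C (K m). of_bool (\<tau> m k ou)))"
    proof (intro pexp_mono mult_left_mono)
      fix m ou assume m: "m \<in> set_pmf U"
      have "card {k \<in> S. k \<noteq> K m \<and> k \<in> L (B m ou)} \<le> card {k\<in>C (K m). \<tau> m k ou}"
        using C(2)[OF m] by (intro card_mono C(1)[OF m]) auto
      also have "real (card {k\<in>C (K m). \<tau> m k ou}) = (\<Sum>k\<in>C (K m). of_bool (\<tau> m k ou))"
        using C(2)[OF m] by (simp add: Int_def)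
      finally show "real (card {k \<in> S. k \<noteq> K m \<and> k \<in> L (B m ou)}) \<le> (\<Sum>k\<in>C (K m). of_bool (\<tau> m k ou))"
        by simp
    qed simp
    finally show "pexp ?P (\<lambda>w. of_bool (W (fst w)) * real (card {k \<in> S. k \<noteq> K (fst w) \<and> k \<in> L (B (fst w) (snd w))})) \<le> 2 powr c"
      using fp(1) by linarith
  qed (use S in auto)
  also have "pexp ?P (\<lambda>w. of_bool (\<not> (W (fst w) \<and> K (fst w) \<in> L (B (fst w) (snd w))))) \<le> 2 * \<delta>"
  proof -
    have "pexp ?P (\<lambda>w. of_bool (\<not> (W (fst w) \<and> K (fst w) \<in> L (B (fst w) (snd w))))) \<le> pexp U (\<lambda>m. of_bool (\<not> W m) + \<delta>)"
      unfolding P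
    proof (rule pexp_mono)
      fix m assume m: "m \<in> set_pmf U"
      show "pexp (ks m) (\<lambda>ou. of_bool (\<not> (W (fst (m, ou)) \<and> K (fst (m, ou)) \<in> L (B (fst (m, ou)) (snd (m, ou)))))) \<le> of_bool (\<not> W m) + \<delta>"
        using miss(2)[OF m] d0 fin(2)[of m] by (cases "W m") (auto simp: pexp_const)
    qed
    also have "\<dots> \<le> 2 * \<delta>" using miss(1) fin by (simp add: pexp_add pexp_const)
    finally show ?thesis .
  qed
  finally show ?thesis using cS by (simp add: mult_right_mono)
qed

text \<open>A wrong choice needs a message outside \<open>W\<close>, a missed true candidate or a
  false alarm, and each contributes at most \<open>\<delta>\<close>.\<close>

lemma decode_from_fp:
  fixes U :: "'m pmf" and ks :: "'m \<Rightarrow> 'o pmf"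
  assumes fin: "finite (set_pmf U)" "\<And>m. finite (set_pmf (ks m))"
    and S: "finite S" "\<And>m. m \<in> set_pmf U \<Longrightarrow> K m \<in> S"
    and C: "\<And>m ou. m \<in> set_pmf U \<Longrightarrow> {k\<in>S. k \<noteq> K m \<and> k \<in> L (B m ou)} \<subseteq> {k\<in>C (K m). \<tau> m k ou}"
      "\<And>m. m \<in> set_pmf U \<Longrightarrow> finite (C (K m))"
    and fp: "pexp U (\<lambda>m. of_bool (W m) * pexp (ks m) (\<lambda>ou. \<Sum>k\<in>C (K m). of_bool (\<tau> m k ou))) \<le> \<delta>"
    and miss: "pexp U (\<lambda>m. of_bool (\<not> W m)) \<le> \<delta>"
      "\<And>m. m \<in> set_pmf U \<Longrightarrow> W m \<Longrightarrow> pexp (ks m) (\<lambda>ou. of_bool (K m \<notin> L (B m ou))) \<le> \<delta>"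
  shows "pexp (bind_pmf U (\<lambda>m. map_pmf (Pair m) (ks m))) (\<lambda>x. of_bool ((SOME k. k \<in> S \<and> k \<in> L (B (fst x) (snd x))) \<noteq> K (fst x)))
    \<le> 3 * \<delta>"
proof -
  have d0: "0 \<le> \<delta>" using miss(1) pexp_nonneg[of U "\<lambda>m. of_bool (\<not> W m)"] by simp
  let ?wrong = "\<lambda>m ou. (SOME k. k \<in> S \<and> k \<in> L (B m ou)) \<noteq> K m"
  have "pexp (bind_pmf U (\<lambda>m. map_pmf (Pair m) (ks m))) (\<lambda>x. of_bool (?wrong (fst x) (snd x)))
    = pexp U (\<lambda>m. pexp (ks m) (\<lambda>ou. of_bool (?wrong m ou)))"
    using fin by (simp add: pexp_bind pexp_map)
  also have "\<dots> \<le> pexp U (\<lambda>m. of_bool (\<not> W m) + \<delta> + of_bool (W m) * pexp (ks m) (\<lambda>ou. \<Sum>k\<in>C (K m). of_bool (\<tau> m k ou)))"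
  proof (rule pexp_mono)
    fix m assume m: "m \<in> set_pmf U"
    show "pexp (ks m) (\<lambda>ou. of_bool (?wrong m ou)) \<le> of_bool (\<not> W m) + \<delta> + of_bool (W m) * pexp (ks m) (\<lambda>ou. \<Sum>k\<in>C (K m). of_bool (\<tau> m k ou))"
    proof (cases "W m")
      case False
      have "pexp (ks m) (\<lambda>ou. of_bool (?wrong m ou) :: real) \<le> 1" using fin(2) by (intro pexp_le_const) auto
      then show ?thesis using False d0 by simp
    next
      case True
      have "pexp (ks m) (\<lambda>ou. of_bool (?wrong m ou)) \<le> pexp (ks m) (\<lambda>ou. of_bool (K m \<notin> L (B m ou)) + (\<Sum>k\<in>C (K m). of_bool (\<tau> m k ou)))"
      proof (rule pexp_mono)
        fix ou
        show "of_bool (?wrong m ou) \<le> of_bool (K m \<notin> L (B m ou)) + (\<Sum>k\<in>C (K m). of_bool (\<tau> m k ou) :: real)"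
        proof (cases "K m \<in> L (B m ou) \<and> ?wrong m ou")
          case False
          moreover have "0 \<le> (\<Sum>k\<in>C (K m). of_bool (\<tau> m k ou) :: real)" by (rule sum_nonneg) simp
          ultimately show ?thesis by auto
        next
          case w: True
          let ?k = "SOME k. k \<in> S \<and> k \<in> L (B m ou)"
          have "?k \<in> S \<and> ?k \<in> L (B m ou)"
            using w S(2)[OF m] by (intro someI[of "\<lambda>k. k \<in> S \<and> k \<in> L (B m ou)" "K m"]) auto
          then have "?k \<in> C (K m)" "\<tau> m ?k ou" using C(1)[OF m, of ou] w by blast+
          then have "1 \<le> (\<Sum>k\<in>C (K m). of_bool (\<tau> m k ou) :: real)"
            using C(2)[OF m] member_le_sum[of ?k "C (K m)" "\<lambda>k. of_bool (\<tau> m k ou) :: real"] by simp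
          then show ?thesis using w by simp
        qed
      qed
      then show ?thesis using True miss(2)[OF m True] by (simp add: pexp_add)
    qed
  qed
  also have "\<dots> \<le> 3 * \<delta>" using miss(1) fp fin by (simp add: pexp_add pexp_const)
  finally show ?thesis .
qed

text \<open>An input letter \<open>a\<close> consists of a part \<open>bf a\<close>, which the
  observer is given, and a part \<open>vf a\<close>; \<open>mk\<close> recombines them. With the law
  of the output letter given \<open>bf a\<close> as reference channel, the divergence in
  \<open>leak_bound\<close> becomes the mean log density.\<close>

lemma leak_letters:
  fixes pa :: "'a pmf" and \<kappa> :: "'a \<Rightarrow> 'o pmf" and Of :: "'o \<Rightarrow> 'z::finite" and U :: "'m pmf"
  assumes fin: "finite (set_pmf pa)" "\<And>a. finite (set_pmf (\<kappa> a))" "finite (set_pmf U)"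
    and mk: "\<And>a. mk (bf a) (vf a) = a"
    and len: "\<And>m. m \<in> set_pmf U \<Longrightarrow> length (aw m) = n"
    and bw: "\<And>m. m \<in> set_pmf U \<Longrightarrow> map bf (aw m) = bw' (K2 m)"
    and good: "\<And>m. m \<in> set_pmf U \<Longrightarrow> good m \<Longrightarrow> set (aw m) \<subseteq> set_pmf pa"
      "\<And>m. m \<in> set_pmf U \<Longrightarrow> good m \<Longrightarrow> sum_list (map (\<lambda>a. pexp (\<kappa> a) (\<lambda>ou. log 2
         (dens (bind_pmf pa (\<lambda>a. map_pmf (Pair a) (\<kappa> a))) (\<lambda>w. vf (fst w)) (\<lambda>w. Of (snd w)) (\<lambda>w. bf (fst w))
            (vf a) (Of ou) (bf a)))) (aw m)) \<le> Dn"
    and Dn: "0 \<le> Dn"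
  defines "P \<equiv> bind_pmf U (\<lambda>m. map_pmf (Pair m) (seq_pmf (map \<kappa> (aw m))))"
  shows "cond_ent P (\<lambda>w. map Of (snd w)) (\<lambda>w. K2 (fst w)) \<le> cond_ent P (\<lambda>w. map Of (snd w)) fst
    + (1 + Dn + pexp U (\<lambda>m. of_bool (\<not> good m)) * (real n * log 2 (CARD('z))))"
proof -
  define R where "R = bind_pmf pa (\<lambda>a. map_pmf (Pair a) (\<kappa> a))"
  have finR: "finite (set_pmf R)" unfolding R_def using fin by auto
  let ?V = "\<lambda>w :: 'a \<times> 'o. vf (fst w)" and ?Z = "\<lambda>w :: 'a \<times> 'o. Of (snd w)" and ?B = "\<lambda>w :: 'a \<times> 'o. bf (fst w)"
  define kz where "kz = (\<lambda>(b, v). map_pmf Of (\<kappa> (mk b v)))"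
  define q where "q = (\<lambda>b z. pmf (map_pmf (\<lambda>w. (?Z w, ?B w)) R) (z, b) / pmf (map_pmf ?B R) b)"
  have kz: "kz (bf a, vf a) = map_pmf Of (\<kappa> a)" for a by (simp add: kz_def mk)
  have inj: "vf a = vf a' \<Longrightarrow> bf a = bf a' \<Longrightarrow> a = a'" for a a' using mk by metis
  have azb: "pmf (map_pmf (\<lambda>w. (?V w, ?Z w, ?B w)) R) (vf a, z, bf a) = pmf pa a * pmf (kz (bf a, vf a)) z" for a z
  proof -
    have "pmf (map_pmf (\<lambda>w. (?V w, ?Z w, ?B w)) R) (vf a, z, bf a) = pmf (map_pmf (\<lambda>w. (fst w, ?Z w)) R) (a, z)"
      using finR by (auto simp: pmf_map_eq_pexp intro!: pexp_cong dest: inj)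
    also have "map_pmf (\<lambda>w. (fst w, ?Z w)) R = bind_pmf pa (\<lambda>a. map_pmf (Pair a) (map_pmf Of (\<kappa> a)))"
      by (simp add: R_def map_bind_pmf map_pmf_comp)
    finally show ?thesis by (simp add: pmf_map_Pair_bind kz)
  qed
  have ab: "pmf (map_pmf (\<lambda>w. (?V w, ?B w)) R) (vf a, bf a) = pmf pa a" for a
  proof -
    have "pmf (map_pmf (\<lambda>w. (?V w, ?B w)) R) (vf a, bf a) = pmf (map_pmf fst R) a"
      using finR by (auto simp: pmf_map_eq_pexp intro!: pexp_cong dest: inj)
    also have "map_pmf fst R = pa"
      by (simp add: R_def map_bind_pmf map_pmf_comp map_pmf_const bind_return_pmf')
    finally show ?thesis .
  qed
  have d: "dens R ?V ?Z ?B (vf a) z (bf a) = pmf (kz (bf a, vf a)) z / q (bf a) z" if "a \<in> set_pmf pa" for a z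
    using that by (simp add: dens_def azb ab q_def set_pmf_iff)
  have qpos: "0 < q (bf a) z" if a: "a \<in> set_pmf pa" "z \<in> set_pmf (kz (bf a, vf a))" for a z
  proof -
    obtain ou where ou: "ou \<in> set_pmf (\<kappa> a)" "z = Of ou" using a by (auto simp: kz)
    then have "(a, ou) \<in> set_pmf R" using a by (auto simp: R_def)
    then show ?thesis
      using pmf_map_pos[of "(a, ou)" R "\<lambda>w. (?Z w, ?B w)"] pmf_map_pos[of "(a, ou)" R ?B] ou by (simp add: q_def)
  qed
  have aws: "zip (map bf (aw m)) (map vf (aw m)) = map (\<lambda>a. (bf a, vf a)) (aw m)" for m
    by (simp add: zip_map_map zip_same_conv_map)
  let ?P = "bind_pmf U (\<lambda>m. map_pmf (Pair m) (seq_pmf (map kz (zip (map bf (aw m)) (map vf (aw m))))))"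
  have P: "map_pmf (\<lambda>w. (fst w, map Of (snd w))) P = ?P"
  proof -
    have "seq_pmf (map kz (zip (map bf (aw m)) (map vf (aw m)))) = map_pmf (map Of) (seq_pmf (map \<kappa> (aw m)))" for m
      by (simp add: aws o_def kz seq_pmf_map')
    then show ?thesis by (simp add: P_def map_bind_pmf map_pmf_comp)
  qed
  have "cond_ent ?P snd (\<lambda>w. K2 (fst w)) \<le> cond_ent ?P snd fst
    + (1 + Dn + pexp U (\<lambda>m. of_bool (\<not> good m)) * (real n * log 2 (CARD('z))))"
  proof (rule leak_bound[where q=q and bw'=bw' and bw="\<lambda>m. map bf (aw m)" and vw="\<lambda>m. map vf (aw m)", OF fin(3) _ _ bw])
    show "(\<Sum>z\<in>UNIV. q b z) \<le> 1" for b
      using sum_pmf_pair[OF finR, of UNIV ?Z ?B b] pmf_nonneg[of "map_pmf ?B R" b]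
      by (auto simp: q_def sum_divide_distrib[symmetric] divide_le_eq_1 less_le simp del: pmf_nonneg)
  next
    fix m b v z assume m: "m \<in> set_pmf U" "good m" "(b, v) \<in> set (zip (map bf (aw m)) (map vf (aw m)))" "z \<in> set_pmf (kz (b, v))"
    then obtain a where "a \<in> set (aw m)" "b = bf a" "v = vf a" by (auto simp: aws)
    then show "0 < q b z" using qpos[of a z] good(1)[OF m(1,2)] m(4) by auto
  next
    fix m assume m: "m \<in> set_pmf U" "good m"
    have "map (\<lambda>(b, v). pexp (kz (b, v)) (\<lambda>z. log 2 (pmf (kz (b, v)) z / q b z))) (zip (map bf (aw m)) (map vf (aw m)))
      = map (\<lambda>a. pexp (\<kappa> a) (\<lambda>ou. log 2 (dens R ?V ?Z ?B (vf a) (Of ou) (bf a)))) (aw m)"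
      unfolding aws map_map o_def
    proof (intro map_cong refl)
      fix a assume "a \<in> set (aw m)"
      then have a: "a \<in> set_pmf pa" using good(1)[OF m] by auto
      have "(case (bf a, vf a) of (b, v) \<Rightarrow> pexp (kz (b, v)) (\<lambda>z. log 2 (pmf (kz (b, v)) z / q b z)))
        = pexp (map_pmf Of (\<kappa> a)) (\<lambda>z. log 2 (dens R ?V ?Z ?B (vf a) z (bf a)))"
        by (simp add: d[OF a] kz)
      then show "(case (bf a, vf a) of (b, v) \<Rightarrow> pexp (kz (b, v)) (\<lambda>z. log 2 (pmf (kz (b, v)) z / q b z)))
        = pexp (\<kappa> a) (\<lambda>ou. log 2 (dens R ?V ?Z ?B (vf a) (Of ou) (bf a)))"
        by (simp add: pexp_map fin)
    qed
    then show "sum_list (map (\<lambda>(b, v). pexp (kz (b, v)) (\<lambda>z. log 2 (pmf (kz (b, v)) z / q b z))) (zip (map bf (aw m)) (map vf (aw m)))) \<le> Dn"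
      using good(2)[OF m] by (simp add: R_def)
  qed (use len Dn in \<open>auto simp: q_def\<close>)
  then show ?thesis
    unfolding P[symmetric] cond_ent_map by simp
qed

section \<open>Typicality tests, and cloud words over which most codeword pairs are good\<close>

context letters
begin

text \<open>\<open>tau1\<close>, \<open>tau2\<close> are the tests of the intended receivers; \<open>tau3\<close>, \<open>tau4\<close> are those of the other
  receiver when it is given the secret part and the other codeword and lists the remaining candidates.
  The encoder may choose the pairs in \<open>Gd\<close>; a cloud word is \<open>nice\<close> if at least half of the mass lies there.\<close>

definition "tau1 s ts v1s ys \<longleftrightarrow> length ys = length ts \<and>
  2 powr (real (length ts) * (I1 - s)) \<le> wprod (dens R vV1 vY vT) ts ys v1s"
definition "tau2 s ts v2s zs \<longleftrightarrow> length zs = length ts \<and>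
  2 powr (real (length ts) * (I2 - s)) \<le> wprod (dens R vV2 vZ vT) ts zs v2s"
definition "tau3 s ts v1s v2s zs \<longleftrightarrow> length zs = length ts \<and> length v2s = length ts \<and>
  2 powr (real (length ts) * (J1 - s)) \<le> wprod (dens R vV1 (\<lambda>w. (vV2 w, vZ w)) vT) ts (zip v2s zs) v1s"
definition "tau4 s ts v2s v1s ys \<longleftrightarrow> length ys = length ts \<and> length v1s = length ts \<and>
  2 powr (real (length ts) * (J2 - s)) \<le> wprod (dens R vV2 (\<lambda>w. (vV1 w, vY w)) vT) ts (zip v1s ys) v2s"
definition "fails bad s ts v1s v2s os \<longleftrightarrow> bad ts os \<or> \<not> tau1 s ts v1s (map Yf os) \<or> \<not> tau2 s ts v2s (map Zf os) \<or>
  \<not> tau3 s ts v1s v2s (map Zf os) \<or> \<not> tau4 s ts v2s v1s (map Yf os)"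
text \<open>The lower bound on the density makes a good partner of a fixed codeword rare, the upper
  bound makes good pairs frequent enough for covering. The sums of \<open>D1\<close> and
  \<open>D2\<close> bound the leakage along the pair, and the support condition keeps the densities
  positive there.\<close>

definition "pairok s ts v1s v2s \<longleftrightarrow> length v1s = length ts \<and> length v2s = length ts \<and>
  set (zip ts (zip v1s v2s)) \<subseteq> set_pmf pa \<and>
  2 powr (real (length ts) * (I12 - s)) \<le> wprod (dens R vV1 vV2 vT) ts v2s v1s \<and>
  wprod (dens R vV1 vV2 vT) ts v2s v1s \<le> 2 powr (real (length ts) * (I12 + s)) \<and>
  sum_list (map D1 (zip ts (zip v1s v2s))) \<le> real (length ts) * (leak1 + s) \<and>
  sum_list (map D2 (zip ts (zip v1s v2s))) \<le> real (length ts) * (leak2 + s)"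
definition "Gd bad s \<delta> ts v1s v2s \<longleftrightarrow> pairok s ts v1s v2s \<and>
  pexp (seq_pmf (map \<kappa> (zip ts (zip v1s v2s)))) (\<lambda>os. of_bool (fails bad s ts v1s v2s os)) \<le> \<delta>"
definition "nice bad s \<delta> ts \<longleftrightarrow>
  1 / 2 \<le> pexp (seq_pmf (map p12 ts)) (\<lambda>vs. of_bool (Gd bad s \<delta> ts (map fst vs) (map snd vs)))"

definition "typical s V C I ws \<longleftrightarrow>
  2 powr (real (length ws) * (I - s)) \<le> wprod (dens R V C vT) (map vT ws) (map C ws) (map V ws) \<and>
  wprod (dens R V C vT) (map vT ws) (map C ws) (map V ws) \<le> 2 powr (real (length ws) * (I + s))"

text \<open>For jointly drawn letters the weak law makes each failure rare. Two Markov steps turn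
  this into a statement on cloud words: a pair that is not good either fails as a pair or fails with
  conditional probability above \<open>\<delta>\<close>, and a cloud word that is not
  \<open>nice\<close> has more than half of its mass on such pairs.\<close>

lemma nice_eventually:
  assumes bad: "\<And>e. 0 < e \<Longrightarrow> \<forall>\<^sub>F n in sequentially.
      pexp (seq_pmf (replicate n R)) (\<lambda>ws. of_bool (bad (map vT ws) (map snd ws))) \<le> e"
    and s: "0 < s" and \<delta>: "0 < \<delta>" "\<delta> \<le> 1" and e: "0 < e"
  shows "\<forall>\<^sub>F n in sequentially. pexp (seq_pmf (replicate n pt)) (\<lambda>ts. of_bool (\<not> nice bad s \<delta> ts)) \<le> e"
proof -
  \<comment> \<open>Of the eight failures three concern the pair alone, and five depend on the
    output and are paid for with a factor \<open>1 / \<delta>\<close>. As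
    \<open>\<delta> \<le> 1\<close>, the total is at most \<open>8 * e' / \<delta> = e / 2\<close>;
    the one half in \<open>nice\<close> doubles it.\<close>
  define e' where "e' = e * \<delta> / 16"
  have e': "0 < e'" using e \<delta> by (simp add: e'_def)
  have two_ev: "\<forall>\<^sub>F n in sequentially. pexp (seq_pmf (replicate n R)) (\<lambda>ws. of_bool (\<not> typical s V C (cmi R V C vT) ws)) \<le> e'" for V :: "_ \<Rightarrow> 'vv" and C :: "_ \<Rightarrow> 'cc"
  proof -
    have "\<forall>\<^sub>F n in sequentially. pexp (seq_pmf (replicate n R)) (\<lambda>ws. of_bool (\<not>
     (2 powr (real n * (cmi R V C vT - s)) \<le> wprod (dens R V C vT) (map vT ws) (map C ws) (map V ws) \<and>
      wprod (dens R V C vT) (map vT ws) (map C ws) (map V ws) \<le> 2 powr (real n * (cmi R V C vT + s))))) \<le> e'"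
      using s e' by (intro weak_law_dens) auto
    then show ?thesis
    proof (rule eventually_mono)
      fix n
      assume "pexp (seq_pmf (replicate n R)) (\<lambda>ws. of_bool (\<not>
     (2 powr (real n * (cmi R V C vT - s)) \<le> wprod (dens R V C vT) (map vT ws) (map C ws) (map V ws) \<and>
      wprod (dens R V C vT) (map vT ws) (map C ws) (map V ws) \<le> 2 powr (real n * (cmi R V C vT + s))))) \<le> e'"
      then show "pexp (seq_pmf (replicate n R)) (\<lambda>ws. of_bool (\<not> typical s V C (cmi R V C vT) ws)) \<le> e'"
        by (subst pexp_cong) (auto simp: typical_def dest: length_seq_pmf)
    qed
  qed
  define dev where "dev = (\<lambda>D (l::real) ws. \<bar>sum_list (map (\<lambda>w :: ('t \<times> 'v1 \<times> 'v2) \<times> 'o. D (fst w)) ws) - real (length ws) * l\<bar> \<ge> real (length ws) * s)"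
  have dev_ev: "\<forall>\<^sub>F n in sequentially. pexp (seq_pmf (replicate n R)) (\<lambda>ws. of_bool (dev D (pexp pa D) ws)) \<le> e'" for D
  proof -
    have "\<forall>\<^sub>F n in sequentially. pexp (seq_pmf (replicate n R)) (\<lambda>ws. of_bool
       (\<bar>sum_list (map (\<lambda>w. D (fst w)) ws) - real n * pexp R (\<lambda>w. D (fst w))\<bar> \<ge> real n * s)) \<le> e'"
      using s e' by (intro weak_law) auto
    moreover have "pexp R (\<lambda>w. D (fst w)) = pexp pa D"
      by (simp add: map_fst_R[symmetric] pexp_map)
    ultimately have "\<forall>\<^sub>F n in sequentially. pexp (seq_pmf (replicate n R)) (\<lambda>ws. of_bool
       (\<bar>sum_list (map (\<lambda>w. D (fst w)) ws) - real n * pexp pa D\<bar> \<ge> real n * s)) \<le> e'" by simp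
    then show ?thesis
    proof (rule eventually_mono)
      fix n
      assume "pexp (seq_pmf (replicate n R)) (\<lambda>ws. of_bool
       (\<bar>sum_list (map (\<lambda>w. D (fst w)) ws) - real n * pexp pa D\<bar> \<ge> real n * s)) \<le> e'"
      then show "pexp (seq_pmf (replicate n R)) (\<lambda>ws. of_bool (dev D (pexp pa D) ws)) \<le> e'"
        by (subst pexp_cong) (auto simp: dev_def dest: length_seq_pmf)
    qed
  qed
  define Fb where "Fb = (\<lambda>ws. of_bool (bad (map vT ws) (map snd ws)) + of_bool (\<not> typical s vV1 vY I1 ws) + of_bool (\<not> typical s vV2 vZ I2 ws)
     + of_bool (\<not> typical s vV1 (\<lambda>w. (vV2 w, vZ w)) J1 ws) + of_bool (\<not> typical s vV2 (\<lambda>w. (vV1 w, vY w)) J2 ws) :: real)"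
  define Fw where "Fw = (\<lambda>ws. of_bool (\<not> typical s vV1 vV2 I12 ws) + of_bool (dev D1 leak1 ws) + of_bool (dev D2 leak2 ws) + Fb ws * (1 / \<delta>))"
  have Fb0: "0 \<le> Fb ws" for ws by (simp add: Fb_def)
  have pointwise: "of_bool (\<not> Gd bad s \<delta> ts (map fst vs) (map snd vs)) \<le> pexp (seq_pmf (map \<kappa> (zip ts vs))) (\<lambda>os. Fw (zip (zip ts vs) os))"
    if ts: "ts \<in> set_pmf (seq_pmf (replicate n pt))" and vs: "vs \<in> set_pmf (seq_pmf (map p12 ts))" for n ts vs
  proof (cases "Gd bad s \<delta> ts (map fst vs) (map snd vs)")
    case True
    then show ?thesis using Fb0 \<delta> by (auto simp: Fw_def intro!: pexp_nonneg add_nonneg_nonneg divide_nonneg_pos)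
  next
    case False
    let ?S = "seq_pmf (map \<kappa> (zip ts vs))"
    have lv: "length vs = length ts" using length_seq_pmf[OF vs] by simp
    have zv: "zip (map fst vs) (map snd vs) = vs" by (rule zip_map_fst_snd)
    have maps: "map vT ws = ts" "map vV1 ws = map fst vs" "map vV2 ws = map snd vs" "map vY ws = map Yf os"
       "map vZ ws = map Zf os" "map snd ws = os" "length ws = length ts" "map (\<lambda>w. D (fst w)) ws = map D (zip ts vs)"
       "map (\<lambda>w. (vV2 w, vZ w)) ws = zip (map snd vs) (map Zf os)" "map (\<lambda>w. (vV1 w, vY w)) ws = zip (map fst vs) (map Yf os)"
      if "ws = zip (zip ts vs) os" "os \<in> set_pmf ?S" for ws os and D :: "_ \<Rightarrow> real"
    proof -
      have lo: "length os = length ts" using length_seq_pmf[OF that(2)] lv by simp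
      show "map vT ws = ts" "map vV1 ws = map fst vs" "map vV2 ws = map snd vs" "map vY ws = map Yf os"
       "map vZ ws = map Zf os" "map snd ws = os" "length ws = length ts" "map (\<lambda>w. D (fst w)) ws = map D (zip ts vs)"
       "map (\<lambda>w. (vV2 w, vZ w)) ws = zip (map snd vs) (map Zf os)" "map (\<lambda>w. (vV1 w, vY w)) ws = zip (map fst vs) (map Yf os)"
        unfolding that(1) using lo lv
        by (auto intro!: nth_equalityI simp: vT_def vV1_def vV2_def vY_def vZ_def)
    qed
    have sup: "set (zip ts vs) \<subseteq> set_pmf pa"
    proof
      fix a assume "a \<in> set (zip ts vs)"
      then obtain i where i: "i < length ts" "i < length vs" "a = (ts ! i, vs ! i)" by (auto simp: set_zip)
      have "ts ! i \<in> set_pmf pt" "vs ! i \<in> set_pmf (p12 (ts ! i))"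
        using ts vs i by (auto simp: set_seq_pmf list_all2_conv_all_nth)
      then show "a \<in> set_pmf pa" unfolding i(3) pa_def set_bind_pmf set_map_pmf by blast
    qed
    have ge1: "1 \<le> pexp ?S (\<lambda>os. Fw (zip (zip ts vs) os))" if "\<And>os. os \<in> set_pmf ?S \<Longrightarrow> 1 \<le> Fw (zip (zip ts vs) os)"
      using that by (intro pexp_ge_const) auto
    have "1 \<le> pexp ?S (\<lambda>os. Fw (zip (zip ts vs) os))"
    proof (cases "pairok s ts (map fst vs) (map snd vs)")
      case nok: False
      show ?thesis
      proof (rule ge1)
        fix os assume os: "os \<in> set_pmf ?S"
        let ?ws = "zip (zip ts vs) os"
        have "\<not> typical s vV1 vV2 I12 ?ws \<or> dev D1 leak1 ?ws \<or> dev D2 leak2 ?ws"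
        proof (rule ccontr)
          assume c: "\<not> ?thesis"
          have "sum_list (map D1 (zip ts vs)) \<le> real (length ts) * (leak1 + s)" "sum_list (map D2 (zip ts vs)) \<le> real (length ts) * (leak2 + s)"
            using c maps(7,8)[OF refl os] unfolding dev_def by (auto simp: algebra_simps)
          then have "pairok s ts (map fst vs) (map snd vs)"
            using c sup lv maps[OF refl os] unfolding pairok_def typical_def zv by auto
          then show False using nok by simp
        qed
        then show "1 \<le> Fw ?ws" using Fb0[of ?ws] \<delta> by (auto simp: Fw_def add_nonneg_nonneg)
      qed
    next
      case True
      then have "\<delta> < pexp ?S (\<lambda>os. of_bool (fails bad s ts (map fst vs) (map snd vs) os))"
        using False by (simp add: Gd_def zv)
      also have "\<dots> \<le> pexp ?S (\<lambda>os. Fb (zip (zip ts vs) os))"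
      proof (rule pexp_mono)
        fix os assume os: "os \<in> set_pmf ?S"
        have lo: "length os = length ts" using length_seq_pmf[OF os] lv by simp
        show "of_bool (fails bad s ts (map fst vs) (map snd vs) os) \<le> Fb (zip (zip ts vs) os)"
          using maps[OF refl os] lo lv
          unfolding Fb_def fails_def tau1_def tau2_def tau3_def tau4_def typical_def
          by (auto simp: of_bool_def)
      qed
      finally have "1 \<le> pexp ?S (\<lambda>os. Fb (zip (zip ts vs) os)) * (1 / \<delta>)"
        using \<delta> by simp
      also have "\<dots> = pexp ?S (\<lambda>os. Fb (zip (zip ts vs) os) * (1 / \<delta>))"
        by (simp only: pexp_cmultr)
      also have "\<dots> \<le> pexp ?S (\<lambda>os. Fw (zip (zip ts vs) os))"
        by (intro pexp_mono) (simp add: Fw_def)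
      finally show ?thesis .
    qed
    then show ?thesis using False by simp
  qed
  have "\<forall>\<^sub>F n in sequentially.
     pexp (seq_pmf (replicate n R)) (\<lambda>ws. of_bool (bad (map vT ws) (map snd ws))) \<le> e' \<and>
     pexp (seq_pmf (replicate n R)) (\<lambda>ws. of_bool (\<not> typical s vV1 vY I1 ws)) \<le> e' \<and>
     pexp (seq_pmf (replicate n R)) (\<lambda>ws. of_bool (\<not> typical s vV2 vZ I2 ws)) \<le> e' \<and>
     pexp (seq_pmf (replicate n R)) (\<lambda>ws. of_bool (\<not> typical s vV1 (\<lambda>w. (vV2 w, vZ w)) J1 ws)) \<le> e' \<and>
     pexp (seq_pmf (replicate n R)) (\<lambda>ws. of_bool (\<not> typical s vV2 (\<lambda>w. (vV1 w, vY w)) J2 ws)) \<le> e' \<and>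
     pexp (seq_pmf (replicate n R)) (\<lambda>ws. of_bool (\<not> typical s vV1 vV2 I12 ws)) \<le> e' \<and>
     pexp (seq_pmf (replicate n R)) (\<lambda>ws. of_bool (dev D1 leak1 ws)) \<le> e' \<and>
     pexp (seq_pmf (replicate n R)) (\<lambda>ws. of_bool (dev D2 leak2 ws)) \<le> e'"
    by (intro eventually_conj bad[OF e'] two_ev[of vV1 vY, folded I1_def] two_ev[of vV2 vZ, folded I2_def]
      two_ev[of vV1 "\<lambda>w. (vV2 w, vZ w)", folded J1_def] two_ev[of vV2 "\<lambda>w. (vV1 w, vY w)", folded J2_def]
      two_ev[of vV1 vV2, folded I12_def] dev_ev[of D1, unfolded pexp_D1] dev_ev[of D2, unfolded pexp_D2])
  then show ?thesis
  proof (rule eventually_mono)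
    fix n
    let ?RN = "seq_pmf (replicate n R)"
    assume ev: "pexp ?RN (\<lambda>ws. of_bool (bad (map vT ws) (map snd ws))) \<le> e' \<and>
     pexp ?RN (\<lambda>ws. of_bool (\<not> typical s vV1 vY I1 ws)) \<le> e' \<and>
     pexp ?RN (\<lambda>ws. of_bool (\<not> typical s vV2 vZ I2 ws)) \<le> e' \<and>
     pexp ?RN (\<lambda>ws. of_bool (\<not> typical s vV1 (\<lambda>w. (vV2 w, vZ w)) J1 ws)) \<le> e' \<and>
     pexp ?RN (\<lambda>ws. of_bool (\<not> typical s vV2 (\<lambda>w. (vV1 w, vY w)) J2 ws)) \<le> e' \<and>
     pexp ?RN (\<lambda>ws. of_bool (\<not> typical s vV1 vV2 I12 ws)) \<le> e' \<and>
     pexp ?RN (\<lambda>ws. of_bool (dev D1 leak1 ws)) \<le> e' \<and>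
     pexp ?RN (\<lambda>ws. of_bool (dev D2 leak2 ws)) \<le> e'"
    have "pexp ?RN Fb \<le> 5 * e'"
      unfolding Fb_def pexp_add using ev by linarith
    then have "pexp ?RN Fb * (1 / \<delta>) \<le> 5 * e' * (1 / \<delta>)" using \<delta> by (intro mult_right_mono) auto
    then have "pexp ?RN Fw \<le> 3 * e' + 5 * e' * (1 / \<delta>)"
      unfolding Fw_def pexp_add pexp_cmultr using ev by linarith
    also have "3 * e' \<le> 3 * e' * (1 / \<delta>)" using e' \<delta> by (simp add: field_simps)
    finally have Fw: "pexp ?RN Fw \<le> e / 2" using \<delta> by (simp add: e'_def)
    have "pexp (seq_pmf (replicate n pt)) (\<lambda>ts. of_bool (\<not> nice bad s \<delta> ts)) \<le>
      pexp (seq_pmf (replicate n pt)) (\<lambda>ts. 2 * pexp (seq_pmf (map p12 ts)) (\<lambda>vs. of_bool (\<not> Gd bad s \<delta> ts (map fst vs) (map snd vs))))"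
    proof (rule pexp_mono)
      fix ts
      have "pexp (seq_pmf (map p12 ts)) (\<lambda>vs. of_bool (\<not> Gd bad s \<delta> ts (map fst vs) (map snd vs)))
        = 1 - pexp (seq_pmf (map p12 ts)) (\<lambda>vs. of_bool (Gd bad s \<delta> ts (map fst vs) (map snd vs)))"
        by (rule pexp_of_bool_compl) simp
      moreover have "0 \<le> pexp (seq_pmf (map p12 ts)) (\<lambda>vs. of_bool (\<not> Gd bad s \<delta> ts (map fst vs) (map snd vs)) :: real)"
        by (rule pexp_nonneg) simp
      ultimately show "of_bool (\<not> nice bad s \<delta> ts) \<le> 2 * pexp (seq_pmf (map p12 ts)) (\<lambda>vs. of_bool (\<not> Gd bad s \<delta> ts (map fst vs) (map snd vs)))"
        by (auto simp: nice_def)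
    qed
    also have "\<dots> \<le> pexp (seq_pmf (replicate n pt)) (\<lambda>ts. 2 * pexp (seq_pmf (map p12 ts)) (\<lambda>vs. pexp (seq_pmf (map \<kappa> (zip ts vs))) (\<lambda>os. Fw (zip (zip ts vs) os))))"
      using pointwise by (intro pexp_mono mult_left_mono) auto
    also have "\<dots> = 2 * pexp ?RN Fw"
      by (simp only: pexp_cmult pexp_seq_R)
    also have "\<dots> \<le> e" using Fw by simp
    finally show "pexp (seq_pmf (replicate n pt)) (\<lambda>ts. of_bool (\<not> nice bad s \<delta> ts)) \<le> e" .
  qed
qed

end

lemma ent_uniform: "finite S \<Longrightarrow> S \<noteq> {} \<Longrightarrow> ent (pmf_of_set S) (\<lambda>x. x) = log 2 (card S)"
  by (subst ent_pexp) (auto simp: map_pmf_ident pexp_pmf_of_set log_divide card_gt_0_iff)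

section \<open>The private code over one fixed cloud word\<close>

context letters
begin

definition msgs :: "nat \<Rightarrow> nat \<Rightarrow> nat \<Rightarrow> nat \<Rightarrow> ((nat \<times> nat) \<times> (nat \<times> nat)) pmf" where
  "msgs A1 Q1 A2 Q2 = pair_pmf (pmf_of_set ({..<A1} \<times> {..<Q1})) (pmf_of_set ({..<A2} \<times> {..<Q2}))"
definition "blaw U ts en = bind_pmf U (\<lambda>m. map_pmf (Pair m) (seq_pmf (map \<kappa> (zip ts (en m)))))"

text \<open>A private code for a fixed cloud word \<open>ts\<close>. In a message \<open>((a1, q1), (a2, q2))\<close>
  the components \<open>a1\<close>, \<open>a2\<close> are to be kept secret; \<open>q1\<close>, \<open>q2\<close> are revealed to
  the other receiver by the channel.\<close>

definition "good_code bad \<epsilon> c A1 Q1 A2 Q2 ts en de1 de2 \<longleftrightarrow>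
  (\<forall>m. length (en m) = length ts) \<and>
  (let P = blaw (msgs A1 Q1 A2 Q2) ts en in
   pexp P (\<lambda>w. of_bool (bad ts (snd w))) \<le> \<epsilon> \<and>
   pexp P (\<lambda>w. of_bool (de1 (map Yf (snd w)) \<noteq> fst (fst w))) \<le> \<epsilon> \<and>
   pexp P (\<lambda>w. of_bool (de2 (map Zf (snd w)) \<noteq> snd (fst w))) \<le> \<epsilon> \<and>
   log 2 (real A1) - c \<le> cond_ent P (\<lambda>w. fst (fst (fst w))) (\<lambda>w. map Zf (snd w)) \<and>
   cond_ent P (\<lambda>w. fst (fst w)) (\<lambda>w. (fst (fst (fst w)), map Zf (snd w))) \<le> c \<and>
   log 2 (real A2) - c \<le> cond_ent P (\<lambda>w. fst (snd (fst w))) (\<lambda>w. map Yf (snd w)) \<and>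
   cond_ent P (\<lambda>w. snd (fst w)) (\<lambda>w. (fst (snd (fst w)), map Yf (snd w))) \<le> c)"

lemma leak_nonneg: "0 \<le> leak1" "0 \<le> leak2" "0 \<le> I1" "0 \<le> I2" "0 \<le> I12"
  by (simp_all add: leak1_def leak2_def I1_def I2_def I12_def cmi_nonneg)

lemma D1_alt: "D1 = (\<lambda>a. pexp (\<kappa> a) (\<lambda>ou. log 2
   (dens (bind_pmf pa (\<lambda>a. map_pmf (Pair a) (\<kappa> a))) (\<lambda>w. fst (snd (fst w))) (\<lambda>w. Zf (snd w)) (\<lambda>w. (fst (fst w), snd (snd (fst w))))
     (fst (snd a)) (Zf ou) (fst a, snd (snd a)))))"
  by (rule ext) (simp only: D1_def R_def vV1_def[abs_def] vV2_def[abs_def] vT_def[abs_def] vZ_def[abs_def])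

lemma D2_alt: "D2 = (\<lambda>a. pexp (\<kappa> a) (\<lambda>ou. log 2
   (dens (bind_pmf pa (\<lambda>a. map_pmf (Pair a) (\<kappa> a))) (\<lambda>w. snd (snd (fst w))) (\<lambda>w. Yf (snd w)) (\<lambda>w. (fst (fst w), fst (snd (fst w))))
     (snd (snd a)) (Yf ou) (fst a, fst (snd a)))))"
  by (rule ext) (simp only: D2_def R_def vV1_def[abs_def] vV2_def[abs_def] vT_def[abs_def] vY_def[abs_def])

lemma leak1_code:
  assumes fin: "finite (set_pmf U)"
    and len: "\<And>m. length (v1w m) = length ts" "\<And>m. length (v2w m) = length ts"
    and dep: "\<And>m. m \<in> set_pmf U \<Longrightarrow> v2w m = c2 (K2 m)"
    and good: "\<And>m. good m \<Longrightarrow> pairok s ts (v1w m) (v2w m)" and s: "0 < s"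
  defines "P \<equiv> blaw U ts (\<lambda>m. zip (v1w m) (v2w m))"
  shows "cond_ent P (\<lambda>w. map Zf (snd w)) (\<lambda>w. K2 (fst w)) \<le> cond_ent P (\<lambda>w. map Zf (snd w)) fst
    + (1 + real (length ts) * (leak1 + s) + pexp U (\<lambda>m. of_bool (\<not> good m)) * (real (length ts) * log 2 (CARD('z))))"
  unfolding P_def blaw_def
proof (rule leak_letters[where bf="\<lambda>a. (fst a, snd (snd a))" and vf="\<lambda>a. fst (snd a)" and mk="\<lambda>b v. (fst b, v, snd b)" and bw'="\<lambda>k. zip ts (c2 k)" and good=good and pa=pa])
  fix m assume m: "m \<in> set_pmf U"
  show "map (\<lambda>a. (fst a, snd (snd a))) (zip ts (zip (v1w m) (v2w m))) = zip ts (c2 (K2 m))"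
    using len dep[OF m] by (intro nth_equalityI) auto
next
  fix m assume m: "good m"
  show "sum_list (map (\<lambda>a. pexp (\<kappa> a) (\<lambda>ou. log 2 (dens (bind_pmf pa (\<lambda>a. map_pmf (Pair a) (\<kappa> a))) (\<lambda>w. fst (snd (fst w)))
      (\<lambda>w. Zf (snd w)) (\<lambda>w. (fst (fst w), snd (snd (fst w)))) (fst (snd a)) (Zf ou) (fst a, snd (snd a))))) (zip ts (zip (v1w m) (v2w m))))
      \<le> real (length ts) * (leak1 + s)"
    using good[OF m] unfolding pairok_def D1_alt by auto
qed (use fin len good s leak_nonneg in \<open>auto simp: pairok_def\<close>)

lemma leak2_code:
  assumes fin: "finite (set_pmf U)"
    and len: "\<And>m. length (v1w m) = length ts" "\<And>m. length (v2w m) = length ts"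
    and dep: "\<And>m. m \<in> set_pmf U \<Longrightarrow> v1w m = c1 (K1 m)"
    and good: "\<And>m. good m \<Longrightarrow> pairok s ts (v1w m) (v2w m)" and s: "0 < s"
  defines "P \<equiv> blaw U ts (\<lambda>m. zip (v1w m) (v2w m))"
  shows "cond_ent P (\<lambda>w. map Yf (snd w)) (\<lambda>w. K1 (fst w)) \<le> cond_ent P (\<lambda>w. map Yf (snd w)) fst
    + (1 + real (length ts) * (leak2 + s) + pexp U (\<lambda>m. of_bool (\<not> good m)) * (real (length ts) * log 2 (CARD('y))))"
  unfolding P_def blaw_def
proof (rule leak_letters[where bf="\<lambda>a. (fst a, fst (snd a))" and vf="\<lambda>a. snd (snd a)" and mk="\<lambda>b v. (fst b, snd b, v)" and bw'="\<lambda>k. zip ts (c1 k)" and good=good and pa=pa])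
  fix m assume m: "m \<in> set_pmf U"
  show "map (\<lambda>a. (fst a, fst (snd a))) (zip ts (zip (v1w m) (v2w m))) = zip ts (c1 (K1 m))"
    using len dep[OF m] by (intro nth_equalityI) auto
next
  fix m assume m: "good m"
  show "sum_list (map (\<lambda>a. pexp (\<kappa> a) (\<lambda>ou. log 2 (dens (bind_pmf pa (\<lambda>a. map_pmf (Pair a) (\<kappa> a))) (\<lambda>w. snd (snd (fst w)))
      (\<lambda>w. Yf (snd w)) (\<lambda>w. (fst (fst w), fst (snd (fst w)))) (snd (snd a)) (Yf ou) (fst a, fst (snd a))))) (zip ts (zip (v1w m) (v2w m))))
      \<le> real (length ts) * (leak2 + s)"
    using good[OF m] unfolding pairok_def D2_alt by auto
qed (use fin len good s leak_nonneg in \<open>auto simp: pairok_def\<close>)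

text \<open>For one fixed codeword, a good partner is a false alarm of the density test. For the
  pair, at least half of the joint mass is good, and on good pairs the change of measure has weight
  at most \<open>2 powr (real (length ts) * (I12 + s))\<close>.\<close>

lemma Gd_bounds:
  assumes ts: "set ts \<subseteq> set_pmf pt" "nice bad s \<delta> ts"
  shows "v1s \<in> set_pmf (seq_pmf (map p1 ts)) \<Longrightarrow> pexp (seq_pmf (map p2 ts)) (\<lambda>v2s. of_bool (Gd bad s \<delta> ts v1s v2s)) \<le> 2 powr (- (real (length ts) * (I12 - s)))"
    and "v2s \<in> set_pmf (seq_pmf (map p2 ts)) \<Longrightarrow> pexp (seq_pmf (map p1 ts)) (\<lambda>v1s. of_bool (Gd bad s \<delta> ts v1s v2s)) \<le> 2 powr (- (real (length ts) * (I12 - s)))"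
    and "2 powr (- (real (length ts) * (I12 + s))) / 2 \<le> pexp (seq_pmf (map p1 ts)) (\<lambda>v1s. pexp (seq_pmf (map p2 ts)) (\<lambda>v2s. of_bool (Gd bad s \<delta> ts v1s v2s)))"
proof -
  let ?n = "real (length ts)"
  let ?g = "2 powr (?n * (I12 - s))"
  have g: "1 / ?g = 2 powr (- (?n * (I12 - s)))" by (simp add: powr_minus_divide)
  show "pexp (seq_pmf (map p2 ts)) (\<lambda>v2s. of_bool (Gd bad s \<delta> ts v1s v2s)) \<le> 2 powr (- (?n * (I12 - s)))"
    if v1s: "v1s \<in> set_pmf (seq_pmf (map p1 ts))" for v1s
  proof -
    have l: "length v1s = length ts" using length_seq_pmf[OF v1s] by simp
    have "pexp (seq_pmf (map p2 ts)) (\<lambda>v2s. of_bool (Gd bad s \<delta> ts v1s v2s)) \<le>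
      pexp (seq_pmf (map p2 ts)) (\<lambda>v2s. of_bool (?g \<le> wprod (\<lambda>c v t. dens R vV1 vV2 vT v c t) ts v1s v2s))"
    proof (rule pexp_mono)
      fix v2s
      show "of_bool (Gd bad s \<delta> ts v1s v2s) \<le> (of_bool (?g \<le> wprod (\<lambda>c v t. dens R vV1 vV2 vT v c t) ts v1s v2s) :: real)"
        using wprod_swap[of v2s ts v1s "dens R vV1 vV2 vT"] by (auto simp: Gd_def pairok_def)
    qed
    also have "\<dots> \<le> 1 / ?g"
      by (rule wprod_false_positive) (auto simp: l dens_nonneg dens_swap[of R vV1 vV2] pexp_dens_V2)
    finally show ?thesis by (simp only: g)
  qed
  show "pexp (seq_pmf (map p1 ts)) (\<lambda>v1s. of_bool (Gd bad s \<delta> ts v1s v2s)) \<le> 2 powr (- (?n * (I12 - s)))"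
    if v2s: "v2s \<in> set_pmf (seq_pmf (map p2 ts))" for v2s
  proof -
    have l: "length v2s = length ts" using length_seq_pmf[OF v2s] by simp
    have "pexp (seq_pmf (map p1 ts)) (\<lambda>v1s. of_bool (Gd bad s \<delta> ts v1s v2s)) \<le>
      pexp (seq_pmf (map p1 ts)) (\<lambda>v1s. of_bool (?g \<le> wprod (dens R vV1 vV2 vT) ts v2s v1s))"
      by (intro pexp_mono) (auto simp: Gd_def pairok_def)
    also have "\<dots> \<le> 1 / ?g"
      by (rule wprod_false_positive) (auto simp: l dens_nonneg pexp_dens_V1)
    finally show ?thesis by (simp only: g)
  qed
  let ?G = "2 powr (?n * (I12 + s))"
  have "1 / 2 \<le> pexp (seq_pmf (map p12 ts)) (\<lambda>vs. of_bool (Gd bad s \<delta> ts (map fst vs) (map snd vs)))"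
    using ts(2) by (simp add: nice_def)
  also have "\<dots> = pexp (seq_pmf (map p1 ts)) (\<lambda>v1s. pexp (seq_pmf (map p2 ts))
     (\<lambda>v2s. wprod (dens R vV1 vV2 vT) ts v2s v1s * of_bool (Gd bad s \<delta> ts (map fst (zip v1s v2s)) (map snd (zip v1s v2s)))))"
    by (rule pexp_seq_p12[OF ts(1)])
  also have "\<dots> \<le> pexp (seq_pmf (map p1 ts)) (\<lambda>v1s. pexp (seq_pmf (map p2 ts)) (\<lambda>v2s. ?G * of_bool (Gd bad s \<delta> ts v1s v2s)))"
  proof (intro pexp_mono)
    fix v1s v2s assume v: "v1s \<in> set_pmf (seq_pmf (map p1 ts))" "v2s \<in> set_pmf (seq_pmf (map p2 ts))"
    have "length v1s = length v2s" using length_seq_pmf[OF v(1)] length_seq_pmf[OF v(2)] by simp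
    then show "wprod (dens R vV1 vV2 vT) ts v2s v1s * of_bool (Gd bad s \<delta> ts (map fst (zip v1s v2s)) (map snd (zip v1s v2s)))
      \<le> ?G * of_bool (Gd bad s \<delta> ts v1s v2s)"
      by (auto simp: Gd_def pairok_def)
  qed
  also have "\<dots> = ?G * pexp (seq_pmf (map p1 ts)) (\<lambda>v1s. pexp (seq_pmf (map p2 ts)) (\<lambda>v2s. of_bool (Gd bad s \<delta> ts v1s v2s)))"
    by (simp only: pexp_cmult)
  finally show "2 powr (- (?n * (I12 + s))) / 2 \<le> pexp (seq_pmf (map p1 ts)) (\<lambda>v1s. pexp (seq_pmf (map p2 ts)) (\<lambda>v2s. of_bool (Gd bad s \<delta> ts v1s v2s)))"
  proof -
    assume *: "1 / 2 \<le> ?G * pexp (seq_pmf (map p1 ts)) (\<lambda>v1s. pexp (seq_pmf (map p2 ts)) (\<lambda>v2s. of_bool (Gd bad s \<delta> ts v1s v2s)))"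
    have "2 powr (- (?n * (I12 + s))) / 2 = (1 / 2) / ?G" by (simp only: powr_minus_divide) simp
    also have "\<dots> \<le> pexp (seq_pmf (map p1 ts)) (\<lambda>v1s. pexp (seq_pmf (map p2 ts)) (\<lambda>v2s. of_bool (Gd bad s \<delta> ts v1s v2s)))"
      using * by (subst pos_divide_le_eq) (auto simp: mult.commute)
    finally show ?thesis .
  qed
qed

text \<open>A word of the wrong length fails by definition. Otherwise the codeword is drawn
  independently of the observation, which for \<open>tau3\<close> and \<open>tau4\<close> includes
  the codeword of the other side.\<close>

lemma tau_false_positive:
  fixes ts :: "'t list"
  shows "pexp (seq_pmf (map p1 ts)) (\<lambda>v1s. of_bool (tau1 s ts v1s ys)) \<le> 2 powr (- (real (length ts) * (I1 - s)))"
    and "pexp (seq_pmf (map p2 ts)) (\<lambda>v2s. of_bool (tau2 s ts v2s zs)) \<le> 2 powr (- (real (length ts) * (I2 - s)))"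
    and "pexp (seq_pmf (map p1 ts)) (\<lambda>v1s. of_bool (tau3 s ts v1s v2s' zs)) \<le> 2 powr (- (real (length ts) * (J1 - s)))"
    and "pexp (seq_pmf (map p2 ts)) (\<lambda>v2s. of_bool (tau4 s ts v2s v1s' ys)) \<le> 2 powr (- (real (length ts) * (J2 - s)))"
proof -
  have gen: "pexp (seq_pmf (map K ts)) (\<lambda>vs. of_bool (A \<and> 2 powr x \<le> wprod (dens R V C vT) ts cs vs)) \<le> 2 powr (- x)"
    if "A \<Longrightarrow> length cs = length ts" "\<And>t c. pexp (K t) (\<lambda>v. dens R V C vT v c t) \<le> 1"
    for K :: "'t \<Rightarrow> 'v::finite pmf" and V and C :: "_ \<Rightarrow> 'c" and A x cs
  proof (cases A)
    case True
    then have "pexp (seq_pmf (map K ts)) (\<lambda>vs. of_bool (2 powr x \<le> wprod (dens R V C vT) ts cs vs)) \<le> 1 / 2 powr x"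
      using that by (intro wprod_false_positive) (auto simp: dens_nonneg)
    then show ?thesis using True by (simp add: powr_minus_divide)
  next
    case False
    then show ?thesis by (simp add: pexp_const)
  qed
  show "pexp (seq_pmf (map p1 ts)) (\<lambda>v1s. of_bool (tau1 s ts v1s ys)) \<le> 2 powr (- (real (length ts) * (I1 - s)))"
    unfolding tau1_def by (rule gen) (auto simp: pexp_dens_V1)
  show "pexp (seq_pmf (map p2 ts)) (\<lambda>v2s. of_bool (tau2 s ts v2s zs)) \<le> 2 powr (- (real (length ts) * (I2 - s)))"
    unfolding tau2_def by (rule gen) (auto simp: pexp_dens_V2)
  show "pexp (seq_pmf (map p1 ts)) (\<lambda>v1s. of_bool (tau3 s ts v1s v2s' zs)) \<le> 2 powr (- (real (length ts) * (J1 - s)))"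
    unfolding tau3_def conj_assoc[symmetric] by (rule gen) (auto simp: pexp_dens_V1)
  show "pexp (seq_pmf (map p2 ts)) (\<lambda>v2s. of_bool (tau4 s ts v2s v1s' ys)) \<le> 2 powr (- (real (length ts) * (J2 - s)))"
    unfolding tau4_def conj_assoc[symmetric] by (rule gen) (auto simp: pexp_dens_V2)
qed

end

text \<open>\<open>K m\<close> consists of the secret part, the rest of the message and the position
  in the bin; \<open>K'\<close> is the index of the other side. The own test \<open>tp\<close>
  ranges over all of \<open>S\<close> and leaves hardly any false candidate. The test
  \<open>tq\<close> of the other receiver is restricted to candidates with the right secret part and
  leaves a list of mean length about \<open>2 powr c\<close>.\<close>

lemma one_sided_lists:
  fixes U :: "'m pmf" and km :: "'m \<Rightarrow> 'o list pmf" and K :: "'m \<Rightarrow> ('a \<times> 'q) \<times> 'l" and Yf :: "'o \<Rightarrow> 'y" and Zf :: "'o \<Rightarrow> 'z"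
  assumes fin: "finite (set_pmf U)" "\<And>m. finite (set_pmf (km m))" and S: "finite S" "\<And>m. m \<in> set_pmf U \<Longrightarrow> K m \<in> S"
    and PW: "pexp U (\<lambda>m. of_bool (\<not> W m)) \<le> \<delta>" and \<delta>: "\<delta> \<le> 1" and c: "0 \<le> c"
    and tp: "pexp U (\<lambda>m. of_bool (W m) * pexp (km m) (\<lambda>os. \<Sum>k\<in>S - {K m}. of_bool (tp k (map Yf os)))) \<le> \<delta>"
      "\<And>m. W m \<Longrightarrow> pexp (km m) (\<lambda>os. of_bool (\<not> tp (K m) (map Yf os))) \<le> \<delta>"
    and tq: "pexp U (\<lambda>m. of_bool (W m) * pexp (km m) (\<lambda>os. \<Sum>k\<in>{k\<in>S. fst (fst k) = fst (fst (K m))} - {K m}.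
        of_bool (tq k (K' m) (map Zf os)))) \<le> 2 powr c"
      "\<And>m. W m \<Longrightarrow> pexp (km m) (\<lambda>os. of_bool (\<not> tq (K m) (K' m) (map Zf os))) \<le> \<delta>"
  defines "P \<equiv> bind_pmf U (\<lambda>m. map_pmf (Pair m) (km m))"
  shows "pexp P (\<lambda>w. of_bool (fst (SOME k. k \<in> S \<and> tp k (map Yf (snd w))) \<noteq> fst (K (fst w)))) \<le> 3 * \<delta>"
    and "cond_ent P (\<lambda>w. K (fst w)) (\<lambda>w. map Yf (snd w)) \<le> 3 + 2 * \<delta> * log 2 (card S)"
    and "cond_ent P (\<lambda>w. K (fst w)) (\<lambda>w. (fst (fst (K (fst w))), map Zf (snd w), K' (fst w))) \<le> c + 3 + 2 * \<delta> * log 2 (card S)"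
proof -
  have tp': "pexp U (\<lambda>m. of_bool (W m) * pexp (km m) (\<lambda>os. \<Sum>k\<in>S - {K m}. of_bool (tp k (map Yf os)))) \<le> 2 powr 0"
    using tp(1) \<delta> by simp
  have "pexp P (\<lambda>w. of_bool (fst (SOME k. k \<in> S \<and> tp k (map Yf (snd w))) \<noteq> fst (K (fst w))))
    \<le> pexp P (\<lambda>w. of_bool ((SOME k. k \<in> S \<and> k \<in> {k. tp k (map Yf (snd w))}) \<noteq> K (fst w)))"
    by (intro pexp_mono) auto
  also have "\<dots> \<le> 3 * \<delta>"
    unfolding P_def
    by (rule decode_from_fp[where B="\<lambda>_ os. map Yf os" and L="\<lambda>ys. {k. tp k ys}" and C="\<lambda>k. S - {k}" and W=W and \<tau>="\<lambda>m k os. tp k (map Yf os)"])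
      (use fin S PW tp in auto)
  finally show "pexp P (\<lambda>w. of_bool (fst (SOME k. k \<in> S \<and> tp k (map Yf (snd w))) \<noteq> fst (K (fst w)))) \<le> 3 * \<delta>" .
  have "cond_ent P (\<lambda>w. K (fst w)) (\<lambda>w. map Yf (snd w)) \<le> 0 + 3 + 2 * \<delta> * log 2 (card S)"
    unfolding P_def
    by (rule list_from_fp[where B="\<lambda>_ os. map Yf os" and L="\<lambda>ys. {k. tp k ys}" and C="\<lambda>k. S - {k}" and W=W and \<tau>="\<lambda>m k os. tp k (map Yf os)"])
      (use fin S PW tp(2) tp' in auto)
  then show "cond_ent P (\<lambda>w. K (fst w)) (\<lambda>w. map Yf (snd w)) \<le> 3 + 2 * \<delta> * log 2 (card S)" by simp
  show "cond_ent P (\<lambda>w. K (fst w)) (\<lambda>w. (fst (fst (K (fst w))), map Zf (snd w), K' (fst w))) \<le> c + 3 + 2 * \<delta> * log 2 (card S)"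
    unfolding P_def
    by (rule list_from_fp[where B="\<lambda>m os. (fst (fst (K m)), map Zf os, K' m)" and L="\<lambda>(a, zs, k'). {k. fst (fst k) = a \<and> tq k k' zs}"
          and C="\<lambda>k. {k'\<in>S. fst (fst k') = fst (fst k)} - {k}" and W=W and \<tau>="\<lambda>m k os. tq k (K' m) (map Zf os)"])
      (use fin S PW tq c in auto)
qed

text \<open>The first claim is the secrecy bound. The second says that little stays hidden beyond
  the secret part: what \<open>Z\<close> leaves open about \<open>K'\<close>, and then the ambiguity
  \<open>am\<close>.\<close>

lemma secrecy_side:
  assumes fin: "finite (set_pmf P)"
    and leak: "cond_ent P Z (\<lambda>w. K' (fst w)) \<le> cond_ent P Z fst + lk"
    and amb: "cond_ent P (\<lambda>w. K (fst w)) (\<lambda>w. (fst (fst (K (fst w))), Z w, K' (fst w))) \<le> am"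
    and M: "\<And>m. m = mf (K m) (K' m)"
  shows "ent P fst - ent P (\<lambda>w. K' (fst w)) - lk - am \<le> cond_ent P (\<lambda>w. fst (fst (K (fst w)))) Z"
    and "cond_ent P (\<lambda>w. fst (K (fst w))) (\<lambda>w. (fst (fst (K (fst w))), Z w)) \<le> cond_ent P (\<lambda>w. K' (fst w)) Z + am"
proof -
  show "ent P fst - ent P (\<lambda>w. K' (fst w)) - lk - am \<le> cond_ent P (\<lambda>w. fst (fst (K (fst w)))) Z"
    by (rule secrecy_core[OF fin, where ?k1.0=K and ?k2.0=K' and sf="\<lambda>k. fst (fst k)" and mf=mf, OF refl refl refl M leak amb])
  let ?B = "\<lambda>w. (fst (fst (K (fst w))), Z w)"
  have "cond_ent P (\<lambda>w. fst (K (fst w))) ?B \<le> cond_ent P (\<lambda>w. (K (fst w), K' (fst w))) ?B"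
    by (rule cond_ent_mono[OF fin, where g="\<lambda>k. fst (fst k)"]) simp
  also have "\<dots> = cond_ent P (\<lambda>w. K' (fst w)) ?B + cond_ent P (\<lambda>w. K (fst w)) (\<lambda>w. (K' (fst w), ?B w))"
    by (rule cond_ent_chain[OF fin])
  also have "cond_ent P (\<lambda>w. K' (fst w)) ?B \<le> cond_ent P (\<lambda>w. K' (fst w)) Z"
    by (rule cond_ent_reduce[OF fin, where g=snd]) simp
  also have "cond_ent P (\<lambda>w. K (fst w)) (\<lambda>w. (K' (fst w), ?B w)) = cond_ent P (\<lambda>w. K (fst w)) (\<lambda>w. (fst (fst (K (fst w))), Z w, K' (fst w)))"
    by (rule cond_ent_inj'[OF fin]) auto
  finally show "cond_ent P (\<lambda>w. fst (K (fst w))) ?B \<le> cond_ent P (\<lambda>w. K' (fst w)) Z + am" using amb by linarith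
qed

context letters
begin

text \<open>The sizes play these parts. \<open>covL\<close> lets two bins contain a good pair.
  \<open>own\<close> limits a side to what its receiver can decode. \<open>gen\<close> limits the
  candidates left once the secret part is known, so that the other receiver can list them.
  \<open>sec\<close> makes public part and dummy large enough to absorb the leakage and the binning
  of the other side. The factor \<open>L1 * L2\<close> stems from the union over all pairs in two
  bins. In the loss, 17 is 12 for the list, 4 for \<open>sec\<close> and 1 for the leakage.\<close>

lemma private_code:
  fixes A1 Q1 L1 A2 Q2 L2 n :: nat
  assumes ts: "length ts = n" "set ts \<subseteq> set_pmf pt" "nice bad s \<delta> ts"
    and s: "0 < s" and \<delta>: "0 < \<delta>" "\<delta> \<le> 1" "50 * 2 powr (- (real n * s)) \<le> \<delta>"
    and pos: "0 < A1" "0 < Q1" "0 < L1" "0 < A2" "0 < Q2" "0 < L2"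
    and covL: "2 powr (real n * (I12 + 2 * s)) \<le> real L1 * real L2"
      "2 powr (real n * (3 * s)) \<le> 2 * real L1" "2 powr (real n * (3 * s)) \<le> 2 * real L2"
    and own: "real L1 * real L2 * real (A1 * Q1 * L1) \<le> 2 powr (real n * (I12 + I1 - 3 * s))"
      "real L1 * real L2 * real (A2 * Q2 * L2) \<le> 2 powr (real n * (I12 + I2 - 3 * s))"
    and gen: "real L1 * real L2 * real (Q1 * L1) \<le> 2 powr (real n * (I12 + J1 + 10 * s))"
      "real L1 * real L2 * real (Q2 * L2) \<le> 2 powr (real n * (I12 + J2 + 10 * s))"
    and sec: "real L2 * 2 powr (real n * (leak1 - 4 * s)) \<le> real Q1"
      "real L1 * 2 powr (real n * (leak2 - 4 * s)) \<le> real Q2"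
    and tot: "real (A1 * Q1 * L1) \<le> 2 powr (real n * I1)" "real (A2 * Q2 * L2) \<le> 2 powr (real n * I2)"
  shows "\<exists>en de1 de2. good_code bad (3 * \<delta>)
    (17 * real n * s + 10 + real n * \<delta> * (log 2 (CARD('y)) + log 2 (CARD('z)) + 2 * I1 + 2 * I2)) A1 Q1 A2 Q2 ts en de1 de2"
proof -
  define M1 where "M1 = {..<A1} \<times> {..<Q1}"
  define M2 where "M2 = {..<A2} \<times> {..<Q2}"
  define S1 where "S1 = M1 \<times> {..<L1}"
  define S2 where "S2 = M2 \<times> {..<L2}"
  have fM: "finite M1" "finite M2" "finite S1" "finite S2" by (auto simp: M1_def M2_def S1_def S2_def)
  have nM: "M1 \<noteq> {}" "M2 \<noteq> {}" using pos by (auto simp: M1_def M2_def)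
  have cM: "card M1 = A1 * Q1" "card M2 = A2 * Q2" "card S1 = A1 * Q1 * L1" "card S2 = A2 * Q2 * L2"
    by (simp_all add: M1_def M2_def S1_def S2_def)
  define r where "r = (\<lambda>x. 2 powr (real n * x) :: real)"
  have r_add: "r x * r y = r (x + y)" for x y by (simp add: r_def powr_add[symmetric] distrib_left)
  have r_pos: "0 < r x" for x by (simp add: r_def)
  have r_inv: "1 / r x = r (- x)" for x by (simp add: r_def powr_minus_divide)
  have r_neg: "2 powr (- (real n * x)) = r (- x)" for x by (simp add: r_def)
  define Cand1 :: "bool \<Rightarrow> (nat \<times> nat) \<times> nat \<Rightarrow> ((nat \<times> nat) \<times> nat) set"
    where "Cand1 = (\<lambda>j k. if j then S1 - {k} else {k'\<in>S1. fst (fst k') = fst (fst k)} - {k})"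
  define Cand2 :: "bool \<Rightarrow> (nat \<times> nat) \<times> nat \<Rightarrow> ((nat \<times> nat) \<times> nat) set"
    where "Cand2 = (\<lambda>j k. if j then S2 - {k} else {k'\<in>S2. fst (fst k') = fst (fst k)} - {k})"
  define N1 where "N1 = (\<lambda>j. if j then real (A1 * Q1 * L1) else real (Q1 * L1))"
  define N2 where "N2 = (\<lambda>j. if j then real (A2 * Q2 * L2) else real (Q2 * L2))"
  define \<beta>1 where "\<beta>1 = (\<lambda>j. if j then r (- (I1 - s)) else r (- (J1 - s)))"
  define \<beta>2 where "\<beta>2 = (\<lambda>j. if j then r (- (I2 - s)) else r (- (J2 - s)))"
  \<comment> \<open>False alarms in decoding have to decay, whereas a list may have mean length of
    order \<open>r (12 * s)\<close>: that costs only about \<open>12 * real n * s\<close>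
    bits.\<close>
  define bb where "bb = (\<lambda>j. if j then r (- s) else r (12 * s))"
  define t1 where "t1 = (\<lambda>j v1 v2 os. if j then tau1 s ts v1 (map Yf os) else tau3 s ts v1 v2 (map Zf os))"
  define t2 where "t2 = (\<lambda>j v2 v1 os. if j then tau2 s ts v2 (map Zf os) else tau4 s ts v2 v1 (map Yf os))"
  define ks where "ks = (\<lambda>v1s v2s. seq_pmf (map \<kappa> (zip ts (zip v1s v2s))))"
  define Gw where "Gw = Gd bad s \<delta> ts"
  define g where "g = r (- (I12 - s))"
  \<comment> \<open>In \<open>covb\<close> the three covering terms add up to at most 5 times
    \<open>r (- I12 - 2 * s)\<close>, and a good pair has probability at least
    \<open>r (- (I12 + s)) / 2\<close>, which gives 10. The factor 5 from the choice of the codebook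
    makes it the 50 of the hypothesis.\<close>
  define cov where "cov = 10 * r (- s)"
  let ?U = "pair_pmf (pmf_of_set M1) (pmf_of_set M2)"
  have U: "?U = msgs A1 Q1 A2 Q2" by (simp add: msgs_def M1_def M2_def)
  have finU: "finite (set_pmf ?U)" and setU: "set_pmf ?U = M1 \<times> M2" using fM nM by auto
  note gb = Gd_bounds[OF ts(2,3), unfolded ts(1)]
  have card_sub: "real (card ({k'\<in>(({..<A} \<times> {..<Q}) \<times> {..<L}). fst (fst k') = fst (fst k)} - {k})) \<le> real (Q * L)"
    if "k \<in> ({..<A} \<times> {..<Q}) \<times> {..<L}" for A Q L and k :: "(nat \<times> nat) \<times> nat"
  proof -
    have "card ({k'\<in>(({..<A} \<times> {..<Q}) \<times> {..<L}). fst (fst k') = fst (fst k)} - {k}) \<le> card (({fst (fst k)} \<times> {..<Q}) \<times> {..<L})"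
      by (intro card_mono) auto
    also have "\<dots> = Q * L" by simp
    finally show ?thesis by (simp only: of_nat_le_iff)
  qed
  have covb: "(1 / (real L1 * real L2) + g / real L1 + g / real L2) / (r (- (I12 + s)) / 2) \<le> cov"
  proof -
    have 1: "1 / (real L1 * real L2) \<le> r (- (I12 + 2 * s))"
    proof -
      have "r (I12 + 2 * s) \<le> real L1 * real L2" using covL(1) by (simp add: r_def)
      then have "1 / (real L1 * real L2) \<le> 1 / r (I12 + 2 * s)" using r_pos pos by (intro divide_left_mono) auto
      also have "\<dots> = r (- (I12 + 2 * s))" by (rule r_inv)
      finally show ?thesis .
    qed
    have 2: "g / real L \<le> 2 * r (- I12 - 2 * s)" if "2 powr (real n * (3 * s)) \<le> 2 * real L" "0 < L" for L
    proof -
      have "r (3 * s) / 2 \<le> real L" using that by (simp add: r_def)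
      then have "g / real L \<le> g / (r (3 * s) / 2)" using r_pos that by (intro divide_left_mono) (auto simp: g_def less_imp_le)
      also have "\<dots> = 2 * (g * (1 / r (3 * s)))" by simp
      also have "\<dots> = 2 * r (- (I12 - s) + - (3 * s))" unfolding r_inv g_def r_add by simp
      also have "- (I12 - s) + - (3 * s) = - I12 - 2 * s" by simp
      finally show ?thesis .
    qed
    have "1 / (real L1 * real L2) + g / real L1 + g / real L2 \<le> 5 * r (- I12 - 2 * s)"
      using 1 2[OF covL(2) pos(3)] 2[OF covL(3) pos(6)] by (simp add: algebra_simps)
    then have "(1 / (real L1 * real L2) + g / real L1 + g / real L2) / (r (- (I12 + s)) / 2) \<le> 5 * r (- I12 - 2 * s) / (r (- (I12 + s)) / 2)"
      using r_pos by (intro divide_right_mono) (auto simp: less_imp_le)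
    also have "\<dots> = 10 * (r (- I12 - 2 * s) * (1 / r (- (I12 + s))))" by simp
    also have "\<dots> = 10 * r (- I12 - 2 * s + - (- (I12 + s)))" unfolding r_inv r_add by simp
    also have "- I12 - 2 * s + - (- (I12 + s)) = - s" by simp
    finally show ?thesis by (simp only: cov_def)
  qed
  have b: "real L1 * real L2 * g * (if j then real (A * Q * L) else real (Q * L)) * (if j then r (- (I - s)) else r (- (J - s))) \<le> bb j"
    if o: "real L1 * real L2 * real (A * Q * L) \<le> 2 powr (real n * (I12 + I - 3 * s))"
      "real L1 * real L2 * real (Q * L) \<le> 2 powr (real n * (I12 + J + 10 * s))" for j A Q L I J
  proof -
    have *: "real L1 * real L2 * g * N * r (- (X - s)) \<le> r e"
      if "real L1 * real L2 * N \<le> r (I12 + X + e - 2 * s)" for N X e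
    proof -
      have "real L1 * real L2 * g * N * r (- (X - s)) = (real L1 * real L2 * N) * (g * r (- (X - s)))" by simp
      also have "\<dots> \<le> r (I12 + X + e - 2 * s) * (g * r (- (X - s)))"
        using that r_pos by (intro mult_right_mono) (auto simp: g_def less_imp_le)
      also have "\<dots> = r e" by (simp add: g_def r_add)
      finally show ?thesis .
    qed
    show ?thesis using *[of "real (A * Q * L)" I "- s"] *[of "real (Q * L)" J "12 * s"] o
      by (simp add: r_def bb_def algebra_simps)
  qed
  note b1 = b[OF own(1) gen(1)] and b2 = b[OF own(2) gen(2)]
  have "\<exists>c1 c2 l1 l2.
     (\<forall>k\<in>M1 \<times> {..<L1}. c1 k \<in> set_pmf (seq_pmf (map p1 ts))) \<and> (\<forall>k\<in>M2 \<times> {..<L2}. c2 k \<in> set_pmf (seq_pmf (map p2 ts))) \<and>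
     (\<forall>m1 m2. l1 m1 m2 < L1 \<and> l2 m1 m2 < L2) \<and>
     pexp ?U (\<lambda>(m1, m2).
        of_bool (\<not> Gw (c1 (m1, l1 m1 m2)) (c2 (m2, l2 m1 m2)))) \<le> 5 * cov \<and>
     (\<forall>j. pexp ?U (\<lambda>(m1, m2).
        of_bool (Gw (c1 (m1, l1 m1 m2)) (c2 (m2, l2 m1 m2))) *
          pexp (ks (c1 (m1, l1 m1 m2)) (c2 (m2, l2 m1 m2)))
            (\<lambda>ou. \<Sum>k\<in>Cand1 j (m1, l1 m1 m2). of_bool (t1 j (c1 k) (c2 (m2, l2 m1 m2)) ou))) \<le> 5 * bb j) \<and>
     (\<forall>j. pexp ?U (\<lambda>(m1, m2).
        of_bool (Gw (c1 (m1, l1 m1 m2)) (c2 (m2, l2 m1 m2))) *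
          pexp (ks (c1 (m1, l1 m1 m2)) (c2 (m2, l2 m1 m2)))
            (\<lambda>ou. \<Sum>k\<in>Cand2 j (m2, l2 m1 m2). of_bool (t2 j (c2 k) (c1 (m1, l1 m1 m2)) ou))) \<le> 5 * bb j)"
  proof (rule one_shot_private[where g=g and p="r (- (I12 + s)) / 2" and ?N1.0=N1 and ?N2.0=N2 and ?\<beta>1.0=\<beta>1 and ?\<beta>2.0=\<beta>2])
    fix j and v2 :: "'v2 list" and os
    show "pexp (seq_pmf (map p1 ts)) (\<lambda>v1. of_bool (t1 j v1 v2 os)) \<le> \<beta>1 j"
      using tau_false_positive(1)[of ts s "map Yf os"] tau_false_positive(3)[of ts s v2 "map Zf os"]
      by (simp add: t1_def \<beta>1_def r_def ts(1) minus_mult_right del: mult_minus_right)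
  next
    fix j and v1 :: "'v1 list" and os
    show "pexp (seq_pmf (map p2 ts)) (\<lambda>v2. of_bool (t2 j v2 v1 os)) \<le> \<beta>2 j"
      using tau_false_positive(2)[of ts s "map Zf os"] tau_false_positive(4)[of ts s v1 "map Yf os"]
      by (simp add: t2_def \<beta>2_def r_def ts(1) minus_mult_right del: mult_minus_right)
  next
    fix j k assume "k \<in> M1 \<times> {..<L1}"
    then show "real (card (Cand1 j k)) \<le> N1 j"
      using card_sub[of k A1 Q1 L1] card_mono[OF fM(3), of "S1 - {k}"] cM(3)
      by (auto simp: Cand1_def N1_def S1_def M1_def)
  next
    fix j k assume "k \<in> M2 \<times> {..<L2}"
    then show "real (card (Cand2 j k)) \<le> N2 j"
      using card_sub[of k A2 Q2 L2] card_mono[OF fM(4), of "S2 - {k}"] cM(4)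
      by (auto simp: Cand2_def N2_def S2_def M2_def)
  next
    show "r (- (I12 + s)) / 2 \<le> pexp (seq_pmf (map p1 ts)) (\<lambda>v1. pexp (seq_pmf (map p2 ts)) (\<lambda>v2. of_bool (Gw v1 v2)))"
      using gb(3) unfolding Gw_def r_neg .
  next
    show "(1 / (real L1 * real L2) + g / real L1 + g / real L2) / (r (- (I12 + s)) / 2) \<le> cov" by (rule covb)
  qed (use fM nM pos gb(1,2) r_pos b1 b2 in \<open>auto simp: ks_def g_def Gw_def r_neg Cand1_def Cand2_def S1_def S2_def \<beta>1_def \<beta>2_def bb_def N1_def N2_def\<close>)
  then obtain c1 c2 l1 l2 where
    c1: "\<forall>k\<in>S1. c1 k \<in> set_pmf (seq_pmf (map p1 ts))" and c2: "\<forall>k\<in>S2. c2 k \<in> set_pmf (seq_pmf (map p2 ts))"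
    and l12: "\<And>m1 m2. l1 m1 m2 < L1" "\<And>m1 m2. l2 m1 m2 < L2"
    and Pcov: "pexp ?U (\<lambda>(m1, m2). of_bool (\<not> Gw (c1 (m1, l1 m1 m2)) (c2 (m2, l2 m1 m2)))) \<le> 5 * cov"
    and fp1: "\<And>j. pexp ?U (\<lambda>(m1, m2).
        of_bool (Gw (c1 (m1, l1 m1 m2)) (c2 (m2, l2 m1 m2))) *
          pexp (ks (c1 (m1, l1 m1 m2)) (c2 (m2, l2 m1 m2)))
            (\<lambda>ou. \<Sum>k\<in>Cand1 j (m1, l1 m1 m2). of_bool (t1 j (c1 k) (c2 (m2, l2 m1 m2)) ou))) \<le> 5 * bb j"
    and fp2: "\<And>j. pexp ?U (\<lambda>(m1, m2).
        of_bool (Gw (c1 (m1, l1 m1 m2)) (c2 (m2, l2 m1 m2))) *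
          pexp (ks (c1 (m1, l1 m1 m2)) (c2 (m2, l2 m1 m2)))
            (\<lambda>ou. \<Sum>k\<in>Cand2 j (m2, l2 m1 m2). of_bool (t2 j (c2 k) (c1 (m1, l1 m1 m2)) ou))) \<le> 5 * bb j"
    unfolding S1_def S2_def by blast
  define K1 where "K1 = (\<lambda>m. (fst m, l1 (fst m) (snd m)))"
  define K2 where "K2 = (\<lambda>m. (snd m, l2 (fst m) (snd m)))"
  text \<open>Outside the message set the codewords are padded to the right length.\<close>
  define w1 where "w1 = (\<lambda>k. if length (c1 k) = n then c1 k else replicate n undefined)"
  define w2 where "w2 = (\<lambda>k. if length (c2 k) = n then c2 k else replicate n undefined)"
  have lw: "length (w1 k) = n" "length (w2 k) = n" for k by (simp_all add: w1_def w2_def)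
  have w1: "w1 k = c1 k" if "k \<in> S1" for k using c1 that ts(1) length_seq_pmf[of "c1 k"] by (force simp: w1_def)
  have w2: "w2 k = c2 k" if "k \<in> S2" for k using c2 that ts(1) length_seq_pmf[of "c2 k"] by (force simp: w2_def)
  have K: "K1 m \<in> S1" "K2 m \<in> S2" if "m \<in> set_pmf ?U" for m
    using that l12 unfolding setU by (auto simp: K1_def K2_def S1_def S2_def)
  define W where "W = (\<lambda>m. Gw (w1 (K1 m)) (w2 (K2 m)))"
  define en where "en = (\<lambda>m. zip (w1 (K1 m)) (w2 (K2 m)))"
  define km where "km = (\<lambda>m. seq_pmf (map \<kappa> (zip ts (en m))))"
  define P where "P = bind_pmf ?U (\<lambda>m. map_pmf (Pair m) (km m))"
  have P: "P = blaw (msgs A1 Q1 A2 Q2) ts en" by (simp add: P_def blaw_def U km_def)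
  have finP: "finite (set_pmf P)" unfolding P_def km_def using finU by auto
  have suppP: "fst w \<in> set_pmf ?U" if "w \<in> set_pmf P" for w using that unfolding P_def by auto
  have PW: "pexp ?U (\<lambda>m. of_bool (\<not> W m)) \<le> \<delta>"
  proof -
    have "pexp ?U (\<lambda>m. of_bool (\<not> W m)) = pexp ?U (\<lambda>(m1, m2). of_bool (\<not> Gw (c1 (m1, l1 m1 m2)) (c2 (m2, l2 m1 m2))))"
      using K w1 w2 by (intro pexp_cong) (auto simp: W_def K1_def K2_def)
    also have "\<dots> \<le> \<delta>" using Pcov \<delta>(3) by (simp add: cov_def r_def)
    finally show ?thesis .
  qed
  have Gfail: "pexp (km m) (\<lambda>os. of_bool (fails bad s ts (w1 (K1 m)) (w2 (K2 m)) os)) \<le> \<delta>" if "W m" for m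
    using that by (simp add: W_def Gw_def Gd_def km_def en_def)
  have Gf: "pexp (km m) (\<lambda>os. of_bool (Q os)) \<le> \<delta>" if "W m" "\<And>os. Q os \<Longrightarrow> fails bad s ts (w1 (K1 m)) (w2 (K2 m)) os" for Q m
    using that by (intro order_trans[OF pexp_mono Gfail[of m]]) auto
  have fp1': "pexp ?U (\<lambda>m. of_bool (W m) * pexp (km m) (\<lambda>ou. \<Sum>k\<in>Cand1 j (K1 m). of_bool (t1 j (w1 k) (w2 (K2 m)) ou))) \<le> 5 * bb j" for j
  proof -
    have "pexp ?U (\<lambda>m. of_bool (W m) * pexp (km m) (\<lambda>ou. \<Sum>k\<in>Cand1 j (K1 m). of_bool (t1 j (w1 k) (w2 (K2 m)) ou)))
      = pexp ?U (\<lambda>(m1, m2).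
        of_bool (Gw (c1 (m1, l1 m1 m2)) (c2 (m2, l2 m1 m2))) *
          pexp (ks (c1 (m1, l1 m1 m2)) (c2 (m2, l2 m1 m2)))
            (\<lambda>ou. \<Sum>k\<in>Cand1 j (m1, l1 m1 m2). of_bool (t1 j (c1 k) (c2 (m2, l2 m1 m2)) ou)))"
    proof (rule pexp_cong)
      fix m assume m: "m \<in> set_pmf ?U"
      have "(\<Sum>k\<in>Cand1 j (K1 m). of_bool (t1 j (w1 k) (w2 (K2 m)) ou)) = (\<Sum>k\<in>Cand1 j (K1 m). of_bool (t1 j (c1 k) (c2 (K2 m)) ou) :: real)" for ou
        using w1 w2[OF K(2)[OF m]] by (intro sum.cong) (auto simp: Cand1_def split: if_splits)
      then show "of_bool (W m) * pexp (km m) (\<lambda>ou. \<Sum>k\<in>Cand1 j (K1 m). of_bool (t1 j (w1 k) (w2 (K2 m)) ou)) =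
        (case m of (m1, m2) \<Rightarrow> of_bool (Gw (c1 (m1, l1 m1 m2)) (c2 (m2, l2 m1 m2))) *
          pexp (ks (c1 (m1, l1 m1 m2)) (c2 (m2, l2 m1 m2)))
            (\<lambda>ou. \<Sum>k\<in>Cand1 j (m1, l1 m1 m2). of_bool (t1 j (c1 k) (c2 (m2, l2 m1 m2)) ou)))"
        using w1[OF K(1)[OF m]] w2[OF K(2)[OF m]] by (simp add: W_def km_def ks_def en_def K1_def K2_def case_prod_unfold)
    qed
    also have "\<dots> \<le> 5 * bb j" by (rule fp1)
    finally show ?thesis .
  qed
  have fp2': "pexp ?U (\<lambda>m. of_bool (W m) * pexp (km m) (\<lambda>ou. \<Sum>k\<in>Cand2 j (K2 m). of_bool (t2 j (w2 k) (w1 (K1 m)) ou))) \<le> 5 * bb j" for j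
  proof -
    have "pexp ?U (\<lambda>m. of_bool (W m) * pexp (km m) (\<lambda>ou. \<Sum>k\<in>Cand2 j (K2 m). of_bool (t2 j (w2 k) (w1 (K1 m)) ou)))
      = pexp ?U (\<lambda>(m1, m2).
        of_bool (Gw (c1 (m1, l1 m1 m2)) (c2 (m2, l2 m1 m2))) *
          pexp (ks (c1 (m1, l1 m1 m2)) (c2 (m2, l2 m1 m2)))
            (\<lambda>ou. \<Sum>k\<in>Cand2 j (m2, l2 m1 m2). of_bool (t2 j (c2 k) (c1 (m1, l1 m1 m2)) ou)))"
    proof (rule pexp_cong)
      fix m assume m: "m \<in> set_pmf ?U"
      have "(\<Sum>k\<in>Cand2 j (K2 m). of_bool (t2 j (w2 k) (w1 (K1 m)) ou)) = (\<Sum>k\<in>Cand2 j (K2 m). of_bool (t2 j (c2 k) (c1 (K1 m)) ou) :: real)" for ou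
        using w2 w1[OF K(1)[OF m]] by (intro sum.cong) (auto simp: Cand2_def split: if_splits)
      then show "of_bool (W m) * pexp (km m) (\<lambda>ou. \<Sum>k\<in>Cand2 j (K2 m). of_bool (t2 j (w2 k) (w1 (K1 m)) ou)) =
        (case m of (m1, m2) \<Rightarrow> of_bool (Gw (c1 (m1, l1 m1 m2)) (c2 (m2, l2 m1 m2))) *
          pexp (ks (c1 (m1, l1 m1 m2)) (c2 (m2, l2 m1 m2)))
            (\<lambda>ou. \<Sum>k\<in>Cand2 j (m2, l2 m1 m2). of_bool (t2 j (c2 k) (c1 (m1, l1 m1 m2)) ou)))"
        using w1[OF K(1)[OF m]] w2[OF K(2)[OF m]] by (simp add: W_def km_def ks_def en_def K1_def K2_def case_prod_unfold)
    qed
    also have "\<dots> \<le> 5 * bb j" by (rule fp2)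
    finally show ?thesis .
  qed
  have bbT: "5 * bb True \<le> \<delta>"
    using \<delta> r_pos[of "- s"] by (auto simp: bb_def r_def)
  have bbF: "5 * bb False \<le> 2 powr (12 * real n * s + 3)"
    using r_pos[of "12 * s"] by (simp add: bb_def r_def powr_add mult.assoc mult.left_commute)
  have finkm: "finite (set_pmf (km m))" for m by (simp add: km_def)
  define de1 where "de1 = (\<lambda>ys. fst (SOME k. k \<in> S1 \<and> tau1 s ts (w1 k) ys))"
  define de2 where "de2 = (\<lambda>zs. fst (SOME k. k \<in> S2 \<and> tau2 s ts (w2 k) zs))"
  have Ks: "fst (K1 m) = fst m" "fst (K2 m) = snd m" for m by (simp_all add: K1_def K2_def)
  have lS: "log 2 (card S1) \<le> real n * I1" "log 2 (card S2) \<le> real n * I2"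
    using tot pos by (simp_all add: cM log_le_iff)
  have d2: "2 * \<delta> * log 2 (card S1) \<le> 2 * \<delta> * (real n * I1)" "2 * \<delta> * log 2 (card S2) \<le> 2 * \<delta> * (real n * I2)"
    using lS \<delta> by (auto intro: mult_left_mono)
  have s12: "0 \<le> 12 * real n * s + 3" using s by simp
  note o1 = one_sided_lists[where U="?U" and km=km and S=S1 and K=K1 and K'=K2 and W=W and \<delta>=\<delta> and c="12 * real n * s + 3" and Yf=Yf and Zf=Zf
      and tp="\<lambda>k ys. tau1 s ts (w1 k) ys" and tq="\<lambda>k k' zs. tau3 s ts (w1 k) (w2 k') zs", OF finU finkm fM(3) K(1) PW \<delta>(2) s12 order_trans[OF fp1'[of True, unfolded Cand1_def t1_def if_True] bbT] Gf
      order_trans[OF fp1'[of False, unfolded Cand1_def t1_def if_False] bbF] Gf, folded P_def]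
    and o2 = one_sided_lists[where U="?U" and km=km and S=S2 and K=K2 and K'=K1 and W=W and \<delta>=\<delta> and c="12 * real n * s + 3" and Yf=Zf and Zf=Yf
      and tp="\<lambda>k zs. tau2 s ts (w2 k) zs" and tq="\<lambda>k k' ys. tau4 s ts (w2 k) (w1 k') ys", OF finU finkm fM(4) K(2) PW \<delta>(2) s12 order_trans[OF fp2'[of True, unfolded Cand2_def t2_def if_True] bbT] Gf
      order_trans[OF fp2'[of False, unfolded Cand2_def t2_def if_False] bbF] Gf, folded P_def]
  have e1: "pexp P (\<lambda>w. of_bool (de1 (map Yf (snd w)) \<noteq> fst (fst w))) \<le> 3 * \<delta>"
    and e2: "pexp P (\<lambda>w. of_bool (de2 (map Zf (snd w)) \<noteq> snd (fst w))) \<le> 3 * \<delta>"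
    unfolding de1_def de2_def Ks[symmetric] by (rule o1(1) o2(1); auto simp: fails_def)+
  have k1y: "cond_ent P (\<lambda>w. K1 (fst w)) (\<lambda>w. map Yf (snd w)) \<le> 3 + 2 * \<delta> * (real n * I1)"
    by (rule order_trans[OF o1(2) add_left_mono[OF d2(1)]]; auto simp: fails_def)
  have k2z: "cond_ent P (\<lambda>w. K2 (fst w)) (\<lambda>w. map Zf (snd w)) \<le> 3 + 2 * \<delta> * (real n * I2)"
    by (rule order_trans[OF o2(2) add_left_mono[OF d2(2)]]; auto simp: fails_def)
  have amb1: "cond_ent P (\<lambda>w. K1 (fst w)) (\<lambda>w. (fst (fst (K1 (fst w))), map Zf (snd w), K2 (fst w))) \<le> 12 * real n * s + 3 + 3 + 2 * \<delta> * (real n * I1)"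
    by (rule order_trans[OF o1(3) add_left_mono[OF d2(1)]]; auto simp: fails_def)
  have amb2: "cond_ent P (\<lambda>w. K2 (fst w)) (\<lambda>w. (fst (fst (K2 (fst w))), map Yf (snd w), K1 (fst w))) \<le> 12 * real n * s + 3 + 3 + 2 * \<delta> * (real n * I2)"
    by (rule order_trans[OF o2(3) add_left_mono[OF d2(2)]]; auto simp: fails_def)
  have Pb: "P = blaw ?U ts (\<lambda>m. zip (w1 (K1 m)) (w2 (K2 m)))"
    by (simp add: P_def blaw_def km_def en_def)
  have pW: "W m \<Longrightarrow> pairok s ts (w1 (K1 m)) (w2 (K2 m))" for m by (simp add: W_def Gw_def Gd_def)
  have lk1: "cond_ent P (\<lambda>w. map Zf (snd w)) (\<lambda>w. K2 (fst w)) \<le> cond_ent P (\<lambda>w. map Zf (snd w)) fst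
    + (1 + real n * (leak1 + s) + \<delta> * (real n * log 2 (CARD('z))))"
  proof -
    have "cond_ent P (\<lambda>w. map Zf (snd w)) (\<lambda>w. K2 (fst w)) \<le> cond_ent P (\<lambda>w. map Zf (snd w)) fst
      + (1 + real (length ts) * (leak1 + s) + pexp ?U (\<lambda>m. of_bool (\<not> W m)) * (real (length ts) * log 2 (CARD('z))))"
      unfolding Pb by (rule leak1_code[where good=W and ?K2.0=K2 and ?c2.0=w2]) (use finU lw ts(1) pW s in auto)
    moreover have "pexp ?U (\<lambda>m. of_bool (\<not> W m)) * (real (length ts) * log 2 (CARD('z))) \<le> \<delta> * (real n * log 2 (CARD('z)))"
      using PW ts(1) \<delta> by (intro mult_mono) auto
    ultimately show ?thesis using ts(1) by simp
  qed
  have lk2: "cond_ent P (\<lambda>w. map Yf (snd w)) (\<lambda>w. K1 (fst w)) \<le> cond_ent P (\<lambda>w. map Yf (snd w)) fst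
    + (1 + real n * (leak2 + s) + \<delta> * (real n * log 2 (CARD('y))))"
  proof -
    have "cond_ent P (\<lambda>w. map Yf (snd w)) (\<lambda>w. K1 (fst w)) \<le> cond_ent P (\<lambda>w. map Yf (snd w)) fst
      + (1 + real (length ts) * (leak2 + s) + pexp ?U (\<lambda>m. of_bool (\<not> W m)) * (real (length ts) * log 2 (CARD('y))))"
      unfolding Pb by (rule leak2_code[where good=W and ?K1.0=K1 and ?c1.0=w1]) (use finU lw ts(1) pW s in auto)
    moreover have "pexp ?U (\<lambda>m. of_bool (\<not> W m)) * (real (length ts) * log 2 (CARD('y))) \<le> \<delta> * (real n * log 2 (CARD('y)))"
      using PW ts(1) \<delta> by (intro mult_mono) auto
    ultimately show ?thesis using ts(1) by simp
  qed
  have entM: "ent P fst = log 2 (real A1) + log 2 (real Q1) + (log 2 (real A2) + log 2 (real Q2))"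
  proof -
    have "ent P fst = ent (map_pmf fst P) (\<lambda>x. x)" by (simp add: ent_map)
    also have "map_pmf fst P = ?U"
      by (simp add: P_def map_bind_pmf map_pmf_comp map_pmf_const bind_return_pmf')
    also have "ent ?U (\<lambda>x. x) = ent ?U (\<lambda>(x, y). (x, y))" by (simp add: case_prod_unfold)
    also have "\<dots> = log 2 (card M1) + log 2 (card M2)"
      using fM nM by (subst ent_pair) (auto simp: ent_uniform)
    finally show ?thesis using pos by (simp add: cM log_mult)
  qed
  \<comment> \<open>Bounding the entropy of the other index by its full range charges the binning
    rate of that side to this one; \<open>sec\<close> returns it through the size of
    \<open>Q1\<close> and \<open>Q2\<close>.\<close>
  have entK: "ent P (\<lambda>w. K2 (fst w)) \<le> log 2 (real A2) + log 2 (real Q2) + log 2 (real L2)"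
    "ent P (\<lambda>w. K1 (fst w)) \<le> log 2 (real A1) + log 2 (real Q1) + log 2 (real L1)"
  proof -
    have "ent P (\<lambda>w. K2 (fst w)) \<le> log 2 (card S2)" "ent P (\<lambda>w. K1 (fst w)) \<le> log 2 (card S1)"
      using finP fM K suppP by (intro ent_le_log_card; force)+
    then show "ent P (\<lambda>w. K2 (fst w)) \<le> log 2 (real A2) + log 2 (real Q2) + log 2 (real L2)"
    "ent P (\<lambda>w. K1 (fst w)) \<le> log 2 (real A1) + log 2 (real Q1) + log 2 (real L1)"
      using pos by (simp_all add: cM log_mult)
  qed
  have logsec: "log 2 (real L2) + real n * (leak1 - 4 * s) \<le> log 2 (real Q1)" "log 2 (real L1) + real n * (leak2 - 4 * s) \<le> log 2 (real Q2)"
  proof -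
    have "log 2 (real L2 * 2 powr (real n * (leak1 - 4 * s))) \<le> log 2 (real Q1)" "log 2 (real L1 * 2 powr (real n * (leak2 - 4 * s))) \<le> log 2 (real Q2)"
      using sec pos by (auto intro!: log_mono)
    then show "log 2 (real L2) + real n * (leak1 - 4 * s) \<le> log 2 (real Q1)" "log 2 (real L1) + real n * (leak2 - 4 * s) \<le> log 2 (real Q2)"
      using pos by (simp_all add: log_mult)
  qed
  define c where "c = 17 * real n * s + 10 + real n * \<delta> * (log 2 (CARD('y)) + log 2 (CARD('z)) + 2 * I1 + 2 * I2)"
  have cnn: "0 \<le> real n * \<delta> * log 2 (CARD('y))" "0 \<le> real n * \<delta> * log 2 (CARD('z))" "0 \<le> real n * \<delta> * I1" "0 \<le> real n * \<delta> * I2" "0 \<le> real n * s"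
    using \<delta> s leak_nonneg by auto
  have ceq: "c = 17 * (real n * s) + 10 + real n * \<delta> * log 2 (CARD('y)) + real n * \<delta> * log 2 (CARD('z)) + 2 * (real n * \<delta> * I1) + 2 * (real n * \<delta> * I2)"
    by (simp add: c_def algebra_simps)
  have M: "m = (fst (K1 m), fst (K2 m))" for m by (simp add: Ks)
  note z1 = secrecy_side[OF finP lk1 amb1, of "\<lambda>k k'. (fst k, fst k')", OF M, unfolded Ks]
    and z2 = secrecy_side[OF finP lk2 amb2, of "\<lambda>k k'. (fst k', fst k)", OF M, unfolded Ks]
  have s1: "log 2 (real A1) - c \<le> cond_ent P (\<lambda>w. fst (fst (fst w))) (\<lambda>w. map Zf (snd w))"
    and s2: "log 2 (real A2) - c \<le> cond_ent P (\<lambda>w. fst (snd (fst w))) (\<lambda>w. map Yf (snd w))"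
    and q1: "cond_ent P (\<lambda>w. fst (fst w)) (\<lambda>w. (fst (fst (fst w)), map Zf (snd w))) \<le> c"
    and q2: "cond_ent P (\<lambda>w. snd (fst w)) (\<lambda>w. (fst (snd (fst w)), map Yf (snd w))) \<le> c"
    using z1 z2 k1y k2z entM entK logsec cnn unfolding ceq by (simp_all add: algebra_simps)
  have pb: "pexp P (\<lambda>w. of_bool (bad ts (snd w))) \<le> 3 * \<delta>"
  proof -
    have "pexp P (\<lambda>w. of_bool (bad ts (snd w))) = pexp ?U (\<lambda>m. pexp (km m) (\<lambda>os. of_bool (bad ts os)))"
      unfolding P_def using finU finkm by (simp add: pexp_bind pexp_map)
    also have "\<dots> \<le> pexp ?U (\<lambda>m. of_bool (\<not> W m) + \<delta>)"
    proof (rule pexp_mono)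
      fix m
      have "pexp (km m) (\<lambda>os. of_bool (bad ts os) :: real) \<le> 1" using finkm by (intro pexp_le_const) auto
      moreover have "W m \<Longrightarrow> pexp (km m) (\<lambda>os. of_bool (bad ts os)) \<le> \<delta>"
        by (rule Gf) (auto simp: fails_def)
      ultimately show "pexp (km m) (\<lambda>os. of_bool (bad ts os)) \<le> of_bool (\<not> W m) + \<delta>" using \<delta> by (cases "W m") auto
    qed
    also have "\<dots> \<le> 3 * \<delta>" using PW finU \<delta> by (simp add: pexp_add pexp_const)
    finally show ?thesis .
  qed
  have "good_code bad (3 * \<delta>) c A1 Q1 A2 Q2 ts en de1 de2"
    unfolding good_code_def Let_def P[symmetric] using pb e1 e2 s1 s2 q1 q2 lw ts(1) by (auto simp: en_def)
  then show ?thesis unfolding c_def by blast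
qed

end

section \<open>Cloud and relay letters, and the tests for the cloud indices\<close>

locale relay_letters = letters pt p12 \<kappa> Yf Zf
  for pt :: "('u::finite \<times> 'x1::finite) pmf" and p12 :: "'u \<times> 'x1 \<Rightarrow> ('v1::finite \<times> 'v2::finite) pmf"
    and \<kappa> :: "('u \<times> 'x1) \<times> 'v1 \<times> 'v2 \<Rightarrow> 'o::finite pmf" and Yf :: "'o \<Rightarrow> 'y::finite" and Zf :: "'o \<Rightarrow> 'z::finite" +
  fixes px :: "'x1 pmf" and pu :: "'x1 \<Rightarrow> 'u pmf" and Y1f :: "'o \<Rightarrow> 'y1::finite"
  assumes pt_eq: "pt = bind_pmf px (\<lambda>x. map_pmf (\<lambda>u. (u, x)) (pu x))"
begin

definition vU :: "(('u \<times> 'x1) \<times> 'v1 \<times> 'v2) \<times> 'o \<Rightarrow> 'u" where "vU w = fst (vT w)"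
definition vX1 :: "(('u \<times> 'x1) \<times> 'v1 \<times> 'v2) \<times> 'o \<Rightarrow> 'x1" where "vX1 w = snd (vT w)"
definition vY1 :: "(('u \<times> 'x1) \<times> 'v1 \<times> 'v2) \<times> 'o \<Rightarrow> 'y1" where "vY1 w = Y1f (snd w)"
definition "IY = cmi R vT vY (\<lambda>_. ())"
definition "IZ = cmi R vT vZ (\<lambda>_. ())"
definition "IR = cmi R vU vY1 vX1"

text \<open>A conditioning word over the unit type turns the conditional density into the
  unconditional one, so the same estimates cover I(U,X1;Y) and I(U,X1;Z).\<close>

definition "tauY s ts ys \<longleftrightarrow> length ys = length ts \<and>
  2 powr (real (length ts) * (IY - s)) \<le> wprod (dens R vT vY (\<lambda>_. ())) (map (\<lambda>_. ()) ys) ys ts"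
definition "tauZ s ts zs \<longleftrightarrow> length zs = length ts \<and>
  2 powr (real (length ts) * (IZ - s)) \<le> wprod (dens R vT vZ (\<lambda>_. ())) (map (\<lambda>_. ()) zs) zs ts"
definition "tauR s x1s us y1s \<longleftrightarrow> length y1s = length x1s \<and>
  2 powr (real (length x1s) * (IR - s)) \<le> wprod (dens R vU vY1 vX1) x1s y1s us"
text \<open>Failure of the true cloud word at one of the three decoders. The output over a fixed
  private code is not distributed like letters of \<open>R\<close>, so rarity of this event has to
  be demanded of the private code; it is therefore a parameter of \<open>fails\<close>.\<close>

definition "bad s ts os \<longleftrightarrow> \<not> tauY s ts (map Yf os) \<or> \<not> tauZ s ts (map Zf os) \<or>
  \<not> tauR s (map snd ts) (map fst ts) (map Y1f os)"

lemma bad_eventually: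
  assumes s: "0 < s" and e: "0 < e"
  shows "\<forall>\<^sub>F n in sequentially. pexp (seq_pmf (replicate n R)) (\<lambda>ws. of_bool (bad s (map vT ws) (map snd ws))) \<le> e"
proof -
  have e3: "0 < e / 3" using e by simp
  have "\<forall>\<^sub>F n in sequentially.
    pexp (seq_pmf (replicate n R)) (\<lambda>ws. of_bool (\<not> (2 powr (real n * (IY - s)) \<le> wprod (dens R vT vY (\<lambda>_. ())) (map (\<lambda>_. ()) ws) (map vY ws) (map vT ws) \<and>
      wprod (dens R vT vY (\<lambda>_. ())) (map (\<lambda>_. ()) ws) (map vY ws) (map vT ws) \<le> 2 powr (real n * (IY + s))))) \<le> e / 3 \<and>
    pexp (seq_pmf (replicate n R)) (\<lambda>ws. of_bool (\<not> (2 powr (real n * (IZ - s)) \<le> wprod (dens R vT vZ (\<lambda>_. ())) (map (\<lambda>_. ()) ws) (map vZ ws) (map vT ws) \<and>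
      wprod (dens R vT vZ (\<lambda>_. ())) (map (\<lambda>_. ()) ws) (map vZ ws) (map vT ws) \<le> 2 powr (real n * (IZ + s))))) \<le> e / 3 \<and>
    pexp (seq_pmf (replicate n R)) (\<lambda>ws. of_bool (\<not> (2 powr (real n * (IR - s)) \<le> wprod (dens R vU vY1 vX1) (map vX1 ws) (map vY1 ws) (map vU ws) \<and>
      wprod (dens R vU vY1 vX1) (map vX1 ws) (map vY1 ws) (map vU ws) \<le> 2 powr (real n * (IR + s))))) \<le> e / 3"
    unfolding IY_def IZ_def IR_def by (intro eventually_conj weak_law_dens s e3) auto
  then show ?thesis
  proof (rule eventually_mono, elim conjE)
    fix n
    let ?RN = "seq_pmf (replicate n R)"
    let ?Y = "\<lambda>ws. \<not> (2 powr (real n * (IY - s)) \<le> wprod (dens R vT vY (\<lambda>_. ())) (map (\<lambda>_. ()) ws) (map vY ws) (map vT ws) \<and>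
      wprod (dens R vT vY (\<lambda>_. ())) (map (\<lambda>_. ()) ws) (map vY ws) (map vT ws) \<le> 2 powr (real n * (IY + s)))"
    let ?Z = "\<lambda>ws. \<not> (2 powr (real n * (IZ - s)) \<le> wprod (dens R vT vZ (\<lambda>_. ())) (map (\<lambda>_. ()) ws) (map vZ ws) (map vT ws) \<and>
      wprod (dens R vT vZ (\<lambda>_. ())) (map (\<lambda>_. ()) ws) (map vZ ws) (map vT ws) \<le> 2 powr (real n * (IZ + s)))"
    let ?R = "\<lambda>ws. \<not> (2 powr (real n * (IR - s)) \<le> wprod (dens R vU vY1 vX1) (map vX1 ws) (map vY1 ws) (map vU ws) \<and>
      wprod (dens R vU vY1 vX1) (map vX1 ws) (map vY1 ws) (map vU ws) \<le> 2 powr (real n * (IR + s)))"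
    assume le: "pexp ?RN (\<lambda>ws. of_bool (?Y ws)) \<le> e / 3" "pexp ?RN (\<lambda>ws. of_bool (?Z ws)) \<le> e / 3" "pexp ?RN (\<lambda>ws. of_bool (?R ws)) \<le> e / 3"
    have "pexp ?RN (\<lambda>ws. of_bool (bad s (map vT ws) (map snd ws))) \<le> pexp ?RN (\<lambda>ws. of_bool (?Y ws) + of_bool (?Z ws) + of_bool (?R ws))"
    proof (rule pexp_mono)
      fix ws assume ws: "ws \<in> set_pmf ?RN"
      have l: "length ws = n" using length_seq_pmf[OF ws] by simp
      have m: "map Yf (map snd ws) = map vY ws" "map Zf (map snd ws) = map vZ ws" "map Y1f (map snd ws) = map vY1 ws"
        "map snd (map vT ws) = map vX1 ws" "map fst (map vT ws) = map vU ws"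
        by (simp_all add: vY_def vZ_def vY1_def vX1_def vU_def)
      have u: "map (\<lambda>_. ()) (map f ws) = map (\<lambda>_. ()) ws" for f :: "_ \<Rightarrow> 'q" by simp
      have "bad s (map vT ws) (map snd ws) \<Longrightarrow> ?Y ws \<or> ?Z ws \<or> ?R ws"
        unfolding bad_def tauY_def tauZ_def tauR_def m u length_map l by blast
      then show "of_bool (bad s (map vT ws) (map snd ws)) \<le> (of_bool (?Y ws) + of_bool (?Z ws) + of_bool (?R ws) :: real)"
        by (cases "bad s (map vT ws) (map snd ws)") auto
    qed
    also have "\<dots> \<le> e" unfolding pexp_add using le by linarith
    finally show "pexp ?RN (\<lambda>ws. of_bool (bad s (map vT ws) (map snd ws))) \<le> e" .
  qed
qed

subsection \<open>The random cloud code\<close>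

text \<open>A row belongs to the index that the relay already knows: one relay word, and for every
  next index a cloud word drawn given it. Rows will be drawn independently; words of one row are
  independent only given the relay word.\<close>

definition "crow n I = bind_pmf (seq_pmf (replicate n px)) (\<lambda>xs. map_pmf (Pair xs) (Pi_pmf I undefined (\<lambda>_. seq_pmf (map pu xs))))"
definition "cloud cb w w' = zip (snd (cb w) w') (fst (cb w))"

lemma seq_pt: "seq_pmf (replicate n pt) = bind_pmf (seq_pmf (replicate n px)) (\<lambda>xs. map_pmf (\<lambda>us. zip us xs) (seq_pmf (map pu xs)))"
proof -
  have "seq_pmf (replicate n pt) = seq_pmf (map (\<lambda>_. bind_pmf px (\<lambda>x. map_pmf (\<lambda>u. (u, x)) (pu x))) (replicate n ()))"
    by (simp add: pt_eq map_replicate)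
  also have "\<dots> = bind_pmf (seq_pmf (map (\<lambda>_. px) (replicate n ()))) (\<lambda>xs. seq_pmf (map2 (\<lambda>_ x. map_pmf (\<lambda>u. (u, x)) (pu x)) (replicate n ()) xs))"
    by (rule seq_pmf_bind)
  also have "\<dots> = bind_pmf (seq_pmf (replicate n px)) (\<lambda>xs. map_pmf (\<lambda>us. zip us xs) (seq_pmf (map pu xs)))"
  proof (rule bind_pmf_cong)
    fix xs assume "xs \<in> set_pmf (seq_pmf (replicate n px))"
    then have "length xs = n" using length_seq_pmf by fastforce
    then have "seq_pmf (map2 (\<lambda>_ x. map_pmf (\<lambda>u. (u, x)) (pu x)) (replicate n ()) xs) = seq_pmf (map (\<lambda>x. map_pmf (\<lambda>u. (u, x)) (pu x)) xs)"
      by (simp add: map2_replicate_unit)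
    also have "\<dots> = map_pmf (map2 (\<lambda>x u. (u, x)) xs) (seq_pmf (map pu xs))" by (rule seq_pmf_map)
    also have "\<dots> = map_pmf (\<lambda>us. zip us xs) (seq_pmf (map pu xs))"
    proof (rule map_pmf_cong)
      fix us assume "us \<in> set_pmf (seq_pmf (map pu xs))"
      then have "length us = length xs" using length_seq_pmf by fastforce
      then show "map2 (\<lambda>x u. (u, x)) xs us = zip us xs" by (intro nth_equalityI) auto
    qed simp
    finally show "seq_pmf (map2 (\<lambda>_ x. map_pmf (\<lambda>u. (u, x)) (pu x)) (replicate n ()) xs) = map_pmf (\<lambda>us. zip us xs) (seq_pmf (map pu xs))" .
  qed (simp add: map_replicate)
  finally show ?thesis .
qed

lemma finite_crow: "finite I \<Longrightarrow> finite (set_pmf (crow n I))"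
  unfolding crow_def by (auto intro!: finite_set_Pi_pmf)

lemma pexp_crow: "finite I \<Longrightarrow> pexp (crow n I) F = pexp (seq_pmf (replicate n px)) (\<lambda>xs. pexp (Pi_pmf I undefined (\<lambda>_. seq_pmf (map pu xs))) (\<lambda>us. F (xs, us)))"
  unfolding crow_def
  by (subst pexp_bind) (auto intro!: finite_set_Pi_pmf pexp_cong pexp_map)

lemma pexp_crow_one:
  assumes "finite I" "w' \<in> I"
  shows "pexp (crow n I) (\<lambda>r. f (zip (snd r w') (fst r))) = pexp (seq_pmf (replicate n pt)) f"
proof -
  have "pexp (crow n I) (\<lambda>r. f (zip (snd r w') (fst r))) = pexp (seq_pmf (replicate n px)) (\<lambda>xs. pexp (seq_pmf (map pu xs)) (\<lambda>us. f (zip us xs)))"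
    unfolding pexp_crow[OF assms(1)] fst_conv snd_conv
    by (intro pexp_cong pexp_Pi_one[where f="\<lambda>us. f (zip us _)"]) (use assms in auto)
  also have "\<dots> = pexp (seq_pmf (replicate n pt)) f"
    by (simp add: seq_pt pexp_bind pexp_map)
  finally show ?thesis .
qed

lemma length_cloud:
  assumes "finite I" "cb \<in> set_pmf (Pi_pmf I undefined (\<lambda>_. crow n I))" "w \<in> I" "w' \<in> I"
  shows "length (snd (cb w) w') = n" "length (fst (cb w)) = n"
proof -
  have "cb w \<in> set_pmf (crow n I)" using Pi_pmf_support[OF assms(1,2,3)] .
  then obtain xs us where r: "cb w = (xs, us)" "xs \<in> set_pmf (seq_pmf (replicate n px))"
    "us \<in> set_pmf (Pi_pmf I undefined (\<lambda>_. seq_pmf (map pu xs)))"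
    by (auto simp: crow_def)
  have "us w' \<in> set_pmf (seq_pmf (map pu xs))" using Pi_pmf_support[OF assms(1) r(3) assms(4)] .
  then show "length (snd (cb w) w') = n" "length (fst (cb w)) = n"
    using r length_seq_pmf[of xs] length_seq_pmf[of "us w'"] by auto
qed

lemma tauT_false_positive:
  "pexp (seq_pmf (replicate n pt)) (\<lambda>ts. of_bool (tauY s ts ys)) \<le> 2 powr (- (real n * (IY - s)))"
  "pexp (seq_pmf (replicate n pt)) (\<lambda>ts. of_bool (tauZ s ts zs)) \<le> 2 powr (- (real n * (IZ - s)))"
proof -
  have gen: "pexp (seq_pmf (replicate n pt)) (\<lambda>ts. of_bool (length cs = length ts \<and> 2 powr (real (length ts) * x) \<le> wprod (dens R vT C (\<lambda>_. ())) (map (\<lambda>_. ()) cs) cs ts)) \<le> 2 powr (- (real n * x))"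
    for C :: "_ \<Rightarrow> 'c" and cs x
  proof (cases "length cs = n")
    case True
    have "pexp (seq_pmf (replicate n pt)) (\<lambda>ts. of_bool (length cs = length ts \<and> 2 powr (real (length ts) * x) \<le> wprod (dens R vT C (\<lambda>_. ())) (map (\<lambda>_. ()) cs) cs ts))
      = pexp (seq_pmf (map (\<lambda>_. pt) (map (\<lambda>_. ()) cs))) (\<lambda>ts. of_bool (2 powr (real n * x) \<le> wprod (dens R vT C (\<lambda>_. ())) (map (\<lambda>_. ()) cs) cs ts))"
    proof -
      have "map (\<lambda>_. pt) (map (\<lambda>_. ()) cs) = replicate n pt" using True by (simp add: map_replicate_const o_def)
      then show ?thesis using True by (auto intro!: pexp_cong dest!: length_seq_pmf)
    qed
    also have "\<dots> \<le> 1 / 2 powr (real n * x)"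
    proof (rule wprod_false_positive)
      fix t :: unit and c
      show "pexp pt (\<lambda>v. dens R vT C (\<lambda>_. ()) v c t) \<le> 1"
      proof (rule pexp_dens_le1[where K="\<lambda>_. pt"])
        fix v
        have "pmf (map_pmf (\<lambda>w. (vT w, ())) R) (v, t) = pmf (map_pmf vT R) v"
          by (auto simp: pmf_map_eq_pexp intro!: pexp_cong)
        moreover have "pmf (map_pmf (\<lambda>_. ()) R) t = 1" by simp
        ultimately show "pmf (map_pmf (\<lambda>w. (vT w, ())) R) (v, t) = pmf (map_pmf (\<lambda>_. ()) R) t * pmf pt v"
          by (simp add: map_vT)
      qed auto
    qed (auto simp: dens_nonneg)
    finally show ?thesis by (simp add: powr_minus_divide)
  next
    case False
    have "pexp (seq_pmf (replicate n pt)) (\<lambda>ts. of_bool (length cs = length ts \<and> 2 powr (real (length ts) * x) \<le> wprod (dens R vT C (\<lambda>_. ())) (map (\<lambda>_. ()) cs) cs ts))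
      = pexp (seq_pmf (replicate n pt)) (\<lambda>ts. 0)"
      using False by (intro pexp_cong) (auto dest!: length_seq_pmf)
    then show ?thesis by (simp add: pexp_const)
  qed
  show "pexp (seq_pmf (replicate n pt)) (\<lambda>ts. of_bool (tauY s ts ys)) \<le> 2 powr (- (real n * (IY - s)))"
    unfolding tauY_def by (rule gen)
  show "pexp (seq_pmf (replicate n pt)) (\<lambda>ts. of_bool (tauZ s ts zs)) \<le> 2 powr (- (real n * (IZ - s)))"
    unfolding tauZ_def by (rule gen)
qed

lemma map_vX1: "map_pmf vX1 R = px"
proof -
  have "map_pmf vX1 R = map_pmf snd (map_pmf vT R)" by (simp add: map_pmf_comp vX1_def[abs_def])
  also have "\<dots> = map_pmf snd pt" by (simp only: map_vT)
  also have "\<dots> = px" unfolding pt_eq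
    by (simp add: map_bind_pmf map_pmf_comp map_pmf_const bind_return_pmf')
  finally show ?thesis .
qed

lemma pmf_UX1: "pmf (map_pmf (\<lambda>w. (vU w, vX1 w)) R) (u, x) = pmf (map_pmf vX1 R) x * pmf (pu x) u"
proof -
  have "pmf (map_pmf (\<lambda>w. (vU w, vX1 w)) R) (u, x) = pmf (map_pmf (\<lambda>t. (snd t, fst t)) (map_pmf vT R)) (x, u)"
    unfolding map_pmf_comp by (auto simp: pmf_map_eq_pexp vU_def vX1_def intro!: pexp_cong)
  also have "map_pmf (\<lambda>t. (snd t, fst t)) (map_pmf vT R) = map_pmf (\<lambda>t. (snd t, fst t)) pt"
    by (simp only: map_vT)
  also have "\<dots> = bind_pmf px (\<lambda>x. map_pmf (Pair x) (pu x))"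
    unfolding pt_eq by (simp add: map_bind_pmf map_pmf_comp)
  finally show ?thesis by (simp add: pmf_map_Pair_bind map_vX1)
qed

lemma tauR_false_positive:
  "pexp (seq_pmf (map pu xs)) (\<lambda>us. of_bool (tauR s xs us y1s)) \<le> 2 powr (- (real (length xs) * (IR - s)))"
proof (cases "length y1s = length xs")
  case True
  have "pexp (seq_pmf (map pu xs)) (\<lambda>us. of_bool (2 powr (real (length xs) * (IR - s)) \<le> wprod (dens R vU vY1 vX1) xs y1s us)) \<le> 1 / 2 powr (real (length xs) * (IR - s))"
  proof (rule wprod_false_positive)
    fix x c show "pexp (pu x) (\<lambda>v. dens R vU vY1 vX1 v c x) \<le> 1"
      by (rule pexp_dens_le1) (auto simp: pmf_UX1)
  qed (auto simp: True dens_nonneg)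
  then show ?thesis using True by (simp add: tauR_def powr_minus_divide)
next
  case False
  then show ?thesis by (simp add: tauR_def pexp_const)
qed

text \<open>The receivers know the column \<open>w'\<close> and may confuse rows, the relay knows
  the row \<open>w\<close> and may confuse columns. \<open>out\<close> is the law of the output over
  a cloud word, private code included; the sums count competitors that pass.\<close>

definition "cloud_err s nic (out :: ('u \<times> 'x1) list \<Rightarrow> 'o list pmf) I cb w w' =
  of_bool (\<not> nic (cloud cb w w')) + pexp (out (cloud cb w w')) (\<lambda>os.
     (\<Sum>v\<in>I - {w}. of_bool (tauY s (cloud cb v w') (map Yf os))) +
     (\<Sum>v\<in>I - {w}. of_bool (tauZ s (cloud cb v w') (map Zf os))) +
     (\<Sum>v\<in>I - {w'}. of_bool (tauR s (fst (cb w)) (snd (cb w) v) (map Y1f os))))"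

text \<open>Competitors at the receivers lie in other rows, hence are independent of the cloud word
  sent and of the output. Competitors at the relay share the relay word and are independent given
  it. Counting \<open>card I - 1\<close> competitors instead of \<open>card I\<close> makes the
  second term vanish for a single cloud index, whatever the information quantities are.\<close>

lemma cloud_err_expectation:
  assumes I: "finite I" "w \<in> I" "w' \<in> I" and out: "\<And>ts. finite (set_pmf (out ts))"
  shows "pexp (Pi_pmf I undefined (\<lambda>_. crow n I)) (\<lambda>cb. cloud_err s nic out I cb w w')
    \<le> pexp (seq_pmf (replicate n pt)) (\<lambda>ts. of_bool (\<not> nic ts)) +
       (real (card I) - 1) * (2 powr (- (real n * (IY - s))) + 2 powr (- (real n * (IZ - s))) + 2 powr (- (real n * (IR - s))))"
proof -
  let ?CB = "Pi_pmf I undefined (\<lambda>_. crow n I)"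
  have cl: "cloud cb w w' = zip (snd (cb w) w') (fst (cb w))" for cb and w w' :: 'b by (simp add: cloud_def)
  have a: "pexp ?CB (\<lambda>cb. of_bool (\<not> nic (cloud cb w w')) :: real) = pexp (seq_pmf (replicate n pt)) (\<lambda>ts. of_bool (\<not> nic ts))"
  proof -
    have "pexp ?CB (\<lambda>cb. of_bool (\<not> nic (cloud cb w w')) :: real) = pexp (crow n I) (\<lambda>r. of_bool (\<not> nic (zip (snd r w') (fst r))))"
      unfolding cl by (rule pexp_Pi_one) (use I finite_crow in auto)
    then show ?thesis using pexp_crow_one[OF I(1,3), of n "\<lambda>ts. of_bool (\<not> nic ts)"] by simp
  qed
  have cross: "pexp ?CB (\<lambda>cb. pexp (out (cloud cb w w')) (\<lambda>os. of_bool (Q (cloud cb v w') os))) \<le> \<beta>"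
    if v: "v \<in> I" "v \<noteq> w" and Q: "\<And>os. pexp (seq_pmf (replicate n pt)) (\<lambda>ts. of_bool (Q ts os)) \<le> \<beta>" for v Q \<beta>
  proof -
    have "pexp ?CB (\<lambda>cb. pexp (out (cloud cb w w')) (\<lambda>os. of_bool (Q (cloud cb v w') os)))
      = pexp (crow n I) (\<lambda>r. pexp (crow n I) (\<lambda>r'. pexp (out (zip (snd r w') (fst r))) (\<lambda>os. of_bool (Q (zip (snd r' w') (fst r')) os))))"
      unfolding cl by (rule pexp_Pi_two) (use I v finite_crow in auto)
    also have "\<dots> = pexp (crow n I) (\<lambda>r. pexp (out (zip (snd r w') (fst r))) (\<lambda>os. pexp (crow n I) (\<lambda>r'. of_bool (Q (zip (snd r' w') (fst r')) os))))"
      by (intro pexp_cong pexp_commute)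
    also have "\<dots> = pexp (crow n I) (\<lambda>r. pexp (out (zip (snd r w') (fst r))) (\<lambda>os. pexp (seq_pmf (replicate n pt)) (\<lambda>ts. of_bool (Q ts os))))"
      by (intro pexp_cong pexp_crow_one[OF I(1,3)])
    also have "\<dots> \<le> \<beta>"
      by (intro pexp_le_const[OF finite_crow[OF I(1)]] pexp_le_const[OF out] Q)
    finally show ?thesis .
  qed
  have rel: "pexp ?CB (\<lambda>cb. pexp (out (cloud cb w w')) (\<lambda>os. of_bool (tauR s (fst (cb w)) (snd (cb w) v) (map Y1f os)))) \<le> 2 powr (- (real n * (IR - s)))"
    if v: "v \<in> I" "v \<noteq> w'" for v
  proof -
    have "pexp ?CB (\<lambda>cb. pexp (out (cloud cb w w')) (\<lambda>os. of_bool (tauR s (fst (cb w)) (snd (cb w) v) (map Y1f os))))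
      = pexp (crow n I) (\<lambda>r. pexp (out (zip (snd r w') (fst r))) (\<lambda>os. of_bool (tauR s (fst r) (snd r v) (map Y1f os))))"
      unfolding cl by (rule pexp_Pi_one) (use I finite_crow in auto)
    also have "\<dots> = pexp (seq_pmf (replicate n px)) (\<lambda>xs. pexp (Pi_pmf I undefined (\<lambda>_. seq_pmf (map pu xs)))
         (\<lambda>us. pexp (out (zip (us w') xs)) (\<lambda>os. of_bool (tauR s xs (us v) (map Y1f os)))))"
      by (simp add: pexp_crow I)
    also have "\<dots> = pexp (seq_pmf (replicate n px)) (\<lambda>xs. pexp (seq_pmf (map pu xs)) (\<lambda>us. pexp (seq_pmf (map pu xs)) (\<lambda>us'.
         pexp (out (zip us xs)) (\<lambda>os. of_bool (tauR s xs us' (map Y1f os))))))"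
      by (intro pexp_cong pexp_Pi_two[where f="\<lambda>us us'. pexp (out (zip us _)) (\<lambda>os. of_bool (tauR s _ us' (map Y1f os)))"]) (use I v in auto)
    also have "\<dots> = pexp (seq_pmf (replicate n px)) (\<lambda>xs. pexp (seq_pmf (map pu xs)) (\<lambda>us.
         pexp (out (zip us xs)) (\<lambda>os. pexp (seq_pmf (map pu xs)) (\<lambda>us'. of_bool (tauR s xs us' (map Y1f os))))))"
      by (intro pexp_cong pexp_commute)
    also have "\<dots> \<le> 2 powr (- (real n * (IR - s)))"
    proof (rule pexp_le_const)
      fix xs assume "xs \<in> set_pmf (seq_pmf (replicate n px))"
      then have l: "length xs = n" using length_seq_pmf by fastforce
      show "pexp (seq_pmf (map pu xs)) (\<lambda>us.
         pexp (out (zip us xs)) (\<lambda>os. pexp (seq_pmf (map pu xs)) (\<lambda>us'. of_bool (tauR s xs us' (map Y1f os))))) \<le> 2 powr (- (real n * (IR - s)))"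
        by (rule pexp_le_const, simp, rule pexp_le_const[OF out], use tauR_false_positive[of xs s] in \<open>simp add: l\<close>)
    qed simp
    finally show ?thesis .
  qed
  have cardI: "real (card (I - {x})) = real (card I) - 1" if "x \<in> I" for x
  proof -
    have "0 < card I" using that I(1) by (auto simp: card_gt_0_iff)
    then show ?thesis using that I(1) by (simp add: card_Diff_singleton of_nat_diff)
  qed
  have "pexp ?CB (\<lambda>cb. cloud_err s nic out I cb w w') = pexp ?CB (\<lambda>cb. of_bool (\<not> nic (cloud cb w w')))
     + ((\<Sum>v\<in>I - {w}. pexp ?CB (\<lambda>cb. pexp (out (cloud cb w w')) (\<lambda>os. of_bool (tauY s (cloud cb v w') (map Yf os)))))
     + (\<Sum>v\<in>I - {w}. pexp ?CB (\<lambda>cb. pexp (out (cloud cb w w')) (\<lambda>os. of_bool (tauZ s (cloud cb v w') (map Zf os)))))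
     + (\<Sum>v\<in>I - {w'}. pexp ?CB (\<lambda>cb. pexp (out (cloud cb w w')) (\<lambda>os. of_bool (tauR s (fst (cb w)) (snd (cb w) v) (map Y1f os))))))"
    unfolding cloud_err_def by (simp only: pexp_add pexp_sum)
  also have "\<dots> \<le> pexp (seq_pmf (replicate n pt)) (\<lambda>ts. of_bool (\<not> nic ts)) + ((\<Sum>v\<in>I - {w}. 2 powr (- (real n * (IY - s))))
     + (\<Sum>v\<in>I - {w}. 2 powr (- (real n * (IZ - s)))) + (\<Sum>v\<in>I - {w'}. 2 powr (- (real n * (IR - s)))))"
    unfolding a
    by (intro add_mono order_refl sum_mono cross rel) (use tauT_false_positive in auto)
  also have "\<dots> = pexp (seq_pmf (replicate n pt)) (\<lambda>ts. of_bool (\<not> nic ts)) +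
       (real (card I) - 1) * (2 powr (- (real n * (IY - s))) + 2 powr (- (real n * (IZ - s))) + 2 powr (- (real n * (IR - s))))"
    unfolding sum_constant cardI[OF I(2)] cardI[OF I(3)] by (simp add: algebra_simps)
  finally show ?thesis .
qed

end

section \<open>Averages along the sequence of cloud indices\<close>

lemma eventually_small_powr:
  assumes "0 < s" "0 < e"
  shows "\<forall>\<^sub>F n in sequentially. 2 powr (- (real n * s)) \<le> (e::real)"
proof -
  have "\<forall>\<^sub>F n in sequentially. real n \<ge> - log 2 e / s"
    using filterlim_real_sequentially[unfolded filterlim_at_top, rule_format, of "- log 2 e / s"] .
  then show ?thesis
  proof (rule eventually_mono)
    fix n assume "real n \<ge> - log 2 e / s"
    then have "- (real n * s) \<le> log 2 e" using assms by (simp add: field_simps)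
    then show "2 powr (- (real n * s)) \<le> e" using assms by (simp add: le_log_iff)
  qed
qed

lemma set_seq_replicate: "xs \<in> set_pmf (seq_pmf (replicate n P)) \<longleftrightarrow> length xs = n \<and> set xs \<subseteq> set_pmf P"
  by (induction n arbitrary: xs) (force simp: length_Suc_conv image_iff)+

text \<open>\<open>T\<close> free indices serve \<open>T + 1\<close> blocks: both ends are fixed to
  \<open>w0\<close>, so the relay knows its first word and the backward decoders know where to
  start.\<close>

definition wpairs :: "'i \<Rightarrow> 'i list \<Rightarrow> ('i \<times> 'i) list" where
  "wpairs w0 wv = zip (w0 # wv) (wv @ [w0])"

lemma length_wpairs [simp]: "length (wpairs w0 wv) = Suc (length wv)"
  by (simp add: wpairs_def)

lemma set_wpairs:
  assumes "set wv \<subseteq> I" "w0 \<in> I"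
  shows "set (wpairs w0 wv) \<subseteq> I \<times> I"
proof
  fix p assume "p \<in> set (wpairs w0 wv)"
  then have "fst p \<in> set (w0 # wv)" "snd p \<in> set (wv @ [w0])"
    unfolding wpairs_def by (metis prod.collapse set_zip_leftD, metis prod.collapse set_zip_rightD)
  then show "p \<in> I \<times> I" using assms by (cases p) auto
qed

text \<open>Summed over the \<open>T + 1\<close> blocks, block \<open>b\<close> carrying the pair of consecutive cloud
  indices \<open>(w b, w (b + 1))\<close>.\<close>

definition wavg :: "nat \<Rightarrow> 'i set \<Rightarrow> 'i \<Rightarrow> ('i \<Rightarrow> 'i \<Rightarrow> real) \<Rightarrow> real" where
  "wavg T I w0 G = pexp (seq_pmf (replicate T (pmf_of_set I))) (\<lambda>wv. \<Sum>p\<leftarrow>wpairs w0 wv. G (fst p) (snd p))"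

lemma finite_wv: "finite I \<Longrightarrow> I \<noteq> {} \<Longrightarrow> finite (set_pmf (seq_pmf (replicate T (pmf_of_set I))))"
  by (rule finite_set_seq_pmf) simp

lemma wv_support:
  assumes "finite I" "I \<noteq> {}" "wv \<in> set_pmf (seq_pmf (replicate T (pmf_of_set I)))"
  shows "length wv = T" "set wv \<subseteq> I"
proof -
  have *: "length wv = T" "\<forall>i<T. wv ! i \<in> I"
    using assms(3) set_pmf_of_set[OF assms(2,1)] by (auto simp: set_seq_pmf list_all2_conv_all_nth)
  then show "length wv = T" "set wv \<subseteq> I" by (auto simp: in_set_conv_nth)
qed

lemma sum_list_mono': "(\<And>x. x \<in> set xs \<Longrightarrow> f x \<le> (g x :: real)) \<Longrightarrow> (\<Sum>x\<leftarrow>xs. f x) \<le> (\<Sum>x\<leftarrow>xs. g x)"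
  by (induction xs) (auto intro: add_mono)

lemma wavg_mono:
  assumes "finite I" "I \<noteq> {}" "w0 \<in> I" "\<And>w w'. w \<in> I \<Longrightarrow> w' \<in> I \<Longrightarrow> G w w' \<le> H w w'"
  shows "wavg T I w0 G \<le> wavg T I w0 H"
  unfolding wavg_def
proof (intro pexp_mono sum_list_mono')
  fix wv p assume wv: "wv \<in> set_pmf (seq_pmf (replicate T (pmf_of_set I)))" and p: "p \<in> set (wpairs w0 wv)"
  have "p \<in> I \<times> I" using set_wpairs[OF wv_support(2)[OF assms(1,2) wv] assms(3)] p by blast
  then show "G (fst p) (snd p) \<le> H (fst p) (snd p)" using assms(4) by auto
qed

lemma wavg_affine:
  assumes "finite I" "I \<noteq> {}"
  shows "wavg T I w0 (\<lambda>w w'. a + b * G w w') = real (Suc T) * a + b * wavg T I w0 G"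
proof -
  have "wavg T I w0 (\<lambda>w w'. a + b * G w w') = pexp (seq_pmf (replicate T (pmf_of_set I))) (\<lambda>wv. real (Suc T) * a + b * (\<Sum>p\<leftarrow>wpairs w0 wv. G (fst p) (snd p)))"
    unfolding wavg_def
  proof (rule pexp_cong)
    fix wv assume "wv \<in> set_pmf (seq_pmf (replicate T (pmf_of_set I)))"
    then have "length wv = T" using wv_support(1)[OF assms] by blast
    then show "(\<Sum>p\<leftarrow>wpairs w0 wv. a + b * G (fst p) (snd p)) = real (Suc T) * a + b * (\<Sum>p\<leftarrow>wpairs w0 wv. G (fst p) (snd p))"
      by (simp add: sum_list_addf sum_list_const_mult sum_list_triv del: of_nat_Suc)
  qed
  then show ?thesis using finite_wv[OF assms] by (simp only: pexp_add pexp_const pexp_cmult wavg_def)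
qed

lemma log_prod_le:
  assumes "0 < A" "0 < (Q::nat)" "0 < L" "real (A * Q * L) \<le> 2 powr x"
  shows "log 2 (real (A * Q)) \<le> x" "log 2 (real A) \<le> x"
proof -
  have "real (A * Q) \<le> real (A * Q * L)" using assms by (intro of_nat_mono) simp
  then have "real (A * Q) \<le> 2 powr x" using assms(4) by linarith
  then have "log 2 (real (A * Q)) \<le> log 2 (2 powr x)" using assms(1,2) by (intro log_mono) auto
  then show 1: "log 2 (real (A * Q)) \<le> x" by simp
  have "real A \<le> real (A * Q)" using assms by (intro of_nat_mono) simp
  then have "log 2 (real A) \<le> log 2 (real (A * Q))" using assms by (intro log_mono) auto
  with 1 show "log 2 (real A) \<le> x" by simp
qed

section \<open>Cloud and private codes combined, good on average over the index sequence\<close>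

context relay_letters
begin

lemma set_msgs:
  assumes "0 < A1" "0 < Q1" "0 < A2" "0 < Q2"
  shows "set_pmf (msgs A1 Q1 A2 Q2) = ({..<A1} \<times> {..<Q1}) \<times> ({..<A2} \<times> {..<Q2})"
proof -
  have "set_pmf (pmf_of_set ({..<A} \<times> {..<Q})) = {..<A} \<times> {..<Q}" if "0 < A" "0 < Q" for A Q :: nat
    using that by (intro set_pmf_of_set) auto
  then show ?thesis using assms by (simp add: msgs_def)
qed

text \<open>Success of all decisions of a block, each taken with the right neighbouring index.
  Errors that propagate from other blocks need no separate event: they start with a block that
  violates this condition.\<close>

definition "block_ok s I (xw :: 'i \<Rightarrow> 'x1 list) (uw :: 'i \<Rightarrow> 'i \<Rightarrow> 'u list) de1 de2 w w' x \<longleftrightarrow>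
  \<not> bad s (zip (uw w w') (xw w)) (snd x) \<and>
  (\<forall>v\<in>I - {w}. \<not> tauY s (zip (uw v w') (xw v)) (map Yf (snd x))) \<and>
  (\<forall>v\<in>I - {w}. \<not> tauZ s (zip (uw v w') (xw v)) (map Zf (snd x))) \<and>
  (\<forall>v\<in>I - {w'}. \<not> tauR s (xw w) (uw w v) (map Y1f (snd x))) \<and>
  de1 (zip (uw w w') (xw w)) (map Yf (snd x)) = fst (fst x) \<and>
  de2 (zip (uw w w') (xw w)) (map Zf (snd x)) = snd (fst x)"

text \<open>Random coding makes the cloud code good only on average over index pairs, so the
  requirements are sums along the blocks, averaged over the index sequence that is really
  used.\<close>

definition "block_code s n I w0 T A1 Q1 A2 Q2 c \<eta> xw uw en de1 de2 \<longleftrightarrow>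
  (\<forall>w\<in>I. length (xw w) = n) \<and> (\<forall>w\<in>I. \<forall>w'\<in>I. length (uw w w') = n) \<and> (\<forall>ts m. length (en ts m) = length ts) \<and>
  (let blk = (\<lambda>w w'. blaw (msgs A1 Q1 A2 Q2) (zip (uw w w') (xw w)) (en (zip (uw w w') (xw w)))) in
   wavg T I w0 (\<lambda>w w'. pexp (blk w w') (\<lambda>x. of_bool (\<not> block_ok s I xw uw de1 de2 w w' x))) \<le> real (Suc T) * \<eta> \<and>
   real (Suc T) * (log 2 (real A1) - c) \<le> wavg T I w0 (\<lambda>w w'. cond_ent (blk w w') (\<lambda>x. fst (fst (fst x))) (\<lambda>x. map Zf (snd x))) \<and>
   wavg T I w0 (\<lambda>w w'. cond_ent (blk w w') (\<lambda>x. fst (fst x)) (\<lambda>x. (fst (fst (fst x)), map Zf (snd x)))) \<le> real (Suc T) * c \<and>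
   real (Suc T) * (log 2 (real A2) - c) \<le> wavg T I w0 (\<lambda>w w'. cond_ent (blk w w') (\<lambda>x. fst (snd (fst x))) (\<lambda>x. map Yf (snd x))) \<and>
   wavg T I w0 (\<lambda>w w'. cond_ent (blk w w') (\<lambda>x. snd (fst x)) (\<lambda>x. (fst (snd (fst x)), map Yf (snd x)))) \<le> real (Suc T) * c)"

text \<open>For receiver \<open>i\<close> there are \<open>Ai\<close> secret parts, \<open>Qi\<close> values for the public part together with the dummy,
  and \<open>Li\<close> codewords per message for the binning; \<open>C\<close> is the number of cloud indices.\<close>

definition "size_ok s n A1 Q1 L1 A2 Q2 L2 (C::nat) \<longleftrightarrow>
  0 < A1 \<and> 0 < Q1 \<and> 0 < L1 \<and> 0 < A2 \<and> 0 < Q2 \<and> 0 < L2 \<and>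
  2 powr (real n * (I12 + 2 * s)) \<le> real L1 * real L2 \<and>
  2 powr (real n * (3 * s)) \<le> 2 * real L1 \<and> 2 powr (real n * (3 * s)) \<le> 2 * real L2 \<and>
  real L1 * real L2 * real (A1 * Q1 * L1) \<le> 2 powr (real n * (I12 + I1 - 3 * s)) \<and>
  real L1 * real L2 * real (A2 * Q2 * L2) \<le> 2 powr (real n * (I12 + I2 - 3 * s)) \<and>
  real L1 * real L2 * real (Q1 * L1) \<le> 2 powr (real n * (I12 + J1 + 10 * s)) \<and>
  real L1 * real L2 * real (Q2 * L2) \<le> 2 powr (real n * (I12 + J2 + 10 * s)) \<and>
  real L2 * 2 powr (real n * (leak1 - 4 * s)) \<le> real Q1 \<and>
  real L1 * 2 powr (real n * (leak2 - 4 * s)) \<le> real Q2 \<and>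
  real (A1 * Q1 * L1) \<le> 2 powr (real n * I1) \<and> real (A2 * Q2 * L2) \<le> 2 powr (real n * I2) \<and>
  real C - 1 \<le> 2 powr (real n * (min IR (min IY IZ) - 2 * s))"

text \<open>How large \<open>n\<close> must be depends on \<open>s\<close> and \<open>\<eta>\<close>
  alone: the sizes enter only through \<open>size_ok\<close>, the horizon \<open>T\<close> only
  through averages. This uniformity lets the sizes be chosen as functions of
  \<open>n\<close>.\<close>

lemma block_code_exists:
  assumes s: "0 < s" and \<eta>: "0 < \<eta>"
  shows "\<forall>\<^sub>F n in sequentially. \<forall>A1 Q1 L1 A2 Q2 L2 T (I :: 'i set) w0.
    size_ok s n A1 Q1 L1 A2 Q2 L2 (card I) \<longrightarrow> finite I \<longrightarrow> w0 \<in> I \<longrightarrow>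
    (\<exists>xw uw en de1 de2. block_code s n I w0 T A1 Q1 A2 Q2 (20 * real n * s) \<eta> xw uw en de1 de2)"
proof -
  define BB where "BB = log 2 (CARD('y)) + log 2 (CARD('z)) + 2 * I1 + 2 * I2"
  have BB: "0 \<le> BB" using leak_nonneg by (simp add: BB_def)
  \<comment> \<open>A cloud word without private code spoils up to \<open>real n * I1\<close> or
    \<open>real n * I2\<close> bits in the entropy bounds; such words are made so rare that the mean
    loss is at most \<open>real n * s\<close>.\<close>
  define \<eta>' where "\<eta>' = min \<eta> (s / (I1 + I2 + 1))"
  have Ipos: "0 < I1 + I2 + 1" using leak_nonneg by simp
  have \<eta>': "0 < \<eta>'" "\<eta>' \<le> \<eta>" "\<eta>' * I1 \<le> s" "\<eta>' * I2 \<le> s"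
  proof -
    show "0 < \<eta>'" "\<eta>' \<le> \<eta>" using s \<eta> Ipos by (auto simp: \<eta>'_def)
    have "\<eta>' * (I1 + I2 + 1) \<le> s"
    proof -
      have "\<eta>' \<le> s / (I1 + I2 + 1)" by (simp add: \<eta>'_def)
      then have "\<eta>' * (I1 + I2 + 1) \<le> s / (I1 + I2 + 1) * (I1 + I2 + 1)"
        using Ipos by (intro mult_right_mono) auto
      then show ?thesis using Ipos by simp
    qed
    moreover have "\<eta>' * I1 \<le> \<eta>' * (I1 + I2 + 1)" "\<eta>' * I2 \<le> \<eta>' * (I1 + I2 + 1)"
      using \<open>0 < \<eta>'\<close> leak_nonneg by (auto intro!: mult_left_mono)
    ultimately show "\<eta>' * I1 \<le> s" "\<eta>' * I2 \<le> s" by auto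
  qed
  \<comment> \<open>The bound \<open>s / (BB + 1)\<close> keeps the \<open>\<delta>\<close> term in
    the loss of \<open>private_code\<close> below \<open>real n * s\<close>. The bound
    \<open>\<eta>' / 30\<close> keeps \<open>9 * \<delta>\<close> below 3/10 of
    \<open>\<eta>'\<close>, next to the 2/3 spent on the cloud.\<close>
  define \<delta> where "\<delta> = min 1 (min (s / (BB + 1)) (\<eta>' / 30))"
  have \<delta>: "0 < \<delta>" "\<delta> \<le> 1" "\<delta> \<le> \<eta>' / 30" "\<delta> * BB \<le> s"
  proof -
    show d: "0 < \<delta>" "\<delta> \<le> 1" "\<delta> \<le> \<eta>' / 30" unfolding \<delta>_def using s \<eta>' BB by (simp_all del: le_divide_eq_numeral1)
    have "\<delta> \<le> s / (BB + 1)" by (simp add: \<delta>_def)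
    then have "\<delta> * (BB + 1) \<le> s" using BB by (simp add: field_simps)
    moreover have "\<delta> * BB \<le> \<delta> * (BB + 1)" using d by (intro mult_left_mono) auto
    ultimately show "\<delta> * BB \<le> s" by simp
  qed
  have "\<forall>\<^sub>F n in sequentially. pexp (seq_pmf (replicate n pt)) (\<lambda>ts. of_bool (\<not> nice (bad s) s \<delta> ts)) \<le> \<eta>' / 3"
    using s \<delta> \<eta>' by (intro nice_eventually bad_eventually) auto
  moreover have "\<forall>\<^sub>F n in sequentially. 2 powr (- (real n * s)) \<le> \<delta> / 50"
    using s \<delta> by (intro eventually_small_powr) auto
  moreover have "\<forall>\<^sub>F n in sequentially. 2 powr (- (real n * s)) \<le> \<eta>' / 9"
    using s \<eta>' by (intro eventually_small_powr) auto
  moreover have "\<forall>\<^sub>F n in sequentially. real n \<ge> 10 / s"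
    using filterlim_real_sequentially[unfolded filterlim_at_top, rule_format, of "10 / s"] .
  ultimately show ?thesis
  proof eventually_elim
    case (elim n)
    show ?case
    proof (intro allI impI)
      fix A1 Q1 L1 A2 Q2 L2 T and I :: "'i set" and w0
      assume sz: "size_ok s n A1 Q1 L1 A2 Q2 L2 (card I)" and finI: "finite I" and w0: "w0 \<in> I"
      have neI: "I \<noteq> {}" using w0 by auto
      define U where "U = msgs A1 Q1 A2 Q2"
      have pos: "0 < A1" "0 < Q1" "0 < L1" "0 < A2" "0 < Q2" "0 < L2" using sz by (auto simp: size_ok_def)
      have finU: "finite (set_pmf U)" and setU: "set_pmf U = ({..<A1} \<times> {..<Q1}) \<times> ({..<A2} \<times> {..<Q2})"
        using set_msgs[of A1 Q1 A2 Q2] pos by (auto simp: U_def)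
      have n10: "10 \<le> real n * s" using elim(4) s by (simp add: field_simps)
      define c where "c = 18 * real n * s + 10"
      \<comment> \<open>Membership in the support is added because \<open>private_code\<close> needs
        the right length and letters of positive probability; it holds almost surely for random
        cloud words.\<close>
      define nic where "nic = (\<lambda>ts. nice (bad s) s \<delta> ts \<and> ts \<in> set_pmf (seq_pmf (replicate n pt)))"
      have priv: "\<exists>en de1 de2. good_code (bad s) (3 * \<delta>) c A1 Q1 A2 Q2 ts en de1 de2" if "nic ts" for ts
      proof -
        have ts: "length ts = n" "set ts \<subseteq> set_pmf pt" "nice (bad s) s \<delta> ts"
          using that by (simp_all add: nic_def set_seq_replicate)
        have "\<exists>en de1 de2. good_code (bad s) (3 * \<delta>) (17 * real n * s + 10 + real n * \<delta> * (log 2 (CARD('y)) + log 2 (CARD('z)) + 2 * I1 + 2 * I2)) A1 Q1 A2 Q2 ts en de1 de2"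
          by (rule private_code[OF ts s \<delta>(1,2), where ?L1.0=L1 and ?L2.0=L2]) (use sz elim(2) in \<open>simp_all add: size_ok_def\<close>)
        then obtain en de1 de2 where gc: "good_code (bad s) (3 * \<delta>) (17 * real n * s + 10 + real n * \<delta> * (log 2 (CARD('y)) + log 2 (CARD('z)) + 2 * I1 + 2 * I2)) A1 Q1 A2 Q2 ts en de1 de2" by blast
        have "real n * (\<delta> * BB) \<le> real n * s" using \<delta>(4) by (intro mult_left_mono) auto
        then have "17 * real n * s + 10 + real n * \<delta> * (log 2 (CARD('y)) + log 2 (CARD('z)) + 2 * I1 + 2 * I2) \<le> c"
          unfolding BB_def[symmetric] c_def by (simp add: algebra_simps)
        then have "good_code (bad s) (3 * \<delta>) c A1 Q1 A2 Q2 ts en de1 de2"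
          using gc unfolding good_code_def Let_def by (auto intro: order_trans diff_left_mono)
        then show ?thesis by blast
      qed
      then obtain EN DE1 DE2 where EN: "\<And>ts. nic ts \<Longrightarrow> good_code (bad s) (3 * \<delta>) c A1 Q1 A2 Q2 ts (EN ts) (DE1 ts) (DE2 ts)"
        by metis
      \<comment> \<open>Over a cloud word without private code a default word is sent, of the right
        length, so that the length condition holds for all cloud words.\<close>
      define en where "en = (\<lambda>ts m. if nic ts then EN ts m else replicate (length ts) (undefined, undefined))"
      have len: "length (en ts m) = length ts" for ts m
      proof (cases "nic ts")
        case True
        have "\<forall>m. length (EN ts m) = length ts" using EN[OF True] unfolding good_code_def by (rule conjunct1)
        then show ?thesis unfolding en_def if_P[OF True] by (rule spec)
      qed (simp add: en_def)
      have gc: "good_code (bad s) (3 * \<delta>) c A1 Q1 A2 Q2 ts (en ts) (DE1 ts) (DE2 ts)" if "nic ts" for ts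
      proof -
        have "en ts = EN ts" using that by (auto simp: en_def)
        then show ?thesis using EN[OF that] by simp
      qed
      \<comment> \<open>The private codes are fixed as functions of the cloud word before the cloud
        code is drawn, so the random cloud argument can treat them as part of the channel.\<close>
      define out where "out = (\<lambda>ts. map_pmf snd (blaw U ts (en ts)))"
      have finB: "finite (set_pmf (blaw U ts e))" for ts e using finU by (auto simp: blaw_def)
      have finout: "finite (set_pmf (out ts))" for ts using finB by (simp add: out_def)
      define CB where "CB = Pi_pmf I undefined (\<lambda>_. crow n I)"
      have finCB: "finite (set_pmf CB)" unfolding CB_def using finI finite_crow by (intro finite_set_Pi_pmf) auto
      define ce where "ce = (\<lambda>cb w w'. cloud_err s nic out I cb w w')"
      have Ece: "pexp CB (\<lambda>cb. ce cb w w') \<le> \<eta>' * (2 / 3)" if ww: "w \<in> I" "w' \<in> I" for w w'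
      proof -
        let ?M = "min IR (min IY IZ)"
        have b: "2 powr (- (real n * (X - s))) \<le> 2 powr (- (real n * (?M - s)))" if "?M \<le> X" for X
          using that by (intro powr_mono) (auto intro!: mult_left_mono)
        have C0: "0 \<le> real (card I) - 1" using ww finI by (simp add: Suc_leI card_gt_0_iff) (metis One_nat_def Suc_leI card_gt_0_iff empty_iff)
        have "pexp CB (\<lambda>cb. ce cb w w') \<le> pexp (seq_pmf (replicate n pt)) (\<lambda>ts. of_bool (\<not> nic ts)) +
          (real (card I) - 1) * (2 powr (- (real n * (IY - s))) + 2 powr (- (real n * (IZ - s))) + 2 powr (- (real n * (IR - s))))"
          unfolding CB_def ce_def by (rule cloud_err_expectation[OF finI ww finout])
        also have "pexp (seq_pmf (replicate n pt)) (\<lambda>ts. of_bool (\<not> nic ts)) = pexp (seq_pmf (replicate n pt)) (\<lambda>ts. of_bool (\<not> nice (bad s) s \<delta> ts))"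
          by (intro pexp_cong) (simp add: nic_def)
        also have "\<dots> \<le> \<eta>' / 3" by (rule elim(1))
        also have "(real (card I) - 1) * (2 powr (- (real n * (IY - s))) + 2 powr (- (real n * (IZ - s))) + 2 powr (- (real n * (IR - s))))
          \<le> 2 powr (real n * (?M - 2 * s)) * (2 powr (- (real n * (?M - s))) + 2 powr (- (real n * (?M - s))) + 2 powr (- (real n * (?M - s))))"
          using sz C0 unfolding size_ok_def by (intro mult_mono add_mono b) auto
        also have "\<dots> = 3 * 2 powr (- (real n * s))"
          by (simp add: powr_add[symmetric] distrib_left algebra_simps)
        also have "\<dots> \<le> \<eta>' / 3" using elim(3) by simp
        finally show ?thesis by simp
      qed
      have "pexp CB (\<lambda>cb. wavg T I w0 (ce cb)) \<le> real (Suc T) * \<eta>' * (2 / 3)"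
      proof -
        have "pexp CB (\<lambda>cb. wavg T I w0 (ce cb)) = wavg T I w0 (\<lambda>w w'. pexp CB (\<lambda>cb. ce cb w w'))"
        proof -
          have sl: "pexp CB (\<lambda>cb. \<Sum>p\<leftarrow>ps. ce cb (fst p) (snd p)) = (\<Sum>p\<leftarrow>ps. pexp CB (\<lambda>cb. ce cb (fst p) (snd p)))" for ps
            using finCB by (induction ps) (auto simp: pexp_add pexp_const)
          show ?thesis unfolding wavg_def by (subst pexp_commute) (simp only: sl)
        qed
        also have "\<dots> \<le> wavg T I w0 (\<lambda>w w'. \<eta>' * (2 / 3) + 0 * 0)"
          using Ece by (intro wavg_mono finI neI w0) auto
        also have "\<dots> = real (Suc T) * \<eta>' * (2 / 3)" by (subst wavg_affine[OF finI neI]) simp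
        finally show ?thesis .
      qed
      then obtain cb where cb: "cb \<in> set_pmf CB" "wavg T I w0 (ce cb) \<le> real (Suc T) * \<eta>' * (2 / 3)"
        using pexp_ex_le[OF finCB, of "\<lambda>cb. wavg T I w0 (ce cb)"] by force
      define xw where "xw = (\<lambda>w. fst (cb w))"
      define uw where "uw = (\<lambda>w. snd (cb w))"
      define cl where "cl = (\<lambda>w w'. zip (uw w w') (xw w))"
      have cl: "cloud cb w w' = cl w w'" for w w' by (simp add: cloud_def cl_def uw_def xw_def)
      define blk where "blk = (\<lambda>w w'. blaw U (cl w w') (en (cl w w')))"
      have blk_eq: "blaw U (cl w w') (en (cl w w')) = blk w w'" for w w' by (simp add: blk_def)
      have finblk: "finite (set_pmf (blk w w'))" for w w' by (simp add: blk_def finB)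
      have ce_eq: "ce cb w w' = of_bool (\<not> nic (cl w w')) + pexp (blk w w') (\<lambda>x.
         (\<Sum>v\<in>I - {w}. of_bool (tauY s (cl v w') (map Yf (snd x)))) +
         (\<Sum>v\<in>I - {w}. of_bool (tauZ s (cl v w') (map Zf (snd x)))) +
         (\<Sum>v\<in>I - {w'}. of_bool (tauR s (xw w) (uw w v) (map Y1f (snd x)))))" for w w'
        unfolding ce_def cloud_err_def out_def cl blk_def by (simp add: pexp_map finB xw_def uw_def)
      have cenn: "of_bool (\<not> nic (cl w w')) \<le> ce cb w w'" for w w'
        unfolding ce_eq by (auto intro!: pexp_nonneg add_nonneg_nonneg sum_nonneg)
      have err: "pexp (blk w w') (\<lambda>x. of_bool (\<not> block_ok s I xw uw DE1 DE2 w w' x)) \<le> 9 * \<delta> + 1 * ce cb w w'" for w w'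
      proof (cases "nic (cl w w')")
        case False
        have "pexp (blk w w') (\<lambda>x. of_bool (\<not> block_ok s I xw uw DE1 DE2 w w' x) :: real) \<le> 1"
          by (rule pexp_le_const[OF finblk]) simp
        then show ?thesis using cenn[of w w'] False \<delta> by simp
      next
        case True
        note g = gc[OF True, unfolded good_code_def Let_def U_def[symmetric] blk_eq]
        have "pexp (blk w w') (\<lambda>x. of_bool (\<not> block_ok s I xw uw DE1 DE2 w w' x)) \<le> pexp (blk w w') (\<lambda>x.
           of_bool (bad s (cl w w') (snd x)) + of_bool (DE1 (cl w w') (map Yf (snd x)) \<noteq> fst (fst x)) + of_bool (DE2 (cl w w') (map Zf (snd x)) \<noteq> snd (fst x)) +
           ((\<Sum>v\<in>I - {w}. of_bool (tauY s (cl v w') (map Yf (snd x)))) +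
         (\<Sum>v\<in>I - {w}. of_bool (tauZ s (cl v w') (map Zf (snd x)))) +
         (\<Sum>v\<in>I - {w'}. of_bool (tauR s (xw w) (uw w v) (map Y1f (snd x))))))"
        proof (rule pexp_mono)
          fix x :: "((nat \<times> nat) \<times> nat \<times> nat) \<times> 'o list"
          have sge: "1 \<le> (\<Sum>v\<in>S. of_bool (Q v) :: real)" if "v \<in> S" "Q v" "finite S" for v S and Q :: "'i \<Rightarrow> bool"
            using member_le_sum[of v S "\<lambda>v. of_bool (Q v) :: real"] that by simp
          have sge': "\<exists>v\<in>S. Q v \<Longrightarrow> finite S \<Longrightarrow> 1 \<le> (\<Sum>v\<in>S. of_bool (Q v) :: real)" for S and Q :: "'i \<Rightarrow> bool"
            using sge by blast
          have snn: "0 \<le> (\<Sum>v\<in>S. of_bool (Q v) :: real)" for S and Q :: "'i \<Rightarrow> bool" by (rule sum_nonneg) simp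
          define SY where "SY = (\<Sum>v\<in>I - {w}. of_bool (tauY s (cl v w') (map Yf (snd x))) :: real)"
          define SZ where "SZ = (\<Sum>v\<in>I - {w}. of_bool (tauZ s (cl v w') (map Zf (snd x))) :: real)"
          define SR where "SR = (\<Sum>v\<in>I - {w'}. of_bool (tauR s (xw w) (uw w v) (map Y1f (snd x))) :: real)"
          define X where "X = (of_bool (bad s (cl w w') (snd x)) + of_bool (DE1 (cl w w') (map Yf (snd x)) \<noteq> fst (fst x)) + of_bool (DE2 (cl w w') (map Zf (snd x)) \<noteq> snd (fst x)) :: real)"
          have X0: "0 \<le> X" by (simp add: X_def)
          have S0: "0 \<le> SY" "0 \<le> SZ" "0 \<le> SR" unfolding SY_def SZ_def SR_def by (rule snn)+
          have S1: "\<exists>v\<in>I - {w}. tauY s (cl v w') (map Yf (snd x)) \<Longrightarrow> 1 \<le> SY"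
            "\<exists>v\<in>I - {w}. tauZ s (cl v w') (map Zf (snd x)) \<Longrightarrow> 1 \<le> SZ"
            "\<exists>v\<in>I - {w'}. tauR s (xw w) (uw w v) (map Y1f (snd x)) \<Longrightarrow> 1 \<le> SR"
            unfolding SY_def SZ_def SR_def by (rule sge', assumption, rule finite_Diff, rule finI)+
          have main: "of_bool (\<not> block_ok s I xw uw DE1 DE2 w w' x) \<le> X + (SY + SZ + SR)"
          proof (cases "block_ok s I xw uw DE1 DE2 w w' x")
            case True
            then show ?thesis using S0 X0 by simp
          next
            case nok: False

            from nok consider "bad s (cl w w') (snd x)" | "DE1 (cl w w') (map Yf (snd x)) \<noteq> fst (fst x)" | "DE2 (cl w w') (map Zf (snd x)) \<noteq> snd (fst x)"
              | "\<exists>v\<in>I - {w}. tauY s (cl v w') (map Yf (snd x))" | "\<exists>v\<in>I - {w}. tauZ s (cl v w') (map Zf (snd x))"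
              | "\<exists>v\<in>I - {w'}. tauR s (xw w) (uw w v) (map Y1f (snd x))"
              unfolding block_ok_def cl_def by blast
            then have "1 \<le> X + (SY + SZ + SR)"
            proof cases
              case 4
              then show ?thesis using S1(1) S0 X0 by auto
            next
              case 5
              then show ?thesis using S1(2) S0 X0 by auto
            next
              case 6
              then show ?thesis using S1(3) S0 X0 by auto
            qed (use S0 in \<open>auto simp: X_def\<close>)
            then show ?thesis using nok by simp
          qed
          show "(of_bool (\<not> block_ok s I xw uw DE1 DE2 w w' x) :: real) \<le>
           of_bool (bad s (cl w w') (snd x)) + of_bool (DE1 (cl w w') (map Yf (snd x)) \<noteq> fst (fst x)) + of_bool (DE2 (cl w w') (map Zf (snd x)) \<noteq> snd (fst x)) +
           ((\<Sum>v\<in>I - {w}. of_bool (tauY s (cl v w') (map Yf (snd x)))) +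
         (\<Sum>v\<in>I - {w}. of_bool (tauZ s (cl v w') (map Zf (snd x)))) +
         (\<Sum>v\<in>I - {w'}. of_bool (tauR s (xw w) (uw w v) (map Y1f (snd x)))))"
            using main unfolding X_def SY_def SZ_def SR_def .
        qed
        also have "\<dots> \<le> 9 * \<delta> + 1 * ce cb w w'"
          unfolding ce_eq pexp_add[of "blk w w'" "\<lambda>x. of_bool (bad s (cl w w') (snd x)) + of_bool (DE1 (cl w w') (map Yf (snd x)) \<noteq> fst (fst x)) + of_bool (DE2 (cl w w') (map Zf (snd x)) \<noteq> snd (fst x))"]
          using g True by (simp add: pexp_add)
        finally show ?thesis .
      qed
      have lA: "log 2 (real (A1 * Q1)) \<le> real n * I1" "log 2 (real A1) \<le> real n * I1" "log 2 (real (A2 * Q2)) \<le> real n * I2" "log 2 (real A2) \<le> real n * I2"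
        using sz log_prod_le[of A1 Q1 L1 "real n * I1"] log_prod_le[of A2 Q2 L2 "real n * I2"] by (auto simp: size_ok_def)
      have nI: "0 \<le> real n * I1" "0 \<le> real n * I2" using leak_nonneg by auto
      have cen: "0 \<le> (real n * X) * ce cb w w'" "\<not> nic (cl w w') \<Longrightarrow> real n * X \<le> (real n * X) * ce cb w w'" if "0 \<le> real n * X" for X w w'
      proof -
        have "(real n * X) * of_bool (\<not> nic (cl w w')) \<le> (real n * X) * ce cb w w'" by (intro mult_left_mono cenn that)
        then show "0 \<le> (real n * X) * ce cb w w'" "\<not> nic (cl w w') \<Longrightarrow> real n * X \<le> (real n * X) * ce cb w w'"
          using that by (cases "nic (cl w w')"; simp)+
      qed
      have c0: "0 \<le> c" using s by (simp add: c_def)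
      \<comment> \<open>Over a cloud word without private code \<open>ce cb w w'\<close> is at least
        1; the left side is then at most 0 and the bound is trivial. \<open>up_gen\<close> uses the
        same device with the maximal entropy.\<close>
      have lo_gen: "(log 2 (real A) - c) + (- (real n * X)) * ce cb w w' \<le> G"
        if "nic (cl w w') \<Longrightarrow> log 2 (real A) - c \<le> G" "0 \<le> G" "log 2 (real A) \<le> real n * X" "0 \<le> real n * X" for A X G w w'
        using that(1-3) cen[OF that(4), of w w'] c0 by (cases "nic (cl w w')") auto
      have up_gen: "G \<le> c + (real n * X) * ce cb w w'"
        if "nic (cl w w') \<Longrightarrow> G \<le> c" "G \<le> real n * X" "0 \<le> real n * X" for X G w w'
        using that(1-2) cen[OF that(3), of w w'] c0 by (cases "nic (cl w w')") auto
      note gcs = gc[unfolded good_code_def Let_def U_def[symmetric], of "cl _ _", unfolded blk_eq]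
      have lo1: "(log 2 (real A1) - c) + (- (real n * I1)) * ce cb w w' \<le> cond_ent (blk w w') (\<lambda>x. fst (fst (fst x))) (\<lambda>x. map Zf (snd x))"
        and lo2: "(log 2 (real A2) - c) + (- (real n * I2)) * ce cb w w' \<le> cond_ent (blk w w') (\<lambda>x. fst (snd (fst x))) (\<lambda>x. map Yf (snd x))" for w w'
        by (rule lo_gen[OF _ cond_ent_nonneg[OF finblk]]; use gcs lA nI in simp)+
      have card_le: "cond_ent (blk w w') (\<lambda>x. fst (fst x)) B \<le> real n * I1" "cond_ent (blk w w') (\<lambda>x. snd (fst x)) B' \<le> real n * I2"
        for w w' and B :: "_ \<Rightarrow> 'b1" and B' :: "_ \<Rightarrow> 'b2"
      proof -
        have supp: "fst x \<in> set_pmf U" if "x \<in> set_pmf (blk w w')" for x using that by (auto simp: blk_def blaw_def)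
        have "cond_ent (blk w w') (\<lambda>x. fst (fst x)) B \<le> log 2 (card ({..<A1} \<times> {..<Q1}))"
          "cond_ent (blk w w') (\<lambda>x. snd (fst x)) B' \<le> log 2 (card ({..<A2} \<times> {..<Q2}))"
          using supp setU by (intro cond_ent_le_log_card[OF finblk]; force)+
        then show "cond_ent (blk w w') (\<lambda>x. fst (fst x)) B \<le> real n * I1" "cond_ent (blk w w') (\<lambda>x. snd (fst x)) B' \<le> real n * I2"
          using lA by simp_all
      qed
      have up1: "cond_ent (blk w w') (\<lambda>x. fst (fst x)) (\<lambda>x. (fst (fst (fst x)), map Zf (snd x))) \<le> c + (real n * I1) * ce cb w w'"
        and up2: "cond_ent (blk w w') (\<lambda>x. snd (fst x)) (\<lambda>x. (fst (snd (fst x)), map Yf (snd x))) \<le> c + (real n * I2) * ce cb w w'" for w w'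
        by (rule up_gen[OF _ card_le(1)] up_gen[OF _ card_le(2)]; use gcs nI in simp)+
      have slack: "real n * X * wavg T I w0 (ce cb) \<le> real (Suc T) * (real n * s)" if "0 \<le> X" "\<eta>' * X \<le> s" for X
      proof -
        have "real n * X * wavg T I w0 (ce cb) \<le> real n * X * (real (Suc T) * \<eta>' * (2 / 3))"
          using cb(2) that by (intro mult_left_mono) auto
        also have "\<dots> \<le> real (Suc T) * (real n * (\<eta>' * X))"
        proof -
          have "0 \<le> real (Suc T) * (real n * (\<eta>' * X))" using that \<eta>' by simp
          then have "real (Suc T) * (real n * (\<eta>' * X)) * (2 / 3) \<le> real (Suc T) * (real n * (\<eta>' * X))" by linarith
          moreover have "real n * X * (real (Suc T) * \<eta>' * (2 / 3)) = real (Suc T) * (real n * (\<eta>' * X)) * (2 / 3)" by (simp only: mult_ac)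
          ultimately show ?thesis by linarith
        qed
        also have "\<dots> \<le> real (Suc T) * (real n * s)" using that by (intro mult_left_mono) auto
        finally show ?thesis .
      qed
      \<comment> \<open>18 and 1 times \<open>real n * s\<close>, plus the constant 10, which
        \<open>n10\<close> bounds by one more \<open>real n * s\<close>.\<close>
      have cc: "c + real n * s \<le> 20 * real n * s" using n10 unfolding c_def mult.assoc by linarith
      have r1: "wavg T I w0 (\<lambda>w w'. pexp (blk w w') (\<lambda>x. of_bool (\<not> block_ok s I xw uw DE1 DE2 w w' x))) \<le> real (Suc T) * \<eta>"
      proof -
        have "wavg T I w0 (\<lambda>w w'. pexp (blk w w') (\<lambda>x. of_bool (\<not> block_ok s I xw uw DE1 DE2 w w' x))) \<le> wavg T I w0 (\<lambda>w w'. 9 * \<delta> + 1 * ce cb w w')"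
          by (intro wavg_mono finI neI w0 err)
        also have "\<dots> = real (Suc T) * (9 * \<delta>) + 1 * wavg T I w0 (ce cb)" by (rule wavg_affine[OF finI neI])
        also have "\<dots> \<le> real (Suc T) * (9 * (\<eta>' / 30)) + real (Suc T) * \<eta>' * (2 / 3)"
          using cb(2) \<delta>(3) by (intro add_mono mult_left_mono) auto
        also have "real (Suc T) * (9 * (\<eta>' / 30)) = (real (Suc T) * \<eta>') * (3 / 10)" by simp
        also have "(real (Suc T) * \<eta>') * (3 / 10) + real (Suc T) * \<eta>' * (2 / 3) \<le> real (Suc T) * \<eta>'"
          using mult_nonneg_nonneg[of "real (Suc T)" \<eta>'] \<eta>'(1) by linarith
        also have "\<dots> \<le> real (Suc T) * \<eta>" using \<eta>' by (intro mult_left_mono) auto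
        finally show ?thesis .
      qed
      have lo: "real (Suc T) * (log 2 (real A) - 20 * real n * s) \<le> wavg T I w0 G"
        if G: "\<And>w w'. (log 2 (real A) - c) + (- (real n * X)) * ce cb w w' \<le> G w w'" and X: "0 \<le> X" "\<eta>' * X \<le> s" for A X G
      proof -
        have "wavg T I w0 (\<lambda>w w'. (log 2 (real A) - c) + (- (real n * X)) * ce cb w w') \<le> wavg T I w0 G"
          by (intro wavg_mono finI neI w0 G)
        then have 1: "real (Suc T) * (log 2 (real A) - c) + (- (real n * X)) * wavg T I w0 (ce cb) \<le> wavg T I w0 G"
          by (simp only: wavg_affine[OF finI neI])
        have "real (Suc T) * (log 2 (real A) - 20 * real n * s) \<le> real (Suc T) * (log 2 (real A) - c - real n * s)"
          using cc by (intro mult_left_mono) auto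
        also have "\<dots> = real (Suc T) * (log 2 (real A) - c) - real (Suc T) * (real n * s)" by (simp only: right_diff_distrib)
        finally show ?thesis using 1[unfolded mult_minus_left] slack[OF X] by linarith
      qed
      have up: "wavg T I w0 G \<le> real (Suc T) * (20 * real n * s)"
        if G: "\<And>w w'. G w w' \<le> c + (real n * X) * ce cb w w'" and X: "0 \<le> X" "\<eta>' * X \<le> s" for X G
      proof -
        have "wavg T I w0 G \<le> wavg T I w0 (\<lambda>w w'. c + (real n * X) * ce cb w w')"
          by (intro wavg_mono finI neI w0 G)
        then have 1: "wavg T I w0 G \<le> real (Suc T) * c + (real n * X) * wavg T I w0 (ce cb)"
          by (simp only: wavg_affine[OF finI neI])
        have "real (Suc T) * (c + real n * s) \<le> real (Suc T) * (20 * real n * s)"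
          using cc by (intro mult_left_mono) auto
        then show ?thesis using 1 slack[OF X] by (simp only: distrib_left)
      qed
      have lens: "length (xw w) = n" "length (uw w w') = n" if "w \<in> I" "w' \<in> I" for w w'
        using length_cloud[OF finI cb(1)[unfolded CB_def] that] by (auto simp: xw_def uw_def)
      have "block_code s n I w0 T A1 Q1 A2 Q2 (20 * real n * s) \<eta> xw uw en DE1 DE2"
        unfolding block_code_def Let_def U_def[symmetric] cl_def[symmetric, THEN fun_cong, THEN fun_cong] blk_def[symmetric, THEN fun_cong, THEN fun_cong]
        using lens w0 len r1 lo[OF lo1 leak_nonneg(3) \<eta>'(3)] lo[OF lo2 leak_nonneg(4) \<eta>'(4)] up[OF up1 leak_nonneg(3) \<eta>'(3)] up[OF up2 leak_nonneg(4) \<eta>'(4)]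
        unfolding cl_def blk_def by (auto simp: U_def)
      then show "\<exists>xw uw en de1 de2. block_code s n I w0 T A1 Q1 A2 Q2 (20 * real n * s) \<eta> xw uw en de1 de2" by blast
    qed
  qed
qed

end

subsection \<open>Running a deterministic relay\<close>

lemma pmf_seq_nth:
  "pmf (seq_pmf ps) xs = (if length xs = length ps then \<Prod>i<length ps. pmf (ps ! i) (xs ! i) else 0)"
proof (cases "length xs = length ps")
  case True
  then show ?thesis
  proof (induction xs ps rule: list_induct2)
    case (Cons x xs p ps)
    then show ?case
      by (simp add: pmf_seq_pmf_Cons prod.lessThan_Suc_shift del: seq_pmf.simps(2) prod.lessThan_Suc)
  qed simp
qed (simp add: pmf_seq_pmf_length)

lemma pexp_seq_prod_nth:
  assumes "\<And>a. finite (set_pmf (f a))"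
  shows "pexp (seq_pmf (map f as)) (\<lambda>xs. \<Prod>i<length as. g i (xs ! i)) = (\<Prod>i<length as. pexp (f (as ! i)) (g i))"
proof (induction as arbitrary: g)
  case (Cons a as)
  have "pexp (seq_pmf (map f (a # as))) (\<lambda>xs. \<Prod>i<length (a # as). g i (xs ! i))
    = pexp (f a) (\<lambda>x. pexp (seq_pmf (map f as)) (\<lambda>xs. g 0 x * (\<Prod>i<length as. g (Suc i) (xs ! i))))"
    unfolding list.map using assms
    by (subst pexp_seq_Cons) (auto simp: prod.lessThan_Suc_shift simp del: prod.lessThan_Suc)
  also have "\<dots> = pexp (f a) (g 0) * (\<Prod>i<length as. pexp (f (as ! i)) (g (Suc i)))"
    by (simp only: pexp_cmult Cons.IH[of "\<lambda>i. g (Suc i)"] pexp_cmultr)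
  also have "\<dots> = (\<Prod>i<length (a # as). pexp (f ((a # as) ! i)) (g i))"
    by (simp add: prod.lessThan_Suc_shift del: prod.lessThan_Suc)
  finally show ?case .
qed simp

text \<open>The channel with feedback through a deterministic relay. Only outputs are recorded,
  since the relay letters are functions of them.\<close>

primrec orun :: "('a \<Rightarrow> 'h \<Rightarrow> 'o pmf) \<Rightarrow> (nat \<Rightarrow> 'o list \<Rightarrow> 'h) \<Rightarrow> 'a list \<Rightarrow> nat \<Rightarrow> 'o list pmf" where
  "orun k \<rho> as 0 = return_pmf []"
| "orun k \<rho> as (Suc i) = bind_pmf (orun k \<rho> as i) (\<lambda>os. map_pmf (\<lambda>ou. os @ [ou]) (k (as ! i) (\<rho> i os)))"

lemma length_orun: "os \<in> set_pmf (orun k \<rho> as N) \<Longrightarrow> length os = N"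
  by (induction N arbitrary: os) auto

lemma finite_orun: "(\<And>a h. finite (set_pmf (k a h))) \<Longrightarrow> finite (set_pmf (orun k \<rho> as N))"
  by (induction N) auto

lemma pmf_bind_snoc:
  "pmf (bind_pmf P (\<lambda>xs. map_pmf (\<lambda>x. xs @ [x]) (K xs))) (ys @ [y]) = pmf P ys * pmf (K ys) y"
proof -
  have 1: "pmf (map_pmf (\<lambda>x. xs @ [x]) (K xs)) (ys @ [y]) = of_bool (xs = ys) * pmf (K ys) y" for xs
  proof (cases "xs = ys")
    case True
    then show ?thesis using pmf_map_inj'[of "\<lambda>x. ys @ [x]" "K ys" y] by (simp add: inj_on_def)
  next
    case False
    then have "ys @ [y] \<notin> set_pmf (map_pmf (\<lambda>x. xs @ [x]) (K xs))" by auto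
    then have "pmf (map_pmf (\<lambda>x. xs @ [x]) (K xs)) (ys @ [y]) = 0" by (simp only: set_pmf_iff not_not)
    then show ?thesis using False by simp
  qed
  have "pmf (bind_pmf P (\<lambda>xs. map_pmf (\<lambda>x. xs @ [x]) (K xs))) (ys @ [y]) = measure_pmf.expectation P (\<lambda>xs. of_bool (xs = ys) * pmf (K ys) y)"
    by (simp add: pmf_bind 1)
  also have "\<dots> = (\<Sum>xs\<in>{ys}. pmf P xs *\<^sub>R (of_bool (xs = ys) * pmf (K ys) y))"
    by (rule integral_measure_pmf) auto
  finally show ?thesis by simp
qed

lemma pmf_orun:
  "pmf (orun k \<rho> as N) os = (if length os = N then \<Prod>i<N. pmf (k (as ! i) (\<rho> i (take i os))) (os ! i) else 0)"
proof (cases "length os = N")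
  case True
  then show ?thesis
  proof (induction N arbitrary: os)
    case (Suc N)
    then obtain ys y where os: "os = ys @ [y]" "length ys = N" by (metis length_Suc_conv_rev)
    have "pmf (orun k \<rho> as (Suc N)) os = pmf (orun k \<rho> as N) ys * pmf (k (as ! N) (\<rho> N ys)) y"
      unfolding orun.simps os by (rule pmf_bind_snoc)
    also have "pmf (orun k \<rho> as N) ys = (\<Prod>i<N. pmf (k (as ! i) (\<rho> i (take i ys))) (ys ! i))"
      using Suc.IH[OF os(2)] os(2) by simp
    also have "\<dots> = (\<Prod>i<N. pmf (k (as ! i) (\<rho> i (take i os))) (os ! i))"
      using os by (intro prod.cong) (auto simp: nth_append)
    finally show ?case using os by (simp add: mult.commute nth_append)
  qed simp
next
  case False
  then show ?thesis using length_orun[of os k \<rho> as N] by (auto simp: set_pmf_iff)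
qed

text \<open>For one fixed output word the relay letters are determined. If they are those of
  \<open>hs\<close>, the probability is the product of a memoryless channel; the feedback shows only
  on other output words.\<close>

lemma orun_eq_seq:
  assumes "length as = N" "length hs = N" "\<And>i. i < N \<Longrightarrow> \<rho> i (take i os) = hs ! i"
  shows "pmf (orun k \<rho> as N) os = pmf (seq_pmf (map2 k as hs)) os"
  using assms by (auto simp: pmf_orun pmf_seq_nth intro!: prod.cong)

text \<open>The relay sees outputs only, so for a fixed output word the sum over input words factors
  letter by letter, and a random input letter can be absorbed into the channel in spite of the
  feedback.\<close>

lemma orun_mix:
  fixes f :: "'a \<Rightarrow> 'x::finite pmf"
  shows "bind_pmf (seq_pmf (map f as)) (\<lambda>xs. orun W \<rho> xs (length as)) = orun (\<lambda>a h. bind_pmf (f a) (\<lambda>x. W x h)) \<rho> as (length as)"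
proof (rule pmf_eqI)
  fix os
  show "pmf (bind_pmf (seq_pmf (map f as)) (\<lambda>xs. orun W \<rho> xs (length as))) os = pmf (orun (\<lambda>a h. bind_pmf (f a) (\<lambda>x. W x h)) \<rho> as (length as)) os"
  proof (cases "length os = length as")
    case True
    then show ?thesis
      by (simp add: pmf_bind_eq_pexp pmf_orun pexp_seq_prod_nth[where g="\<lambda>i x. pmf (W x (\<rho> i (take i os))) (os ! i)"])
  next
    case False
    then show ?thesis by (simp add: pmf_bind_eq_pexp pmf_orun pexp_const)
  qed
qed

lemma rbc_run_orun:
  "map_pmf (\<lambda>(x1s, ys, y1s, zs). (ys, y1s, zs)) (rbc_run W (\<lambda>i h. return_pmf (\<rho> i h)) xs N)
   = map_pmf (\<lambda>os. (map fst os, map (\<lambda>ou. fst (snd ou)) os, map (\<lambda>ou. snd (snd ou)) os))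
       (orun W (\<lambda>i os. \<rho> i (map (\<lambda>ou. fst (snd ou)) os)) xs N)"
proof (induction N)
  case (Suc i)
  let ?k = "\<lambda>(ys, y1s, zs). map_pmf (\<lambda>(y, y1, z). (ys @ [y], y1s @ [y1], zs @ [z])) (W (xs ! i) (\<rho> i y1s))"
  have "map_pmf (\<lambda>(x1s, ys, y1s, zs). (ys, y1s, zs)) (rbc_run W (\<lambda>i h. return_pmf (\<rho> i h)) xs (Suc i))
    = bind_pmf (map_pmf (\<lambda>(x1s, ys, y1s, zs). (ys, y1s, zs)) (rbc_run W (\<lambda>i h. return_pmf (\<rho> i h)) xs i)) ?k"
    by (simp add: map_bind_pmf bind_map_pmf bind_return_pmf map_pmf_comp case_prod_unfold)
  also have "\<dots> = map_pmf (\<lambda>os. (map fst os, map (\<lambda>ou. fst (snd ou)) os, map (\<lambda>ou. snd (snd ou)) os))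
       (orun W (\<lambda>i os. \<rho> i (map (\<lambda>ou. fst (snd ou)) os)) xs (Suc i))"
    unfolding Suc by (simp add: map_bind_pmf bind_map_pmf map_pmf_comp case_prod_unfold)
  finally show ?case .
qed simp

subsection \<open>Entropies of many blocks\<close>

lemma pexp_seq_union:
  assumes "\<And>p. p \<in> set ps \<Longrightarrow> finite (set_pmf (k p))"
  shows "pexp (seq_pmf (map k ps)) (\<lambda>xs. of_bool (\<not> list_all2 Q ps xs)) \<le> (\<Sum>p\<leftarrow>ps. pexp (k p) (\<lambda>x. of_bool (\<not> Q p x)))"
  using assms
proof (induction ps)
  case (Cons p ps)
  have fin: "finite (set_pmf (k p))" "finite (set_pmf (seq_pmf (map k ps)))"
    using Cons.prems by (auto intro!: finite_set_seq_pmf)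
  have "pexp (seq_pmf (map k (p # ps))) (\<lambda>xs. of_bool (\<not> list_all2 Q (p # ps) xs))
    = pexp (k p) (\<lambda>x. pexp (seq_pmf (map k ps)) (\<lambda>xs. of_bool (\<not> list_all2 Q (p # ps) (x # xs))))"
    unfolding list.map using Cons.prems by (subst pexp_seq_Cons) auto
  also have "\<dots> \<le> pexp (k p) (\<lambda>x. pexp (seq_pmf (map k ps)) (\<lambda>xs. of_bool (\<not> Q p x) + of_bool (\<not> list_all2 Q ps xs)))"
    by (intro pexp_mono) auto
  also have "\<dots> = pexp (k p) (\<lambda>x. of_bool (\<not> Q p x)) + pexp (seq_pmf (map k ps)) (\<lambda>xs. of_bool (\<not> list_all2 Q ps xs))"
    using fin by (simp only: pexp_add pexp_const)
  also have "\<dots> \<le> (\<Sum>p\<leftarrow>p # ps. pexp (k p) (\<lambda>x. of_bool (\<not> Q p x)))"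
    using Cons by simp
  finally show ?case .
qed simp

lemma cond_ent_const: "finite (set_pmf P) \<Longrightarrow> cond_ent P (\<lambda>_. ()) B = 0"
  unfolding cond_ent_def by (subst ent_inj'[of P "\<lambda>w. ((), B w)" B]) auto

lemma cond_ent_pair_left:
  assumes fin: "finite (set_pmf P)" "finite (set_pmf Q)"
  shows "cond_ent (pair_pmf P Q) (\<lambda>w. A (fst w)) (\<lambda>w. (B (fst w), B' (snd w))) = cond_ent P A B"
proof -
  have "cond_ent (pair_pmf P Q) (\<lambda>w. A (fst w)) (\<lambda>w. (B (fst w), B' (snd w)))
    = cond_ent (pair_pmf P Q) (\<lambda>(x, y). (A x, ())) (\<lambda>(x, y). (B x, B' y))"
    using fin by (intro cond_ent_inj') auto
  also have "\<dots> = cond_ent P A B + cond_ent Q (\<lambda>_. ()) B'"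
    by (rule cond_ent_pair[OF fin])
  finally show ?thesis using fin by (simp add: cond_ent_const)
qed

lemma card_lists_over: "finite S \<Longrightarrow> card {xs. length xs = n \<and> set xs \<subseteq> S} = card S ^ n"
  using card_lists_length_eq[of S n] by (simp add: conj_commute)

lemma finite_lists_over: "finite S \<Longrightarrow> finite {xs. length xs = n \<and> set xs \<subseteq> S}"
  using finite_lists_length_eq[of S n] by (simp add: conj_commute)

text \<open>The output is kept as a list of blocks with a separate padding word \<open>Pp\<close>,
  so that the entropies of the blocks can be added.\<close>

definition ideal_law where
  "ideal_law T I w0 blk Pp = bind_pmf (seq_pmf (replicate T (pmf_of_set I))) (\<lambda>wv. map_pmf (Pair wv)
     (pair_pmf (seq_pmf (map (\<lambda>p. blk (fst p) (snd p)) (wpairs w0 wv))) Pp))"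

text \<open>From below: given the index sequence the blocks are independent, so the entropies of the
  secret parts add. From above: the indices are decodable, the secret parts contribute at most the
  logarithm of their number, and given both, the full block messages contribute the residual entropy
  of each block. \<open>af\<close>, \<open>gf\<close> and \<open>qf\<close> read off the secret
  part, the part without dummy and the full block message of one side.\<close>

lemma multi_entropy:
  fixes blk :: "'i \<Rightarrow> 'i \<Rightarrow> ('m \<times> 'o list) pmf" and Zo :: "'o \<Rightarrow> 'z" and T :: nat and Pp :: "'o list pmf" and w0 :: 'i
  assumes I: "finite I" "w0 \<in> I" and finb: "\<And>w w'. finite (set_pmf (blk w w'))" and finp: "finite (set_pmf Pp)"
    and af: "\<And>m. af m = ha (gf m)" and gf: "\<And>m. gf m = hg (qf m)"
    and SA: "finite SA" "\<And>w w' y. y \<in> set_pmf (blk w w') \<Longrightarrow> af (fst y) \<in> SA"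
  defines "P \<equiv> ideal_law T I w0 blk Pp"
  defines "obs \<equiv> (\<lambda>y. (map (\<lambda>mo. map Zo (snd mo)) (fst (snd y)), map Zo (snd (snd y))))"
  assumes perr: "pexp P (\<lambda>y. of_bool (zdec (obs y) \<noteq> fst y)) \<le> perr"
  shows "wavg T I w0 (\<lambda>w w'. cond_ent (blk w w') (\<lambda>y. af (fst y)) (\<lambda>y. map Zo (snd y)))
      \<le> cond_ent P (\<lambda>y. (map cf (fst y), map (\<lambda>mo. gf (fst mo)) (fst (snd y)))) obs" (is ?lower)
    and "cond_ent P (\<lambda>y. (map cf (fst y), map (\<lambda>mo. gf (fst mo)) (fst (snd y)))) obs
      \<le> real (Suc T) * log 2 (card SA) + (3 + perr * (real T * log 2 (card I)))
        + wavg T I w0 (\<lambda>w w'. cond_ent (blk w w') (\<lambda>y. qf (fst y)) (\<lambda>y. (af (fst y), map Zo (snd y))))" (is ?upper)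
proof -
  have neI: "I \<noteq> {}" using I by auto
  let ?Wd = "seq_pmf (replicate T (pmf_of_set I))"
  let ?S = "\<lambda>wv. seq_pmf (map (\<lambda>p. blk (fst p) (snd p)) (wpairs w0 wv))"
  have finW: "finite (set_pmf ?Wd)" by (rule finite_wv[OF I(1) neI])
  have finS: "finite (set_pmf (?S wv))" for wv by (rule finite_set_seq_pmf) (auto simp: finb)
  have finP: "finite (set_pmf P)" unfolding P_def ideal_law_def using finW finS finp by auto
  define as where "as = (\<lambda>y :: 'i list \<times> ('m \<times> 'o list) list \<times> 'o list. map (\<lambda>mo. af (fst mo)) (fst (snd y)))"
  define qs where "qs = (\<lambda>y :: 'i list \<times> ('m \<times> 'o list) list \<times> 'o list. map (\<lambda>mo. qf (fst mo)) (fst (snd y)))"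
  have inner: "cond_ent P (\<lambda>y. map A (fst (snd y))) (\<lambda>y. (fst y, map B (fst (snd y)), map Zo (snd (snd y))))
      = wavg T I w0 (\<lambda>w w'. cond_ent (blk w w') A B)" for A :: "'m \<times> 'o list \<Rightarrow> 'aa" and B :: "'m \<times> 'o list \<Rightarrow> 'bb"
  proof -
    have "cond_ent P (\<lambda>y. map A (fst (snd y))) (\<lambda>y. (fst y, map B (fst (snd y)), map Zo (snd (snd y))))
      = cond_ent P (\<lambda>(wv, x). map A (fst x)) (\<lambda>(wv, x). (wv, map B (fst x), map Zo (snd x)))"
      by (simp add: case_prod_unfold)
    also have "\<dots> = pexp ?Wd (\<lambda>wv. cond_ent (pair_pmf (?S wv) Pp) (\<lambda>x. map A (fst x)) (\<lambda>x. (map B (fst x), map Zo (snd x))))"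
      unfolding P_def ideal_law_def using finW finS finp by (intro cond_ent_mixture) auto
    also have "\<dots> = pexp ?Wd (\<lambda>wv. cond_ent (?S wv) (map A) (map B))"
      using finS finp by (simp add: cond_ent_pair_left)
    also have "\<dots> = wavg T I w0 (\<lambda>w w'. cond_ent (blk w w') A B)"
      unfolding wavg_def by (intro pexp_cong) (subst cond_ent_seq, auto simp: finb o_def)
    finally show ?thesis .
  qed
  have "wavg T I w0 (\<lambda>w w'. cond_ent (blk w w') (\<lambda>y. af (fst y)) (\<lambda>y. map Zo (snd y)))
    = cond_ent P as (\<lambda>y. (fst y, obs y))"
    unfolding as_def obs_def by (rule inner[symmetric])
  also have "\<dots> \<le> cond_ent P as obs"
    by (rule cond_ent_reduce[OF finP, where g=snd]) simp
  also have "\<dots> \<le> cond_ent P (\<lambda>y. (map cf (fst y), map (\<lambda>mo. gf (fst mo)) (fst (snd y)))) obs"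
    by (rule cond_ent_mono[OF finP, where g="\<lambda>x. map ha (snd x)"]) (simp add: as_def af)
  finally show ?lower .
  have supp: "length (fst y) = T" "set (fst y) \<subseteq> I" "length (fst (snd y)) = Suc T" "set (as y) \<subseteq> SA" if "y \<in> set_pmf P" for y
  proof -
    have w: "fst y \<in> set_pmf ?Wd" and x: "fst (snd y) \<in> set_pmf (?S (fst y))" using that by (auto simp: P_def ideal_law_def)
    show l: "length (fst y) = T" "set (fst y) \<subseteq> I" using wv_support[OF I(1) neI w] by auto
    show lx: "length (fst (snd y)) = Suc T" using length_seq_pmf[OF x] l by simp
    have "af (fst mo) \<in> SA" if mo: "mo \<in> set (fst (snd y))" for mo
    proof -
      obtain i where i: "i < length (fst (snd y))" "mo = fst (snd y) ! i" using mo by (auto simp: in_set_conv_nth)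
      have "mo \<in> set_pmf (blk (fst (wpairs w0 (fst y) ! i)) (snd (wpairs w0 (fst y) ! i)))"
        using x i by (auto simp: set_seq_pmf list_all2_conv_all_nth simp del: length_wpairs)
      then show ?thesis by (rule SA(2))
    qed
    then show "set (as y) \<subseteq> SA" by (auto simp: as_def)
  qed
  have fano: "cond_ent P fst obs \<le> 3 + perr * (real T * log 2 (card I))"
  proof -
    let ?L = "{wv. length wv = T \<and> set wv \<subseteq> I}"
    \<comment> \<open>Fano's inequality, as the list bound with the decoded sequence as only
      candidate and \<open>c = 0\<close>.\<close>
    have "cond_ent P fst obs \<le> 0 + 3 + pexp P (\<lambda>y. of_bool (\<not> (True \<and> fst y \<in> {zdec (obs y)}))) * log 2 (card ?L)"
    proof (rule cond_ent_list_bound[OF finP finite_lists_over[OF I(1)], where L="\<lambda>z. {zdec z}" and W="\<lambda>_. True"])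
      have "card {k \<in> ?L. k \<noteq> fst y \<and> k \<in> {zdec (obs y)}} \<le> 1" for y
        by (rule order_trans[OF card_mono[of "{zdec (obs y)}"]]) auto
      then have "of_bool True * real (card {k \<in> ?L. k \<noteq> fst y \<and> k \<in> {zdec (obs y)}}) \<le> 1" for y
        by (simp add: of_nat_le_1_iff)
      then show "pexp P (\<lambda>y. of_bool True * real (card {k \<in> ?L. k \<noteq> fst y \<and> k \<in> {zdec (obs y)}})) \<le> 2 powr 0"
        by (intro pexp_le_const[OF finP]) auto
    qed (use supp in auto)
    also have "log 2 (card ?L) = real T * log 2 (card I)"
      using I neI by (simp add: card_lists_over log_nat_power card_gt_0_iff)
    also have "pexp P (\<lambda>y. of_bool (\<not> (True \<and> fst y \<in> {zdec (obs y)}))) = pexp P (\<lambda>y. of_bool (zdec (obs y) \<noteq> fst y))"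
      by (intro pexp_cong) auto
    also have "0 + 3 + pexp P (\<lambda>y. of_bool (zdec (obs y) \<noteq> fst y)) * (real T * log 2 (card I)) \<le> 3 + perr * (real T * log 2 (card I))"
      using perr I neI by (simp add: mult_right_mono Suc_leI card_gt_0_iff)
    finally show ?thesis .
  qed
  have "cond_ent P (\<lambda>y. (map cf (fst y), map (\<lambda>mo. gf (fst mo)) (fst (snd y)))) obs \<le> cond_ent P (\<lambda>y. (qs y, (as y, fst y))) obs"
    by (rule cond_ent_mono[OF finP, where g="\<lambda>x. (map cf (snd (snd x)), map hg (fst x))"]) (simp add: qs_def gf)
  also have "\<dots> = cond_ent P (\<lambda>y. (as y, fst y)) obs + cond_ent P qs (\<lambda>y. ((as y, fst y), obs y))"
    by (rule cond_ent_chain[OF finP])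
  also have "cond_ent P (\<lambda>y. (as y, fst y)) obs \<le> cond_ent P fst obs + cond_ent P as obs"
    by (rule cond_ent_subadd[OF finP])
  also have "cond_ent P as obs \<le> log 2 (card {xs. length xs = Suc T \<and> set xs \<subseteq> SA})"
  proof (rule cond_ent_le_log_card[OF finP finite_lists_over[OF SA(1)]])
    show "as ` set_pmf P \<subseteq> {xs. length xs = Suc T \<and> set xs \<subseteq> SA}"
    proof (rule image_subsetI)
      fix y assume w: "y \<in> set_pmf P"
      show "as y \<in> {xs. length xs = Suc T \<and> set xs \<subseteq> SA}"
        using supp(3,4)[OF w] by (simp add: as_def)
    qed
  qed
  also have "log 2 (card {xs. length xs = Suc T \<and> set xs \<subseteq> SA}) = real (Suc T) * log 2 (card SA)"
  proof -
    have "set_pmf (blk w0 w0) \<noteq> {}" by (rule set_pmf_not_empty)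
    then have "card SA > 0" using SA by (auto simp: card_gt_0_iff)
    then show ?thesis unfolding card_lists_over[OF SA(1)] by (subst log_nat_power[symmetric]) auto
  qed
  also have "cond_ent P qs (\<lambda>y. ((as y, fst y), obs y))
    = cond_ent P qs (\<lambda>y. (fst y, map (\<lambda>mo. (af (fst mo), map Zo (snd mo))) (fst (snd y)), map Zo (snd (snd y))))"
  proof (rule cond_ent_inj'[OF finP])
    fix a b
    have "map (\<lambda>mo. (af (fst mo), map Zo (snd mo))) xs = map (\<lambda>mo. (af (fst mo), map Zo (snd mo))) ys \<longleftrightarrow>
      map (\<lambda>mo. af (fst mo)) xs = map (\<lambda>mo. af (fst mo)) ys \<and> map (\<lambda>mo. map Zo (snd mo)) xs = map (\<lambda>mo. map Zo (snd mo)) ys"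
      for xs ys :: "('m \<times> 'o list) list"
      by (auto simp: list_eq_iff_nth_eq)
    then show "(((as a, fst a), obs a) = ((as b, fst b), obs b)) =
       ((fst a, map (\<lambda>mo. (af (fst mo), map Zo (snd mo))) (fst (snd a)), map Zo (snd (snd a))) =
        (fst b, map (\<lambda>mo. (af (fst mo), map Zo (snd mo))) (fst (snd b)), map Zo (snd (snd b))))"
      by (auto simp: as_def obs_def)
  qed simp
  also have "\<dots> = wavg T I w0 (\<lambda>w w'. cond_ent (blk w w') (\<lambda>y. qf (fst y)) (\<lambda>y. (af (fst y), map Zo (snd y))))"
    unfolding qs_def by (rule inner)
  finally show ?upper using fano by linarith
qed

subsection \<open>Block-wise decoding of the cloud indices\<close>

text \<open>The result has one entry more than there are blocks, because a block is tested with the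
  pair of its own and the next index; the last entry is the known \<open>w0\<close>.\<close>

primrec bdec :: "'i \<Rightarrow> ('i \<Rightarrow> 'i \<Rightarrow> 'y \<Rightarrow> bool) \<Rightarrow> 'y list \<Rightarrow> 'i list" where
  "bdec w0 \<tau> [] = [w0]"
| "bdec w0 \<tau> (y # ys) = (SOME w. \<tau> w (hd (bdec w0 \<tau> ys)) y) # bdec w0 \<tau> ys"

primrec fdec :: "('i \<Rightarrow> 'i \<Rightarrow> 'y \<Rightarrow> bool) \<Rightarrow> 'i \<Rightarrow> 'y list \<Rightarrow> 'i" where
  "fdec \<tau> w [] = w"
| "fdec \<tau> w (y # ys) = fdec \<tau> (SOME w'. \<tau> w w' y) ys"

text \<open>The hypotheses speak only of tests with the true next index; induction from the last
  block shows that the decoder makes no others.\<close>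

lemma bdec_correct:
  assumes "length vs = Suc (length ys)" "last vs = w0"
    and "\<And>b. b < length ys \<Longrightarrow> \<tau> (vs ! b) (vs ! Suc b) (ys ! b)"
    and "\<And>b w. b < length ys \<Longrightarrow> \<tau> w (vs ! Suc b) (ys ! b) \<Longrightarrow> w = vs ! b"
  shows "bdec w0 \<tau> ys = vs"
  using assms
proof (induction ys arbitrary: vs)
  case Nil
  then show ?case by (cases vs) auto
next
  case (Cons y ys)
  then obtain v vs' where vs: "vs = v # vs'" "length vs' = Suc (length ys)" by (cases vs) auto
  have IH: "bdec w0 \<tau> ys = vs'"
  proof (rule Cons.IH[OF vs(2)])
    show "last vs' = w0" using Cons.prems(2) vs by (cases vs') auto
    show "\<tau> (vs' ! b) (vs' ! Suc b) (ys ! b)" if "b < length ys" for b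
      using Cons.prems(3)[of "Suc b"] that vs by simp
    show "w = vs' ! b" if "b < length ys" "\<tau> w (vs' ! Suc b) (ys ! b)" for b w
      using Cons.prems(4)[of "Suc b" w] that vs by simp
  qed
  have hd: "hd vs' = vs' ! 0" using vs(2) by (cases vs') auto
  have "(SOME w. \<tau> w (hd vs') y) = v"
  proof (rule some_equality)
    show "\<tau> v (hd vs') y" using Cons.prems(3)[of 0] vs hd by simp
    show "w = v" if "\<tau> w (hd vs') y" for w using Cons.prems(4)[of 0 w] that vs hd by simp
  qed
  then show ?case by (simp add: IH vs)
qed

lemma fdec_correct:
  assumes "length vs = Suc (length ys)"
    and "\<And>b. b < length ys \<Longrightarrow> \<tau> (vs ! b) (vs ! Suc b) (ys ! b)"
    and "\<And>b w. b < length ys \<Longrightarrow> \<tau> (vs ! b) w (ys ! b) \<Longrightarrow> w = vs ! Suc b"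
  shows "fdec \<tau> (vs ! 0) ys = last vs"
  using assms
proof (induction ys arbitrary: vs)
  case Nil
  then show ?case by (cases vs) auto
next
  case (Cons y ys)
  then obtain v vs' where vs: "vs = v # vs'" "length vs' = Suc (length ys)" by (cases vs) auto
  have IH: "fdec \<tau> (vs' ! 0) ys = last vs'"
  proof (rule Cons.IH[OF vs(2)])
    show "\<tau> (vs' ! b) (vs' ! Suc b) (ys ! b)" if "b < length ys" for b
      using Cons.prems(2)[of "Suc b"] that vs by simp
    show "w = vs' ! Suc b" if "b < length ys" "\<tau> (vs' ! b) w (ys ! b)" for b w
      using Cons.prems(3)[of "Suc b" w] that vs by simp
  qed
  have "(SOME w'. \<tau> v w' y) = vs' ! 0"
  proof (rule some_equality)
    show "\<tau> v (vs' ! 0) y" using Cons.prems(2)[of 0] vs by simp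
    show "w = vs' ! 0" if "\<tau> v w y" for w using Cons.prems(3)[of 0 w] that vs by simp
  qed
  moreover have "last vs = last vs'" using vs by (cases vs') auto
  ultimately show ?case using IH vs by simp
qed

definition chunks :: "nat \<Rightarrow> nat \<Rightarrow> 'a list \<Rightarrow> 'a list list" where
  "chunks n b xs = map (\<lambda>k. take n (drop (k * n) xs)) [0..<b]"

lemma length_chunks [simp]: "length (chunks n b xs) = b"
  by (simp add: chunks_def)

lemma chunks_map: "chunks n b (map f xs) = map (map f) (chunks n b xs)"
  by (simp add: chunks_def take_map drop_map o_def)

lemma chunks_concat:
  assumes "\<And>x. x \<in> set xss \<Longrightarrow> length x = n"
  shows "chunks n (length xss) (concat xss @ ys) = xss"
proof (rule nth_equalityI)
  fix k assume "k < length (chunks n (length xss) (concat xss @ ys))"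
  then have k: "k < length xss" by simp
  have "take n (drop (k * n) (concat xss @ ys)) = xss ! k"
    using assms k
  proof (induction xss arbitrary: k)
    case (Cons x xss)
    have lx: "length x = n" using Cons.prems by simp
    show ?case
    proof (cases k)
      case 0
      then show ?thesis using lx by simp
    next
      case (Suc j)
      have "drop (k * n) (concat (x # xss) @ ys) = drop (j * n) (concat xss @ ys)"
        using lx Suc by (simp add: drop_drop[symmetric] add.commute[of n] del: drop_drop)
      then show ?thesis using Cons Suc by simp
    qed
  qed simp
  then show "chunks n (length xss) (concat xss @ ys) ! k = xss ! k" using k by (simp add: chunks_def)
qed simp

text \<open>Causality: blocks completed by time \<open>i\<close> are unaffected by cutting the word
  at \<open>i\<close>.\<close>

lemma chunks_take:
  assumes "b * n \<le> i"
  shows "chunks n b (take i xs) = chunks n b xs"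
  unfolding chunks_def
proof (rule map_cong)
  fix k assume "k \<in> set [0..<b]"
  then have "Suc k \<le> b" by simp
  then have "Suc k * n \<le> b * n" by (rule mult_le_mono1)
  then have "k * n + n \<le> i" using assms by simp
  then show "take n (drop (k * n) (take i xs)) = take n (drop (k * n) xs)"
    by (simp add: drop_take min_def)
qed simp

subsection \<open>Uniform messages from uniform block messages\<close>

lemma disintegrate: "bind_pmf (map_pmf g U) (\<lambda>y. cond_pmf U {x. g x = y}) = U"
proof (rule bind_cond_pmf_cancel)
  fix y assume "y \<in> set_pmf (map_pmf g U)"
  then show "set_pmf U \<inter> {x. g x = y} \<noteq> {}" by auto
next
  fix x assume "x \<in> set_pmf U"
  then show "set_pmf (map_pmf g U) \<inter> {y. g x = y} \<noteq> {}" by auto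
next
  fix y x assume "g x = y"
  have "measure (measure_pmf (map_pmf g U)) {y. g x = y} = measure (measure_pmf U) (g -` {y. g x = y})"
    by (rule measure_map_pmf)
  also have "g -` {y. g x = y} = {x. g x = y}" using \<open>g x = y\<close> by auto
  finally show "measure (measure_pmf U) {x. g x = y} = measure (measure_pmf (map_pmf g U)) {x'. g x = x'}" by simp
qed

text \<open>A message index together with a draw from its fibre is a draw from \<open>U\<close>, and
  the index can be recovered from that draw. Thus message and local randomness of the encoder are
  replaced by the uniform block messages.\<close>

lemma uniform_split:
  assumes gV: "map_pmf g U = map_pmf e V" and inj: "inj_on e (set_pmf V)"
  shows "bind_pmf V (\<lambda>i. bind_pmf (cond_pmf U {x. g x = e i}) (\<lambda>x. F i x)) = bind_pmf U (\<lambda>x. F (inv_into (set_pmf V) e (g x)) x)"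
proof -
  have "bind_pmf U (\<lambda>x. F (inv_into (set_pmf V) e (g x)) x)
    = bind_pmf (bind_pmf (map_pmf g U) (\<lambda>y. cond_pmf U {x. g x = y})) (\<lambda>x. F (inv_into (set_pmf V) e (g x)) x)"
    by (simp only: disintegrate)
  also have "\<dots> = bind_pmf V (\<lambda>i. bind_pmf (cond_pmf U {x. g x = e i}) (\<lambda>x. F (inv_into (set_pmf V) e (g x)) x))"
    unfolding gV by (simp add: bind_assoc_pmf bind_map_pmf)
  also have "\<dots> = bind_pmf V (\<lambda>i. bind_pmf (cond_pmf U {x. g x = e i}) (\<lambda>x. F i x))"
  proof (intro bind_pmf_cong refl)
    fix i x assume i: "i \<in> set_pmf V" and x: "x \<in> set_pmf (cond_pmf U {x. g x = e i})"
    have "e i \<in> set_pmf (map_pmf g U)" using i gV by simp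
    then have "set_pmf U \<inter> {x. g x = e i} \<noteq> {}" by auto
    then have "g x = e i" using x by (simp add: set_cond_pmf)
    then show "F (inv_into (set_pmf V) e (g x)) x = F i x" using i inj by simp
  qed
  finally show ?thesis by simp
qed

lemma pair_pmf_of_set:
  assumes "finite A" "A \<noteq> {}" "finite B" "B \<noteq> {}"
  shows "pair_pmf (pmf_of_set A) (pmf_of_set B) = pmf_of_set (A \<times> B)"
proof (rule pmf_eqI)
  fix x
  have "A \<times> B \<noteq> {}" "finite (A \<times> B)" using assms by auto
  then show "pmf (pair_pmf (pmf_of_set A) (pmf_of_set B)) x = pmf (pmf_of_set (A \<times> B)) x"
    using assms by (cases x) (simp add: pmf_pair indicator_def card_cartesian_product)
qed

lemma seq_pmf_of_set:
  assumes "finite A" "A \<noteq> {}"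
  shows "seq_pmf (replicate n (pmf_of_set A)) = pmf_of_set {xs. length xs = n \<and> set xs \<subseteq> A}"
proof (rule pmf_eqI)
  fix xs
  have ne: "{xs. length xs = n \<and> set xs \<subseteq> A} \<noteq> {}"
  proof -
    obtain a where "a \<in> A" using assms by auto
    then have "replicate n a \<in> {xs. length xs = n \<and> set xs \<subseteq> A}" by auto
    then show ?thesis by blast
  qed
  have fin: "finite {xs. length xs = n \<and> set xs \<subseteq> A}" by (rule finite_lists_over[OF assms(1)])
  have "pmf (seq_pmf (replicate n (pmf_of_set A))) xs = (if length xs = n \<and> set xs \<subseteq> A then 1 / real (card A ^ n) else 0)"
  proof (cases "length xs = n \<and> set xs \<subseteq> A")
    case True
    then have "pmf (pmf_of_set A) (xs ! i) = 1 / real (card A)" if "i < n" for i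
      using assms that nth_mem[of i xs] by (auto simp: subset_iff)
    then show ?thesis using True by (simp add: pmf_seq_nth power_one_over)
  next
    case False
    then have "xs \<notin> set_pmf (seq_pmf (replicate n (pmf_of_set A)))"
      using set_seq_replicate[of xs n "pmf_of_set A"] set_pmf_of_set[OF assms(2,1)] by auto
    then have "pmf (seq_pmf (replicate n (pmf_of_set A))) xs = 0" by (simp add: set_pmf_iff)
    then show ?thesis by (simp only: False if_False)
  qed
  also have "\<dots> = pmf (pmf_of_set {xs. length xs = n \<and> set xs \<subseteq> A}) xs"
    using fin ne by (simp add: card_lists_over[OF assms(1)] indicator_def)
  finally show "pmf (seq_pmf (replicate n (pmf_of_set A))) xs = pmf (pmf_of_set {xs. length xs = n \<and> set xs \<subseteq> A}) xs" .
qed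

lemma seq_pmf_zip:
  "map_pmf (\<lambda>(xs, ys). zip xs ys) (pair_pmf (seq_pmf (replicate n P)) (seq_pmf (replicate n Q))) = seq_pmf (replicate n (pair_pmf P Q))"
proof (induction n)
  case (Suc n)
  let ?P = "seq_pmf (replicate n P)" and ?Q = "seq_pmf (replicate n Q)"
  have "map_pmf (\<lambda>(xs, ys). zip xs ys) (pair_pmf (seq_pmf (replicate (Suc n) P)) (seq_pmf (replicate (Suc n) Q)))
    = bind_pmf P (\<lambda>x. bind_pmf ?P (\<lambda>xs. bind_pmf Q (\<lambda>y. bind_pmf ?Q (\<lambda>ys. return_pmf ((x, y) # zip xs ys)))))"
    by (simp add: pair_pmf_def map_pmf_def bind_assoc_pmf bind_return_pmf)
  also have "\<dots> = bind_pmf P (\<lambda>x. bind_pmf Q (\<lambda>y. bind_pmf ?P (\<lambda>xs. bind_pmf ?Q (\<lambda>ys. return_pmf ((x, y) # zip xs ys)))))"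
    by (subst bind_commute_pmf) simp
  also have "\<dots> = bind_pmf (pair_pmf P Q) (\<lambda>xy. map_pmf (Cons xy) (map_pmf (\<lambda>(xs, ys). zip xs ys) (pair_pmf ?P ?Q)))"
    by (simp add: pair_pmf_def map_pmf_def bind_assoc_pmf bind_return_pmf)
  finally show ?case by (simp add: Suc)
qed (simp add: pair_pmf_def bind_return_pmf)

text \<open>Every fibre has exactly \<open>D\<close> elements, so dropping the dummy preserves
  uniformity.\<close>

lemma map_div_uniform:
  assumes "0 < A" "0 < P" "0 < (D::nat)"
  shows "map_pmf (\<lambda>m. (fst m, snd m div D)) (pmf_of_set ({..<A::nat} \<times> {..<P * D})) = pmf_of_set ({..<A} \<times> {..<P})"
proof (rule pmf_eqI)
  fix y :: "nat \<times> nat"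
  obtain a p where y: "y = (a, p)" by force
  let ?S = "{..<A} \<times> {..<P * D}" and ?f = "\<lambda>m :: nat \<times> nat. (fst m, snd m div D)"
  have S: "finite ?S" "?S \<noteq> {}" "finite ({..<A} \<times> {..<P})" "{..<A} \<times> {..<P} \<noteq> {}"
    using assms by (auto simp: lessThan_empty_iff)
  have "pmf (map_pmf ?f (pmf_of_set ?S)) y = real (card (?S \<inter> ?f -` {y})) / real (card ?S)"
    using S by (simp add: pmf_map measure_pmf_of_set)
  also have "\<dots> = pmf (pmf_of_set ({..<A} \<times> {..<P})) y"
  proof (cases "a < A \<and> p < P")
    case True
    have "?S \<inter> ?f -` {y} = {a} \<times> {p * D..<p * D + D}"
    proof (intro equalityI subsetI)
      fix m assume "m \<in> ?S \<inter> ?f -` {y}"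
      then have "fst m = a" "snd m div D = p" by (auto simp: y)
      moreover have "snd m div D * D \<le> snd m" "snd m < snd m div D * D + D"
        using assms(3) dividend_less_div_times[of D "snd m"] by (auto simp: add.commute)
      ultimately show "m \<in> {a} \<times> {p * D..<p * D + D}" by (cases m) auto
    next
      fix m assume m: "m \<in> {a} \<times> {p * D..<p * D + D}"
      then have "snd m div D = p" using assms(3)
        by (intro div_nat_eqI) (auto simp: mult.commute add.commute)
      moreover have "snd m < P * D"
      proof -
        have "Suc p * D \<le> P * D" using True by (intro mult_le_mono1) auto
        then show ?thesis using m by auto
      qed
      ultimately show "m \<in> ?S \<inter> ?f -` {y}" using m True by (auto simp: y)
    qed
    then show ?thesis using True assms S(3,4) by (simp add: y card_cartesian_product indicator_def)
  next
    case False
    have "?S \<inter> ?f -` {y} = {}" using False assms(3) by (auto simp: y less_mult_imp_div_less)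
    then show ?thesis using False S(3,4) by (simp add: y indicator_def)
  qed
  finally show "pmf (map_pmf ?f (pmf_of_set ?S)) y = pmf (pmf_of_set ({..<A} \<times> {..<P})) y" .
qed

lemma map_pair_fst: "map_pmf (\<lambda>x. (f (fst x), g (snd x))) (pair_pmf P Q) = pair_pmf (map_pmf f P) (map_pmf g Q)"
  using map_pair[of f g P Q] by (simp add: case_prod_unfold)

text \<open>Everything that one side sends: its components of the \<open>T\<close> free cloud
  indices and, for all \<open>T + 1\<close> blocks, the secret part with the combined public part
  and dummy.\<close>

definition "side_msgs T C A Q = pair_pmf (seq_pmf (replicate T (pmf_of_set {..<C::nat}))) (seq_pmf (replicate (Suc T) (pmf_of_set ({..<A::nat} \<times> {..<Q::nat}))))"
definition "side_set T C A P = {cs. length cs = T \<and> set cs \<subseteq> {..<C::nat}} \<times> {ms. length ms = Suc T \<and> set ms \<subseteq> {..<A::nat} \<times> {..<P::nat}}"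
definition "side_public D x = (fst x, map (\<lambda>m. (fst m, snd m div D)) (snd x))" for D :: nat and x :: "nat list \<times> (nat \<times> nat) list"

lemma finite_side_set: "finite (side_set T C A P)"
  unfolding side_set_def by (intro finite_cartesian_product finite_lists_over) auto

lemma card_side_set: "card (side_set T C A P) = C ^ T * (A * P) ^ Suc T"
proof -
  have "card {cs. length cs = T \<and> set cs \<subseteq> {..<C}} = C ^ T" by (subst card_lists_over) auto
  moreover have "card {ms. length ms = Suc T \<and> set ms \<subseteq> {..<A} \<times> {..<P}} = (A * P) ^ Suc T" by (subst card_lists_over) auto
  ultimately show ?thesis unfolding side_set_def by (simp only: card_cartesian_product)
qed

lemma map_side_public:
  assumes "0 < C" "0 < A" "0 < P" "0 < D"
  shows "map_pmf (side_public D) (side_msgs T C A (P * D)) = pmf_of_set (side_set T C A P)"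
proof -
  have "map_pmf (side_public D) (side_msgs T C A (P * D)) = pair_pmf (map_pmf (\<lambda>x. x) (seq_pmf (replicate T (pmf_of_set {..<C}))))
     (map_pmf (map (\<lambda>m. (fst m, snd m div D))) (seq_pmf (replicate (Suc T) (pmf_of_set ({..<A} \<times> {..<P * D})))))"
    unfolding side_msgs_def map_pair_fst[symmetric] side_public_def[abs_def] ..
  also have "map_pmf (map (\<lambda>m. (fst m, snd m div D))) (seq_pmf (replicate (Suc T) (pmf_of_set ({..<A} \<times> {..<P * D}))))
    = seq_pmf (replicate (Suc T) (pmf_of_set ({..<A} \<times> {..<P})))"
  proof -
    have "seq_pmf (map (\<lambda>x. map_pmf (\<lambda>m. (fst m, snd m div D)) (pmf_of_set ({..<A} \<times> {..<P * D}))) (replicate (Suc T) ()))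
      = map_pmf (map (\<lambda>m. (fst m, snd m div D))) (seq_pmf (map (\<lambda>x. pmf_of_set ({..<A} \<times> {..<P * D})) (replicate (Suc T) ())))"
      by (rule seq_pmf_map')
    then show ?thesis by (simp only: map_replicate map_div_uniform[OF assms(2-4)])
  qed
  also have "pair_pmf (map_pmf (\<lambda>x. x) (seq_pmf (replicate T (pmf_of_set {..<C})))) (seq_pmf (replicate (Suc T) (pmf_of_set ({..<A} \<times> {..<P}))))
    = pmf_of_set (side_set T C A P)"
  proof -
    have ne: "{xs. length xs = n \<and> set xs \<subseteq> S} \<noteq> {}" if "S \<noteq> {}" for n and S :: "'q set"
    proof -
      have "replicate n (SOME a. a \<in> S) \<in> {xs. length xs = n \<and> set xs \<subseteq> S}"
        using some_in_eq[of S] that by auto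
      then show ?thesis by blast
    qed
    have n1: "{..<C} \<noteq> {}" and n2: "{..<A} \<times> {..<P} \<noteq> {}" using assms by auto
    have "seq_pmf (replicate T (pmf_of_set {..<C})) = pmf_of_set {cs. length cs = T \<and> set cs \<subseteq> {..<C}}"
      using n1 by (intro seq_pmf_of_set) auto
    moreover have "seq_pmf (replicate (Suc T) (pmf_of_set ({..<A} \<times> {..<P}))) = pmf_of_set {ms. length ms = Suc T \<and> set ms \<subseteq> {..<A} \<times> {..<P}}"
      using n2 by (intro seq_pmf_of_set) auto
    ultimately show ?thesis
      unfolding side_set_def map_pmf_ident
      by (simp only: pair_pmf_of_set[OF finite_lists_over ne[OF n1] finite_lists_over ne[OF n2]] finite_lessThan finite_cartesian_product)
  qed
  finally show ?thesis .
qed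

lemma side_msgs_zip:
  assumes "0 < C1" "0 < C2"
  shows "map_pmf (\<lambda>(x, x'). (zip (fst x) (fst x'), zip (snd x) (snd x'))) (pair_pmf (side_msgs T C1 A1 Q1) (side_msgs T C2 A2 Q2))
    = pair_pmf (seq_pmf (replicate T (pmf_of_set ({..<C1} \<times> {..<C2}))))
       (seq_pmf (replicate (Suc T) (pair_pmf (pmf_of_set ({..<A1} \<times> {..<Q1})) (pmf_of_set ({..<A2} \<times> {..<Q2})))))"
proof -
  let ?a = "seq_pmf (replicate T (pmf_of_set {..<C1}))" and ?b = "seq_pmf (replicate (Suc T) (pmf_of_set ({..<A1} \<times> {..<Q1})))"
  let ?c = "seq_pmf (replicate T (pmf_of_set {..<C2}))" and ?d = "seq_pmf (replicate (Suc T) (pmf_of_set ({..<A2} \<times> {..<Q2})))"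
  have "map_pmf (\<lambda>(x, x'). (zip (fst x) (fst x'), zip (snd x) (snd x'))) (pair_pmf (pair_pmf ?a ?b) (pair_pmf ?c ?d))
    = bind_pmf ?a (\<lambda>a. bind_pmf ?b (\<lambda>b. bind_pmf ?c (\<lambda>c. bind_pmf ?d (\<lambda>d. return_pmf (zip a c, zip b d)))))"
    by (simp add: pair_pmf_def map_pmf_def bind_assoc_pmf bind_return_pmf)
  also have "\<dots> = bind_pmf ?a (\<lambda>a. bind_pmf ?c (\<lambda>c. bind_pmf ?b (\<lambda>b. bind_pmf ?d (\<lambda>d. return_pmf (zip a c, zip b d)))))"
    by (subst bind_commute_pmf) simp
  also have "\<dots> = pair_pmf (map_pmf (\<lambda>(xs, ys). zip xs ys) (pair_pmf ?a ?c)) (map_pmf (\<lambda>(xs, ys). zip xs ys) (pair_pmf ?b ?d))"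
    by (simp add: pair_pmf_def map_pmf_def bind_assoc_pmf bind_return_pmf)
  also have "\<dots> = pair_pmf (seq_pmf (replicate T (pmf_of_set ({..<C1} \<times> {..<C2}))))
       (seq_pmf (replicate (Suc T) (pair_pmf (pmf_of_set ({..<A1} \<times> {..<Q1})) (pmf_of_set ({..<A2} \<times> {..<Q2})))))"
    using assms by (simp only: seq_pmf_zip, subst pair_pmf_of_set) auto
  finally show ?thesis by (simp only: side_msgs_def)
qed

subsection \<open>The block Markov scheme\<close>

lemma chunks_nth: "b < m \<Longrightarrow> chunks n m xs ! b = take n (drop (b * n) xs)"
  by (simp add: chunks_def)

lemma take_chunks: "b \<le> m \<Longrightarrow> take b (chunks n m xs) = chunks n b xs"
  by (simp add: chunks_def take_map)

lemma nth_concat_blocks: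
  assumes "\<And>x. x \<in> set xss \<Longrightarrow> length x = n" "i < n * length xss"
  shows "(concat xss @ ys) ! i = xss ! (i div n) ! (i mod n)"
proof -
  have n: "0 < n" using assms(2) by (cases n) auto
  have b: "i div n < length xss" using assms(2) n by (simp add: div_less_iff_less_mult mult.commute)
  have i: "i div n * n \<le> i" by (rule div_times_less_eq_dividend)
  have l: "length (concat xss) = length xss * n"
    using assms(1) by (induction xss) auto
  have "xss ! (i div n) = take n (drop (i div n * n) (concat xss @ ys))"
    using chunks_concat[of xss n ys] assms(1) chunks_nth[OF b, of n "concat xss @ ys"] by simp
  moreover have "i div n * n + i mod n = i" by simp
  moreover have "i div n * n \<le> length (concat xss @ ys)" using assms(2) l i unfolding length_append mult.commute[of n] by linarith
  ultimately show ?thesis using n by (simp del: drop_append take_append)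
qed

lemma length_concat_blocks: "(\<And>x. x \<in> set xss \<Longrightarrow> length x = n) \<Longrightarrow> length (concat xss) = n * length xss"
  by (induction xss) auto

lemma seq_pmf_map2_Pair:
  "length xs = length ys \<Longrightarrow> seq_pmf (map2 (\<lambda>x y. map_pmf (Pair y) (K x y)) xs ys) = map_pmf (zip ys) (seq_pmf (map2 K xs ys))"
proof (induction xs ys rule: list_induct2)
  case (Cons x xs y ys)
  then show ?case by (simp add: map_bind_pmf bind_map_pmf map_pmf_comp)
qed simp

text \<open>\<open>k\<close> is the channel with the relay letter as a free argument; it becomes
  \<open>\<kappa>\<close> when this letter is the one inside the cloud letter. \<open>r\<close>
  copies of \<open>a0\<close> are appended to reach block lengths that are not multiples of
  \<open>n * Suc T\<close>.\<close>

locale block_scheme = relay_letters pt p12 \<kappa> Yf Zf px pu Y1f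
  for pt :: "('u::finite \<times> 'x1::finite) pmf" and p12 :: "'u \<times> 'x1 \<Rightarrow> ('v1::finite \<times> 'v2::finite) pmf"
    and \<kappa> :: "('u \<times> 'x1) \<times> 'v1 \<times> 'v2 \<Rightarrow> 'o::finite pmf" and Yf :: "'o \<Rightarrow> 'y::finite" and Zf :: "'o \<Rightarrow> 'z::finite"
    and px :: "'x1 pmf" and pu :: "'x1 \<Rightarrow> 'u pmf" and Y1f :: "'o \<Rightarrow> 'y1::finite" +
  fixes k :: "('u \<times> 'x1) \<times> 'v1 \<times> 'v2 \<Rightarrow> 'x1 \<Rightarrow> 'o pmf"
    and s :: real and n :: nat and I :: "'i set" and w0 :: 'i and T A1 Q1 A2 Q2 :: nat and c \<eta> :: real
    and xw :: "'i \<Rightarrow> 'x1 list" and uw :: "'i \<Rightarrow> 'i \<Rightarrow> 'u list"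
    and en :: "('u \<times> 'x1) list \<Rightarrow> (nat \<times> nat) \<times> nat \<times> nat \<Rightarrow> ('v1 \<times> 'v2) list"
    and de1 :: "('u \<times> 'x1) list \<Rightarrow> 'y list \<Rightarrow> nat \<times> nat" and de2 :: "('u \<times> 'x1) list \<Rightarrow> 'z list \<Rightarrow> nat \<times> nat"
    and r :: nat and a0 :: "('u \<times> 'x1) \<times> 'v1 \<times> 'v2"
  assumes k: "\<And>a. k a (snd (fst a)) = \<kappa> a"
    and bc: "block_code s n I w0 T A1 Q1 A2 Q2 c \<eta> xw uw en de1 de2"
    and I: "finite I" "w0 \<in> I" and pos: "0 < n" "0 < A1" "0 < Q1" "0 < A2" "0 < Q2"
begin

definition "cl p = zip (uw (fst p) (snd p)) (xw (fst p))"
definition "lb p m = zip (cl p) (en (cl p) m)"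
definition "lw b = concat (map2 lb (wpairs w0 (fst b)) (snd b)) @ replicate r a0"
definition "Nt = n * Suc T + r"
text \<open>In block \<open>b\<close> the relay knows \<open>w b\<close> and looks for \<open>w (b + 1)\<close>, whereas the receivers, who start from the
  last block, know \<open>w (b + 1)\<close> and look for \<open>w b\<close>.\<close>

definition "tR w w' y \<longleftrightarrow> w' \<in> I \<and> tauR s (xw w) (uw w w') y"
definition "tY w w' y \<longleftrightarrow> w \<in> I \<and> tauY s (cl (w, w')) y"
definition "tZ w w' y \<longleftrightarrow> w \<in> I \<and> tauZ s (cl (w, w')) y"
text \<open>In block \<open>i div n\<close> only completed blocks are used. During the padding the
  relay sends the letter prescribed by \<open>a0\<close>, so that true and ideal law agree there as
  well.\<close>

definition "rho i h = (if i < n * Suc T then xw (fdec tR w0 (chunks n (i div n) h)) ! (i mod n) else snd (fst a0))"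
text \<open>The decoded sequence has the fixed index at both ends; removing them leaves the
  \<open>T\<close> free indices.\<close>

definition "dY ys = take T (tl (bdec w0 tY (chunks n (Suc T) ys)))"
definition "dZ zs = take T (tl (bdec w0 tZ (chunks n (Suc T) zs)))"
definition "mY ys = map2 (\<lambda>p y. de1 (cl p) y) (wpairs w0 (dY ys)) (chunks n (Suc T) ys)"
definition "mZ zs = map2 (\<lambda>p z. de2 (cl p) z) (wpairs w0 (dZ zs)) (chunks n (Suc T) zs)"
definition "Base = pair_pmf (seq_pmf (replicate T (pmf_of_set I))) (seq_pmf (replicate (Suc T) (msgs A1 Q1 A2 Q2)))"
text \<open>\<open>Ereal\<close> is the true law. In \<open>Eid\<close> the relay knows the cloud indices, so that the blocks are
  independent given them; the two laws coincide pointwise on \<open>OK\<close>, where no decision is wrong.\<close>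

definition "Ereal = bind_pmf Base (\<lambda>b. map_pmf (Pair b) (orun k (\<lambda>i os. rho i (map Y1f os)) (lw b) Nt))"
definition "Eid = bind_pmf Base (\<lambda>b. map_pmf (Pair b) (seq_pmf (map \<kappa> (lw b))))"
definition "blk w w' = blaw (msgs A1 Q1 A2 Q2) (cl (w, w')) (en (cl (w, w')))"
definition "Jid = ideal_law T I w0 blk (seq_pmf (replicate r (\<kappa> a0)))"
definition "glue w = ((fst w, map fst (fst (snd w))), concat (map snd (fst (snd w))) @ snd (snd w))"
text \<open>The event refers to base variables and outputs alone, so it makes sense under both laws.
  Lengths and index ranges, which hold almost surely, are included because the laws are compared
  point by point.\<close>

definition "OK = {w. length (fst (fst w)) = T \<and> set (fst (fst w)) \<subseteq> I \<and> length (snd (fst w)) = Suc T \<and> length (snd w) = Nt \<and>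
  (\<forall>b<Suc T. block_ok s I xw uw de1 de2 (fst (wpairs w0 (fst (fst w)) ! b)) (snd (wpairs w0 (fst (fst w)) ! b))
     (snd (fst w) ! b, chunks n (Suc T) (snd w) ! b))}"

lemma lens: "w \<in> I \<Longrightarrow> length (xw w) = n" "w \<in> I \<Longrightarrow> w' \<in> I \<Longrightarrow> length (uw w w') = n" "length (en ts m) = length ts"
  using bc unfolding block_code_def by blast+

lemma neI: "I \<noteq> {}"
  using I by auto

lemma finite_msgs: "finite (set_pmf (msgs A1 Q1 A2 Q2))"
  using pos by (simp add: set_msgs)

lemma finite_blk: "finite (set_pmf (blk w w'))"
  using finite_msgs by (simp add: blk_def blaw_def)

lemma finite_Base: "finite (set_pmf Base)"
proof -
  have "finite (set_pmf (seq_pmf (replicate (Suc T) (msgs A1 Q1 A2 Q2))))"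
    using finite_msgs by (intro finite_set_seq_pmf) auto
  then show ?thesis unfolding Base_def using finite_wv[OF I(1) neI] by simp
qed

lemma finite_Ereal: "finite (set_pmf Ereal)"
  unfolding Ereal_def using finite_Base by (auto intro!: finite_orun)

lemma finite_Eid: "finite (set_pmf Eid)"
  unfolding Eid_def using finite_Base by auto

lemma finite_Jid: "finite (set_pmf Jid)"
proof -
  have "finite (set_pmf (seq_pmf (map (\<lambda>p. blk (fst p) (snd p)) wp)))" for wp
    using finite_blk by (intro finite_set_seq_pmf) auto
  then show ?thesis unfolding Jid_def ideal_law_def using finite_wv[OF I(1) neI] by simp
qed

lemma Base_support:
  assumes "b \<in> set_pmf Base"
  shows "length (fst b) = T" "set (fst b) \<subseteq> I" "length (snd b) = Suc T" "set (snd b) \<subseteq> ({..<A1} \<times> {..<Q1}) \<times> ({..<A2} \<times> {..<Q2})"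
proof -
  have 1: "fst b \<in> set_pmf (seq_pmf (replicate T (pmf_of_set I)))" and 2: "snd b \<in> set_pmf (seq_pmf (replicate (Suc T) (msgs A1 Q1 A2 Q2)))"
    using assms by (auto simp: Base_def simp del: replicate.simps)
  show "length (fst b) = T" "set (fst b) \<subseteq> I" using wv_support[OF I(1) neI 1] by auto
  show "length (snd b) = Suc T" "set (snd b) \<subseteq> ({..<A1} \<times> {..<Q1}) \<times> ({..<A2} \<times> {..<Q2})"
    using 2[unfolded set_seq_replicate set_msgs[OF pos(2-5)]] by auto
qed

lemma length_cl: "p \<in> I \<times> I \<Longrightarrow> length (cl p) = n"
  using lens by (auto simp: cl_def)

lemma length_lb: "p \<in> I \<times> I \<Longrightarrow> length (lb p m) = n"
  using length_cl lens(3) by (simp add: lb_def)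

lemma lw_blocks:
  assumes "set (fst b) \<subseteq> I" "x \<in> set (map2 lb (wpairs w0 (fst b)) (snd b))"
  shows "length x = n"
proof -
  obtain p m where "x = lb p m" "(p, m) \<in> set (zip (wpairs w0 (fst b)) (snd b))" using assms(2) by auto
  moreover then have "p \<in> I \<times> I" using set_wpairs[OF assms(1) I(2)] set_zip_leftD by fastforce
  ultimately show ?thesis by (simp only: length_lb)
qed

lemma length_lw:
  assumes "length (fst b) = T" "set (fst b) \<subseteq> I" "length (snd b) = Suc T"
  shows "length (lw b) = Nt"
proof -
  have "length (concat (map2 lb (wpairs w0 (fst b)) (snd b))) = n * length (map2 lb (wpairs w0 (fst b)) (snd b))"
    by (rule length_concat_blocks[OF lw_blocks[OF assms(2)]])
  then show ?thesis unfolding lw_def Nt_def using assms by simp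
qed

lemma Jid_support:
  assumes "z \<in> set_pmf Jid"
  shows "length (fst z) = T" "set (fst z) \<subseteq> I" "length (fst (snd z)) = Suc T" "length (snd (snd z)) = r"
    "\<And>mo. mo \<in> set (fst (snd z)) \<Longrightarrow> length (snd mo) = n"
proof -
  have w: "fst z \<in> set_pmf (seq_pmf (replicate T (pmf_of_set I)))"
    and x: "fst (snd z) \<in> set_pmf (seq_pmf (map (\<lambda>p. blk (fst p) (snd p)) (wpairs w0 (fst z))))"
    and y: "snd (snd z) \<in> set_pmf (seq_pmf (replicate r (\<kappa> a0)))"
    using assms by (auto simp: Jid_def ideal_law_def)
  show l: "length (fst z) = T" "set (fst z) \<subseteq> I" using wv_support[OF I(1) neI w] by auto
  show "length (fst (snd z)) = Suc T" using length_seq_pmf[OF x] l by simp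
  show "length (snd (snd z)) = r" using length_seq_pmf[OF y] by simp
  fix mo assume mo: "mo \<in> set (fst (snd z))"
  obtain i where i: "i < length (fst (snd z))" "mo = fst (snd z) ! i" using mo by (auto simp: in_set_conv_nth)
  have p: "wpairs w0 (fst z) ! i \<in> I \<times> I" using set_wpairs[OF l(2) I(2)] i(1) length_seq_pmf[OF x] nth_mem[of i "wpairs w0 (fst z)"] by auto
  have "mo \<in> set_pmf (blk (fst (wpairs w0 (fst z) ! i)) (snd (wpairs w0 (fst z) ! i)))"
    using x i by (auto simp: set_seq_pmf list_all2_conv_all_nth simp del: length_wpairs)
  then obtain m where "snd mo \<in> set_pmf (seq_pmf (map \<kappa> (lb (wpairs w0 (fst z) ! i) m)))"
    by (auto simp: blk_def blaw_def lb_def)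
  from length_seq_pmf[OF this] show "length (snd mo) = n" using length_lb[OF p, of m] by simp
qed

lemma chunks_glue: "x \<in> set_pmf Jid \<Longrightarrow> chunks n (Suc T) (snd (glue x)) = map snd (fst (snd x))"
proof -
  assume w: "x \<in> set_pmf Jid"
  have "chunks n (length (map snd (fst (snd x)))) (concat (map snd (fst (snd x))) @ snd (snd x)) = map snd (fst (snd x))"
    by (rule chunks_concat) (use Jid_support(5)[OF w] in auto)
  then show ?thesis using Jid_support(3)[OF w] by (simp add: glue_def)
qed

lemma length_glue: "x \<in> set_pmf Jid \<Longrightarrow> length (snd (glue x)) = Nt"
proof -
  assume w: "x \<in> set_pmf Jid"
  have "length (concat (map snd (fst (snd x)))) = n * length (map snd (fst (snd x)))"
    by (rule length_concat_blocks) (use Jid_support(5)[OF w] in auto)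
  then show ?thesis using Jid_support(3,4)[OF w] by (simp add: glue_def Nt_def)
qed

text \<open>Both laws draw the same variables, one block by block, the other in stages: all indices,
  all block messages, all outputs. Stagewise drawing and concatenation of independent words
  reconcile them.\<close>

lemma map_glue_Jid: "map_pmf glue Jid = Eid"
proof -
  let ?U = "msgs A1 Q1 A2 Q2" and ?Pp = "seq_pmf (replicate r (\<kappa> a0))"
  have blkseq: "seq_pmf (map (\<lambda>p. blk (fst p) (snd p)) wp) = bind_pmf (seq_pmf (replicate (length wp) ?U)) (\<lambda>ms.
      map_pmf (zip ms) (seq_pmf (map2 (\<lambda>p m. seq_pmf (map \<kappa> (lb p m))) wp ms)))" for wp :: "('i \<times> 'i) list"
  proof -
    have "seq_pmf (map (\<lambda>p. blk (fst p) (snd p)) wp) = seq_pmf (map (\<lambda>p. bind_pmf ?U (\<lambda>m. map_pmf (Pair m) (seq_pmf (map \<kappa> (lb p m))))) wp)"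
      by (simp add: blk_def blaw_def lb_def)
    also have "\<dots> = bind_pmf (seq_pmf (map (\<lambda>_. ?U) wp)) (\<lambda>ms. seq_pmf (map2 (\<lambda>p m. map_pmf (Pair m) (seq_pmf (map \<kappa> (lb p m)))) wp ms))"
      by (rule seq_pmf_bind)
    also have "\<dots> = bind_pmf (seq_pmf (replicate (length wp) ?U)) (\<lambda>ms. map_pmf (zip ms) (seq_pmf (map2 (\<lambda>p m. seq_pmf (map \<kappa> (lb p m))) wp ms)))"
      unfolding map_replicate_const
    proof (intro bind_pmf_cong refl)
      fix ms assume "ms \<in> set_pmf (seq_pmf (replicate (length wp) ?U))"
      then have "length wp = length ms" by (auto dest: length_seq_pmf)
      then show "seq_pmf (map2 (\<lambda>p m. map_pmf (Pair m) (seq_pmf (map \<kappa> (lb p m)))) wp ms) = map_pmf (zip ms) (seq_pmf (map2 (\<lambda>p m. seq_pmf (map \<kappa> (lb p m))) wp ms))"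
        by (rule seq_pmf_map2_Pair)
    qed
    finally show ?thesis .
  qed
  have inner: "map_pmf glue (map_pmf (Pair wv) (pair_pmf (map_pmf (zip ms) (seq_pmf (map2 (\<lambda>p m. seq_pmf (map \<kappa> (lb p m))) (wpairs w0 wv) ms))) ?Pp))
      = map_pmf (Pair (wv, ms)) (seq_pmf (map \<kappa> (lw (wv, ms))))" if l: "length ms = Suc (length wv)" for wv :: "'i list" and ms
  proof -
    let ?K = "map2 (\<lambda>p m. seq_pmf (map \<kappa> (lb p m))) (wpairs w0 wv) ms"
    have "map_pmf glue (map_pmf (Pair wv) (pair_pmf (map_pmf (zip ms) (seq_pmf ?K)) ?Pp))
      = bind_pmf (seq_pmf ?K) (\<lambda>oss. map_pmf (\<lambda>po. glue (wv, zip ms oss, po)) ?Pp)"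
      by (simp add: pair_pmf_def map_bind_pmf bind_map_pmf map_pmf_def bind_assoc_pmf bind_return_pmf)
    also have "\<dots> = bind_pmf (seq_pmf ?K) (\<lambda>oss. map_pmf (\<lambda>po. ((wv, ms), concat oss @ po)) ?Pp)"
    proof (intro bind_pmf_cong refl)
      fix oss assume "oss \<in> set_pmf (seq_pmf ?K)"
      then have "length oss = length ms" using l by (auto dest: length_seq_pmf)
      then show "map_pmf (\<lambda>po. glue (wv, zip ms oss, po)) ?Pp = map_pmf (\<lambda>po. ((wv, ms), concat oss @ po)) ?Pp"
        by (simp add: glue_def)
    qed
    also have "\<dots> = map_pmf (Pair (wv, ms)) (bind_pmf (map_pmf concat (seq_pmf (map seq_pmf (map (map \<kappa>) (map2 lb (wpairs w0 wv) ms))))) (\<lambda>xs. map_pmf ((@) xs) ?Pp))"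
      by (simp add: bind_map_pmf map_bind_pmf map_pmf_comp case_prod_unfold o_def)
    also have "\<dots> = map_pmf (Pair (wv, ms)) (seq_pmf (map \<kappa> (lw (wv, ms))))"
      by (simp only: lw_def fst_conv snd_conv map_append map_concat map_replicate seq_pmf_append seq_pmf_concat)
    finally show ?thesis .
  qed
  have "map_pmf glue Jid = bind_pmf (seq_pmf (replicate T (pmf_of_set I))) (\<lambda>wv. bind_pmf (seq_pmf (replicate (Suc (length wv)) ?U)) (\<lambda>ms.
      map_pmf glue (map_pmf (Pair wv) (pair_pmf (map_pmf (zip ms) (seq_pmf (map2 (\<lambda>p m. seq_pmf (map \<kappa> (lb p m))) (wpairs w0 wv) ms))) ?Pp))))"
    unfolding Jid_def ideal_law_def blkseq
    by (simp add: map_bind_pmf pair_pmf_def bind_assoc_pmf del: replicate.simps)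
  also have "\<dots> = bind_pmf (seq_pmf (replicate T (pmf_of_set I))) (\<lambda>wv. bind_pmf (seq_pmf (replicate (Suc T) ?U)) (\<lambda>ms.
      map_pmf (Pair (wv, ms)) (seq_pmf (map \<kappa> (lw (wv, ms))))))"
  proof (intro bind_pmf_cong refl)
    fix wv assume "wv \<in> set_pmf (seq_pmf (replicate T (pmf_of_set I)))"
    then show "seq_pmf (replicate (Suc (length wv)) ?U) = seq_pmf (replicate (Suc T) ?U)" by (auto dest: length_seq_pmf)
  next
    fix wv ms assume w: "wv \<in> set_pmf (seq_pmf (replicate T (pmf_of_set I)))" and m: "ms \<in> set_pmf (seq_pmf (replicate (Suc T) ?U))"
    have "length ms = Suc (length wv)" using length_seq_pmf[OF w] length_seq_pmf[OF m] by simp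
    then show "map_pmf glue (map_pmf (Pair wv) (pair_pmf (map_pmf (zip ms) (seq_pmf (map2 (\<lambda>p m. seq_pmf (map \<kappa> (lb p m))) (wpairs w0 wv) ms))) ?Pp))
      = map_pmf (Pair (wv, ms)) (seq_pmf (map \<kappa> (lw (wv, ms))))" by (rule inner)
  qed
  also have "\<dots> = Eid"
    by (simp add: Eid_def Base_def pair_pmf_def bind_assoc_pmf bind_return_pmf del: replicate.simps)
  finally show ?thesis .
qed

lemma wpairs_nth: "length wv = T \<Longrightarrow> b < Suc T \<Longrightarrow> wpairs w0 wv ! b = ((w0 # wv @ [w0]) ! b, (w0 # wv @ [w0]) ! Suc b)"
  by (auto simp: wpairs_def nth_append nth_Cons')

lemma okD:
  assumes "w \<in> OK" "b < Suc T"
  defines "v \<equiv> w0 # fst (fst w) @ [w0]"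
  shows "block_ok s I xw uw de1 de2 (v ! b) (v ! Suc b) (snd (fst w) ! b, chunks n (Suc T) (snd w) ! b)" "v ! b \<in> I" "v ! Suc b \<in> I"
proof -
  have l: "length (fst (fst w)) = T" "set (fst (fst w)) \<subseteq> I" using assms(1) by (auto simp: OK_def)
  show "block_ok s I xw uw de1 de2 (v ! b) (v ! Suc b) (snd (fst w) ! b, chunks n (Suc T) (snd w) ! b)"
    using assms(1,2) unfolding OK_def mem_Collect_eq v_def by (metis wpairs_nth fst_conv snd_conv)
  have v: "set v \<subseteq> I" "length v = Suc (Suc T)" using l I by (auto simp: v_def)
  then show "v ! b \<in> I" "v ! Suc b \<in> I" using assms(2) by (auto simp: subset_iff)
qed

text \<open>In each completed block, the test with the true current index accepts the true next
  index and no other. Forward decoding therefore follows the true sequence, and the relay letter is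
  the one inside the cloud letter.\<close>

lemma relay_correct:
  assumes w: "z \<in> OK" and i: "i < Nt"
  shows "rho i (map Y1f (take i (snd z))) = map (\<lambda>a. snd (fst a)) (lw (fst z)) ! i"
proof -
  define wv ms os where "wv = fst (fst z)" and "ms = snd (fst z)" and "os = snd z"
  define v where "v = w0 # wv @ [w0]"
  have l: "length wv = T" "set wv \<subseteq> I" "length ms = Suc T" "length os = Nt" using w by (auto simp: OK_def wv_def ms_def os_def)
  have lN: "length (lw (fst z)) = Nt" using l by (intro length_lw) (auto simp: wv_def ms_def)
  have fo: "fst z = (wv, ms)" by (simp add: wv_def ms_def)
  have blocks: "length x = n" if "x \<in> set (map2 lb (wpairs w0 wv) ms)" for x
    using lw_blocks[of "(wv, ms)" x] that l by simp
  show ?thesis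
  proof (cases "i < n * Suc T")
    case True
    define b where "b = i div n"
    have b: "b < Suc T" "b * n \<le> i" using True pos by (auto simp: b_def div_less_iff_less_mult mult.commute)
    have "chunks n b (map Y1f (take i os)) = map (map Y1f) (take b (chunks n (Suc T) os))"
      using b by (simp only: chunks_map chunks_take take_chunks less_imp_le)
    also have "fdec tR w0 \<dots> = v ! b"
    proof -
      let ?ys = "map (map Y1f) (take b (chunks n (Suc T) os))"
      have ly: "length ?ys = b" using b by simp
      have "fdec tR (take (Suc b) v ! 0) ?ys = last (take (Suc b) v)"
      proof (rule fdec_correct)
        show "length (take (Suc b) v) = Suc (length ?ys)" using b l by (simp add: v_def)
      next
        fix j assume j: "j < length ?ys"
        then have j': "j < Suc T" "Suc j < Suc b" "j < Suc b" using b ly by auto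
        note ok = okD[OF w j'(1), folded wv_def ms_def os_def, folded v_def]
        have y: "?ys ! j = map Y1f (chunks n (Suc T) os ! j)" using j' b by simp
        have "tauR s (xw (v ! j)) (uw (v ! j) (v ! Suc j)) (?ys ! j)"
          using ok lens unfolding y by (simp add: block_ok_def bad_def)
        then show "tR (take (Suc b) v ! j) (take (Suc b) v ! Suc j) (?ys ! j)" using ok j' by (simp add: tR_def)
      next
        fix j w' assume j: "j < length ?ys" and t: "tR (take (Suc b) v ! j) w' (?ys ! j)"
        then have j': "j < Suc T" "Suc j < Suc b" "j < Suc b" using b ly by auto
        note ok = okD[OF w j'(1), folded wv_def ms_def os_def, folded v_def]
        have y: "?ys ! j = map Y1f (chunks n (Suc T) os ! j)" using j' b by simp
        have "w' = v ! Suc j" using ok t j' unfolding y by (auto simp: block_ok_def tR_def)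
        then show "w' = take (Suc b) v ! Suc j" using j' by simp
      qed
      moreover have "take (Suc b) v ! 0 = w0" by (simp add: v_def)
      moreover have "last (take (Suc b) v) = v ! b"
      proof -
        have "b < length v" using b l by (simp add: v_def)
        then show ?thesis by (simp only: take_Suc_conv_app_nth last_snoc)
      qed
      ultimately show ?thesis by simp
    qed
    finally have rho: "rho i (map Y1f (take i os)) = xw (v ! b) ! (i mod n)" using True by (simp add: rho_def b_def)
    have "lw (fst z) ! i = map2 lb (wpairs w0 wv) ms ! b ! (i mod n)"
      unfolding fo lw_def b_def fst_conv snd_conv by (rule nth_concat_blocks[OF blocks]) (use l True in simp_all)
    also have "map2 lb (wpairs w0 wv) ms ! b = lb (v ! b, v ! Suc b) (ms ! b)"
      using b l wpairs_nth[OF l(1) b(1)] by (simp add: v_def)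
    finally have "lw (fst z) ! i = lb (v ! b, v ! Suc b) (ms ! b) ! (i mod n)" .
    moreover have "snd (fst (lb (v ! b, v ! Suc b) (ms ! b) ! (i mod n))) = xw (v ! b) ! (i mod n)"
    proof -
      have m: "i mod n < n" using pos by simp
      note ok = okD[OF w b(1), folded wv_def ms_def os_def, folded v_def]
      have "length (cl (v ! b, v ! Suc b)) = n" using ok by (intro length_cl) auto
      then show ?thesis using m lens(1)[OF ok(2)] lens(2)[OF ok(2,3)] lens(3) by (simp add: lb_def cl_def)
    qed
    ultimately show ?thesis using rho lN i by (simp add: os_def)
  next
    case False
    have "length (concat (map2 lb (wpairs w0 wv) ms)) = n * length (map2 lb (wpairs w0 wv) ms)"
      by (rule length_concat_blocks[OF blocks])
    then have "length (concat (map2 lb (wpairs w0 wv) ms)) = n * Suc T" using l by simp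
    then have "lw (fst z) ! i = a0" using False i unfolding fo lw_def by (simp add: nth_append Nt_def)
    then show ?thesis using False lN i by (simp add: rho_def)
  qed
qed

text \<open>On \<open>OK\<close> the relay letters computed from the output are those of the
  intended word, where \<open>k\<close> reduces to \<open>\<kappa>\<close>; so both probabilities
  are the same product.\<close>

lemma agree:
  assumes w: "x \<in> OK"
  shows "pmf Ereal x = pmf Eid x"
proof -
  obtain b os where o: "x = (b, os)" by (cases x)
  have l: "length (lw b) = Nt" using w o by (intro length_lw) (auto simp: OK_def)
  have "pmf (orun k (\<lambda>i os. rho i (map Y1f os)) (lw b) Nt) os = pmf (seq_pmf (map2 k (lw b) (map (\<lambda>a. snd (fst a)) (lw b)))) os"
    using l relay_correct[OF w] o by (intro orun_eq_seq) auto
  also have "map2 k (lw b) (map (\<lambda>a. snd (fst a)) (lw b)) = map \<kappa> (lw b)"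
    by (rule nth_equalityI) (auto simp: k)
  finally show ?thesis unfolding o Ereal_def Eid_def pmf_map_Pair_bind by simp
qed

lemma receivers_correct:
  assumes w: "x \<in> OK"
  shows "dY (map Yf (snd x)) = fst (fst x)" "mY (map Yf (snd x)) = map fst (snd (fst x))"
    "dZ (map Zf (snd x)) = fst (fst x)" "mZ (map Zf (snd x)) = map snd (snd (fst x))"
proof -
  define wv ms os where "wv = fst (fst x)" and "ms = snd (fst x)" and "os = snd x"
  define v where "v = w0 # wv @ [w0]"
  have l: "length wv = T" "set wv \<subseteq> I" "length ms = Suc T" "length os = Nt" using w by (auto simp: OK_def wv_def ms_def os_def)
  note ok = okD[OF w, folded wv_def ms_def os_def, folded v_def]
  have cls: "tauY s (cl (v ! b, v ! Suc b)) (map Yf (chunks n (Suc T) os ! b))" "tauZ s (cl (v ! b, v ! Suc b)) (map Zf (chunks n (Suc T) os ! b))"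
    if "b < Suc T" for b using ok[OF that] by (auto simp: block_ok_def bad_def cl_def)
  have "bdec w0 tY (map (map Yf) (chunks n (Suc T) os)) = v"
  proof (rule bdec_correct)
    show "length v = Suc (length (map (map Yf) (chunks n (Suc T) os)))" "last v = w0" using l by (simp_all add: v_def)
  next
    fix b assume "b < length (map (map Yf) (chunks n (Suc T) os))"
    then have b: "b < Suc T" by simp
    show "tY (v ! b) (v ! Suc b) (map (map Yf) (chunks n (Suc T) os) ! b)" using b ok[OF b] cls[OF b] by (simp add: tY_def)
    fix w' assume "tY w' (v ! Suc b) (map (map Yf) (chunks n (Suc T) os) ! b)"
    then show "w' = v ! b" using b ok[OF b] by (auto simp: tY_def block_ok_def cl_def)
  qed
  then show dY: "dY (map Yf (snd x)) = fst (fst x)" using l by (simp add: dY_def chunks_map v_def flip: wv_def os_def)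
  have "bdec w0 tZ (map (map Zf) (chunks n (Suc T) os)) = v"
  proof (rule bdec_correct)
    show "length v = Suc (length (map (map Zf) (chunks n (Suc T) os)))" "last v = w0" using l by (simp_all add: v_def)
  next
    fix b assume "b < length (map (map Zf) (chunks n (Suc T) os))"
    then have b: "b < Suc T" by simp
    show "tZ (v ! b) (v ! Suc b) (map (map Zf) (chunks n (Suc T) os) ! b)" using b ok[OF b] cls[OF b] by (simp add: tZ_def)
    fix w' assume "tZ w' (v ! Suc b) (map (map Zf) (chunks n (Suc T) os) ! b)"
    then show "w' = v ! b" using b ok[OF b] by (auto simp: tZ_def block_ok_def cl_def)
  qed
  then show dZ: "dZ (map Zf (snd x)) = fst (fst x)" using l by (simp add: dZ_def chunks_map v_def flip: wv_def os_def)
  show "mY (map Yf (snd x)) = map fst (snd (fst x))"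
  proof (rule nth_equalityI)
    show "length (mY (map Yf (snd x))) = length (map fst (snd (fst x)))" using l dY by (simp add: mY_def flip: wv_def ms_def)
    fix b assume "b < length (mY (map Yf (snd x)))"
    then have b: "b < Suc T" using l dY by (simp add: mY_def flip: wv_def)
    have "de1 (cl (v ! b, v ! Suc b)) (map Yf (chunks n (Suc T) os ! b)) = fst (ms ! b)"
      using ok(1)[OF b] by (simp add: block_ok_def cl_def)
    then show "mY (map Yf (snd x)) ! b = map fst (snd (fst x)) ! b"
      using b l dY wpairs_nth[OF l(1) b] by (simp add: mY_def chunks_map v_def flip: wv_def ms_def os_def)
  qed
  show "mZ (map Zf (snd x)) = map snd (snd (fst x))"
  proof (rule nth_equalityI)
    show "length (mZ (map Zf (snd x))) = length (map snd (snd (fst x)))" using l dZ by (simp add: mZ_def flip: wv_def ms_def)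
    fix b assume "b < length (mZ (map Zf (snd x)))"
    then have b: "b < Suc T" using l dZ by (simp add: mZ_def flip: wv_def)
    have "de2 (cl (v ! b, v ! Suc b)) (map Zf (chunks n (Suc T) os ! b)) = snd (ms ! b)"
      using ok(1)[OF b] by (simp add: block_ok_def cl_def)
    then show "mZ (map Zf (snd x)) ! b = map snd (snd (fst x)) ! b"
      using b l dZ wpairs_nth[OF l(1) b] by (simp add: mZ_def chunks_map v_def flip: wv_def ms_def os_def)
  qed
qed

lemma err_Jid: "pexp Jid (\<lambda>z. of_bool (glue z \<notin> OK)) \<le> real (Suc T) * \<eta>"
proof -
  let ?bo = "\<lambda>p x. block_ok s I xw uw de1 de2 (fst p) (snd p) x"
  let ?Wd = "seq_pmf (replicate T (pmf_of_set I))" and ?Pp = "seq_pmf (replicate r (\<kappa> a0))"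
  let ?S = "\<lambda>wv. seq_pmf (map (\<lambda>p. blk (fst p) (snd p)) (wpairs w0 wv))"
  have fin: "finite (set_pmf ?Wd)" "finite (set_pmf (?S wv))" for wv
    using finite_wv[OF I(1) neI] finite_blk by (auto intro!: finite_set_seq_pmf)
  have "pexp Jid (\<lambda>z. of_bool (glue z \<notin> OK)) \<le> pexp Jid (\<lambda>z. of_bool (\<not> list_all2 ?bo (wpairs w0 (fst z)) (fst (snd z))))"
  proof (rule pexp_mono)
    fix z assume w: "z \<in> set_pmf Jid"
    note sup = Jid_support[OF w]
    have "glue z \<in> OK" if a: "list_all2 ?bo (wpairs w0 (fst z)) (fst (snd z))"
      unfolding OK_def mem_Collect_eq chunks_glue[OF w] length_glue[OF w]
      using sup(1-3) a[unfolded list_all2_conv_all_nth] by (simp add: glue_def)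
    then show "(of_bool (glue z \<notin> OK) :: real) \<le> of_bool (\<not> list_all2 ?bo (wpairs w0 (fst z)) (fst (snd z)))" by auto
  qed
  also have "\<dots> = pexp ?Wd (\<lambda>wv. pexp (?S wv) (\<lambda>x. of_bool (\<not> list_all2 ?bo (wpairs w0 wv) x)))"
    unfolding Jid_def ideal_law_def using fin by (simp add: pexp_bind pexp_map pexp_pair pexp_const)
  also have "\<dots> \<le> pexp ?Wd (\<lambda>wv. \<Sum>p\<leftarrow>wpairs w0 wv. pexp (blk (fst p) (snd p)) (\<lambda>x. of_bool (\<not> ?bo p x)))"
    using finite_blk by (intro pexp_mono pexp_seq_union) auto
  also have "\<dots> = wavg T I w0 (\<lambda>w w'. pexp (blk w w') (\<lambda>z. of_bool (\<not> block_ok s I xw uw de1 de2 w w' z)))"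
    unfolding wavg_def by simp
  also have "\<dots> \<le> real (Suc T) * \<eta>"
    using bc unfolding block_code_def Let_def blk_def cl_def fst_conv snd_conv by blast
  finally show ?thesis .
qed

lemma err_Eid: "pexp Eid (\<lambda>w. of_bool (w \<notin> OK)) \<le> real (Suc T) * \<eta>"
  unfolding map_glue_Jid[symmetric] pexp_map[OF finite_Jid] by (rule err_Jid)

text \<open>Both laws give \<open>OK\<close> the same probability, hence also its complement. The
  error analysis thus never deals with the feedback.\<close>

lemma err_Ereal: "pexp Ereal (\<lambda>w. of_bool (w \<notin> OK)) \<le> real (Suc T) * \<eta>"
proof -
  have "pexp Ereal (\<lambda>w. of_bool (w \<in> OK)) = pexp Eid (\<lambda>w. of_bool (w \<in> OK))"
    by (rule pexp_agree[OF finite_Ereal finite_Eid, of OK]) (auto simp: agree)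
  then show ?thesis using err_Eid by (simp add: pexp_of_bool_compl finite_Ereal finite_Eid)
qed

lemma obs_glue:
  fixes Zo :: "'o \<Rightarrow> 'q"
  assumes "w \<in> set_pmf Jid"
  shows "map (\<lambda>mo. map Zo (snd mo)) (fst (snd w)) = chunks n (Suc T) (map Zo (snd (glue w)))"
    and "map Zo (snd (snd w)) = drop (n * Suc T) (map Zo (snd (glue w)))"
    and "map Zo (snd (glue w)) = concat (map (\<lambda>mo. map Zo (snd mo)) (fst (snd w))) @ map Zo (snd (snd w))"
proof -
  show "map (\<lambda>mo. map Zo (snd mo)) (fst (snd w)) = chunks n (Suc T) (map Zo (snd (glue w)))"
    by (simp add: chunks_map chunks_glue[OF assms] o_def)
  have "length (concat (map snd (fst (snd w)))) = n * length (map snd (fst (snd w)))"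
    by (rule length_concat_blocks) (use Jid_support(5)[OF assms] in auto)
  then have "length (concat (map snd (fst (snd w)))) = n * Suc T" using Jid_support(3)[OF assms] by simp
  then show "map Zo (snd (snd w)) = drop (n * Suc T) (map Zo (snd (glue w)))"
    by (simp add: glue_def)
  show "map Zo (snd (glue w)) = concat (map (\<lambda>mo. map Zo (snd mo)) (fst (snd w))) @ map Zo (snd (snd w))"
    by (simp add: glue_def map_concat o_def)
qed

text \<open>Entropies are computed for \<open>Jid\<close>, carried to \<open>Eid\<close> by
  \<open>glue\<close> and to \<open>Ereal\<close> by agreement on \<open>OK\<close>.
  \<open>cond_ent_agree\<close> is used once in each direction; in the upper bound its 1 joins the 3
  from decoding the indices.\<close>

lemma scheme_entropy:
  fixes Zo :: "'o \<Rightarrow> 'q" and A :: nat and cf :: "'i \<Rightarrow> 'cc" and af :: "(nat \<times> nat) \<times> nat \<times> nat \<Rightarrow> nat"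
    and gf :: "(nat \<times> nat) \<times> nat \<times> nat \<Rightarrow> 'g" and qf :: "(nat \<times> nat) \<times> nat \<times> nat \<Rightarrow> 'r"
    and zd :: "'q list \<Rightarrow> 'i list" and zd' :: "'q list list \<Rightarrow> 'i list"
    and S :: "('i list \<times> ((nat \<times> nat) \<times> nat \<times> nat) list) \<times> 'o list \<Rightarrow> 'cc list \<times> 'g list" and SS :: "('cc list \<times> 'g list) set"
  assumes S_def: "\<And>z. S z = (map cf (fst (fst z)), map gf (snd (fst z)))" and af: "\<And>m. af m = ha (gf m)" and gf: "\<And>m. gf m = hg (qf m)"
    and rng: "\<And>m. m \<in> ({..<A1} \<times> {..<Q1}) \<times> ({..<A2} \<times> {..<Q2}) \<Longrightarrow> af m \<in> {..<A}"
    and lo: "real (Suc T) * (log 2 (real A) - c) \<le> wavg T I w0 (\<lambda>w w'. cond_ent (blk w w') (\<lambda>z. af (fst z)) (\<lambda>z. map Zo (snd z)))"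
    and up: "wavg T I w0 (\<lambda>w w'. cond_ent (blk w w') (\<lambda>z. qf (fst z)) (\<lambda>z. (af (fst z), map Zo (snd z)))) \<le> real (Suc T) * c"
    and dec: "\<And>z. z \<in> OK \<Longrightarrow> zd (map Zo (snd z)) = fst (fst z)" and zd: "\<And>zs. zd zs = zd' (chunks n (Suc T) zs)"
    and SS: "finite SS" "\<And>z. length (fst (fst z)) = T \<Longrightarrow> set (fst (fst z)) \<subseteq> I \<Longrightarrow> length (snd (fst z)) = Suc T \<Longrightarrow>
      set (snd (fst z)) \<subseteq> ({..<A1} \<times> {..<Q1}) \<times> ({..<A2} \<times> {..<Q2}) \<Longrightarrow> S z \<in> SS"
  shows "real (Suc T) * (log 2 (real A) - c) \<le> cond_ent Ereal S (\<lambda>z. map Zo (snd z)) + 1 + real (Suc T) * \<eta> * log 2 (card SS)"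
    and "cond_ent Ereal S (\<lambda>z. map Zo (snd z)) \<le> real (Suc T) * log 2 (real A) + 4 + real (Suc T) * \<eta> * (real T * log 2 (card I))
       + real (Suc T) * c + real (Suc T) * \<eta> * log 2 (card SS)"
proof -
  let ?obs = "\<lambda>z. (map (\<lambda>mo. map Zo (snd mo)) (fst (snd z)), map Zo (snd (snd z)))"
  have m: "fst z \<in> ({..<A1} \<times> {..<Q1}) \<times> ({..<A2} \<times> {..<Q2})" if "z \<in> set_pmf (blk w w')" for z w w'
  proof -
    have "fst z \<in> set_pmf (msgs A1 Q1 A2 Q2)" using that by (auto simp: blk_def blaw_def)
    then show ?thesis unfolding set_msgs[OF pos(2-5)] .
  qed
  have perr: "pexp Jid (\<lambda>z. of_bool (zd' (fst (?obs z)) \<noteq> fst z)) \<le> real (Suc T) * \<eta>"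
  proof (rule order_trans[OF pexp_mono err_Jid])
    fix z assume w: "z \<in> set_pmf Jid"
    have "zd' (fst (?obs z)) = fst z" if "glue z \<in> OK"
      using dec[OF that] unfolding zd obs_glue(1)[OF w, symmetric] by (simp add: glue_def)
    then show "(of_bool (zd' (fst (?obs z)) \<noteq> fst z) :: real) \<le> of_bool (glue z \<notin> OK)" by auto
  qed
  have rng': "af (fst z) \<in> {..<A}" if "z \<in> set_pmf (blk w w')" for w w' z
    by (rule rng[OF m[OF that]])
  have finp: "finite (set_pmf (seq_pmf (replicate r (\<kappa> a0))))" by simp
  note me = multi_entropy[where T=T and I=I and ?w0.0=w0 and blk=blk and Pp="seq_pmf (replicate r (\<kappa> a0))" and af=af and ha=ha and gf=gf and hg=hg
      and qf=qf and Zo=Zo and cf=cf and SA="{..<A}" and zdec="\<lambda>x. zd' (fst x)" and perr="real (Suc T) * \<eta>", folded Jid_def, OF I finite_blk finp af gf finite_lessThan rng' perr, unfolded card_lessThan]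
  have me1: "wavg T I w0 (\<lambda>w w'. cond_ent (blk w w') (\<lambda>z. af (fst z)) (\<lambda>z. map Zo (snd z)))
      \<le> cond_ent Jid (\<lambda>z. (map cf (fst z), map (\<lambda>mo. gf (fst mo)) (fst (snd z)))) ?obs" by (rule me(1))
  have me2: "cond_ent Jid (\<lambda>z. (map cf (fst z), map (\<lambda>mo. gf (fst mo)) (fst (snd z)))) ?obs
      \<le> real (Suc T) * log 2 (real A) + (3 + real (Suc T) * \<eta> * (real T * log 2 (card I)))
        + wavg T I w0 (\<lambda>w w'. cond_ent (blk w w') (\<lambda>z. qf (fst z)) (\<lambda>z. (af (fst z), map Zo (snd z))))" by (rule me(2))
  have idE: "cond_ent Eid S (\<lambda>z. map Zo (snd z)) = cond_ent Jid (\<lambda>z. (map cf (fst z), map (\<lambda>mo. gf (fst mo)) (fst (snd z)))) ?obs"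
    unfolding map_glue_Jid[symmetric] cond_ent_map
  proof (rule cond_ent_inj'[OF finite_Jid])
    fix a b assume "a \<in> set_pmf Jid" "b \<in> set_pmf Jid"
    then show "(map Zo (snd (glue a)) = map Zo (snd (glue b))) = (?obs a = ?obs b)"
      using obs_glue[of a Zo] obs_glue[of b Zo] by (metis prod.inject)
  qed (simp add: S_def glue_def o_def)
  have supE: "S z \<in> SS" if "fst z \<in> set_pmf Base" for z :: "('i list \<times> ((nat \<times> nat) \<times> nat \<times> nat) list) \<times> 'o list"
    using Base_support[OF that] by (intro SS(2)) auto
  have cSS: "0 \<le> log 2 (real (card SS))"
  proof -
    have "set_pmf Base \<noteq> {}" by (rule set_pmf_not_empty)
    then obtain b where "b \<in> set_pmf Base" by auto
    then have "S (b, []) \<in> SS" by (intro supE) simp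
    then have "card SS > 0" using SS(1) by (auto simp: card_gt_0_iff)
    then show ?thesis by simp
  qed
  have 1: "cond_ent Eid S (\<lambda>z. map Zo (snd z)) \<le> cond_ent Ereal S (\<lambda>z. map Zo (snd z)) + 1 + pexp Eid (\<lambda>z. of_bool (z \<notin> OK)) * log 2 (card SS)"
    by (rule cond_ent_agree[OF finite_Ereal finite_Eid agree SS(1) supE]) (auto simp: Eid_def)
  have 2: "cond_ent Ereal S (\<lambda>z. map Zo (snd z)) \<le> cond_ent Eid S (\<lambda>z. map Zo (snd z)) + 1 + pexp Ereal (\<lambda>z. of_bool (z \<notin> OK)) * log 2 (card SS)"
    by (rule cond_ent_agree[OF finite_Eid finite_Ereal agree[symmetric] SS(1) supE]) (auto simp: Ereal_def)
  show "real (Suc T) * (log 2 (real A) - c) \<le> cond_ent Ereal S (\<lambda>z. map Zo (snd z)) + 1 + real (Suc T) * \<eta> * log 2 (card SS)"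
    using 1 me1 lo mult_right_mono[OF err_Eid cSS] unfolding idE by linarith
  show "cond_ent Ereal S (\<lambda>z. map Zo (snd z)) \<le> real (Suc T) * log 2 (real A) + 4 + real (Suc T) * \<eta> * (real T * log 2 (card I))
       + real (Suc T) * c + real (Suc T) * \<eta> * log 2 (card SS)"
    using 2 me2 up mult_right_mono[OF err_Ereal cSS] unfolding idE by linarith
qed

end

subsection \<open>The code\<close>

definition "idx S = (SOME h. bij_betw h {0..<card S} S)" for S :: "'a set"
definition "unidx S = inv_into {0..<card S} (idx S)" for S :: "'a set"

lemma bij_idx: "finite S \<Longrightarrow> bij_betw (idx S) {0..<card S} S"
  unfolding idx_def by (rule someI_ex[OF ex_bij_betw_nat_finite])

lemma inj_unidx: "finite S \<Longrightarrow> x \<in> S \<Longrightarrow> y \<in> S \<Longrightarrow> unidx S x = unidx S y \<longleftrightarrow> x = y"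
  unfolding unidx_def by (metis bij_betw_def bij_idx inv_into_injective)

lemma map_idx: "finite S \<Longrightarrow> S \<noteq> {} \<Longrightarrow> map_pmf (idx S) (pmf_of_set {0..<card S}) = pmf_of_set S"
  by (rule map_pmf_of_set_bij_betw[OF bij_idx]) (auto simp: card_gt_0_iff)

text \<open>A cloud index is a pair with one component for each message, so the cloud rate is shared
  between the two. \<open>PXc\<close> draws the channel input from the cloud letter and both private
  letters.\<close>

locale coded_scheme = block_scheme pt p12 \<kappa> fst "\<lambda>ou. snd (snd ou)" px pu "\<lambda>ou. fst (snd ou)" k s n "{..<C1} \<times> {..<C2}" "(0, 0)" T A1 "P1 * M1" A2 "P2 * M2" c \<eta> xw uw en de1 de2 r a0
  for pt :: "('u::finite \<times> 'x1::finite) pmf" and p12 :: "'u \<times> 'x1 \<Rightarrow> ('v1::finite \<times> 'v2::finite) pmf"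
    and \<kappa> :: "('u \<times> 'x1) \<times> 'v1 \<times> 'v2 \<Rightarrow> ('y::finite \<times> 'y1::finite \<times> 'z::finite) pmf"
    and px pu k s n and C1 C2 :: nat and T A1 P1 M1 A2 P2 M2 c \<eta> xw uw en de1 de2 r a0 +
  fixes W :: "'x::finite \<Rightarrow> 'x1 \<Rightarrow> ('y \<times> 'y1 \<times> 'z) pmf" and PXc :: "('u \<times> 'x1) \<times> 'v1 \<times> 'v2 \<Rightarrow> 'x pmf"
  assumes kW: "k = (\<lambda>a h. bind_pmf (PXc a) (\<lambda>x. W x h))"
begin

definition "SS1 = side_set T C1 A1 P1"
definition "SS2 = side_set T C2 A2 P2"
definition "U1 = side_msgs T C1 A1 (P1 * M1)"
definition "U2 = side_msgs T C2 A2 (P2 * M2)"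
definition "zipper x x' = (zip (fst x) (fst x'), zip (snd x) (snd x'))" for x x' :: "nat list \<times> (nat \<times> nat) list"
text \<open>A message of the code is the index of the cloud indices and of the public parts of all blocks. The dummy
  parts \<open>snd m mod M1\<close> are randomness of the encoder, drawn by conditioning the uniform law on the message.\<close>

definition "spl1 i = cond_pmf U1 {x. side_public M1 x = idx SS1 i}"
definition "spl2 i = cond_pmf U2 {x. side_public M2 x = idx SS2 i}"
definition "code = \<lparr>msz1 = card SS1, msz2 = card SS2,
  enc = (\<lambda>i j. bind_pmf (spl1 i) (\<lambda>x. bind_pmf (spl2 j) (\<lambda>x'. seq_pmf (map PXc (lw (zipper x x')))))),
  rel = (\<lambda>i h. return_pmf (rho i h)),
  dec1 = (\<lambda>ys. unidx SS1 (side_public M1 (map fst (dY ys), mY ys))),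
  dec2 = (\<lambda>zs. unidx SS2 (side_public M2 (map snd (dZ zs), mZ zs)))\<rparr>"
definition "pub1 b = side_public M1 (map fst (fst b), map fst (snd b))" for b :: "(nat \<times> nat) list \<times> ((nat \<times> nat) \<times> nat \<times> nat) list"
definition "pub2 b = side_public M2 (map snd (fst b), map snd (snd b))" for b :: "(nat \<times> nat) list \<times> ((nat \<times> nat) \<times> nat \<times> nat) list"

lemma sizes_pos: "0 < C1" "0 < C2" "0 < P1" "0 < M1" "0 < P2" "0 < M2"
  using pos I(2) by auto

lemma SS: "finite SS1" "finite SS2" "card SS1 = C1 ^ T * (A1 * P1) ^ Suc T" "card SS2 = C2 ^ T * (A2 * P2) ^ Suc T"
  unfolding SS1_def SS2_def by (rule finite_side_set card_side_set)+

lemma SS_ne: "SS1 \<noteq> {}" "SS2 \<noteq> {}" "0 < card SS1" "0 < card SS2"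
proof -
  show 1: "0 < card SS1" "0 < card SS2" unfolding SS using sizes_pos pos by auto
  show "SS1 \<noteq> {}" "SS2 \<noteq> {}" using 1 by auto
qed

lemma map_public: "map_pmf (side_public M1) U1 = map_pmf (idx SS1) (pmf_of_set {0..<card SS1})"
    "map_pmf (side_public M2) U2 = map_pmf (idx SS2) (pmf_of_set {0..<card SS2})"
  unfolding U1_def U2_def map_idx[OF SS(1) SS_ne(1)] map_idx[OF SS(2) SS_ne(2)]
  unfolding SS1_def SS2_def by (rule map_side_public; use sizes_pos pos in simp)+

lemma map_zipper: "map_pmf (\<lambda>(x, x'). zipper x x') (pair_pmf U1 U2) = Base"
  unfolding zipper_def U1_def U2_def Base_def msgs_def by (rule side_msgs_zip[OF sizes_pos(1,2)])

lemma U_lengths: "x \<in> set_pmf U1 \<Longrightarrow> length (fst x) = T \<and> length (snd x) = Suc T"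
    "x \<in> set_pmf U2 \<Longrightarrow> length (fst x) = T \<and> length (snd x) = Suc T"
  unfolding U1_def U2_def side_msgs_def set_pair_pmf by (auto dest!: length_seq_pmf simp del: replicate.simps)

lemma pub_zipper:
  assumes "x \<in> set_pmf U1" "x' \<in> set_pmf U2"
  shows "pub1 (zipper x x') = side_public M1 x" "pub2 (zipper x x') = side_public M2 x'"
  using U_lengths(1)[OF assms(1)] U_lengths(2)[OF assms(2)] by (simp_all add: pub1_def pub2_def zipper_def)

lemma spl_support:
  assumes "i < card SS1" "j < card SS2" "x \<in> set_pmf (spl1 i)" "x' \<in> set_pmf (spl2 j)"
  shows "zipper x x' \<in> set_pmf Base"
proof -
  have "idx SS1 i \<in> set_pmf (map_pmf (side_public M1) U1)" "idx SS2 j \<in> set_pmf (map_pmf (side_public M2) U2)"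
    using assms(1,2) unfolding map_public by auto
  then have "set_pmf U1 \<inter> {x. side_public M1 x = idx SS1 i} \<noteq> {}" "set_pmf U2 \<inter> {x. side_public M2 x = idx SS2 j} \<noteq> {}" by auto
  then have "x \<in> set_pmf U1" "x' \<in> set_pmf U2" using assms(3,4) by (auto simp: spl1_def spl2_def set_cond_pmf)
  then show ?thesis unfolding map_zipper[symmetric] by (auto simp: image_iff)
qed

lemma length_lw_Base: "b \<in> set_pmf Base \<Longrightarrow> length (lw b) = Nt"
  using Base_support by (intro length_lw) auto

lemma valid_code: "valid_code Nt code"
  unfolding valid_code_def
proof (intro conjI allI impI ballI)
  show "0 < msz1 code" "0 < msz2 code" using SS_ne by (simp_all add: code_def)
  fix i j xs assume "i < msz1 code" "j < msz2 code" "xs \<in> set_pmf (enc code i j)"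
  then obtain x x' where "i < card SS1" "j < card SS2" "x \<in> set_pmf (spl1 i)" "x' \<in> set_pmf (spl2 j)" "xs \<in> set_pmf (seq_pmf (map PXc (lw (zipper x x'))))"
    by (auto simp: code_def)
  then show "length xs = Nt" using length_lw_Base[OF spl_support] length_seq_pmf[of xs "map PXc (lw (zipper x x'))"] by simp
qed

text \<open>Each message and the draw from its fibre merge into uniform block messages, and the
  letterwise draw of the input is absorbed into the channel. What remains is \<open>Ereal\<close>,
  with the messages read off its base variables.\<close>

lemma code_law_eq: "code_law W Nt code = map_pmf (\<lambda>w. (unidx SS1 (pub1 (fst w)), unidx SS2 (pub2 (fst w)),
    map fst (snd w), map (\<lambda>ou. snd (snd ou)) (snd w))) Ereal"
proof -
  define G where "G = (\<lambda>i j b. bind_pmf (seq_pmf (map PXc (lw b))) (\<lambda>xs.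
     map_pmf (\<lambda>(x1s, ys, y1s, zs). (i :: nat, j :: nat, ys, zs)) (rbc_run W (\<lambda>i h. return_pmf (rho i h)) xs Nt)))"
  have V: "set_pmf (pmf_of_set {0..<card SS1}) = {0..<card SS1}" "set_pmf (pmf_of_set {0..<card SS2}) = {0..<card SS2}"
    using SS_ne by (auto intro!: set_pmf_of_set)
  have inj: "inj_on (idx SS1) (set_pmf (pmf_of_set {0..<card SS1}))" "inj_on (idx SS2) (set_pmf (pmf_of_set {0..<card SS2}))"
    unfolding V using bij_idx[OF SS(1)] bij_idx[OF SS(2)] by (auto simp: bij_betw_def)
  have "code_law W Nt code = bind_pmf (pmf_of_set {0..<card SS1}) (\<lambda>i. bind_pmf (pmf_of_set {0..<card SS2}) (\<lambda>j.
      bind_pmf (spl1 i) (\<lambda>x. bind_pmf (spl2 j) (\<lambda>x'. G i j (zipper x x')))))"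
    by (simp add: code_law_def code_def G_def bind_assoc_pmf)
  also have "\<dots> = bind_pmf (pmf_of_set {0..<card SS1}) (\<lambda>i. bind_pmf (spl1 i) (\<lambda>x. bind_pmf (pmf_of_set {0..<card SS2}) (\<lambda>j.
      bind_pmf (spl2 j) (\<lambda>x'. G i j (zipper x x')))))"
    by (intro bind_pmf_cong refl) (rule bind_commute_pmf)
  also have "\<dots> = bind_pmf (pmf_of_set {0..<card SS1}) (\<lambda>i. bind_pmf (spl1 i) (\<lambda>x. bind_pmf U2 (\<lambda>x'.
      G i (unidx SS2 (side_public M2 x')) (zipper x x'))))"
    unfolding spl2_def uniform_split[OF map_public(2) inj(2)] V(2) unidx_def ..
  also have "\<dots> = bind_pmf U1 (\<lambda>x. bind_pmf U2 (\<lambda>x'. G (unidx SS1 (side_public M1 x)) (unidx SS2 (side_public M2 x')) (zipper x x')))"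
    unfolding spl1_def uniform_split[OF map_public(1) inj(1)] V(1) unidx_def ..
  also have "\<dots> = bind_pmf U1 (\<lambda>x. bind_pmf U2 (\<lambda>x'. G (unidx SS1 (pub1 (zipper x x'))) (unidx SS2 (pub2 (zipper x x'))) (zipper x x')))"
    by (intro bind_pmf_cong refl) (simp add: pub_zipper)
  also have "\<dots> = bind_pmf Base (\<lambda>b. G (unidx SS1 (pub1 b)) (unidx SS2 (pub2 b)) b)"
    unfolding map_zipper[symmetric] by (simp add: bind_map_pmf pair_pmf_def bind_assoc_pmf bind_return_pmf)
  also have "\<dots> = bind_pmf Base (\<lambda>b. map_pmf (\<lambda>os. (unidx SS1 (pub1 b), unidx SS2 (pub2 b), map fst os, map (\<lambda>ou. snd (snd ou)) os))
      (orun k (\<lambda>i os. rho i (map (\<lambda>ou. fst (snd ou)) os)) (lw b) Nt))"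
  proof (intro bind_pmf_cong refl)
    fix b assume b: "b \<in> set_pmf Base"
    have run: "map_pmf (\<lambda>(x1s, ys, y1s, zs). (i, j, ys, zs)) (rbc_run W (\<lambda>i h. return_pmf (rho i h)) xs Nt)
      = map_pmf (\<lambda>os. (i, j, map fst os, map (\<lambda>ou. snd (snd ou)) os)) (orun W (\<lambda>i os. rho i (map (\<lambda>ou. fst (snd ou)) os)) xs Nt)" for i j :: nat and xs
      using arg_cong[OF rbc_run_orun[of W rho xs Nt], of "map_pmf (\<lambda>(ys, y1s, zs). (i, j, ys, zs))"]
      by (simp add: map_pmf_comp case_prod_unfold)
    have "G i j b = map_pmf (\<lambda>os. (i, j, map fst os, map (\<lambda>ou. snd (snd ou)) os))
       (bind_pmf (seq_pmf (map PXc (lw b))) (\<lambda>xs. orun W (\<lambda>i os. rho i (map (\<lambda>ou. fst (snd ou)) os)) xs Nt))" for i j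
      by (simp add: G_def run map_bind_pmf)
    also have "bind_pmf (seq_pmf (map PXc (lw b))) (\<lambda>xs. orun W (\<lambda>i os. rho i (map (\<lambda>ou. fst (snd ou)) os)) xs Nt)
      = orun k (\<lambda>i os. rho i (map (\<lambda>ou. fst (snd ou)) os)) (lw b) Nt"
      using orun_mix[of PXc "lw b" W] unfolding kW length_lw_Base[OF b] .
    finally show "G (unidx SS1 (pub1 b)) (unidx SS2 (pub2 b)) b = map_pmf (\<lambda>os. (unidx SS1 (pub1 b), unidx SS2 (pub2 b), map fst os, map (\<lambda>ou. snd (snd ou)) os))
      (orun k (\<lambda>i os. rho i (map (\<lambda>ou. fst (snd ou)) os)) (lw b) Nt)" .
  qed
  finally show ?thesis by (simp add: Ereal_def map_bind_pmf map_pmf_comp)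
qed

lemma error_le:
  assumes "\<And>w. w \<in> OK \<Longrightarrow> \<not> F (unidx SS1 (pub1 (fst w)), unidx SS2 (pub2 (fst w)), map fst (snd w), map (\<lambda>ou. snd (snd ou)) (snd w))"
  shows "measure_pmf.prob (code_law W Nt code) {x. F x} \<le> real (Suc T) * \<eta>"
proof -
  have "measure_pmf.prob (code_law W Nt code) {x. F x} = pexp Ereal (\<lambda>w. of_bool (F (unidx SS1 (pub1 (fst w)), unidx SS2 (pub2 (fst w)), map fst (snd w), map (\<lambda>ou. snd (snd ou)) (snd w))))"
    unfolding code_law_eq measure_map_pmf vimage_Collect_eq by (rule prob_eq_pexp[OF finite_Ereal])
  also have "\<dots> \<le> pexp Ereal (\<lambda>w. of_bool (w \<notin> OK))"
    using assms by (intro pexp_mono) (metis of_bool_eq_iff of_bool_less_eq_one order_refl zero_less_one_class.zero_le_one of_bool_eq(1) of_bool_eq(2))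
  finally show ?thesis using err_Ereal by simp
qed

lemma Pe: "Pe1 W Nt code \<le> real (Suc T) * \<eta>" "Pe2 W Nt code \<le> real (Suc T) * \<eta>"
proof -
  have "Pe1 W Nt code = measure_pmf.prob (code_law W Nt code) {x. case x of (w1, w2, ys, zs) \<Rightarrow> dec1 code ys \<noteq> w1}"
    by (simp add: Pe1_def)
  also have "\<dots> \<le> real (Suc T) * \<eta>"
    by (rule error_le) (use receivers_correct in \<open>simp add: code_def pub1_def\<close>)
  finally show "Pe1 W Nt code \<le> real (Suc T) * \<eta>" .
  have "Pe2 W Nt code = measure_pmf.prob (code_law W Nt code) {x. case x of (w1, w2, ys, zs) \<Rightarrow> dec2 code zs \<noteq> w2}"
    by (simp add: Pe2_def)
  also have "\<dots> \<le> real (Suc T) * \<eta>"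
    by (rule error_le) (use receivers_correct in \<open>simp add: code_def pub2_def\<close>)
  finally show "Pe2 W Nt code \<le> real (Suc T) * \<eta>" .
qed

lemma pub_range:
  assumes "length (fst b) = T" "set (fst b) \<subseteq> {..<C1} \<times> {..<C2}" "length (snd b) = Suc T"
    "set (snd b) \<subseteq> ({..<A1} \<times> {..<P1 * M1}) \<times> ({..<A2} \<times> {..<P2 * M2})"
  shows "pub1 b \<in> SS1" "pub2 b \<in> SS2"
proof -
  have m: "fst (fst m) < A1" "snd (fst m) div M1 < P1" "fst (snd m) < A2" "snd (snd m) div M2 < P2" if "m \<in> set (snd b)" for m
  proof -
    have m: "m \<in> ({..<A1} \<times> {..<P1 * M1}) \<times> ({..<A2} \<times> {..<P2 * M2})" using assms(4) that by blast
    then show "fst (fst m) < A1" "fst (snd m) < A2" by auto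
    show "snd (fst m) div M1 < P1" "snd (snd m) div M2 < P2" using m sizes_pos by (auto simp: less_mult_imp_div_less)
  qed
  have c: "fst w < C1" "snd w < C2" if "w \<in> set (fst b)" for w
    using assms(2) that by auto
  show "pub1 b \<in> SS1" "pub2 b \<in> SS2"
    using assms(1,3) m c by (auto simp: pub1_def pub2_def side_public_def SS1_def SS2_def side_set_def)
qed

lemma Delta_pub:
  "cond_ent (code_law W Nt code) (\<lambda>(w1, w2, ys, zs). w1) (\<lambda>(w1, w2, ys, zs). zs) = cond_ent Ereal (\<lambda>w. pub1 (fst w)) (\<lambda>w. map (\<lambda>ou. snd (snd ou)) (snd w))"
  "cond_ent (code_law W Nt code) (\<lambda>(w1, w2, ys, zs). w2) (\<lambda>(w1, w2, ys, zs). ys) = cond_ent Ereal (\<lambda>w. pub2 (fst w)) (\<lambda>w. map fst (snd w))"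
proof -
  have r: "pub1 (fst w) \<in> SS1" "pub2 (fst w) \<in> SS2" if "w \<in> set_pmf Ereal" for w
  proof -
    have "fst w \<in> set_pmf Base" using that by (auto simp: Ereal_def)
    then show "pub1 (fst w) \<in> SS1" "pub2 (fst w) \<in> SS2" using pub_range[OF Base_support] by auto
  qed
  show "cond_ent (code_law W Nt code) (\<lambda>(w1, w2, ys, zs). w1) (\<lambda>(w1, w2, ys, zs). zs) = cond_ent Ereal (\<lambda>w. pub1 (fst w)) (\<lambda>w. map (\<lambda>ou. snd (snd ou)) (snd w))"
    unfolding code_law_eq cond_ent_map split_conv
    by (rule cond_ent_inj'[OF finite_Ereal]) (simp_all add: inj_unidx SS r)
  show "cond_ent (code_law W Nt code) (\<lambda>(w1, w2, ys, zs). w2) (\<lambda>(w1, w2, ys, zs). ys) = cond_ent Ereal (\<lambda>w. pub2 (fst w)) (\<lambda>w. map fst (snd w))"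
    unfolding code_law_eq cond_ent_map split_conv
    by (rule cond_ent_inj'[OF finite_Ereal]) (simp_all add: inj_unidx SS r)
qed

lemma Nt_pos: "0 < Nt"
  using pos by (simp add: Nt_def)

lemma Delta_bounds:
  "real (Suc T) * (log 2 (real A1) - c) \<le> real Nt * Delta1 W Nt code + 1 + real (Suc T) * \<eta> * log 2 (card SS1)"
  "real Nt * Delta1 W Nt code \<le> real (Suc T) * log 2 (real A1) + 4 + real (Suc T) * \<eta> * (real T * log 2 (real (C1 * C2)))
     + real (Suc T) * c + real (Suc T) * \<eta> * log 2 (card SS1)"
  "real (Suc T) * (log 2 (real A2) - c) \<le> real Nt * Delta2 W Nt code + 1 + real (Suc T) * \<eta> * log 2 (card SS2)"
  "real Nt * Delta2 W Nt code \<le> real (Suc T) * log 2 (real A2) + 4 + real (Suc T) * \<eta> * (real T * log 2 (real (C1 * C2)))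
     + real (Suc T) * c + real (Suc T) * \<eta> * log 2 (card SS2)"
proof -
  have cI: "card ({..<C1} \<times> {..<C2}) = C1 * C2" by simp
  have N: "real Nt * (x / real Nt) = x" for x using Nt_pos by simp
  note bcs = bc[unfolded block_code_def Let_def]
  have w1: "real (Suc T) * (log 2 (real A1) - c) \<le> wavg T ({..<C1} \<times> {..<C2}) (0, 0) (\<lambda>w w'. cond_ent (blk w w') (\<lambda>z. fst (fst (fst z))) (\<lambda>z. map (\<lambda>ou. snd (snd ou)) (snd z)))"
    "wavg T ({..<C1} \<times> {..<C2}) (0, 0) (\<lambda>w w'. cond_ent (blk w w') (\<lambda>z. fst (fst z)) (\<lambda>z. (fst (fst (fst z)), map (\<lambda>ou. snd (snd ou)) (snd z)))) \<le> real (Suc T) * c"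
    and w2: "real (Suc T) * (log 2 (real A2) - c) \<le> wavg T ({..<C1} \<times> {..<C2}) (0, 0) (\<lambda>w w'. cond_ent (blk w w') (\<lambda>z. fst (snd (fst z))) (\<lambda>z. map fst (snd z)))"
    "wavg T ({..<C1} \<times> {..<C2}) (0, 0) (\<lambda>w w'. cond_ent (blk w w') (\<lambda>z. snd (fst z)) (\<lambda>z. (fst (snd (fst z)), map fst (snd z)))) \<le> real (Suc T) * c"
    using bcs unfolding blk_def cl_def fst_conv snd_conv by blast+
  have S1: "pub1 (fst z) = (map fst (fst (fst z)), map (\<lambda>m. (fst (fst m), snd (fst m) div M1)) (snd (fst z)))"
    and S2: "pub2 (fst z) = (map snd (fst (fst z)), map (\<lambda>m. (fst (snd m), snd (snd m) div M2)) (snd (fst z)))"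
    for z :: "((nat \<times> nat) list \<times> ((nat \<times> nat) \<times> nat \<times> nat) list) \<times> ('y \<times> 'y1 \<times> 'z) list"
    by (simp_all add: pub1_def pub2_def side_public_def o_def)
  note e1 = scheme_entropy[where Zo="\<lambda>ou. snd (snd ou)" and A=A1 and cf=fst and af="\<lambda>m. fst (fst m)" and gf="\<lambda>m. (fst (fst m), snd (fst m) div M1)"
     and qf=fst and ha=fst and hg="\<lambda>q. (fst q, snd q div M1)" and zd=dZ and zd'="\<lambda>ch. take T (tl (bdec (0, 0) tZ ch))" and S="\<lambda>z. pub1 (fst z)" and SS=SS1]
  note e2 = scheme_entropy[where Zo="fst" and A=A2 and cf=snd and af="\<lambda>m. fst (snd m)" and gf="\<lambda>m. (fst (snd m), snd (snd m) div M2)"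
     and qf=snd and ha=fst and hg="\<lambda>q. (fst q, snd q div M2)" and zd=dY and zd'="\<lambda>ch. take T (tl (bdec (0, 0) tY ch))" and S="\<lambda>z. pub2 (fst z)" and SS=SS2]
  show "real (Suc T) * (log 2 (real A1) - c) \<le> real Nt * Delta1 W Nt code + 1 + real (Suc T) * \<eta> * log 2 (card SS1)"
    unfolding Delta1_def N Delta_pub
    by (rule e1(1)[OF S1 _ _ _ w1 _ dZ_def SS(1)]) ((erule receivers_correct(3)) | (rule pub_range(1); assumption) | force)+
  show "real Nt * Delta1 W Nt code \<le> real (Suc T) * log 2 (real A1) + 4 + real (Suc T) * \<eta> * (real T * log 2 (real (C1 * C2)))
     + real (Suc T) * c + real (Suc T) * \<eta> * log 2 (card SS1)"
    unfolding Delta1_def N Delta_pub cI[symmetric]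
    by (rule e1(2)[OF S1 _ _ _ w1 _ dZ_def SS(1)]) ((erule receivers_correct(3)) | (rule pub_range(1); assumption) | force)+
  show "real (Suc T) * (log 2 (real A2) - c) \<le> real Nt * Delta2 W Nt code + 1 + real (Suc T) * \<eta> * log 2 (card SS2)"
    unfolding Delta2_def N Delta_pub
    by (rule e2(1)[OF S2 _ _ _ w2 _ dY_def SS(2)]) ((erule receivers_correct(1)) | (rule pub_range(2); assumption) | force)+
  show "real Nt * Delta2 W Nt code \<le> real (Suc T) * log 2 (real A2) + 4 + real (Suc T) * \<eta> * (real T * log 2 (real (C1 * C2)))
     + real (Suc T) * c + real (Suc T) * \<eta> * log 2 (card SS2)"
    unfolding Delta2_def N Delta_pub cI[symmetric]
    by (rule e2(2)[OF S2 _ _ _ w2 _ dY_def SS(2)]) ((erule receivers_correct(1)) | (rule pub_range(2); assumption) | force)+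
qed

end

locale rbc_letters = relay_letters pt p12 "\<lambda>a. bind_pmf (PXc a) (\<lambda>x. W x (snd (fst a)))" fst "\<lambda>ou. snd (snd ou)" px pu "\<lambda>ou. fst (snd ou)"
  for W :: "'x::finite \<Rightarrow> 'x1::finite \<Rightarrow> ('y::finite \<times> 'y1::finite \<times> 'z::finite) pmf"
    and pt :: "('u::finite \<times> 'x1) pmf" and p12 :: "'u \<times> 'x1 \<Rightarrow> ('v1::finite \<times> 'v2::finite) pmf"
    and PXc :: "('u \<times> 'x1) \<times> 'v1 \<times> 'v2 \<Rightarrow> 'x pmf" and px pu
begin

definition "code_bounds N T A C1 C2 c \<eta> X D \<longleftrightarrow>
  real (Suc T) * (log 2 (real A) - c) \<le> real N * D + 1 + real (Suc T) * \<eta> * log 2 (real X) \<and>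
  real N * D \<le> real (Suc T) * log 2 (real A) + 4 + real (Suc T) * \<eta> * (real T * log 2 (real (C1 * C2)))
     + real (Suc T) * c + real (Suc T) * \<eta> * log 2 (real X)" for A C1 C2 X :: nat

lemma code_exists:
  assumes s: "0 < s" and \<eta>: "0 < \<eta>"
  shows "\<forall>\<^sub>F n in sequentially. \<forall>A1 P1 M1 L1 A2 P2 M2 L2 C1 C2 T r.
    size_ok s n A1 (P1 * M1) L1 A2 (P2 * M2) L2 (C1 * C2) \<longrightarrow> 0 < C1 \<longrightarrow> 0 < C2 \<longrightarrow>
    (\<exists>c. valid_code (n * Suc T + r) c \<and> msz1 c = C1 ^ T * (A1 * P1) ^ Suc T \<and> msz2 c = C2 ^ T * (A2 * P2) ^ Suc T \<and>
      Pe1 W (n * Suc T + r) c \<le> real (Suc T) * \<eta> \<and> Pe2 W (n * Suc T + r) c \<le> real (Suc T) * \<eta> \<and>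
      code_bounds (n * Suc T + r) T A1 C1 C2 (20 * real n * s) \<eta> (msz1 c) (Delta1 W (n * Suc T + r) c) \<and>
      code_bounds (n * Suc T + r) T A2 C1 C2 (20 * real n * s) \<eta> (msz2 c) (Delta2 W (n * Suc T + r) c))"
  using block_code_exists[where 'i="nat \<times> nat", OF s \<eta>] eventually_gt_at_top[of 0]
proof eventually_elim
  case (elim n)
  show ?case
  proof (intro allI impI)
    fix A1 P1 M1 L1 A2 P2 M2 L2 C1 C2 T r
    assume sz: "size_ok s n A1 (P1 * M1) L1 A2 (P2 * M2) L2 (C1 * C2)" and C: "0 < C1" "0 < C2"
    obtain xw uw en de1 de2 where bc: "block_code s n ({..<C1} \<times> {..<C2}) (0, 0) T A1 (P1 * M1) A2 (P2 * M2) (20 * real n * s) \<eta> xw uw en de1 de2"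
      using elim(1)[rule_format, of A1 "P1 * M1" L1 A2 "P2 * M2" L2 "{..<C1} \<times> {..<C2}" "(0, 0)" T] sz C by auto
    interpret coded_scheme pt p12 "\<lambda>a. bind_pmf (PXc a) (\<lambda>x. W x (snd (fst a)))" px pu "\<lambda>a h. bind_pmf (PXc a) (\<lambda>x. W x h)"
      s n C1 C2 T A1 P1 M1 A2 P2 M2 "20 * real n * s" \<eta> xw uw en de1 de2 r undefined W PXc
      by unfold_locales (use bc elim(2) C sz in \<open>auto simp: size_ok_def\<close>)
    have m: "msz1 code = card SS1" "msz2 code = card SS2" by (simp_all add: code_def)
    show "\<exists>c. valid_code (n * Suc T + r) c \<and> msz1 c = C1 ^ T * (A1 * P1) ^ Suc T \<and> msz2 c = C2 ^ T * (A2 * P2) ^ Suc T \<and>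
      Pe1 W (n * Suc T + r) c \<le> real (Suc T) * \<eta> \<and> Pe2 W (n * Suc T + r) c \<le> real (Suc T) * \<eta> \<and>
      code_bounds (n * Suc T + r) T A1 C1 C2 (20 * real n * s) \<eta> (msz1 c) (Delta1 W (n * Suc T + r) c) \<and>
      code_bounds (n * Suc T + r) T A2 C1 C2 (20 * real n * s) \<eta> (msz2 c) (Delta2 W (n * Suc T + r) c)"
    proof (intro exI[of _ code] conjI)
      show "code_bounds (n * Suc T + r) T A1 C1 C2 (20 * real n * s) \<eta> (msz1 code) (Delta1 W (n * Suc T + r) code)"
        unfolding code_bounds_def m(1) by (rule conjI[OF Delta_bounds(1,2)[unfolded Nt_def]])
      show "code_bounds (n * Suc T + r) T A2 C1 C2 (20 * real n * s) \<eta> (msz2 code) (Delta2 W (n * Suc T + r) code)"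
        unfolding code_bounds_def m(2) by (rule conjI[OF Delta_bounds(3,4)[unfolded Nt_def]])
    qed (fact valid_code[unfolded Nt_def] Pe[unfolded Nt_def] SS(3,4)[folded m])+
  qed
qed

end

subsection \<open>Rates\<close>

definition "approx_code W R1 R2 E1 E2 \<delta> N c \<longleftrightarrow> valid_code N c \<and>
  \<bar>log 2 (real (msz1 c)) / real N - R1\<bar> \<le> \<delta> \<and> \<bar>log 2 (real (msz2 c)) / real N - R2\<bar> \<le> \<delta> \<and>
  \<bar>Delta1 W N c - E1\<bar> \<le> \<delta> \<and> \<bar>Delta2 W N c - E2\<bar> \<le> \<delta> \<and> Pe1 W N c \<le> \<delta> \<and> Pe2 W N c \<le> \<delta>"

lemma approx_code_mono: "approx_code W R1 R2 E1 E2 \<delta> N c \<Longrightarrow> \<delta> \<le> \<delta>' \<Longrightarrow> approx_code W R1 R2 E1 E2 \<delta>' N c"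
  unfolding approx_code_def by (meson order_trans)

lemma tendsto_of_eventually_close:
  fixes f :: "nat \<Rightarrow> real"
  assumes "\<And>\<delta>. 0 < \<delta> \<Longrightarrow> \<forall>\<^sub>F N in sequentially. \<bar>f N - l\<bar> \<le> \<delta>"
  shows "f \<longlonglongrightarrow> l"
proof (rule tendstoI)
  fix e :: real assume "0 < e"
  then have "\<forall>\<^sub>F N in sequentially. \<bar>f N - l\<bar> \<le> e / 2" by (intro assms) simp
  then show "\<forall>\<^sub>F N in sequentially. dist (f N) l < e"
    by eventually_elim (use \<open>0 < e\<close> in \<open>simp add: dist_real_def\<close>)
qed

lemma achievable_of_approx:
  fixes W :: "'x \<Rightarrow> 'x1 \<Rightarrow> ('y \<times> 'y1 \<times> 'z) pmf"
  assumes pos: "0 < R1" "0 < R2" "0 < Re1" "0 < Re2" and E: "Re1 \<le> E1" "Re2 \<le> E2"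
    and ex: "\<And>\<delta>. 0 < \<delta> \<Longrightarrow> \<forall>\<^sub>F N in sequentially. \<exists>c. approx_code W R1 R2 E1 E2 \<delta> N c"
  shows "achievable W R1 R2 Re1 Re2"
proof -
  text \<open>Diagonal choice: \<open>C N\<close> has the best precision \<open>1 / (j + 1)\<close>, \<open>j \<le> N\<close>, that is available at length \<open>N\<close>.\<close>
  define S where "S = (\<lambda>N. {j. j \<le> N \<and> (\<exists>c. approx_code W R1 R2 E1 E2 (1 / real (Suc j)) N c)})"
  define C0 :: "nat \<Rightarrow> ('x, 'x1, 'y, 'y1, 'z) rbc_code" where
    "C0 = (\<lambda>N. \<lparr>msz1 = 1, msz2 = 1, enc = (\<lambda>_ _. return_pmf (replicate N undefined)), rel = (\<lambda>_ _. return_pmf undefined), dec1 = (\<lambda>_. 0), dec2 = (\<lambda>_. 0)\<rparr>)"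
  define C where "C = (\<lambda>N. if S N = {} then C0 N else SOME c. approx_code W R1 R2 E1 E2 (1 / real (Suc (Max (S N)))) N c)"
  have fin: "finite (S N)" for N unfolding S_def by (rule finite_subset[of _ "{..N}"]) auto
  have C: "approx_code W R1 R2 E1 E2 (1 / real (Suc (Max (S N)))) N (C N)" if "S N \<noteq> {}" for N
  proof -
    have "Max (S N) \<in> S N" using fin that by (rule Max_in)
    then have "\<exists>c. approx_code W R1 R2 E1 E2 (1 / real (Suc (Max (S N)))) N c" by (simp add: S_def)
    then show ?thesis using that by (simp add: C_def someI_ex)
  qed
  have valid: "valid_code N (C N)" for N
  proof (cases "S N = {}")
    case True
    then show ?thesis by (simp add: C_def C0_def valid_code_def)
  next
    case False
    then show ?thesis using C[of N] by (simp add: approx_code_def)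
  qed
  have app: "\<forall>\<^sub>F N in sequentially. approx_code W R1 R2 E1 E2 \<delta> N (C N)" if d: "0 < \<delta>" for \<delta>
  proof -
    obtain j :: nat where j: "inverse (real (Suc j)) < \<delta>" using reals_Archimedean[OF d] by auto
    have "\<forall>\<^sub>F N in sequentially. \<exists>c. approx_code W R1 R2 E1 E2 (1 / real (Suc j)) N c" by (rule ex) simp
    then show ?thesis using eventually_ge_at_top[of j]
    proof eventually_elim
      case (elim N)
      then have "j \<in> S N" by (simp add: S_def)
      then have "S N \<noteq> {}" "j \<le> Max (S N)" using fin by auto
      moreover then have "1 / real (Suc (Max (S N))) \<le> 1 / real (Suc j)" by (intro divide_left_mono) auto
      moreover have "1 / real (Suc j) \<le> \<delta>" using j by (simp add: inverse_eq_divide)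
      ultimately show ?case using C approx_code_mono order_trans by metis
    qed
  qed
  have lims: "(\<lambda>N. log 2 (real (msz1 (C N))) / real N) \<longlonglongrightarrow> R1" "(\<lambda>N. log 2 (real (msz2 (C N))) / real N) \<longlonglongrightarrow> R2"
    "(\<lambda>N. Delta1 W N (C N)) \<longlonglongrightarrow> E1" "(\<lambda>N. Delta2 W N (C N)) \<longlonglongrightarrow> E2"
    by (rule tendsto_of_eventually_close, drule app, erule eventually_mono, simp add: approx_code_def)+
  have pe: "\<forall>\<^sub>F N in sequentially. Pe1 W N (C N) \<le> \<epsilon> \<and> Pe2 W N (C N) \<le> \<epsilon>" if "0 < \<epsilon>" for \<epsilon>
    using app[OF that] by eventually_elim (simp add: approx_code_def)
  show ?thesis unfolding achievable_def using pos valid lims E pe by blast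
qed

definition "sz n x = nat \<lfloor>2 powr (real n * x)\<rfloor>" for n :: nat

lemma sz_bounds:
  assumes "0 \<le> x"
  shows "0 < sz n x" "real (sz n x) \<le> 2 powr (real n * x)" "2 powr (real n * x) \<le> 2 * real (sz n x)"
    "log 2 (real (sz n x)) \<le> real n * x" "real n * x - 1 \<le> log 2 (real (sz n x))"
proof -
  have 1: "1 \<le> 2 powr (real n * x)" using assms by (intro ge_one_powr_ge_zero) auto
  then have f: "1 \<le> \<lfloor>2 powr (real n * x)\<rfloor>" by linarith
  then show p: "0 < sz n x" by (simp add: sz_def)
  have e: "real (sz n x) = real_of_int \<lfloor>2 powr (real n * x)\<rfloor>" using f by (simp add: sz_def)
  show u: "real (sz n x) \<le> 2 powr (real n * x)" unfolding e by linarith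
  show l: "2 powr (real n * x) \<le> 2 * real (sz n x)" unfolding e using f 1 by linarith
  show "log 2 (real (sz n x)) \<le> real n * x" using u p by (simp add: log_le_iff)
  have "real n * x = log 2 (2 powr (real n * x))" by simp
  also have "\<dots> \<le> log 2 (2 * real (sz n x))" using l p by (subst log_le_cancel_iff) auto
  also have "\<dots> = 1 + log 2 (real (sz n x))" using p by (simp add: log_mult)
  finally show "real n * x - 1 \<le> log 2 (real (sz n x))" by simp
qed

lemma sz_zero [simp]: "sz n 0 = 1"
  by (simp add: sz_def)

text \<open>\<open>a\<close>, \<open>p\<close>, \<open>m\<close> are the rates of secret part,
  public part and dummy, \<open>l\<close> is the binning rate of this side and \<open>l'\<close>
  that of the other. Rounding loses at most one bit per size, and \<open>2 \<le> real n * s\<close>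
  lets one \<open>s\<close> of slack pay for two sizes. The \<open>3 * s\<close> in the binning
  sizes is the margin for covering.\<close>

lemma size_bounds:
  fixes s a p m l l' :: real
  assumes s: "0 < s" "2 \<le> real n * s" and nn: "0 \<le> a" "0 \<le> p" "0 \<le> m" "0 \<le> l" "0 \<le> l'"
  defines "A \<equiv> sz n a" and "Q \<equiv> sz n p * sz n m" and "L \<equiv> sz n (l + 3 * s)" and "L' \<equiv> sz n (l' + 3 * s)"
  shows "0 < A" "0 < Q" "0 < L"
    "2 powr (real n * (3 * s)) \<le> 2 * real L"
    "2 powr (real n * (l + l' + 2 * s)) \<le> real L * real L'"
    "real L * real L' * real (A * Q * L) \<le> 2 powr (real n * (l + l' + a + p + m + l + 9 * s))"
    "real L * real L' * real (Q * L) \<le> 2 powr (real n * (l + l' + p + m + l + 9 * s))"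
    "real L' * 2 powr (real n * (p + m - l' - 4 * s)) \<le> real Q"
    "real (A * Q * L) \<le> 2 powr (real n * (a + p + m + l + 3 * s))"
proof -
  have l3: "0 \<le> l + 3 * s" "0 \<le> l' + 3 * s" using s nn by auto
  note b = sz_bounds[OF nn(1), of n] sz_bounds[OF nn(2), of n] sz_bounds[OF nn(3), of n] sz_bounds[OF l3(1), of n] sz_bounds[OF l3(2), of n]
  show "0 < A" "0 < Q" "0 < L" using b by (auto simp: A_def Q_def L_def)
  have "2 powr (real n * (3 * s)) \<le> 2 powr (real n * (l + 3 * s))" using nn by (intro powr_mono mult_left_mono) auto
  also have "\<dots> \<le> 2 * real L" unfolding L_def by (rule b)
  finally show "2 powr (real n * (3 * s)) \<le> 2 * real L" .
  have "2 powr (real n * (l + l' + 2 * s)) \<le> 2 powr (real n * (l + 3 * s) - 1 + (real n * (l' + 3 * s) - 1))"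
    using s by (intro powr_mono) (auto simp: algebra_simps)
  also have "\<dots> = 2 powr (real n * (l + 3 * s)) / 2 * (2 powr (real n * (l' + 3 * s)) / 2)"
    by (simp add: powr_add powr_diff)
  also have "\<dots> \<le> real L * real L'" unfolding L_def L'_def using b by (intro mult_mono) auto
  finally show "2 powr (real n * (l + l' + 2 * s)) \<le> real L * real L'" .
  have Qu: "real Q \<le> 2 powr (real n * (p + m))"
    unfolding Q_def of_nat_mult distrib_left powr_add using b by (intro mult_mono) auto
  have QLu: "real (Q * L) \<le> 2 powr (real n * (p + m + l + 3 * s))"
  proof -
    have "real (Q * L) \<le> 2 powr (real n * (p + m)) * 2 powr (real n * (l + 3 * s))"
      unfolding of_nat_mult using Qu b by (intro mult_mono) (auto simp: L_def)
    then show ?thesis unfolding powr_add[symmetric] distrib_left[symmetric] by (simp add: add.assoc)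
  qed
  have LLu: "real L * real L' \<le> 2 powr (real n * (l + l' + 6 * s))"
  proof -
    have "real L * real L' \<le> 2 powr (real n * (l + 3 * s)) * 2 powr (real n * (l' + 3 * s))"
      using b by (intro mult_mono) (auto simp: L_def L'_def)
    then show ?thesis unfolding powr_add[symmetric] distrib_left[symmetric] by (simp add: algebra_simps)
  qed
  show AQLu: "real (A * Q * L) \<le> 2 powr (real n * (a + p + m + l + 3 * s))"
  proof -
    have "real A * real (Q * L) \<le> 2 powr (real n * a) * 2 powr (real n * (p + m + l + 3 * s))"
      using QLu b by (intro mult_mono) (auto simp: A_def)
    then show ?thesis unfolding powr_add[symmetric] distrib_left[symmetric] by (simp add: algebra_simps)
  qed
  have "real L * real L' * real (A * Q * L) \<le> 2 powr (real n * (l + l' + 6 * s)) * 2 powr (real n * (a + p + m + l + 3 * s))"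
    using LLu AQLu by (intro mult_mono) auto
  then show "real L * real L' * real (A * Q * L) \<le> 2 powr (real n * (l + l' + a + p + m + l + 9 * s))"
    unfolding powr_add[symmetric] distrib_left[symmetric] by (simp add: algebra_simps)
  have "real L * real L' * real (Q * L) \<le> 2 powr (real n * (l + l' + 6 * s)) * 2 powr (real n * (p + m + l + 3 * s))"
    using LLu QLu by (intro mult_mono) auto
  then show "real L * real L' * real (Q * L) \<le> 2 powr (real n * (l + l' + p + m + l + 9 * s))"
    unfolding powr_add[symmetric] distrib_left[symmetric] by (simp add: algebra_simps)
  have "real L' * 2 powr (real n * (p + m - l' - 4 * s)) \<le> 2 powr (real n * (l' + 3 * s)) * 2 powr (real n * (p + m - l' - 4 * s))"
    using b by (intro mult_right_mono) (auto simp: L'_def)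
  also have "\<dots> = 2 powr (real n * (p + m) - real n * s)" by (simp add: powr_add[symmetric] algebra_simps)
  also have "\<dots> \<le> 2 powr (real n * p - 1 + (real n * m - 1))" using s by (intro powr_mono) (auto simp: algebra_simps)
  also have "\<dots> = 2 powr (real n * p) / 2 * (2 powr (real n * m) / 2)"
    by (simp add: powr_add powr_diff)
  also have "\<dots> \<le> real Q" unfolding Q_def of_nat_mult using b by (intro mult_mono) auto
  finally show "real L' * 2 powr (real n * (p + m - l' - 4 * s)) \<le> real Q" .
qed

text \<open>The \<open>r < \<tau>\<close> padding letters enlarge the block length by a fraction
  below \<open>1 / real n\<close>, which moves the rate \<open>\<rho>\<close> by at most
  \<open>\<rho> / real n\<close>.\<close>

lemma rate_close:
  assumes "0 < n" "r < \<tau>" "0 \<le> \<rho>" "\<bar>X - real n * real \<tau> * \<rho>\<bar> \<le> real n * real \<tau> * e"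
  shows "\<bar>X / real (n * \<tau> + r) - \<rho>\<bar> \<le> e + \<rho> / real n"
proof -
  have nt: "0 < real n * real \<tau>" using assms by simp
  then have N: "0 < real (n * \<tau> + r)" "real n * real \<tau> \<le> real (n * \<tau> + r)" by auto
  have e: "0 \<le> real n * real \<tau> * e" using assms(4) by linarith
  then have e0: "0 \<le> e" using nt by (simp add: zero_le_mult_iff)
  have "X - real (n * \<tau> + r) * \<rho> = (X - real n * real \<tau> * \<rho>) - real r * \<rho>" by (simp add: algebra_simps)
  then have "\<bar>X - real (n * \<tau> + r) * \<rho>\<bar> \<le> real n * real \<tau> * e + real r * \<rho>"
    using assms(3,4) abs_triangle_ineq4[of "X - real n * real \<tau> * \<rho>" "real r * \<rho>"] by simp
  also have "real r * \<rho> \<le> real \<tau> * \<rho>" using assms(2,3) by (intro mult_right_mono) auto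
  also have "real n * real \<tau> * e + real \<tau> * \<rho> = real n * real \<tau> * (e + \<rho> / real n)" using assms(1) by (simp add: field_simps)
  also have "\<dots> \<le> real (n * \<tau> + r) * (e + \<rho> / real n)" using N(2) e0 assms(3) by (intro mult_right_mono) auto
  finally have "\<bar>X - real (n * \<tau> + r) * \<rho>\<bar> / real (n * \<tau> + r) \<le> e + \<rho> / real n"
    using N(1) by (simp add: divide_le_eq mult.commute)
  moreover have "\<bar>X / real (n * \<tau> + r) - \<rho>\<bar> = \<bar>X - real (n * \<tau> + r) * \<rho>\<bar> / real (n * \<tau> + r)"
  proof -
    have "X / real (n * \<tau> + r) - \<rho> = (X - real (n * \<tau> + r) * \<rho>) / real (n * \<tau> + r)" using N(1) by (simp add: diff_divide_distrib)
    then show ?thesis using N(1) by (simp only: abs_divide abs_of_pos)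
  qed
  ultimately show ?thesis by simp
qed

context rbc_letters
begin

text \<open>Public part, dummy and binning of a side together have rate \<open>J1\<close> or
  \<open>J2\<close>, the information of the other receiver. Lowering the secret rates by
  \<open>20 * s\<close> pays for all margins in the decoding conditions.\<close>

lemma size_ok_sz:
  assumes s: "0 < s" "2 \<le> real n * s" and cl: "0 \<le> c1" "0 \<le> c2" "c1 + c2 \<le> min IR (min IY IZ)"
    and r1: "20 * s \<le> \<sigma>1" "0 \<le> \<pi>1" "0 \<le> \<mu>1" "0 \<le> l1" "\<pi>1 + \<mu>1 + l1 = J1" "\<sigma>1 + J1 \<le> I1"
    and r2: "20 * s \<le> \<sigma>2" "0 \<le> \<pi>2" "0 \<le> \<mu>2" "0 \<le> l2" "\<pi>2 + \<mu>2 + l2 = J2" "\<sigma>2 + J2 \<le> I2"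
    and l: "l1 + l2 = I12"
  shows "size_ok s n (sz n (\<sigma>1 - 20 * s)) (sz n \<pi>1 * sz n \<mu>1) (sz n (l1 + 3 * s)) (sz n (\<sigma>2 - 20 * s)) (sz n \<pi>2 * sz n \<mu>2) (sz n (l2 + 3 * s))
     (sz n (max 0 (c1 - 2 * s)) * sz n (max 0 (c2 - 2 * s)))"
proof -
  have a: "0 \<le> \<sigma>1 - 20 * s" "0 \<le> \<sigma>2 - 20 * s" using r1(1) r2(1) by auto
  note b1 = size_bounds[OF s a(1) r1(2-4) r2(4)] and b2 = size_bounds[OF s a(2) r2(2-4) r1(4)]
  have mono: "2 powr (real n * x) \<le> 2 powr (real n * y)" if "x \<le> y" for x y
    using that by (intro powr_mono mult_left_mono) auto
  have C: "real (sz n (max 0 (c1 - 2 * s)) * sz n (max 0 (c2 - 2 * s))) - 1 \<le> 2 powr (real n * (min IR (min IY IZ) - 2 * s))"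
  \<comment> \<open>If both cloud rates are within the slack, there is a single cloud index and no
    competitor. Otherwise \<open>2 * s\<close> is subtracted from at least one positive rate, which
    suffices for the sum.\<close>
  proof (cases "c1 - 2 * s \<le> 0 \<and> c2 - 2 * s \<le> 0")
    case True
    then have "max 0 (c1 - 2 * s) = 0" "max 0 (c2 - 2 * s) = 0" by auto
    then show ?thesis by simp
  next
    case False
    have "real (sz n (max 0 (c1 - 2 * s)) * sz n (max 0 (c2 - 2 * s))) \<le> 2 powr (real n * max 0 (c1 - 2 * s)) * 2 powr (real n * max 0 (c2 - 2 * s))"
      unfolding of_nat_mult by (intro mult_mono sz_bounds(2)) auto
    also have "\<dots> = 2 powr (real n * (max 0 (c1 - 2 * s) + max 0 (c2 - 2 * s)))" by (simp only: powr_add distrib_left)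
    also have "\<dots> \<le> 2 powr (real n * (min IR (min IY IZ) - 2 * s))"
      by (rule mono) (use False cl s in linarith)
    finally show ?thesis by simp
  qed
  have J: "J1 = I12 + leak1" "J2 = I12 + leak2" by (rule J1_eq J2_eq)+
  show ?thesis
    unfolding size_ok_def
  proof (intro conjI)
    show "2 powr (real n * (I12 + 2 * s)) \<le> real (sz n (l1 + 3 * s)) * real (sz n (l2 + 3 * s))" using b1(5) l by simp
    show "real (sz n (l1 + 3 * s)) * real (sz n (l2 + 3 * s)) * real (sz n (\<sigma>1 - 20 * s) * (sz n \<pi>1 * sz n \<mu>1) * sz n (l1 + 3 * s)) \<le> 2 powr (real n * (I12 + I1 - 3 * s))"
      by (rule order_trans[OF b1(6) mono]) (use l r1 s in linarith)
    show "real (sz n (l1 + 3 * s)) * real (sz n (l2 + 3 * s)) * real (sz n (\<sigma>2 - 20 * s) * (sz n \<pi>2 * sz n \<mu>2) * sz n (l2 + 3 * s)) \<le> 2 powr (real n * (I12 + I2 - 3 * s))"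
      unfolding mult.commute[of "real (sz n (l1 + 3 * s))" "real (sz n (l2 + 3 * s))"]
      by (rule order_trans[OF b2(6) mono]) (use l r2 s in linarith)
    show "real (sz n (l1 + 3 * s)) * real (sz n (l2 + 3 * s)) * real ((sz n \<pi>1 * sz n \<mu>1) * sz n (l1 + 3 * s)) \<le> 2 powr (real n * (I12 + J1 + 10 * s))"
      by (rule order_trans[OF b1(7) mono]) (use l r1 s in linarith)
    show "real (sz n (l1 + 3 * s)) * real (sz n (l2 + 3 * s)) * real ((sz n \<pi>2 * sz n \<mu>2) * sz n (l2 + 3 * s)) \<le> 2 powr (real n * (I12 + J2 + 10 * s))"
      unfolding mult.commute[of "real (sz n (l1 + 3 * s))" "real (sz n (l2 + 3 * s))"]
      by (rule order_trans[OF b2(7) mono]) (use l r2 s in linarith)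
    have "leak1 - 4 * s = \<pi>1 + \<mu>1 - l2 - 4 * s" "leak2 - 4 * s = \<pi>2 + \<mu>2 - l1 - 4 * s" using J l r1 r2 by auto
    then show "real (sz n (l2 + 3 * s)) * 2 powr (real n * (leak1 - 4 * s)) \<le> real (sz n \<pi>1 * sz n \<mu>1)"
      "real (sz n (l1 + 3 * s)) * 2 powr (real n * (leak2 - 4 * s)) \<le> real (sz n \<pi>2 * sz n \<mu>2)" using b1(8) b2(8) by (simp_all only:)
    show "real (sz n (\<sigma>1 - 20 * s) * (sz n \<pi>1 * sz n \<mu>1) * sz n (l1 + 3 * s)) \<le> 2 powr (real n * I1)"
      by (rule order_trans[OF b1(9) mono]) (use r1 s in linarith)
    show "real (sz n (\<sigma>2 - 20 * s) * (sz n \<pi>2 * sz n \<mu>2) * sz n (l2 + 3 * s)) \<le> 2 powr (real n * I2)"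
      by (rule order_trans[OF b2(9) mono]) (use r2 s in linarith)
  qed (fact b1(1-4) b2(1-4) C)+
qed

text \<open>Three losses: \<open>22 * s\<close> is the slack taken from the cloud rate and the
  secret rate, \<open>c / real (Suc T)\<close> comes from \<open>T\<close> cloud indices serving
  \<open>T + 1\<close> blocks, and \<open>3 / real n\<close> from rounding three sizes.\<close>

lemma msz_close:
  fixes T :: nat
  assumes s: "0 < s" "20 * s \<le> \<sigma>" and nn: "0 \<le> c" "0 \<le> \<pi>" and n: "0 < n"
  defines "X \<equiv> log 2 (real (sz n (max 0 (c - 2 * s)) ^ T * (sz n (\<sigma> - 20 * s) * sz n \<pi>) ^ Suc T))"
  shows "\<bar>X - real n * real (Suc T) * (c + \<sigma> + \<pi>)\<bar> \<le> real n * real (Suc T) * (22 * s + c / real (Suc T) + 3 / real n)"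
    and "X \<le> real n * real (Suc T) * (c + \<sigma> + \<pi>)" and "0 \<le> X"
proof -
  have nn': "0 \<le> max 0 (c - 2 * s)" "0 \<le> \<sigma> - 20 * s" using s by auto
  note bc = sz_bounds[OF nn'(1), of n] and ba = sz_bounds[OF nn'(2), of n] and bp = sz_bounds[OF nn(2), of n]
  define x y z where "x = log 2 (real (sz n (max 0 (c - 2 * s))))" and "y = log 2 (real (sz n (\<sigma> - 20 * s)))" and "z = log 2 (real (sz n \<pi>))"
  have X: "X = real T * x + real (Suc T) * (y + z)"
  proof -
    have *: "log 2 (a ^ T * (b * d) ^ Suc T) = real T * log 2 a + real (Suc T) * (log 2 b + log 2 d)" if "0 < a" "0 < b" "0 < d" for a b d :: real
    proof -
      have "log 2 (a ^ T * (b * d) ^ Suc T) = log 2 (a ^ T) + log 2 ((b * d) ^ Suc T)" using that by (subst log_mult) auto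
      also have "log 2 ((b * d) ^ Suc T) = real (Suc T) * log 2 (b * d)" using that by (intro log_nat_power) auto
      also have "log 2 (b * d) = log 2 b + log 2 d" using that by (simp add: log_mult)
      finally show ?thesis using that by (simp only: log_nat_power)
    qed
    show ?thesis unfolding X_def x_def y_def z_def of_nat_mult of_nat_power by (rule *) (use bc(1) ba(1) bp(1) in simp_all)
  qed
  have y: "y \<le> real n * (\<sigma> - 20 * s)" "real n * (\<sigma> - 20 * s) - 1 \<le> y" and z: "z \<le> real n * \<pi>" "real n * \<pi> - 1 \<le> z"
    using ba bp by (auto simp: y_def z_def)
  have x: "x \<le> real n * c" "real n * (c - 2 * s) - 1 \<le> x"
  proof -
    have "x \<le> real n * max 0 (c - 2 * s)" unfolding x_def by (rule bc)
    also have "\<dots> \<le> real n * c" using s nn by (intro mult_left_mono) auto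
    finally show "x \<le> real n * c" .
    have "real n * (c - 2 * s) \<le> real n * max 0 (c - 2 * s)" by (intro mult_left_mono) auto
    then show "real n * (c - 2 * s) - 1 \<le> x" using bc(5) unfolding x_def by linarith
  qed
  show "0 \<le> X" unfolding X using bc(1) ba(1) bp(1) by (simp add: x_def y_def z_def)
  have ns: "0 \<le> real n * s" "0 \<le> real n * c" using s nn by auto
  have "real T * x \<le> real (Suc T) * (real n * c)" using x(1) ns by (intro mult_mono) (auto simp: x_def bc(1) Suc_leI)
  moreover have "real (Suc T) * (y + z) \<le> real (Suc T) * (real n * \<sigma> + real n * \<pi>)"
    using y z ns by (intro mult_left_mono) (auto simp: algebra_simps)
  ultimately show up: "X \<le> real n * real (Suc T) * (c + \<sigma> + \<pi>)" unfolding X by (simp add: algebra_simps)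
  have "real T * (real n * (c - 2 * s) - 1) \<le> real T * x" using x by (intro mult_left_mono) auto
  moreover have "real (Suc T) * (real n * (\<sigma> - 20 * s) - 1 + (real n * \<pi> - 1)) \<le> real (Suc T) * (y + z)"
    using y z by (intro mult_left_mono) auto
  ultimately have "real T * (real n * (c - 2 * s) - 1) + real (Suc T) * (real n * (\<sigma> - 20 * s) - 1 + (real n * \<pi> - 1)) \<le> X"
    unfolding X by linarith
  moreover have "real n * real (Suc T) * (c + \<sigma> + \<pi>) - real n * real (Suc T) * (22 * s + c / real (Suc T) + 3 / real n)
      \<le> real T * (real n * (c - 2 * s) - 1) + real (Suc T) * (real n * (\<sigma> - 20 * s) - 1 + (real n * \<pi> - 1))"
  proof -
    have "real n * real (Suc T) * (22 * s + c / real (Suc T) + 3 / real n) = 22 * (real n * real (Suc T) * s) + real n * c + 3 * real (Suc T)"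
    proof -
      have "real (Suc T) * (c / real (Suc T)) = c" "real n * (3 / real n) = 3" using n by auto
      moreover have "real n * real (Suc T) * (22 * s + c / real (Suc T) + 3 / real n)
        = 22 * (real n * real (Suc T) * s) + real n * (real (Suc T) * (c / real (Suc T))) + real (Suc T) * (real n * (3 / real n))"
        by (simp only: distrib_left mult_ac)
      ultimately show ?thesis by simp
    qed
    then show ?thesis using ns s by (simp add: algebra_simps)
  qed
  ultimately show "\<bar>X - real n * real (Suc T) * (c + \<sigma> + \<pi>)\<bar> \<le> real n * real (Suc T) * (22 * s + c / real (Suc T) + 3 / real n)"
    using up s nn by (intro abs_leI) (auto intro: order_trans[of _ 0])
qed

text \<open>\<open>40 * s\<close> is the reduction of the secret rate by \<open>20 * s\<close> plus
  the loss of the block code. The last term is the error probability over all blocks times the rates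
  of the messages and indices that an error may affect.\<close>

lemma Delta_close:
  assumes s: "0 < s" "20 * s \<le> \<sigma>" and nn: "0 \<le> c1" "0 \<le> c2" and n: "0 < n" and \<eta>: "0 < \<eta>"
    and cb: "code_bounds N T (sz n (\<sigma> - 20 * s)) (sz n (max 0 (c1 - 2 * s))) (sz n (max 0 (c2 - 2 * s))) (20 * real n * s) \<eta> X D"
    and X: "log 2 (real X) \<le> real n * real (Suc T) * B" "0 \<le> log 2 (real X)"
  shows "\<bar>real N * D - real n * real (Suc T) * \<sigma>\<bar> \<le> real n * real (Suc T) * (40 * s + 4 / real n + real (Suc T) * \<eta> * (c1 + c2 + B))"
proof -
  have nn': "0 \<le> max 0 (c1 - 2 * s)" "0 \<le> max 0 (c2 - 2 * s)" "0 \<le> \<sigma> - 20 * s" using s by auto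
  note ba = sz_bounds[OF nn'(3), of n]
  define \<tau> where "\<tau> = real (Suc T)"
  have \<tau>: "1 \<le> \<tau>" "real T \<le> \<tau>" by (auto simp: \<tau>_def)
  define y where "y = log 2 (real (sz n (\<sigma> - 20 * s)))"
  have y: "y \<le> real n * (\<sigma> - 20 * s)" "real n * (\<sigma> - 20 * s) - 1 \<le> y" using ba by (auto simp: y_def)
  define q where "q = log 2 (real (sz n (max 0 (c1 - 2 * s)) * sz n (max 0 (c2 - 2 * s))))"
  have q: "0 \<le> q" "q \<le> real n * (c1 + c2)"
  proof -
    have p: "0 < sz n (max 0 (c1 - 2 * s))" "0 < sz n (max 0 (c2 - 2 * s))" by (rule sz_bounds(1)[OF nn'(1)] sz_bounds(1)[OF nn'(2)])+
    then have q: "q = log 2 (real (sz n (max 0 (c1 - 2 * s)))) + log 2 (real (sz n (max 0 (c2 - 2 * s))))" by (simp add: q_def log_mult)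
    show "0 \<le> q" using p unfolding q by (intro add_nonneg_nonneg) auto
    have "q \<le> real n * max 0 (c1 - 2 * s) + real n * max 0 (c2 - 2 * s)" unfolding q by (intro add_mono sz_bounds nn')
    also have "\<dots> \<le> real n * c1 + real n * c2" using s nn by (intro add_mono mult_left_mono) auto
    finally show "q \<le> real n * (c1 + c2)" by (simp add: distrib_left)
  qed
  have te: "0 \<le> \<tau> * \<eta>" using \<tau> \<eta> by simp
  have lo: "\<tau> * (y - 20 * real n * s) \<le> real N * D + 1 + \<tau> * \<eta> * log 2 (real X)"
    and up: "real N * D \<le> \<tau> * y + 4 + \<tau> * \<eta> * (real T * q) + \<tau> * (20 * real n * s) + \<tau> * \<eta> * log 2 (real X)"
    using cb by (auto simp: code_bounds_def \<tau>_def y_def q_def)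
  have lX: "\<tau> * \<eta> * log 2 (real X) \<le> \<tau> * \<eta> * (real n * \<tau> * B)" using X te by (intro mult_left_mono) (auto simp: \<tau>_def)
  have "real T * q \<le> \<tau> * (real n * (c1 + c2))" using \<tau> q by (intro mult_mono) auto
  then have lq: "\<tau> * \<eta> * (real T * q) \<le> \<tau> * \<eta> * (\<tau> * (real n * (c1 + c2)))" using te by (intro mult_left_mono) auto
  have e: "real n * \<tau> * (40 * s + 4 / real n + \<tau> * \<eta> * (c1 + c2 + B)) = 40 * (real n * \<tau> * s) + 4 * \<tau> + \<tau> * \<eta> * (\<tau> * (real n * (c1 + c2))) + \<tau> * \<eta> * (real n * \<tau> * B)"
    using n by (simp add: field_simps)
  have nts: "0 \<le> real n * \<tau> * s" using s \<tau> by simp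
  have y1: "\<tau> * y \<le> \<tau> * (real n * (\<sigma> - 20 * s))" using y \<tau> by (intro mult_left_mono) auto
  have y2: "\<tau> * (real n * (\<sigma> - 20 * s) - 1 - 20 * real n * s) \<le> \<tau> * (y - 20 * real n * s)" using y \<tau> by (intro mult_left_mono) auto
  have cc: "0 \<le> \<tau> * \<eta> * (\<tau> * (real n * (c1 + c2)))" using te \<tau> nn by simp
  have "real N * D \<le> real n * \<tau> * \<sigma> + (40 * (real n * \<tau> * s) + 4 * \<tau> + \<tau> * \<eta> * (\<tau> * (real n * (c1 + c2))) + \<tau> * \<eta> * (real n * \<tau> * B))"
    using up lX lq y1 nts \<tau>(1) by (simp add: algebra_simps)
  moreover have "real n * \<tau> * \<sigma> \<le> real N * D + (40 * (real n * \<tau> * s) + 4 * \<tau> + \<tau> * \<eta> * (\<tau> * (real n * (c1 + c2))) + \<tau> * \<eta> * (real n * \<tau> * B))"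
    using lo lX y2 cc \<tau>(1) by (simp add: algebra_simps)
  ultimately show ?thesis unfolding \<tau>_def[symmetric] e by (intro abs_leI) linarith+
qed

text \<open>The order of choice matters: \<open>s\<close> from the precision, then \<open>T\<close>
  to make the rate loss of the cloud small, then \<open>\<eta>\<close> small against
  \<open>1 / T\<close>, because errors add up over the blocks and an error can cost entropy of the
  order of all messages, and \<open>n\<close> last.\<close>

lemma achievable_rates:
  assumes cl: "0 \<le> r10" "0 \<le> r20" "r10 + r20 \<le> min IR (min IY IZ)"
    and r1: "0 < \<sigma>1" "0 \<le> \<pi>1" "0 \<le> \<mu>1" "0 \<le> l1" "\<pi>1 + \<mu>1 + l1 = J1" "\<sigma>1 + J1 \<le> I1"
    and r2: "0 < \<sigma>2" "0 \<le> \<pi>2" "0 \<le> \<mu>2" "0 \<le> l2" "\<pi>2 + \<mu>2 + l2 = J2" "\<sigma>2 + J2 \<le> I2"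
    and l: "l1 + l2 = I12" and Re: "0 < Re1" "Re1 \<le> \<sigma>1" "0 < Re2" "Re2 \<le> \<sigma>2"
  shows "achievable W (r10 + \<sigma>1 + \<pi>1) (r20 + \<sigma>2 + \<pi>2) Re1 Re2"
proof (rule achievable_of_approx[where ?E1.0=\<sigma>1 and ?E2.0=\<sigma>2])
  fix \<delta> :: real assume \<delta>: "0 < \<delta>"
  define R1 R2 where "R1 = r10 + \<sigma>1 + \<pi>1" and "R2 = r20 + \<sigma>2 + \<pi>2"
  define B where "B = r10 + r20 + R1 + R2"
  have R: "0 < R1" "0 < R2" "\<sigma>1 \<le> R1" "\<sigma>2 \<le> R2" using cl r1 r2 by (auto simp: R1_def R2_def)
  then have B: "0 < B" "r10 \<le> B" "r20 \<le> B" "r10 + r20 + R1 \<le> B" "r10 + r20 + R2 \<le> B" "R1 \<le> B" "R2 \<le> B" using cl by (auto simp: B_def)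
  define s where "s = min (\<delta> / 200) (min (\<sigma>1 / 20) (\<sigma>2 / 20))"
  have s: "0 < s" "s \<le> \<delta> / 200" "20 * s \<le> \<sigma>1" "20 * s \<le> \<sigma>2" using \<delta> r1 r2 by (auto simp: s_def)
  obtain T where T: "5 * B / \<delta> \<le> real T" using real_arch_simple by blast
  define \<tau> where "\<tau> = Suc T"
  have \<tau>: "0 < real \<tau>" "x / real \<tau> \<le> \<delta> / 5" if "x \<le> B" for x
  proof -
    have "5 * B \<le> \<delta> * real \<tau>" using T \<delta> by (simp add: \<tau>_def divide_le_eq algebra_simps)
    then show "x / real \<tau> \<le> \<delta> / 5" using that by (simp add: \<tau>_def divide_le_eq)
  qed (simp add: \<tau>_def)
  define \<eta> where "\<eta> = \<delta> / (5 * real \<tau> * (B + 1))"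
  have t0: "0 < real \<tau>" by (simp add: \<tau>_def)
  have \<eta>: "0 < \<eta>" using \<delta> B t0 by (simp add: \<eta>_def)
  have te: "real \<tau> * \<eta> = \<delta> / 5 / (B + 1)" using t0 by (simp add: \<eta>_def)
  have tb: "real \<tau> * \<eta> * x \<le> \<delta> / 5" if "0 \<le> x" "x \<le> B" for x
  proof -
    have "\<delta> / 5 / (B + 1) * x \<le> \<delta> / 5 / (B + 1) * (B + 1)" using that \<delta> B by (intro mult_left_mono) auto
    also have "\<dots> = \<delta> / 5" using B by (intro nonzero_eq_divide_eq[THEN iffD1]) auto
    finally show ?thesis unfolding te .
  qed
  have te1: "real \<tau> * \<eta> \<le> \<delta>"
  proof -
    have "\<delta> / 5 / (B + 1) \<le> \<delta> / 5 / 1" using B \<delta> by (intro divide_left_mono) auto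
    then show ?thesis unfolding te using \<delta> by linarith
  qed
  define A1 A2 P1 P2 M1 M2 L1 L2 C1 C2 where sizes: "A1 = (\<lambda>n. sz n (\<sigma>1 - 20 * s))" "A2 = (\<lambda>n. sz n (\<sigma>2 - 20 * s))"
    "P1 = (\<lambda>n. sz n \<pi>1)" "P2 = (\<lambda>n. sz n \<pi>2)" "M1 = (\<lambda>n. sz n \<mu>1)" "M2 = (\<lambda>n. sz n \<mu>2)" "L1 = (\<lambda>n. sz n (l1 + 3 * s))" "L2 = (\<lambda>n. sz n (l2 + 3 * s))"
    "C1 = (\<lambda>n. sz n (max 0 (r10 - 2 * s)))" "C2 = (\<lambda>n. sz n (max 0 (r20 - 2 * s)))"
  have "\<forall>\<^sub>F n in sequentially. 0 < n \<and> 2 / s \<le> real n \<and> 5 * (4 + B) / \<delta> \<le> real n"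
    using eventually_gt_at_top[of 0] filterlim_real_sequentially[unfolded filterlim_at_top] by (auto intro!: eventually_conj)
  then have "\<forall>\<^sub>F n in sequentially. \<forall>r<\<tau>. \<exists>c. approx_code W R1 R2 \<sigma>1 \<sigma>2 \<delta> (n * \<tau> + r) c"
    using code_exists[OF s(1) \<eta>]
  proof eventually_elim
    case (elim n)
    then have n: "0 < n" "2 \<le> real n * s" using s by (auto simp: divide_le_eq)
    have nb: "(4 + x) / real n \<le> \<delta> / 5" if "x \<le> B" for x
    proof -
      have "5 * (4 + B) \<le> \<delta> * real n" using elim(1) \<delta> by (simp add: divide_le_eq mult.commute)
      then show ?thesis using that n by (simp add: divide_le_eq)
    qed
    have C: "0 < C1 n" "0 < C2 n" unfolding sizes by (rule sz_bounds(1); simp)+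
    have so: "size_ok s n (A1 n) (P1 n * M1 n) (L1 n) (A2 n) (P2 n * M2 n) (L2 n) (C1 n * C2 n)"
      unfolding sizes by (rule size_ok_sz[OF s(1) n(2) cl s(3) r1(2-6) s(4) r2(2-6) l])
    show ?case
    proof (intro allI impI)
      fix r assume r: "r < \<tau>"
      define N where "N = n * \<tau> + r"
      have N: "0 < real N" using n(1) unfolding N_def \<tau>_def of_nat_0_less_iff by simp
      obtain c where c: "valid_code N c" "msz1 c = C1 n ^ T * (A1 n * P1 n) ^ Suc T" "msz2 c = C2 n ^ T * (A2 n * P2 n) ^ Suc T"
        "Pe1 W N c \<le> real \<tau> * \<eta>" "Pe2 W N c \<le> real \<tau> * \<eta>"
        "code_bounds N T (A1 n) (C1 n) (C2 n) (20 * real n * s) \<eta> (msz1 c) (Delta1 W N c)"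
        "code_bounds N T (A2 n) (C1 n) (C2 n) (20 * real n * s) \<eta> (msz2 c) (Delta2 W N c)"
        using elim(2) so C unfolding N_def \<tau>_def by blast
      note m1 = msz_close[OF s(1,3) cl(1) r1(2) n(1), of T, folded sizes[THEN fun_cong], folded c(2), folded \<tau>_def R1_def]
        and m2 = msz_close[OF s(1,4) cl(2) r2(2) n(1), of T, folded sizes[THEN fun_cong], folded c(3), folded \<tau>_def R2_def]
      note d1 = Delta_close[OF s(1,3) cl(1,2) n(1) \<eta> c(6)[unfolded sizes], folded \<tau>_def, OF m1(2,3)]
        and d2 = Delta_close[OF s(1,4) cl(1,2) n(1) \<eta> c(7)[unfolded sizes], folded \<tau>_def, OF m2(2,3)]
      have R0: "0 \<le> R1" "0 \<le> R2" "0 \<le> \<sigma>1" "0 \<le> \<sigma>2" using R r1 r2 by auto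
      note q = rate_close[OF n(1) r R0(1) m1(1)] rate_close[OF n(1) r R0(2) m2(1)] rate_close[OF n(1) r R0(3) d1] rate_close[OF n(1) r R0(4) d2]
      have rate: "22 * s + x / real \<tau> + 3 / real n + y / real n \<le> \<delta>" if "x \<le> B" "y \<le> B" for x y
      proof -
        have "3 / real n + y / real n \<le> (4 + y) / real n" unfolding add_divide_distrib[symmetric] by (intro divide_right_mono) auto
        then show ?thesis using nb[OF that(2)] \<tau>(2)[OF that(1)] s(2) \<delta> by linarith
      qed
      have equi: "40 * s + 4 / real n + real \<tau> * \<eta> * x + y / real n \<le> \<delta>" if "0 \<le> x" "x \<le> B" "y \<le> B" for x y
      proof -
        have "4 / real n + y / real n = (4 + y) / real n" by (simp add: add_divide_distrib)
        then show ?thesis using nb[OF that(3)] tb[OF that(1,2)] s(2) \<delta> by linarith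
      qed
      have ND: "real N * D / real N = D" for D using N by simp
      have "approx_code W R1 R2 \<sigma>1 \<sigma>2 \<delta> N c"
        unfolding approx_code_def
      proof (intro conjI)
        show "\<bar>log 2 (real (msz1 c)) / real N - R1\<bar> \<le> \<delta>" using q(1) rate[of r10 R1] B unfolding N_def[symmetric] by linarith
        show "\<bar>log 2 (real (msz2 c)) / real N - R2\<bar> \<le> \<delta>" using q(2) rate[of r20 R2] B unfolding N_def[symmetric] by linarith
        show "\<bar>Delta1 W N c - \<sigma>1\<bar> \<le> \<delta>" using q(3) equi[of "r10 + r20 + R1" \<sigma>1] B R cl unfolding N_def[symmetric] ND by linarith
        show "\<bar>Delta2 W N c - \<sigma>2\<bar> \<le> \<delta>" using q(4) equi[of "r10 + r20 + R2" \<sigma>2] B R cl unfolding N_def[symmetric] ND by linarith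
        show "Pe1 W N c \<le> \<delta>" "Pe2 W N c \<le> \<delta>" using c(4,5) te1 by linarith+
      qed (rule c)
      then show "\<exists>c. approx_code W R1 R2 \<sigma>1 \<sigma>2 \<delta> (n * \<tau> + r) c" unfolding N_def by blast
    qed
  qed
  then obtain n0 where n0: "\<And>n r. n0 \<le> n \<Longrightarrow> r < \<tau> \<Longrightarrow> \<exists>c. approx_code W R1 R2 \<sigma>1 \<sigma>2 \<delta> (n * \<tau> + r) c"
    unfolding eventually_sequentially by blast
  \<comment> \<open>Division by \<open>\<tau>\<close> with remainder reaches every large block
    length; the remainder is the number of padding letters.\<close>
  have "\<exists>c. approx_code W R1 R2 \<sigma>1 \<sigma>2 \<delta> N c" if "n0 * \<tau> \<le> N" for N
  proof -
    have "n0 \<le> N div \<tau>" using div_le_mono[OF that, of \<tau>] t0 by simp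
    then show ?thesis using n0[of "N div \<tau>" "N mod \<tau>", unfolded div_mult_mod_eq] t0 by simp
  qed
  then show "\<forall>\<^sub>F N in sequentially. \<exists>c. approx_code W (r10 + \<sigma>1 + \<pi>1) (r20 + \<sigma>2 + \<pi>2) \<sigma>1 \<sigma>2 \<delta> N c"
    unfolding eventually_sequentially R1_def R2_def by blast
qed (use cl r1 r2 Re in auto)

end

section \<open>From the given joint law to superposition letters and private rates\<close>

lemma disintegrate_bind:
  "bind_pmf (map_pmf g U) (\<lambda>y. bind_pmf (cond_pmf U {x. g x = y}) (F y)) = bind_pmf U (\<lambda>x. F (g x) x)"
proof -
  have "bind_pmf U (\<lambda>x. F (g x) x) = bind_pmf (map_pmf g U) (\<lambda>y. bind_pmf (cond_pmf U {x. g x = y}) (\<lambda>x. F (g x) x))"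
    by (subst disintegrate[of g U, symmetric]) (simp only: bind_assoc_pmf)
  also have "\<dots> = bind_pmf (map_pmf g U) (\<lambda>y. bind_pmf (cond_pmf U {x. g x = y}) (F y))"
  proof (intro bind_pmf_cong refl)
    fix y x assume y: "y \<in> set_pmf (map_pmf g U)" and x: "x \<in> set_pmf (cond_pmf U {x. g x = y})"
    have "set_pmf U \<inter> {x. g x = y} \<noteq> {}" using y by auto
    then show "F (g x) x = F y x" using x by (simp add: set_cond_pmf)
  qed
  finally show ?thesis by simp
qed

lemma disintegrate_map:
  "bind_pmf (map_pmf g U) (\<lambda>y. map_pmf (h y) (cond_pmf U {x. g x = y})) = map_pmf (\<lambda>x. h (g x) x) U"
  using disintegrate_bind[of g U "\<lambda>y x. return_pmf (h y x)"] by (simp add: map_pmf_def)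

lemma cmi_cond_inj:
  assumes "finite (set_pmf P)" "\<And>x x'. C x = C x' \<longleftrightarrow> C' x = C' x'"
  shows "cmi P A B C = cmi P A B C'"
proof -
  have "ent P C = ent P C'" "ent P (\<lambda>w. (A w, C w)) = ent P (\<lambda>w. (A w, C' w))" "ent P (\<lambda>w. (B w, C w)) = ent P (\<lambda>w. (B w, C' w))"
    "ent P (\<lambda>w. (A w, B w, C w)) = ent P (\<lambda>w. (A w, B w, C' w))"
    by (rule ent_inj'[OF assms(1)]; simp add: assms(2))+
  then show ?thesis by (simp add: cmi_def)
qed

text \<open>Each private rate \<open>S1\<close>, \<open>S2\<close> takes as much as possible; the rest of the messages is carried
  by the cloud. The binning rate \<open>I12\<close> is shared between the two sides as \<open>l1 + l2\<close>.\<close>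

lemma split_rates:
  fixes R1 R2 :: real
  assumes "0 \<le> I12" "0 \<le> M" "0 \<le> K1" "0 \<le> K2" "Re1 \<le> R1" "Re2 \<le> R2" "R1 \<le> M + I1" "R2 \<le> M + I2" "R1 + R2 \<le> M + I1 + I2 - I12"
    "Re1 \<le> I1 - I12 - K1" "Re2 \<le> I2 - I12 - K2"
  obtains S1 S2 l1 l2 where "Re1 \<le> S1" "S1 \<le> R1" "Re2 \<le> S2" "S2 \<le> R2" "R1 - S1 + (R2 - S2) \<le> M"
    "0 \<le> l1" "0 \<le> l2" "l1 + l2 = I12" "S1 + l1 \<le> I1" "S2 + l2 \<le> I2"
proof -
  define m1 m2 where "m1 = min R1 I1" and "m2 = min R2 I2"
  have m: "m1 \<le> R1" "m1 \<le> I1" "m2 \<le> R2" "m2 \<le> I2" "Re1 \<le> m1" "Re2 \<le> m2" using assms by (auto simp: m1_def m2_def)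
  have "\<exists>S1 S2. Re1 \<le> S1 \<and> S1 \<le> m1 \<and> Re2 \<le> S2 \<and> S2 \<le> m2 \<and> S1 + S2 \<le> I1 + I2 - I12 \<and> R1 - S1 + (R2 - S2) \<le> M"
  proof (cases "m1 + m2 \<le> I1 + I2 - I12")
    case True
    have "R1 - m1 + (R2 - m2) \<le> M" using assms by (auto simp: m1_def m2_def min_def)
    then show ?thesis using True m by blast
  next
    case False
    \<comment> \<open>When the maximal private rates violate the sum constraint, it is met with
      equality: side 1 gets as little as possible, but at least \<open>Re1\<close>. Exactly
      \<open>R1 + R2 - (I1 + I2 - I12)\<close> is then left for the cloud.\<close>
    define S1 where "S1 = max Re1 (I1 + I2 - I12 - m2)"
    have "Re1 \<le> S1 \<and> S1 \<le> m1 \<and> Re2 \<le> I1 + I2 - I12 - S1 \<and> I1 + I2 - I12 - S1 \<le> m2"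
      using False m assms by (auto simp: S1_def max_def)
    then show ?thesis using assms(9) by (intro exI[of _ S1] exI[of _ "I1 + I2 - I12 - S1"]) auto
  qed
  then obtain S1 S2 where S: "Re1 \<le> S1" "S1 \<le> m1" "Re2 \<le> S2" "S2 \<le> m2" "S1 + S2 \<le> I1 + I2 - I12" "R1 - S1 + (R2 - S2) \<le> M" by blast
  \<comment> \<open>Side 1 takes as much of the binning rate as its room \<open>I1 - S1\<close>
    allows; the sum constraint leaves room for the rest on side 2.\<close>
  define l1 where "l1 = min I12 (I1 - S1)"
  have "0 \<le> l1" "0 \<le> I12 - l1" "S1 + l1 \<le> I1" "S2 + (I12 - l1) \<le> I2" using S m assms(1) by (auto simp: l1_def min_def)
  then show thesis using S m by (intro that[of S1 S2 l1 "I12 - l1"]) auto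
qed

theorem theorem6:
  fixes W :: "'x::finite \<Rightarrow> 'x1::finite \<Rightarrow> ('y::finite \<times> 'y1::finite \<times> 'z::finite) pmf"
    and PUV :: "('u::finite \<times> 'v1::finite \<times> 'v2::finite) pmf"
    and PX :: "'u \<Rightarrow> 'v1 \<Rightarrow> 'v2 \<Rightarrow> ('x \<times> 'x1) pmf"
    and R1 R2 Re1 Re2 :: real
  defines "P \<equiv> single_law W PUV PX"
  defines "M \<equiv> min (cmi P rvU rvY1 rvX1)
                 (min (mi P (\<lambda>w. (rvU w, rvX1 w)) rvY) (mi P (\<lambda>w. (rvU w, rvX1 w)) rvZ))"
  assumes pos: "R1 > 0" "R2 > 0" "Re1 > 0" "Re2 > 0"
    and "Re1 \<le> R1" and "Re2 \<le> R2"
    and "R1 \<le> M + cmi P rvV1 rvY (\<lambda>w. (rvU w, rvX1 w))"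
    and "R2 \<le> M + cmi P rvV2 rvZ (\<lambda>w. (rvU w, rvX1 w))"
    and "R1 + R2 \<le> M + cmi P rvV1 rvY (\<lambda>w. (rvU w, rvX1 w))
                      + cmi P rvV2 rvZ (\<lambda>w. (rvU w, rvX1 w))
                      - cmi P rvV1 rvV2 (\<lambda>w. (rvU w, rvX1 w))"
    and "Re1 \<le> cmi P rvV1 rvY (\<lambda>w. (rvU w, rvX1 w))
               - cmi P rvV1 rvV2 (\<lambda>w. (rvU w, rvX1 w))
               - cmi P rvV1 rvZ (\<lambda>w. (rvU w, rvX1 w, rvV2 w))"
    and "Re2 \<le> cmi P rvV2 rvZ (\<lambda>w. (rvU w, rvX1 w))
               - cmi P rvV1 rvV2 (\<lambda>w. (rvU w, rvX1 w))
               - cmi P rvV2 rvY (\<lambda>w. (rvU w, rvX1 w, rvV1 w))"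
  shows "(R1, R2, Re1, Re2) \<in> RB W"
proof -
  \<comment> \<open>The relay letter is moved from the channel inputs to the cloud letter: (U, X1)
    is the cloud, and X alone is left to the prefix kernel.\<close>
  define J :: "((('u \<times> 'x1) \<times> 'v1 \<times> 'v2) \<times> 'x) pmf" where
    "J = bind_pmf PUV (\<lambda>(u, v1, v2). map_pmf (\<lambda>(x, x1). (((u, x1), (v1, v2)), x)) (PX u v1 v2))"
  define pt where "pt = map_pmf (\<lambda>j. fst (fst j)) J"
  define p12 where "p12 = (\<lambda>t. map_pmf (\<lambda>j. snd (fst j)) (cond_pmf J {j. fst (fst j) = t}))"
  define PXc where "PXc = (\<lambda>a. map_pmf snd (cond_pmf J {j. fst j = a}))"
  define px where "px = map_pmf snd pt"
  define pu where "pu = (\<lambda>x. map_pmf fst (cond_pmf pt {t. snd t = x}))"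
  interpret rbc_letters W pt p12 PXc px pu
  proof unfold_locales
    have "bind_pmf px (\<lambda>x. map_pmf (\<lambda>u. (u, x)) (pu x)) = map_pmf (\<lambda>t. (fst t, snd t)) pt"
      unfolding px_def pu_def map_pmf_comp by (rule disintegrate_map)
    then show "pt = bind_pmf px (\<lambda>x. map_pmf (\<lambda>u. (u, x)) (pu x))" by simp
  qed
  define h :: "'u \<times> 'v1 \<times> 'v2 \<times> 'x \<times> 'x1 \<times> 'y \<times> 'y1 \<times> 'z \<Rightarrow> _" where "h = (\<lambda>w. (((rvU w, rvX1 w), (rvV1 w, rvV2 w)), (rvY w, rvY1 w, rvZ w)))"
  have pa: "pa = map_pmf fst J"
  proof -
    have "pa = map_pmf (\<lambda>j. (fst (fst j), snd (fst j))) J"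
      unfolding pa_def unfolding pt_def p12_def map_pmf_comp by (rule disintegrate_map)
    then show ?thesis by simp
  qed
  \<comment> \<open>Redrawing by conditional laws in the order cloud, private letters, input does
    not change the joint law. So \<open>R\<close> is the given law up to the relabelling
    \<open>h\<close>, and all information quantities agree.\<close>
  have "R = bind_pmf (map_pmf fst J) (\<lambda>a. bind_pmf (cond_pmf J {j. fst j = a}) (\<lambda>j. map_pmf (Pair a) (W (snd j) (snd (fst a)))))"
    unfolding R_def pa by (simp add: PXc_def map_bind_pmf bind_map_pmf)
  also have "\<dots> = bind_pmf J (\<lambda>j. map_pmf (Pair (fst j)) (W (snd j) (snd (fst (fst j)))))"
    by (rule disintegrate_bind)
  also have "\<dots> = map_pmf h P"
    by (simp add: J_def P_def single_law_def h_def bind_assoc_pmf bind_map_pmf map_bind_pmf map_pmf_comp case_prod_unfold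
        rvU_def rvX1_def rvV1_def rvV2_def rvY_def rvY1_def rvZ_def)
  finally have R: "R = map_pmf h P" .
  have finP: "finite (set_pmf P)" by simp
  have v: "(\<lambda>\<omega>. vV1 (h \<omega>)) = rvV1" "(\<lambda>\<omega>. vV2 (h \<omega>)) = rvV2" "(\<lambda>\<omega>. vY (h \<omega>)) = rvY" "(\<lambda>\<omega>. vZ (h \<omega>)) = rvZ"
    "(\<lambda>\<omega>. vT (h \<omega>)) = (\<lambda>w. (rvU w, rvX1 w))" "(\<lambda>\<omega>. vU (h \<omega>)) = rvU" "(\<lambda>\<omega>. vX1 (h \<omega>)) = rvX1" "(\<lambda>\<omega>. vY1 (h \<omega>)) = rvY1"
    "(\<lambda>\<omega>. (vT (h \<omega>), vV1 (h \<omega>))) = (\<lambda>w. ((rvU w, rvX1 w), rvV1 w))" "(\<lambda>\<omega>. (vT (h \<omega>), vV2 (h \<omega>))) = (\<lambda>w. ((rvU w, rvX1 w), rvV2 w))"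
    by (auto simp: h_def vV1_def vV2_def vY_def vZ_def vT_def vU_def vX1_def vY1_def)
  have info: "I1 = cmi P rvV1 rvY (\<lambda>w. (rvU w, rvX1 w))" "I2 = cmi P rvV2 rvZ (\<lambda>w. (rvU w, rvX1 w))"
    "I12 = cmi P rvV1 rvV2 (\<lambda>w. (rvU w, rvX1 w))" "IR = cmi P rvU rvY1 rvX1"
    "IY = mi P (\<lambda>w. (rvU w, rvX1 w)) rvY" "IZ = mi P (\<lambda>w. (rvU w, rvX1 w)) rvZ"
    unfolding I1_def I2_def I12_def IR_def IY_def IZ_def R cmi_map v mi_eq_cmi[OF finP] by (rule refl)+
  have leak: "leak1 = cmi P rvV1 rvZ (\<lambda>w. (rvU w, rvX1 w, rvV2 w))" "leak2 = cmi P rvV2 rvY (\<lambda>w. (rvU w, rvX1 w, rvV1 w))"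
    unfolding leak1_def leak2_def R cmi_map v by (rule cmi_cond_inj[OF finP]; auto)+
  have M: "M = min IR (min IY IZ)" unfolding M_def info ..
  have M0: "0 \<le> M" unfolding M IR_def IY_def IZ_def by (simp add: cmi_nonneg)
  note as = assms(7-)[folded info leak]
  obtain S1 S2 l1 l2 where S: "Re1 \<le> S1" "S1 \<le> R1" "Re2 \<le> S2" "S2 \<le> R2" "R1 - S1 + (R2 - S2) \<le> M"
    "0 \<le> l1" "0 \<le> l2" "l1 + l2 = I12" "S1 + l1 \<le> I1" "S2 + l2 \<le> I2"
    by (rule split_rates[where ?I12.0=I12 and M=M and ?K1.0=leak1 and ?K2.0=leak2 and ?Re1.0=Re1 and ?Re2.0=Re2 and ?R1.0=R1 and ?R2.0=R2 and ?I1.0=I1 and ?I2.0=I2])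
      (use as M0 leak_nonneg in auto)
  \<comment> \<open>The scheme keeps at most rate \<open>I1 - J1\<close> secret on side 1. The
    remaining private rate \<open>S1 - \<sigma>1\<close> becomes the public part, and the dummy
    fills public part and binning up to \<open>J1\<close>. Side 2 is treated alike.\<close>
  define \<sigma>1 \<sigma>2 where "\<sigma>1 = min S1 (I1 - J1)" and "\<sigma>2 = min S2 (I2 - J2)"
  have s: "Re1 \<le> \<sigma>1" "Re2 \<le> \<sigma>2" "\<sigma>1 \<le> S1" "\<sigma>2 \<le> S2" "\<sigma>1 + J1 \<le> I1" "\<sigma>2 + J2 \<le> I2"
    using S as J1_eq J2_eq by (auto simp: \<sigma>1_def \<sigma>2_def)
  \<comment> \<open>Nonnegative dummy rates: if there is a public part, this is
    \<open>S1 + l1 \<le> I1\<close>; otherwise it follows from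
    \<open>l1 \<le> I12 \<le> J1\<close>.\<close>
  have mu: "0 \<le> J1 - l1 - (S1 - \<sigma>1)" "0 \<le> J2 - l2 - (S2 - \<sigma>2)"
    using S J1_eq J2_eq leak_nonneg by (auto simp: \<sigma>1_def \<sigma>2_def min_def)
  have "achievable W ((R1 - S1) + \<sigma>1 + (S1 - \<sigma>1)) ((R2 - S2) + \<sigma>2 + (S2 - \<sigma>2)) Re1 Re2"
  proof (rule achievable_rates[where ?\<mu>1.0="J1 - l1 - (S1 - \<sigma>1)" and ?\<mu>2.0="J2 - l2 - (S2 - \<sigma>2)" and ?l1.0=l1 and ?l2.0=l2])
    show "R1 - S1 + (R2 - S2) \<le> min IR (min IY IZ)" using S(5) unfolding M .
  qed (use S s mu pos in simp_all)
  then show ?thesis by (simp add: RB_def)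
qed

end
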